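(* For any $T>0$ and any $(r,q)\in[1,\infty)\times(1,\infty)$ satisfying $$\text{(i)}\ \Big[r\ge1\text{ and }q>3\text{ and }1<\tfrac2r+\tfrac3q<5\Big]\quad\text{or}\quad\text{(ii)}\ \Big[r\ge1\text{ and either }\tfrac2r+\tfrac3q\ge5\text{ or }1<q\le3\Big],$$ there exist $V_0\in\mathcal G_\sigma$ and $f\in L^r_{\rm loc}(\mathbb R_+;L^q(\mathbb R^3))$ such that: (a) the Navier–Stokes problem (NS) with data $V_0,f$ admits a global Leray–Hopf solution $V\in C^0(\mathbb R_+;L^2(\mathbb R^3))$ which satisfies the energy equality (the energy inequality (EI) with equality sign) for all $t>0$; (b) there exists $\overline q>3$ such that $V\in L^{2s/(s-3)}_{\rm loc}(\mathbb R_+;L^s(\mathbb R^3))$ for all $s>\overline q$ and, hence, this solution is unique (in the class of Leray–Hopf solutions with the same data); (c) there exist a strictly increasing sequence $\{T_m\}_{m\ge1}\subset(0,T)$ and a sequence $\{\xi_m\}_{m\ge1}\subset\mathbb R^3$ such that the solution $V$ and its associated pressure $P$ satisfy $V,P\in C^\infty\big((\mathbb R^3\times\mathbb R_+)\setminus\bigcup_{m=1}^\infty\{(\xi_m,T_m)\}\big)$; (d) this solution satisfies, for all $m\ge1$, $$\lim_{t\to T_m}\|\nabla V(t)\|_{L^\infty(\mathbb R^3)}=\infty,$$ while the associated pressure $P$ satisfies $P\in L^2_{\rm loc}(\mathbb R_+;L^p(\mathbb R^3))$ for all $p\ge1$ and $\nabla P\in L^r_{\rm loc}(\mathbb R_+;L^q(\mathbb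 R^3))$; (e) there exist $(r,q)\in[1,\infty)\times(1,\infty)$ satisfying (i) such that (the solution in addition satisfies) $$V\in C^0(\mathbb R^3\times\mathbb R_+)\quad\text{and}\quad V(\xi,T_m)\equiv0\text{ in }\mathbb R^3\text{ for all }m\ge1.$$
   Context: Notation: $\xi=(x,y,z)\in\mathbb R^3$, $\mathbb R_+=[0,\infty)$. $L^r_{\rm loc}(\mathbb R_+;X)$ denotes functions belonging to $L^r(0,S;X)$ for every $S>0$. $L^p_\sigma(\mathbb R^3)$ is the subspace of divergence-free vector fields in $L^p(\mathbb R^3)$. Set $$\mathcal G=\bigcap_{k\in\mathbb N}\bigcap_{q\in[2,\infty]}W^{k,q}(\mathbb R^3)\subset C^\infty(\mathbb R^3),\qquad \mathcal G_\sigma=\{V\in\mathcal G:\ \nabla\cdot V=0\text{ in }\mathbb R^3\}$$ (vector fields $\mathbb R^3\to\mathbb R^3$). Problem (NS): $V_t-\Delta V+(V\cdot\nabla)V+\nabla P=f$ and $\nabla\cdot V=0$ in $\mathbb R^3\times(0,\infty)$, $V(\xi,0)=V_0(\xi)$. Leray–Hopf solution: for $S>0$ let $\mathcal D_S=\{\phi\in C^\infty_c(\mathbb R^3\times[0,S)):\nabla\cdot\phi=0\}$ (vector-valued $\phi$). For $V_0\in L^2_\sigma(\mathbb R^3)$ and $f\in L^2(0,S;H^{-1}(\mathbb R^3))+L^1(0,S;L^2(\mathbb R^3))$, a vector field $V$ is a Leray–Hopf solution of (NS) in $\mathbb R^3\times(0,S)$ if $V\in L^\infty(0,S;L^2_\sigma(\mathbb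 R^3))\cap L^2(0,S;H^1(\mathbb R^3))$, $$\int_0^\infty\!\int_{\mathbb R^3}\big[\nabla V:\nabla\phi+(V\cdot\nabla)V\cdot\phi-V\cdot\phi_t\big]d\xi\,dt=\int_0^\infty\langle f,\phi\rangle dt+\int_{\mathbb R^3}V_0\cdot\phi(0)\,d\xi\quad\forall\phi\in\mathcal D_S,$$ and the energy inequality holds: $$\text{(EI)}\quad\|V(t)\|_{L^2(\mathbb R^3)}^2+2\int_0^t\|\nabla V(s)\|_{L^2(\mathbb R^3)}^2ds\le\|V_0\|_{L^2(\mathbb R^3)}^2+2\int_0^t\langle f(s),V(s)\rangle ds\quad\forall t\in(0,S].$$ It is a global Leray–Hopf solution if it is a Leray–Hopf solution in $\mathbb R^3\times(0,S)$ for every $S>0$ (in particular $f\in L^2(0,S;H^{-1}(\mathbb R^3))+L^1(0,S;L^2(\mathbb R^3))$ for every $S>0$). Associated pressure: a function $P\in L^1_{\rm loc}(\mathbb R^3\times(0,S))$ for every $S>0$ such that $(V,P)$ satisfies the first equation of (NS) in the distributional sense; it solves $-\Delta P=\nabla\cdot[(V\cdot\nabla)V-f]$ in the distributional sense in $\mathbb R^3$ for a.e. $t$. *)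

theory Defs
  imports "HOL-Probability.Essential_Supremum"
begin

section \<open>Smooth functions\<close>

text \<open>Derivatives are taken within \<open>A\<close>, so that on \<open>{0..} \<times> UNIV\<close> smoothness holds up to the
  initial time (one-sided time derivatives there). \<open>D b\<close> is the partial derivative in direction
  \<open>b\<close>.\<close>

primrec Ck_on :: "nat \<Rightarrow> 'a::euclidean_space set \<Rightarrow> ('a \<Rightarrow> 'b::euclidean_space) \<Rightarrow> bool" where
  "Ck_on 0 A f \<longleftrightarrow> continuous_on A f"
| "Ck_on (Suc k) A f \<longleftrightarrow>
     (\<exists>D. (\<forall>x\<in>A. (f has_derivative (\<lambda>h. \<Sum>b\<in>Basis. (h \<bullet> b) *\<^sub>R D b x)) (at x within A)) \<and>
          (\<forall>b\<in>Basis. Ck_on k A (D b)))"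

definition smooth_on :: "'a::euclidean_space set \<Rightarrow> ('a \<Rightarrow> 'b::euclidean_space) \<Rightarrow> bool" where
  "smooth_on A f \<longleftrightarrow> (\<forall>k. Ck_on k A f)"

text \<open>\<open>C\<^sub>c\<^sup>\<infinity>(A)\<close>, for \<open>A\<close> open or of the form \<open>{0..<S} \<times> UNIV\<close>; in the latter case the functions
  need not vanish at time 0. Elements are extended by zero outside \<open>A\<close>.\<close>

definition Cc_infty :: "'a::euclidean_space set \<Rightarrow> ('a \<Rightarrow> 'b::euclidean_space) set" where
  "Cc_infty A = {\<phi>. smooth_on A \<phi> \<and> (\<exists>K. compact K \<and> K \<subseteq> A \<and> (\<forall>x. x \<notin> K \<longrightarrow> \<phi> x = 0))}"

definition divergence :: "(real^3 \<Rightarrow> real^3) \<Rightarrow> real^3 \<Rightarrow> real" where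
  "divergence u x = trace (jacobian u (at x))"

definition laplacian :: "(real^3 \<Rightarrow> real^3) \<Rightarrow> real^3 \<Rightarrow> real^3" where
  "laplacian u x =
     (\<Sum>b\<in>Basis. frechet_derivative (\<lambda>y. frechet_derivative u (at y) b) (at x) b)"


section \<open>Lebesgue and Sobolev spaces\<close>

text \<open>Elements of Lebesgue spaces are represented by Lebesgue measurable functions, which are not identified when
  they agree almost everywhere.\<close>

definition Lp_space :: "ereal \<Rightarrow> 'a measure \<Rightarrow> ('a \<Rightarrow> 'b::euclidean_space) set" where
  "Lp_space p M = {f \<in> borel_measurable M.
     if p = \<infinity> then \<exists>C. AE x in M. norm (f x) \<le> C
     else integrable M (\<lambda>x. norm (f x) powr real_of_ereal p)}"

text \<open>The norm for finite exponents.\<close>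

definition Lp_norm :: "real \<Rightarrow> ('a::euclidean_space \<Rightarrow> 'b::euclidean_space) \<Rightarrow> real" where
  "Lp_norm p f = (LINT x|lebesgue. norm (f x) powr p) powr (1 / p)"

definition L1_loc :: "'a::euclidean_space set \<Rightarrow> ('a \<Rightarrow> 'b::euclidean_space) set" where
  "L1_loc U = {f. \<forall>K. compact K \<and> K \<subseteq> U \<longrightarrow> set_integrable lebesgue K f}"

definition weak_pderiv ::
  "'a::euclidean_space \<Rightarrow> ('a \<Rightarrow> 'b::euclidean_space) \<Rightarrow> ('a \<Rightarrow> 'b) \<Rightarrow> bool" where
  "weak_pderiv b u g \<longleftrightarrow> u \<in> L1_loc UNIV \<and> g \<in> L1_loc UNIV \<and>
     (\<forall>\<phi>::'a \<Rightarrow> real. \<phi> \<in> Cc_infty UNIV \<longrightarrow>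
        (LINT x|lebesgue. frechet_derivative \<phi> (at x) b *\<^sub>R u x) = - (LINT x|lebesgue. \<phi> x *\<^sub>R g x))"

text \<open>\<open>Sobolev k q\<close> is \<open>W\<^sup>k\<^sup>,\<^sup>q\<close> of the whole space, \<open>1 \<le> q \<le> \<infinity>\<close>.\<close>

primrec Sobolev :: "nat \<Rightarrow> ereal \<Rightarrow> ('a::euclidean_space \<Rightarrow> 'b::euclidean_space) set" where
  "Sobolev 0 q = Lp_space q lebesgue"
| "Sobolev (Suc k) q =
     {u \<in> Lp_space q lebesgue. \<forall>b\<in>Basis. \<exists>g \<in> Sobolev k q. weak_pderiv b u g}"

definition is_weak_gradient :: "(real^3 \<Rightarrow> real) \<Rightarrow> (real^3 \<Rightarrow> real^3) \<Rightarrow> bool" where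
  "is_weak_gradient p g \<longleftrightarrow> (\<forall>j. weak_pderiv (axis j 1) p (\<lambda>x. g x $ j))"

definition is_weak_jacobian :: "(real^3 \<Rightarrow> real^3) \<Rightarrow> (real^3 \<Rightarrow> real^3^3) \<Rightarrow> bool" where
  "is_weak_jacobian u G \<longleftrightarrow> (\<forall>j. weak_pderiv (axis j 1) u (\<lambda>x. column j (G x)))"

text \<open>The matrix \<open>\<nabla>u\<close> with entries \<open>\<partial>\<^sub>ju\<^sub>i\<close> in row \<open>i\<close> and column \<open>j\<close>, so that
  \<open>(u \<cdot> \<nabla>)u = weak_jacobian u x *v u x\<close>. It is determined up to a null set; every use below is
  invariant under changing it on a null set. On matrices, \<open>\<bullet>\<close> and \<open>norm\<close> are the Frobenius inner
  product and norm.\<close>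

definition weak_jacobian :: "(real^3 \<Rightarrow> real^3) \<Rightarrow> real^3 \<Rightarrow> real^3^3" where
  "weak_jacobian u = (SOME G. is_weak_jacobian u G)"

definition H1 :: "(real^3 \<Rightarrow> real^3) set" where
  "H1 = Sobolev 1 2"

definition H1_norm :: "(real^3 \<Rightarrow> real^3) \<Rightarrow> real" where
  "H1_norm u = sqrt ((Lp_norm 2 u)\<^sup>2 + (Lp_norm 2 (weak_jacobian u))\<^sup>2)"

text \<open>Divergence-free in the sense of distributions; \<open>frechet_derivative \<phi> (at x) (u x)\<close> is
  \<open>u \<cdot> \<nabla>\<phi>\<close>.\<close>

definition Lp_sigma :: "ereal \<Rightarrow> (real^3 \<Rightarrow> real^3) set" where
  "Lp_sigma p = {u \<in> Lp_space p lebesgue. \<forall>\<phi>::real^3 \<Rightarrow> real. \<phi> \<in> Cc_infty UNIV \<longrightarrow>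
     (LINT x|lebesgue. frechet_derivative \<phi> (at x) (u x)) = 0}"

text \<open>Elements of the intersection of all \<open>W\<^sup>k\<^sup>,\<^sup>q\<close>, \<open>q \<in> [2,\<infinity>]\<close>, are identified with their smooth
  representatives.\<close>

definition G_space :: "(real^3 \<Rightarrow> real^3) set" where
  "G_space = {V. smooth_on UNIV V \<and> (\<forall>k. \<forall>q::ereal. 2 \<le> q \<longrightarrow> V \<in> Sobolev k q)}"

definition G_sigma :: "(real^3 \<Rightarrow> real^3) set" where
  "G_sigma = {V \<in> G_space. \<forall>x. divergence V x = 0}"


section \<open>Bochner spaces\<close>

text \<open>Time-dependent functions are curried, \<open>V t \<xi>\<close>; space-time is \<open>real \<times> (real^3)\<close> with the time
  coordinate first. The completed measure makes all time integrals below insensitive to changing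
  the integrand on a null set of times.\<close>

abbreviation time :: "real \<Rightarrow> real measure" where
  "time S \<equiv> lebesgue_on {0<..<S}"

text \<open>\<open>L\<^sup>r(0,S;X)\<close> for a space \<open>X\<close> of functions on \<open>real^3\<close> with norm \<open>nrm\<close>. For the separable spaces
  used here (\<open>L\<^sup>q\<close> with \<open>q < \<infinity>\<close>, its divergence-free subspace, \<open>H\<^sup>1\<close>), strong measurability in time is
  the same as having a jointly measurable representative.\<close>

definition Bochner ::
  "ereal \<Rightarrow> real \<Rightarrow> (real^3 \<Rightarrow> 'b) set \<Rightarrow> ((real^3 \<Rightarrow> 'b) \<Rightarrow> real) \<Rightarrow> (real \<Rightarrow> real^3 \<Rightarrow> 'b::euclidean_space) set"
where
  "Bochner r S X nrm = {F.
     (\<lambda>(t, x). F t x) \<in> borel_measurable (lebesgue_on ({0<..<S} \<times> UNIV)) \<and>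
     (AE t in time S. F t \<in> X) \<and>
     (\<lambda>t. nrm (F t)) \<in> Lp_space r (time S)}"

definition LrLq :: "ereal \<Rightarrow> real \<Rightarrow> real \<Rightarrow> (real \<Rightarrow> real^3 \<Rightarrow> 'b::euclidean_space) set" where
  "LrLq r q S = Bochner r S (Lp_space (ereal q) lebesgue) (Lp_norm q)"

definition LrLq_loc :: "real \<Rightarrow> real \<Rightarrow> (real \<Rightarrow> real^3 \<Rightarrow> 'b::euclidean_space) set" where
  "LrLq_loc r q = {F. \<forall>S>0. F \<in> LrLq (ereal r) q S}"

definition C0_L2 :: "(real \<Rightarrow> real^3 \<Rightarrow> real^3) set" where
  "C0_L2 = {V. (\<forall>t\<ge>0. V t \<in> Lp_space 2 lebesgue) \<and>
     (\<forall>t\<ge>0. ((\<lambda>s. Lp_norm 2 (\<lambda>x. V s x - V t x)) \<longlongrightarrow> 0) (at t within {0..}))}"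


section \<open>Forces\<close>

definition H_minus1 :: "((real^3 \<Rightarrow> real^3) \<Rightarrow> real) set" where
  "H_minus1 = {l.
     (\<forall>u\<in>H1. \<forall>v\<in>H1. l (\<lambda>x. u x + v x) = l u + l v) \<and>
     (\<forall>c. \<forall>v\<in>H1. l (\<lambda>x. c *\<^sub>R v x) = c * l v) \<and>
     (\<exists>C. \<forall>v\<in>H1. \<bar>l v\<bar> \<le> C * H1_norm v)}"

definition H_minus1_norm :: "((real^3 \<Rightarrow> real^3) \<Rightarrow> real) \<Rightarrow> real" where
  "H_minus1_norm l = (SUP v\<in>{v \<in> H1. H1_norm v \<le> 1}. \<bar>l v\<bar>)"

text \<open>\<open>L\<^sup>2(0,S;H\<^sup>-\<^sup>1)\<close>; by separability, weak measurability in time suffices.\<close>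

definition L2_H_minus1 :: "real \<Rightarrow> (real \<Rightarrow> (real^3 \<Rightarrow> real^3) \<Rightarrow> real) set" where
  "L2_H_minus1 S = {F.
     (\<forall>v\<in>H1. (\<lambda>t. F t v) \<in> borel_measurable (time S)) \<and>
     (AE t in time S. F t \<in> H_minus1) \<and>
     (\<lambda>t. H_minus1_norm (F t)) \<in> Lp_space 2 (time S)}"

text \<open>\<open>L\<^sup>2(0,S;H\<^sup>-\<^sup>1) + L\<^sup>1(0,S;L\<^sup>2)\<close>. An element \<open>F\<close> is given through its duality pairing:
  \<open>F t v\<close> is \<open>\<langle>F(t),v\<rangle>\<close> for \<open>v\<close> in \<open>H\<^sup>1\<close>.\<close>

definition force_space :: "real \<Rightarrow> (real \<Rightarrow> (real^3 \<Rightarrow> real^3) \<Rightarrow> real) set" where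
  "force_space S = {F. \<exists>f1 \<in> L2_H_minus1 S. \<exists>f2 \<in> LrLq 1 2 S.
     AE t in time S. \<forall>v\<in>H1. F t v = f1 t v + (LINT x|lebesgue. f2 t x \<bullet> v x)}"

text \<open>The distribution defined by the vector field \<open>f\<close> is \<open>F\<close>. By density of the test fields in
  \<open>H\<^sup>1\<close>, \<open>f\<close> determines an element \<open>F\<close> of \<open>force_space\<close> for almost every time.\<close>

definition represents ::
  "(real \<Rightarrow> real^3 \<Rightarrow> real^3) \<Rightarrow> (real \<Rightarrow> (real^3 \<Rightarrow> real^3) \<Rightarrow> real) \<Rightarrow> bool" where
  "represents f F \<longleftrightarrow> (AE t\<in>{0<..} in lebesgue. \<forall>\<phi>\<in>Cc_infty UNIV.
     integrable lebesgue (\<lambda>x. f t x \<bullet> \<phi> x) \<and> F t \<phi> = (LINT x|lebesgue. f t x \<bullet> \<phi> x))"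


section \<open>Leray--Hopf solutions and the pressure\<close>

definition D_space :: "real \<Rightarrow> (real \<Rightarrow> real^3 \<Rightarrow> real^3) set" where
  "D_space S = {\<phi>. (\<lambda>(t, x). \<phi> t x) \<in> Cc_infty ({0..<S} \<times> UNIV) \<and>
     (\<forall>t\<in>{0..<S}. \<forall>x. divergence (\<phi> t) x = 0)}"

definition energy_lhs :: "(real \<Rightarrow> real^3 \<Rightarrow> real^3) \<Rightarrow> real \<Rightarrow> real" where
  "energy_lhs V t =
     (Lp_norm 2 (V t))\<^sup>2 + 2 * (LINT s|time t. (Lp_norm 2 (weak_jacobian (V s)))\<^sup>2)"

definition energy_rhs ::
  "(real^3 \<Rightarrow> real^3) \<Rightarrow> (real \<Rightarrow> (real^3 \<Rightarrow> real^3) \<Rightarrow> real) \<Rightarrow> (real \<Rightarrow> real^3 \<Rightarrow> real^3) \<Rightarrow> real \<Rightarrow> real"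
where
  "energy_rhs V0 F V t = (Lp_norm 2 V0)\<^sup>2 + 2 * (LINT s|time t. F s (V s))"

text \<open>Test fields vanish outside \<open>[0,S)\<close>, so time integrals are over \<open>(0,S)\<close>. The requirement
  \<open>V t \<in> L\<^sup>2\<close> for every \<open>t\<close> expresses that the left side of the energy inequality is finite.\<close>

definition Leray_Hopf ::
  "real \<Rightarrow> (real^3 \<Rightarrow> real^3) \<Rightarrow> (real \<Rightarrow> (real^3 \<Rightarrow> real^3) \<Rightarrow> real) \<Rightarrow> (real \<Rightarrow> real^3 \<Rightarrow> real^3) \<Rightarrow> bool"
where
  "Leray_Hopf S V0 F V \<longleftrightarrow>
     V0 \<in> Lp_sigma 2 \<and> F \<in> force_space S \<and>
     V \<in> Bochner \<infinity> S (Lp_sigma 2) (Lp_norm 2) \<and> V \<in> Bochner 2 S H1 H1_norm \<and>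
     (\<forall>\<phi>\<in>D_space S.
        (LINT t|time S. LINT x|lebesgue.
           weak_jacobian (V t) x \<bullet> jacobian (\<phi> t) (at x)
           + (weak_jacobian (V t) x *v V t x) \<bullet> \<phi> t x
           - V t x \<bullet> vector_derivative (\<lambda>s. \<phi> s x) (at t))
        = (LINT t|time S. F t (\<phi> t)) + (LINT x|lebesgue. V0 x \<bullet> \<phi> 0 x)) \<and>
     (\<forall>t\<in>{0<..S}. V t \<in> Lp_space 2 lebesgue \<and> energy_lhs V t \<le> energy_rhs V0 F V t)"

definition global_Leray_Hopf ::
  "(real^3 \<Rightarrow> real^3) \<Rightarrow> (real \<Rightarrow> (real^3 \<Rightarrow> real^3) \<Rightarrow> real) \<Rightarrow> (real \<Rightarrow> real^3 \<Rightarrow> real^3) \<Rightarrow> bool" where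
  "global_Leray_Hopf V0 F V \<longleftrightarrow> (\<forall>S>0. Leray_Hopf S V0 F V)"

text \<open>Uniqueness is as an equivalence class: on a null set of times, a Leray--Hopf solution can be
  changed arbitrarily as long as the energy inequality persists.\<close>

definition unique_Leray_Hopf ::
  "(real^3 \<Rightarrow> real^3) \<Rightarrow> (real \<Rightarrow> (real^3 \<Rightarrow> real^3) \<Rightarrow> real) \<Rightarrow> (real \<Rightarrow> real^3 \<Rightarrow> real^3) \<Rightarrow> bool" where
  "unique_Leray_Hopf V0 F V \<longleftrightarrow> (\<forall>S>0. \<forall>W. Leray_Hopf S V0 F W \<longrightarrow>
     (AE t in time S. AE x in lebesgue. W t x = V t x))"

text \<open>The momentum equation \<open>V\<^sub>t - \<Delta>V + (V \<cdot> \<nabla>)V + \<nabla>P = F\<close> in the sense of distributions, tested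
  with fields that need not be divergence-free.\<close>

definition associated_pressure ::
  "(real \<Rightarrow> (real^3 \<Rightarrow> real^3) \<Rightarrow> real) \<Rightarrow> (real \<Rightarrow> real^3 \<Rightarrow> real^3) \<Rightarrow> (real \<Rightarrow> real^3 \<Rightarrow> real) \<Rightarrow> bool"
where
  "associated_pressure F V P \<longleftrightarrow> (\<forall>S>0.
     (\<lambda>(t, x). P t x) \<in> L1_loc ({0<..<S} \<times> UNIV) \<and>
     (\<forall>\<phi>. (\<lambda>(t, x). \<phi> t x) \<in> Cc_infty ({0<..<S} \<times> UNIV) \<longrightarrow>
        (LINT t|time S. LINT x|lebesgue.
           - (V t x \<bullet> vector_derivative (\<lambda>s. \<phi> s x) (at t))
           - V t x \<bullet> laplacian (\<phi> t) x
           + (weak_jacobian (V t) x *v V t x) \<bullet> \<phi> t x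
           - P t x * divergence (\<phi> t) x)
        = (LINT t|time S. F t (\<phi> t))))"


section \<open>Solutions with a sequence of singular times\<close>

definition exponents_i :: "real \<Rightarrow> real \<Rightarrow> bool" where
  "exponents_i r q \<longleftrightarrow> r \<ge> 1 \<and> q > 3 \<and> 1 < 2 / r + 3 / q \<and> 2 / r + 3 / q < 5"

definition exponents_ii :: "real \<Rightarrow> real \<Rightarrow> bool" where
  "exponents_ii r q \<longleftrightarrow> r \<ge> 1 \<and> (2 / r + 3 / q \<ge> 5 \<or> 1 < q \<and> q \<le> 3)"

text \<open>The sequences of singular times \<open>\<tau>\<close> and singular points \<open>\<xi>\<close> are indexed from 0. \<open>esssup\<close> is
  extended-valued, and the limit is over \<open>t \<noteq> \<tau> m\<close> from both sides.\<close>

definition singular_solution ::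
  "real \<Rightarrow> real \<Rightarrow> real \<Rightarrow> (real^3 \<Rightarrow> real^3) \<Rightarrow> (real \<Rightarrow> real^3 \<Rightarrow> real^3) \<Rightarrow>
   (real \<Rightarrow> real^3 \<Rightarrow> real^3) \<Rightarrow> (real \<Rightarrow> real^3 \<Rightarrow> real) \<Rightarrow> (nat \<Rightarrow> real) \<Rightarrow> (nat \<Rightarrow> real^3) \<Rightarrow> bool"
where
  "singular_solution T r q V0 f V P \<tau> \<xi> \<longleftrightarrow>
     (\<exists>F. represents f F \<and>
        global_Leray_Hopf V0 F V \<and> V \<in> C0_L2 \<and>
        (\<forall>t>0. energy_lhs V t = energy_rhs V0 F V t) \<and>
        (\<exists>qbar>3. \<forall>s>qbar. V \<in> LrLq_loc (2 * s / (s - 3)) s) \<and>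
        unique_Leray_Hopf V0 F V \<and>
        associated_pressure F V P) \<and>
     strict_mono \<tau> \<and> (\<forall>m. \<tau> m \<in> {0<..<T}) \<and>
     smooth_on ({0..} \<times> UNIV - (\<Union>m. {(\<tau> m, \<xi> m)})) (\<lambda>(t, x). V t x) \<and>
     smooth_on ({0..} \<times> UNIV - (\<Union>m. {(\<tau> m, \<xi> m)})) (\<lambda>(t, x). P t x) \<and>
     (\<forall>m. ((\<lambda>t. esssup lebesgue (\<lambda>x. ereal (norm (weak_jacobian (V t) x)))) \<longlongrightarrow> \<infinity>) (at (\<tau> m))) \<and>
     (\<forall>p\<ge>1. P \<in> LrLq_loc 2 p) \<and>
     (\<exists>Q \<in> LrLq_loc r q. AE t\<in>{0<..} in lebesgue. is_weak_gradient (P t) (Q t))"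

end

theory Submission
  imports Defs
begin

text \<open>The solution is an infinite collection of vortices, far apart in space and with disjoint lifetimes. The
  vortex around the singular point \<open>(\<tau>, \<xi>)\<close> is the swirl \<open>u = a \<psi>(1 - |y|\<^sup>2/R\<^sup>2) (-y\<^sub>2, y\<^sub>1, 0)\<close>,
  \<open>y = x - \<xi>\<close>, with the radius \<open>R = |t - \<tau>|\<^sup>1\<^sup>/\<^sup>2\<close> and \<open>a\<close> of order \<open>R\<close> to the power \<open>-2\<gamma>\<close>. It is divergence-free, its
  size is at most \<open>R\<close> to the power \<open>1 - 2\<gamma>\<close>, so it is continuous and vanishes at time \<open>\<tau>\<close>, while
  \<open>\<nabla>u(\<xi>)\<close> blows up like \<open>R\<close> to the power \<open>-2\<gamma>\<close>. The pressure is taken to be 0 and the force is whatever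
  the equation then dictates; it is of order \<open>R\<close> to the power \<open>-1 - 2\<gamma>\<close> on a ball of radius \<open>R\<close>, hence
  lies in \<open>L\<^sup>r(L\<^sup>q)\<close> as soon as \<open>2\<gamma> < 2/r + 3/q - 1\<close>. The initial field is 0.

  Uniqueness is weak-strong. The equation of a second solution \<open>W\<close> is tested with \<open>\<kappa>(t) V\<close>, where \<open>V\<close> is
  approximated by smooth fields with finitely many vortices, and combined with the energy inequality
  for \<open>W\<close> and the energy equality for \<open>V\<close>. As \<open>|V| \<le> 1\<close>, the convective terms are bounded by
  \<open>|\<nabla>(W - V)|\<^sup>2 + |W - V|\<^sup>2/4\<close>, and a weight \<open>\<kappa>\<close> with \<open>-\<kappa>' \<ge> \<kappa>\<close> absorbs them.\<close>

section \<open>Calculus of smooth functions\<close>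

text \<open>Where the exponents come from: a force of order R^(-1-2\<gamma>) on a ball of volume R^3
  has an L^q norm whose r-th power is |t - \<tau>| to the power r (-1/2 - \<gamma> + 3/(2q)). The
  condition 1 < 2/r + 3/q, common to (i) and (ii), is what leaves room for \<gamma> > 0. Keeping the
  force bounded in L^2 at all times asks for 2 (1 + 2\<gamma>) \<le> 3, hence for \<gamma> \<le>
  1/4. A swirl is chosen because its convective term points towards the axis, orthogonally to u, and
  does no work. Two obstacles shape the uniqueness proof. V is not a test field: it is singular at
  infinitely many points and its vortices march off to infinity. And its gradient is unbounded, so
  every convective term has to be rewritten until V appears undifferentiated. A technical difficulty
  is added by the weak gradient of W, which is determined separately at each time and carries no
  joint measurability in (t, x).\<close>

lemma linear_sum_Basis:
  assumes "linear f"
  shows "(\<Sum>b\<in>Basis. (h \<bullet> b) *\<^sub>R f b) = f h"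
proof -
  have "f h = f (\<Sum>b\<in>Basis. (h \<bullet> b) *\<^sub>R b)" by (simp add: euclidean_representation)
  also have "\<dots> = (\<Sum>b\<in>Basis. (h \<bullet> b) *\<^sub>R f b)"
    by (simp add: linear_sum[OF assms] linear_scale[OF assms])
  finally show ?thesis by simp
qed

lemma sum_Basis_single:
  assumes "b \<in> Basis"
  shows "(\<Sum>c\<in>Basis. (b \<bullet> c) *\<^sub>R F c) = (F b :: 'b::real_vector)"
proof -
  have "(\<Sum>c\<in>Basis. (b \<bullet> c) *\<^sub>R F c) = (\<Sum>c\<in>Basis. if c = b then F b else 0)"
    by (rule sum.cong) (use assms in \<open>auto simp: inner_Basis\<close>)
  then show ?thesis using assms by simp
qed

text \<open>Trades the family of partial derivatives in \<open>Ck_on\<close> for the derivative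
  \<open>F x\<close> as a linear map, the form in which the calculus rules produce it. Linearity
  recovers \<open>F x\<close> from its values on the basis.\<close>

lemma Ck_on_SucI:
  assumes "\<And>x. x \<in> A \<Longrightarrow> (f has_derivative F x) (at x within A)"
    and "\<And>b. b \<in> Basis \<Longrightarrow> Ck_on k A (\<lambda>x. F x b)"
  shows "Ck_on (Suc k) A f"
proof -
  have "(f has_derivative (\<lambda>h. \<Sum>b\<in>Basis. (h \<bullet> b) *\<^sub>R F x b)) (at x within A)" if "x \<in> A" for x
  proof -
    have "linear (F x)" using assms(1)[OF that] by (rule has_derivative_linear)
    then show ?thesis using assms(1)[OF that] by (simp add: linear_sum_Basis)
  qed
  then show ?thesis using assms(2) by (auto intro!: exI[of _ "\<lambda>b x. F x b"])
qed

text \<open>Within a general set \<open>A\<close> the derivative may fail to be unique, so one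
  witness \<open>F\<close> has to be carried along. Being rebuilt from its partials, it is linear at
  every point.\<close>

lemma Ck_on_SucE:
  assumes "Ck_on (Suc k) A f"
  obtains F where "\<And>x. x \<in> A \<Longrightarrow> (f has_derivative F x) (at x within A)"
    and "\<And>b. b \<in> Basis \<Longrightarrow> Ck_on k A (\<lambda>x. F x b)" and "\<And>x. bounded_linear (F x)"
proof -
  obtain D where D: "\<forall>x\<in>A. (f has_derivative (\<lambda>h. \<Sum>b\<in>Basis. (h \<bullet> b) *\<^sub>R D b x)) (at x within A)"
    "\<forall>b\<in>Basis. Ck_on k A (D b)" using assms by auto
  show thesis
  proof (rule that[of "\<lambda>x h. \<Sum>b\<in>Basis. (h \<bullet> b) *\<^sub>R D b x"])
    show "bounded_linear (\<lambda>h. \<Sum>b\<in>Basis. (h \<bullet> b) *\<^sub>R D b x)" for x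
      by (intro bounded_linear_intros)
  qed (use D in \<open>auto simp: sum_Basis_single\<close>)
qed

lemma Ck_on_subset: "Ck_on k A f \<Longrightarrow> B \<subseteq> A \<Longrightarrow> Ck_on k B f"
proof (induction k arbitrary: f)
  case 0 then show ?case by (auto intro: continuous_on_subset)
next
  case (Suc k)
  obtain F where F: "\<And>x. x \<in> A \<Longrightarrow> (f has_derivative F x) (at x within A)"
    "\<And>b. b \<in> Basis \<Longrightarrow> Ck_on k A (\<lambda>x. F x b)" using Suc.prems(1) by (elim Ck_on_SucE) blast
  show ?case
  proof (rule Ck_on_SucI[where F=F])
    show "(f has_derivative F x) (at x within B)" if "x \<in> B" for x
      using has_derivative_subset[OF F(1) Suc.prems(2)] that Suc.prems(2) by blast
  qed (use F(2) Suc in blast)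
qed

lemma Ck_on_cong:
  assumes "Ck_on k A f" "\<And>x. x \<in> A \<Longrightarrow> f x = g x"
  shows "Ck_on k A g"
proof (cases k)
  case 0 then show ?thesis using assms by (simp cong: continuous_on_cong)
next
  case (Suc k')
  then have "Ck_on (Suc k') A f" using assms by simp
  then obtain F where F: "\<And>x. x \<in> A \<Longrightarrow> (f has_derivative F x) (at x within A)"
    "\<And>b. b \<in> Basis \<Longrightarrow> Ck_on k' A (\<lambda>x. F x b)" by (elim Ck_on_SucE) blast
  show ?thesis unfolding Suc
    by (rule Ck_on_SucI[where F=F]) (use F assms(2) in \<open>auto intro: has_derivative_transform_within[OF _ zero_less_one]\<close>)
qed

lemma Ck_on_SucD: "Ck_on (Suc k) A f \<Longrightarrow> Ck_on k A f"
proof (induction k arbitrary: f)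
  case 0
  then obtain F where "\<And>x. x \<in> A \<Longrightarrow> (f has_derivative F x) (at x within A)"
    by (elim Ck_on_SucE) blast
  then show ?case by (auto intro: has_derivative_continuous_on)
next
  case (Suc k)
  obtain F where F: "\<And>x. x \<in> A \<Longrightarrow> (f has_derivative F x) (at x within A)"
    "\<And>b. b \<in> Basis \<Longrightarrow> Ck_on (Suc k) A (\<lambda>x. F x b)" using Suc.prems by (elim Ck_on_SucE) blast
  show ?case
    by (rule Ck_on_SucI[where F=F]) (use F Suc.IH in auto)
qed

lemma Ck_on_imp_continuous: "Ck_on k A f \<Longrightarrow> continuous_on A f"
  by (induction k) (use Ck_on_SucD in auto)

lemma Ck_on_const [intro, simp]: "Ck_on k A (\<lambda>x. c)"
proof (induction k arbitrary: c)
  case (Suc k)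
  then show ?case by (intro Ck_on_SucI[where F="\<lambda>x h. 0"]) auto
qed simp

lemma Ck_on_linear: "bounded_linear f \<Longrightarrow> Ck_on k A f"
proof (cases k)
  case (Suc k')
  assume "bounded_linear f"
  then show ?thesis unfolding Suc
    by (intro Ck_on_SucI[where F="\<lambda>x. f"]) (auto intro: bounded_linear_imp_has_derivative)
qed (auto intro: linear_continuous_on)

lemma Ck_on_add: "Ck_on k A f \<Longrightarrow> Ck_on k A g \<Longrightarrow> Ck_on k A (\<lambda>x. f x + g x)"
proof (induction k arbitrary: f g)
  case (Suc k)
  obtain F where F: "\<And>x. x \<in> A \<Longrightarrow> (f has_derivative F x) (at x within A)"
    "\<And>b. b \<in> Basis \<Longrightarrow> Ck_on k A (\<lambda>x. F x b)" using Suc.prems(1) by (elim Ck_on_SucE) blast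
  obtain G where G: "\<And>x. x \<in> A \<Longrightarrow> (g has_derivative G x) (at x within A)"
    "\<And>b. b \<in> Basis \<Longrightarrow> Ck_on k A (\<lambda>x. G x b)" using Suc.prems(2) by (elim Ck_on_SucE) blast
  show ?case
    by (rule Ck_on_SucI[where F="\<lambda>x h. F x h + G x h"]) (auto intro!: derivative_intros F G Suc.IH)
qed (auto intro: continuous_on_add)

lemma Ck_on_sum: "(\<And>i. i \<in> I \<Longrightarrow> Ck_on k A (f i)) \<Longrightarrow> Ck_on k A (\<lambda>x. \<Sum>i\<in>I. f i x)"
  by (induction I rule: infinite_finite_induct) (auto intro: Ck_on_add)

lemma Ck_on_bilinear:
  assumes "bounded_bilinear p"
  shows "Ck_on k A f \<Longrightarrow> Ck_on k A g \<Longrightarrow> Ck_on k A (\<lambda>x. p (f x) (g x))"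
proof (induction k arbitrary: f g)
  case 0 then show ?case by (auto intro: bounded_bilinear.continuous_on[OF assms])
next
  case (Suc k)
  obtain F where F: "\<And>x. x \<in> A \<Longrightarrow> (f has_derivative F x) (at x within A)"
    "\<And>b. b \<in> Basis \<Longrightarrow> Ck_on k A (\<lambda>x. F x b)" using Suc.prems(1) by (elim Ck_on_SucE) blast
  obtain G where G: "\<And>x. x \<in> A \<Longrightarrow> (g has_derivative G x) (at x within A)"
    "\<And>b. b \<in> Basis \<Longrightarrow> Ck_on k A (\<lambda>x. G x b)" using Suc.prems(2) by (elim Ck_on_SucE) blast
  show ?case
    by (rule Ck_on_SucI[where F="\<lambda>x h. p (f x) (G x h) + p (F x h) (g x)"])
      (auto intro!: bounded_bilinear.FDERIV[OF assms] F G Suc.IH Ck_on_add Ck_on_SucD[OF Suc.prems(1)]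
          Ck_on_SucD[OF Suc.prems(2)])
qed

lemmas Ck_on_mult = Ck_on_bilinear[OF bounded_bilinear_mult]
lemmas Ck_on_scaleR = Ck_on_bilinear[OF bounded_bilinear_scaleR]
lemmas Ck_on_inner = Ck_on_bilinear[OF bounded_bilinear_inner]

lemma Ck_on_minus: "Ck_on k A f \<Longrightarrow> Ck_on k A (\<lambda>x. - f x)"
  using Ck_on_scaleR[OF Ck_on_const[of k A "-1"], of f] by simp

lemma Ck_on_diff: "Ck_on k A f \<Longrightarrow> Ck_on k A g \<Longrightarrow> Ck_on k A (\<lambda>x. f x - g x)"
  using Ck_on_add[OF _ Ck_on_minus, of k A f g] by simp

lemma Ck_on_power:
  fixes f :: "'a::euclidean_space \<Rightarrow> real"
  shows "Ck_on k A f \<Longrightarrow> Ck_on k A (\<lambda>x. f x ^ n)"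
  by (induction n) (auto intro: Ck_on_mult)

lemma Ck_on_id: "Ck_on k A (\<lambda>x. x)"
  by (rule Ck_on_linear) (rule bounded_linear_ident)

text \<open>Expanded over a basis, the chain rule gives a sum of products of partials of
  \<open>g\<close> with \<open>F (g x) c\<close>. The latter are compositions again, which is why
  the induction varies \<open>f\<close> and keeps \<open>g\<close>.\<close>

lemma Ck_on_compose:
  fixes f :: "'b::euclidean_space \<Rightarrow> 'c::euclidean_space" and g :: "'a::euclidean_space \<Rightarrow> 'b"
  assumes "g ` A \<subseteq> B"
  shows "Ck_on k B f \<Longrightarrow> Ck_on k A g \<Longrightarrow> Ck_on k A (\<lambda>x. f (g x))"
proof (induction k arbitrary: f)
  case 0 then show ?case using assms by (auto intro: continuous_on_compose2)
next
  case (Suc k)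
  obtain F where F: "\<And>x. x \<in> B \<Longrightarrow> (f has_derivative F x) (at x within B)"
    "\<And>b. b \<in> Basis \<Longrightarrow> Ck_on k B (\<lambda>x. F x b)" "\<And>x. bounded_linear (F x)"
    using Suc.prems(1) by (elim Ck_on_SucE) blast
  obtain G where G: "\<And>x. x \<in> A \<Longrightarrow> (g has_derivative G x) (at x within A)"
    "\<And>b. b \<in> Basis \<Longrightarrow> Ck_on k A (\<lambda>x. G x b)" using Suc.prems(2) by (elim Ck_on_SucE) blast
  show ?case
  proof (rule Ck_on_SucI[where F="\<lambda>x h. \<Sum>c\<in>Basis. (G x h \<bullet> c) *\<^sub>R F (g x) c"])
    fix x assume x: "x \<in> A"
    have "(f has_derivative F (g x)) (at (g x) within g ` A)"
      using F(1)[of "g x"] x assms by (auto intro: has_derivative_subset)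
    then have "((\<lambda>x. f (g x)) has_derivative (\<lambda>h. F (g x) (G x h))) (at x within A)"
      by (rule has_derivative_in_compose[OF G(1)[OF x]])
    then show "((\<lambda>x. f (g x)) has_derivative (\<lambda>h. \<Sum>c\<in>Basis. (G x h \<bullet> c) *\<^sub>R F (g x) c)) (at x within A)"
      using linear_sum_Basis[OF bounded_linear.linear[OF F(3)]] by simp
  next
    fix b :: 'a assume "b \<in> Basis"
    then show "Ck_on k A (\<lambda>x. \<Sum>c\<in>Basis. (G x b \<bullet> c) *\<^sub>R F (g x) c)"
      by (intro Ck_on_sum Ck_on_scaleR Ck_on_inner Ck_on_const G(2) Suc.IH F(2) Ck_on_SucD[OF Suc.prems(2)])
  qed
qed

text \<open>On an open set the derivative is unique, so the existential witness in
  \<open>Ck_on\<close> can be replaced by \<open>frechet_derivative\<close>. This is what allows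
  local witnesses to be glued in \<open>Ck_on_local\<close>.\<close>

lemma Ck_on_Suc_open:
  fixes f :: "'a::euclidean_space \<Rightarrow> 'b::euclidean_space"
  assumes "open A"
  shows "Ck_on (Suc k) A f \<longleftrightarrow> (\<forall>x\<in>A. f differentiable at x) \<and>
    (\<forall>b\<in>Basis. Ck_on k A (\<lambda>x. frechet_derivative f (at x) b))"
proof
  assume "Ck_on (Suc k) A f"
  then obtain F where F: "\<And>x. x \<in> A \<Longrightarrow> (f has_derivative F x) (at x within A)"
    "\<And>b. b \<in> Basis \<Longrightarrow> Ck_on k A (\<lambda>x. F x b)" by (elim Ck_on_SucE) blast
  have F1: "(f has_derivative F x) (at x)" if "x \<in> A" for x
    using F(1)[OF that] at_within_open[OF that assms] by simp
  then show "(\<forall>x\<in>A. f differentiable at x) \<and> (\<forall>b\<in>Basis. Ck_on k A (\<lambda>x. frechet_derivative f (at x) b))"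
    using Ck_on_cong[OF F(2)] frechet_derivative_at[OF F1] by (auto simp: differentiable_def)
next
  assume *: "(\<forall>x\<in>A. f differentiable at x) \<and> (\<forall>b\<in>Basis. Ck_on k A (\<lambda>x. frechet_derivative f (at x) b))"
  show "Ck_on (Suc k) A f"
    by (rule Ck_on_SucI[where F="\<lambda>x. frechet_derivative f (at x)"])
      (use * in \<open>auto simp: frechet_derivative_works has_derivative_at_withinI\<close>)
qed

lemma Ck_on_local:
  fixes f :: "'a::euclidean_space \<Rightarrow> 'b::euclidean_space"
  assumes "open A" "\<And>x. x \<in> A \<Longrightarrow> \<exists>U. open U \<and> x \<in> U \<and> Ck_on k (A \<inter> U) f"
  shows "Ck_on k A f"
  using assms(2)
proof (induction k arbitrary: f)
  case 0
  show ?case unfolding Ck_on.simps continuous_on_eq_continuous_at[OF assms(1)]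
  proof
    fix x assume x: "x \<in> A"
    with 0 obtain U where U: "open U" "x \<in> U" "continuous_on (A \<inter> U) f" by auto
    then show "isCont f x" using x assms(1) by (auto simp: continuous_on_eq_continuous_at open_Int)
  qed
next
  case (Suc k)
  show ?case unfolding Ck_on_Suc_open[OF assms(1)]
  proof (intro conjI ballI)
    fix x assume x: "x \<in> A"
    with Suc.prems obtain U where U: "open U" "x \<in> U" "Ck_on (Suc k) (A \<inter> U) f" by blast
    then show "f differentiable at x"
      using x Ck_on_Suc_open[OF open_Int[OF assms(1) U(1)]] by auto
  next
    fix b :: 'a assume b: "b \<in> Basis"
    show "Ck_on k A (\<lambda>x. frechet_derivative f (at x) b)"
    proof (rule Suc.IH)
      fix x assume x: "x \<in> A"
      with Suc.prems obtain U where U: "open U" "x \<in> U" "Ck_on (Suc k) (A \<inter> U) f" by blast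
      then show "\<exists>U. open U \<and> x \<in> U \<and> Ck_on k (A \<inter> U) (\<lambda>x. frechet_derivative f (at x) b)"
        using Ck_on_Suc_open[OF open_Int[OF assms(1) U(1)]] b by blast
    qed
  qed
qed

lemma Ck_on_Un_open:
  assumes "open A" "open B" "Ck_on k A f" "Ck_on k B f"
  shows "Ck_on k (A \<union> B) f"
proof (rule Ck_on_local)
  fix x assume "x \<in> A \<union> B"
  then show "\<exists>U. open U \<and> x \<in> U \<and> Ck_on k ((A \<union> B) \<inter> U) f"
  proof
    assume "x \<in> A" then show ?thesis using assms by (intro exI[of _ A]) (auto simp: Int_absorb1)
  next
    assume "x \<in> B" then show ?thesis using assms by (intro exI[of _ B]) (auto simp: Int_absorb1)
  qed
qed (use assms in auto)

lemma Ck_on_real_deriv: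
  fixes f :: "real \<Rightarrow> real"
  assumes "\<And>x. x \<in> A \<Longrightarrow> (f has_real_derivative f' x) (at x)" "Ck_on k A f'"
  shows "Ck_on (Suc k) A f"
  using assms
  by (intro Ck_on_SucI[where F="\<lambda>x h. f' x * h"]) (auto simp: has_field_derivative_def intro: has_derivative_at_withinI)

text \<open>\<open>flat p\<close> is \<open>p(1/s) e\<^sup>-\<^sup>1\<^sup>/\<^sup>s\<close> on the positive half line. This family is closed under
  differentiation, which gives smoothness at 0.\<close>

definition flat :: "real poly \<Rightarrow> real \<Rightarrow> real" where
  "flat p s = (if s > 0 then poly p (1 / s) * exp (- (1 / s)) else 0)"

text \<open>With u = 1/s, differentiation in s is -u^2 times differentiation in u, which turns p(u)
  e^(-u) into u^2 (p(u) - p'(u)) e^(-u).\<close>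

definition flat_deriv :: "real poly \<Rightarrow> real poly" where
  "flat_deriv p = [:0, 0, 1:] * (p - pderiv p)"

lemma poly_exp_tendsto_0: "((\<lambda>u. poly p u * exp (- u)) \<longlongrightarrow> (0::real)) at_top"
proof -
  have "(\<lambda>u. poly p u * exp (- u)) = (\<lambda>u. \<Sum>i\<le>degree p. coeff p i * (u ^ i / exp u))"
    by (simp add: poly_altdef fun_eq_iff sum_distrib_right exp_minus field_simps sum_divide_distrib)
  then show ?thesis
    by (simp only:) (auto intro!: tendsto_null_sum tendsto_mult_right_zero tendsto_power_div_exp_0 simp: times_divide_eq_right[symmetric] simp del: times_divide_eq_right)
qed

lemma flat_tendsto_0: "((\<lambda>s. flat p s) \<longlongrightarrow> 0) (at 0)"
proof -
  have "filterlim (\<lambda>s::real. 1 / s) at_top (at_right 0)"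
    using filterlim_inverse_at_top_right by (simp add: inverse_eq_divide)
  from filterlim_compose[OF poly_exp_tendsto_0[of p] this]
  have R: "((\<lambda>s. flat p s) \<longlongrightarrow> 0) (at_right 0)"
    by (rule Lim_transform_eventually) (auto simp: flat_def eventually_at_filter)
  have "((\<lambda>s. flat p s) \<longlongrightarrow> 0) (at_left 0)"
    by (rule Lim_transform_eventually[OF tendsto_const]) (auto simp: flat_def eventually_at_filter)
  then show ?thesis using R by (simp add: filterlim_at_split)
qed

lemma DERIV_flat: "(flat p has_real_derivative flat (flat_deriv p) s) (at s)"
proof -
  consider "s < 0" | "s = 0" | "s > 0" by linarith
  then show ?thesis
  proof cases
    case 1
    have "((\<lambda>s. 0) has_real_derivative 0) (at s)" by simp
    then have "(flat p has_real_derivative 0) (at s)"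
      by (rule has_field_derivative_transform_within_open[of _ _ _ "{..<0}"]) (use 1 in \<open>auto simp: flat_def\<close>)
    then show ?thesis using 1 by (simp add: flat_def)
  next
    case 2
    \<comment> \<open>Dividing by h multiplies the polynomial by its variable 1/h, so the difference
      quotient at 0 is again a member of the family and tends to 0.\<close>
    have "((\<lambda>h. flat ([:0, 1:] * p) h) \<longlongrightarrow> 0) (at 0)" by (rule flat_tendsto_0)
    then have "((\<lambda>h. (flat p (0 + h) - flat p 0) / h) \<longlongrightarrow> 0) (at 0)"
      by (rule Lim_transform_eventually) (auto simp: flat_def field_simps intro!: always_eventually)
    then show ?thesis using 2 by (simp add: DERIV_def flat_def)
  next
    case 3
    have "((\<lambda>s. poly p (1 / s) * exp (- (1 / s))) has_real_derivative flat (flat_deriv p) s) (at s)"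
      using 3 by (auto intro!: derivative_eq_intros DERIV_chain2[where f="poly p", OF poly_DERIV]
          simp: flat_def flat_deriv_def field_simps power2_eq_square)
    then show ?thesis
      by (rule has_field_derivative_transform_within_open[of _ _ _ "{0<..}"]) (use 3 in \<open>auto simp: flat_def\<close>)
  qed
qed

lemma Ck_on_flat: "Ck_on k A (flat p)"
proof (induction k arbitrary: p)
  case 0
  show ?case using DERIV_flat by (auto intro!: continuous_at_imp_continuous_on DERIV_isCont)
next
  case (Suc k) then show ?case by (intro Ck_on_real_deriv[OF DERIV_flat])
qed

lemma continuous_flat [continuous_intros]: "continuous_on A f \<Longrightarrow> continuous_on A (\<lambda>x. flat p (f x))"
  using continuous_on_compose2[of UNIV "flat p" A f] Ck_on_flat[of 0 UNIV p] by auto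

lemma flat_nonpos: "s \<le> 0 \<Longrightarrow> flat p s = 0"
  by (simp add: flat_def)

text \<open>The arguments to be bounded have the form 1 minus a nonnegative quantity. On that half
  line \<open>flat p\<close> is 0 for negative arguments and continuous on the compact rest.\<close>

lemma flat_bound: "\<exists>C>0. \<forall>s\<le>1. \<bar>flat p s\<bar> \<le> C"
proof -
  have "compact (flat p ` {0..1})"
    by (intro compact_continuous_image) (auto intro: continuous_intros)
  then obtain C where C: "C > 0" "\<And>s. s \<in> {0..1} \<Longrightarrow> norm (flat p s) \<le> C"
    using compact_imp_bounded bounded_pos by (metis image_eqI)
  have "\<bar>flat p s\<bar> \<le> C" if "s \<le> 1" for s
    using C that by (cases "s \<ge> 0") (auto simp: flat_nonpos)
  then show ?thesis using C(1) by blast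
qed

lemma Ck_on_exp: "Ck_on k A (exp :: real \<Rightarrow> real)"
proof (induction k)
  case (Suc k) then show ?case by (intro Ck_on_real_deriv[OF DERIV_exp])
qed (auto intro: continuous_intros)

lemma Ck_on_powr: "Ck_on k {0<..} (\<lambda>x::real. x powr e)"
proof (induction k arbitrary: e)
  case 0
  show ?case by (auto intro!: continuous_intros)
next
  case (Suc k)
  show ?case
  proof (rule Ck_on_real_deriv)
    show "((\<lambda>x. x powr e) has_real_derivative e * x powr (e - 1)) (at x)" if "x \<in> {0<..}" for x
      using that by (auto intro!: derivative_eq_intros simp: powr_diff)
    show "Ck_on k {0<..} (\<lambda>x. e * x powr (e - 1))" by (intro Ck_on_mult Ck_on_const Suc)
  qed
qed

section \<open>Weak derivatives\<close>

lemma measurable_lebesgue_borel: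
  "f \<in> borel_measurable borel \<Longrightarrow> f \<in> borel_measurable lebesgue"
  by (intro measurable_completion) simp

lemma measurable_lebesgue_continuous:
  fixes f :: "'a::euclidean_space \<Rightarrow> 'b::topological_space"
  shows "continuous_on UNIV f \<Longrightarrow> f \<in> borel_measurable lebesgue"
  by (intro measurable_lebesgue_borel borel_measurable_continuous_onI)

lemma integrable_lebesgue_continuous_compact:
  fixes f :: "'a::euclidean_space \<Rightarrow> 'b::euclidean_space"
  assumes "continuous_on UNIV f" "compact K" "\<And>x. x \<notin> K \<Longrightarrow> f x = 0"
  shows "integrable lebesgue f"
proof -
  have "integrable lborel (\<lambda>x. indicator K x *\<^sub>R f x)"
    using assms(1,2) by (intro borel_integrable_compact) (auto intro: continuous_on_subset)
  moreover have "(\<lambda>x. indicator K x *\<^sub>R f x) = f" using assms(3) by (auto simp: indicator_def)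
  ultimately have "integrable lborel f" by simp
  then show ?thesis using borel_measurable_continuous_onI[OF assms(1)] by (simp add: integrable_completion)
qed

section \<open>Integration by parts on the whole space\<close>

lemma integral_lborel_shift:
  fixes f :: "'a::euclidean_space \<Rightarrow> 'b::euclidean_space"
  assumes "f \<in> borel_measurable borel"
  shows "(LINT x|lborel. f (c + x)) = (LINT x|lborel. f x)"
  using integral_distr[of "(+) c" lborel borel f] assms by (simp add: lborel_distr_plus)

lemma integrable_lborel_shift:
  fixes f :: "'a::euclidean_space \<Rightarrow> 'b::euclidean_space"
  assumes "integrable lborel f"
  shows "integrable lborel (\<lambda>x. f (c + x))"
proof -
  have "f \<in> borel_measurable borel" using assms by simp
  then show ?thesis using integrable_distr_eq[of "(+) c" lborel borel f] assms by (simp add: lborel_distr_plus)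
qed

text \<open>Translation invariance does the work: the difference quotients of \<open>u\<close> in
  direction \<open>b\<close> all have integral 0, they are uniformly bounded and supported in one
  ball, and dominated convergence passes to the derivative.\<close>

lemma integral_partial_derivative:
  fixes u :: "'a::euclidean_space \<Rightarrow> 'b::euclidean_space"
  assumes d: "\<And>x. (u has_derivative u' x) (at x)"
    and c: "continuous_on UNIV (\<lambda>x. u' x b)"
    and K: "compact K" "\<And>x. x \<notin> K \<Longrightarrow> u x = 0" and b: "b \<in> Basis"
  shows "(LINT x|lebesgue. u' x b) = 0"
proof -
  have u'0: "u' x b = 0" if "x \<notin> K" for x
  proof -
    have "((\<lambda>x. 0) has_derivative (\<lambda>h. 0)) (at x)" by simp
    then have "(u has_derivative (\<lambda>h. 0)) (at x)"
      by (rule has_derivative_transform_within_open[of _ _ _ _ "- K"])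
        (use that K in \<open>auto intro: compact_imp_closed\<close>)
    then show ?thesis using has_derivative_unique[OF d] by metis
  qed
  obtain C where C: "C > 0" "\<And>x. norm (u' x b) \<le> C"
  proof -
    have "bounded ((\<lambda>x. u' x b) ` K)"
      by (intro compact_imp_bounded compact_continuous_image K continuous_on_subset[OF c]) auto
    then obtain C where "C > 0" "\<And>x. x \<in> K \<Longrightarrow> norm (u' x b) \<le> C"
      by (auto simp: bounded_pos)
    then show thesis using u'0 that[of C] by (metis norm_zero less_imp_le)
  qed
  have cu: "continuous_on UNIV u"
    using d by (auto intro!: continuous_at_imp_continuous_on has_derivative_continuous)
  then have mu [measurable]: "u \<in> borel_measurable borel" by (rule borel_measurable_continuous_onI)
  have iu: "integrable lborel u"
    using integrable_lebesgue_continuous_compact[OF cu K] mu by (simp add: integrable_completion)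
  obtain R where R: "R > 0" "\<And>x. x \<in> K \<Longrightarrow> norm x \<le> R"
    using compact_imp_bounded[OF K(1)] by (auto simp: bounded_pos)
  define D where "D = (\<lambda>n x. real (Suc n) *\<^sub>R (u ((1 / real (Suc n)) *\<^sub>R b + x) - u x))"
  have D0: "D n x = 0" if "norm x > R + 1" for n x
  proof -
    have "norm ((1 / real (Suc n)) *\<^sub>R b) \<le> 1" using b by simp
    then have "norm ((1 / real (Suc n)) *\<^sub>R b + x) > R" using that norm_triangle_ineq2[of x "- ((1 / real (Suc n)) *\<^sub>R b)"]
      unfolding norm_minus_cancel diff_minus_eq_add by (subst add.commute) linarith
    then have "(1 / real (Suc n)) *\<^sub>R b + x \<notin> K" "x \<notin> K" using R that by force+
    then show ?thesis by (simp add: D_def K)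
  qed
  have Db: "norm (D n x) \<le> C" for n x
  proof -
    define w where "w = (1 / real (Suc n)) *\<^sub>R b"
    \<comment> \<open>The mean value inequality on a segment of length 1/(n+1) bounds the quotient
      by the supremum \<open>C\<close> of the derivative, uniformly in n.\<close>
    have "norm (u (x + 1 *\<^sub>R w) - u (x + 0 *\<^sub>R w)) \<le> (C / real (Suc n)) * norm (1 - 0::real)"
    proof (rule differentiable_bound[of "UNIV::real set" "\<lambda>s. u (x + s *\<^sub>R w)" "\<lambda>s h. u' (x + s *\<^sub>R w) (h *\<^sub>R w)"])
      fix s :: real
      show "((\<lambda>s. u (x + s *\<^sub>R w)) has_derivative (\<lambda>h. u' (x + s *\<^sub>R w) (h *\<^sub>R w))) (at s within UNIV)"
        by (rule has_derivative_compose[OF _ d]) (auto intro!: derivative_eq_intros)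
      show "onorm (\<lambda>h. u' (x + s *\<^sub>R w) (h *\<^sub>R w)) \<le> C / real (Suc n)"
      proof (rule onorm_le)
        fix h :: real
        have lin: "linear (u' (x + s *\<^sub>R w))" using d by (rule has_derivative_linear)
        have "norm (u' (x + s *\<^sub>R w) (h *\<^sub>R w)) = \<bar>h\<bar> / real (Suc n) * norm (u' (x + s *\<^sub>R w) b)"
        proof -
          have "h *\<^sub>R w = (h / real (Suc n)) *\<^sub>R b" by (simp add: w_def)
          then show ?thesis by (simp only: linear_scale[OF lin] norm_scaleR) (simp add: abs_divide del: of_nat_Suc)
        qed
        also have "\<dots> \<le> \<bar>h\<bar> / real (Suc n) * C" by (intro mult_left_mono C) auto
        finally show "norm (u' (x + s *\<^sub>R w) (h *\<^sub>R w)) \<le> C / real (Suc n) * norm h" by (simp add: mult.commute)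
      qed
    qed auto
    then have "norm (u (w + x) - u x) \<le> C / real (Suc n)" by (simp add: add.commute)
    then have "real (Suc n) * norm (u (w + x) - u x) \<le> C" by (simp add: field_simps)
    then show ?thesis unfolding D_def w_def[symmetric] norm_scaleR by simp
  qed
  have Dlim: "(\<lambda>n. D n x) \<longlonglongrightarrow> u' x b" for x
  proof -
    have lin: "linear (u' x)" using d by (rule has_derivative_linear)
    define y where "y = (\<lambda>n. (1 / real (Suc n)) *\<^sub>R b + x)"
    have y: "norm (y n - x) = 1 / real (Suc n)" "y n - x = (1 / real (Suc n)) *\<^sub>R b" for n
      using b by (auto simp: y_def)
    have lim: "((\<lambda>y. (u y - u x - u' x (y - x)) /\<^sub>R norm (y - x)) \<longlongrightarrow> 0) (at x)"
      using d[of x] by (simp add: has_derivative_at_within)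
    have "y \<longlonglongrightarrow> x"
    proof -
      have "(\<lambda>n. 1 / real (Suc n)) \<longlonglongrightarrow> 0" using LIMSEQ_inverse_real_of_nat by (simp add: inverse_eq_divide)
      then have "(\<lambda>n. (1 / real (Suc n)) *\<^sub>R b + x) \<longlonglongrightarrow> 0 *\<^sub>R b + x" by (intro tendsto_intros)
      then show ?thesis by (simp add: y_def)
    qed
    moreover have "\<forall>n. y n \<noteq> x" using y(1) by (metis divide_eq_0_iff norm_zero of_nat_Suc of_nat_eq_0_iff nat.distinct(1) right_minus_eq zero_neq_one)
    ultimately have "filterlim y (at x) sequentially" by (simp add: filterlim_at)
    from filterlim_compose[OF lim this]
    have "(\<lambda>n. (u (y n) - u x - u' x (y n - x)) /\<^sub>R norm (y n - x)) \<longlonglongrightarrow> 0" .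
    moreover have "(u (y n) - u x - u' x (y n - x)) /\<^sub>R norm (y n - x) = D n x - u' x b" for n
      unfolding y by (simp add: D_def y_def linear_scale[OF lin] scaleR_diff_right norm_Basis[OF b] del: of_nat_Suc)
    ultimately have "(\<lambda>n. D n x - u' x b) \<longlonglongrightarrow> 0" by simp
    then show ?thesis by (rule LIM_zero_cancel)
  qed
  have "(\<lambda>n. LINT x|lborel. D n x) \<longlonglongrightarrow> (LINT x|lborel. u' x b)"
  proof (rule integral_dominated_convergence[where w="\<lambda>x. indicator (cball 0 (R + 1)) x *\<^sub>R C"])
    show "integrable lborel (\<lambda>x. indicator (cball (0::'a) (R + 1)) x *\<^sub>R C)"
      by (intro borel_integrable_compact) auto
    show "(\<lambda>x. u' x b) \<in> borel_measurable lborel" using borel_measurable_continuous_onI[OF c] by simp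
    show "D n \<in> borel_measurable lborel" for n
    proof -
      have "continuous_on UNIV (D n)"
        unfolding D_def by (intro continuous_intros cu continuous_on_compose2[OF cu]) auto
      then show ?thesis using borel_measurable_continuous_onI by simp
    qed
    show "AE x in lborel. norm (D n x) \<le> indicator (cball 0 (R + 1)) x *\<^sub>R C" for n
      using Db D0 by (intro AE_I2) (auto simp: indicator_def not_le)
  qed (use Dlim in auto)
  moreover have "(LINT x|lborel. D n x) = 0" for n
    unfolding D_def using iu integrable_lborel_shift[OF iu] by (simp add: integral_lborel_shift)
  ultimately have "(LINT x|lborel. u' x b) = 0" by (simp add: LIMSEQ_const_iff)
  then show ?thesis using borel_measurable_continuous_onI[OF c] by (simp add: integral_completion)
qed

text \<open>\<open>integral_partial_derivative\<close> applied to the product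
  \<open>p (u x) (v x)\<close>, which vanishes outside \<open>K\<close> as soon as one factor does.
  The general bilinear \<open>p\<close> covers multiplication, scaling and inner products.\<close>

lemma integral_by_parts_compact:
  fixes u :: "'a::euclidean_space \<Rightarrow> 'b::euclidean_space" and v :: "'a \<Rightarrow> 'c::euclidean_space"
    and p :: "'b \<Rightarrow> 'c \<Rightarrow> 'd::euclidean_space"
  assumes p: "bounded_bilinear p"
    and u: "\<And>x. (u has_derivative u' x) (at x)" and v: "\<And>x. (v has_derivative v' x) (at x)"
    and cu: "continuous_on UNIV (\<lambda>x. u' x b)" and cv: "continuous_on UNIV (\<lambda>x. v' x b)"
    and K: "compact K" "\<And>x. x \<notin> K \<Longrightarrow> u x = 0 \<or> v x = 0" and b: "b \<in> Basis"
  shows "integrable lebesgue (\<lambda>x. p (u' x b) (v x)) \<Longrightarrow> integrable lebesgue (\<lambda>x. p (u x) (v' x b)) \<Longrightarrow>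
    (LINT x|lebesgue. p (u' x b) (v x)) = - (LINT x|lebesgue. p (u x) (v' x b))"
proof -
  interpret p: bounded_bilinear p by fact
  have cu0: "continuous_on UNIV u" and cv0: "continuous_on UNIV v"
    using u v by (auto intro!: continuous_at_imp_continuous_on has_derivative_continuous)
  assume i1: "integrable lebesgue (\<lambda>x. p (u' x b) (v x))"
    and i2: "integrable lebesgue (\<lambda>x. p (u x) (v' x b))"
  have "(LINT x|lebesgue. p (u x) (v' x b) + p (u' x b) (v x)) = 0"
    by (rule integral_partial_derivative[where u="\<lambda>x. p (u x) (v x)" and K=K and u'="\<lambda>x h. p (u x) (v' x h) + p (u' x h) (v x)"])
      (use K(1) b in \<open>auto dest!: K(2) simp: p.zero_left p.zero_right intro!: p.FDERIV u v continuous_intros p.continuous_on cu cv cu0 cv0\<close>)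
  then show ?thesis using i1 i2 by (simp add: eq_neg_iff_add_eq_0 add.commute)
qed

lemma Ck_on_prod:
  fixes f :: "'i \<Rightarrow> 'a::euclidean_space \<Rightarrow> real"
  shows "(\<And>i. i \<in> I \<Longrightarrow> Ck_on k A (f i)) \<Longrightarrow> Ck_on k A (\<lambda>x. \<Prod>i\<in>I. f i x)"
  by (induction I rule: infinite_finite_induct) (auto intro: Ck_on_mult)

lemma flat_1_nonneg: "0 \<le> flat 1 s" and flat_1_le_1: "flat 1 s \<le> 1"
  by (auto simp: flat_def)

lemma flat_1_pos: "s > 0 \<Longrightarrow> flat 1 s > 0"
  by (auto simp: flat_def)

lemma flat_1_mono: "s \<le> t \<Longrightarrow> flat 1 s \<le> flat 1 t"
  by (auto simp: flat_def frac_le)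

lemma flat_1_tendsto_1: "s > 0 \<Longrightarrow> (\<lambda>n. flat 1 (real (Suc n) * s)) \<longlonglongrightarrow> 1"
proof -
  assume s: "s > 0"
  have "(\<lambda>n. 1 / real (Suc n)) \<longlonglongrightarrow> 0" using LIMSEQ_inverse_real_of_nat by (simp add: inverse_eq_divide)
  then have "(\<lambda>n. exp (- ((1 / real (Suc n)) * (1 / s)))) \<longlonglongrightarrow> exp (- (0 * (1 / s)))" by (intro tendsto_intros)
  then show ?thesis using s by (simp add: flat_def del: of_nat_Suc)
qed

text \<open>Smooth functions between 0 and the indicator of the open box that converge to it
  pointwise: \<open>flat 1 ((n+1) s)\<close> is exp(-1/((n+1) s)) for s > 0, which tends to 1, and
  it is 0 for s \<le> 0.\<close>

definition box_bump :: "'a::euclidean_space \<Rightarrow> 'a \<Rightarrow> nat \<Rightarrow> 'a \<Rightarrow> real" where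
  "box_bump a b n x = (\<Prod>i\<in>Basis. flat 1 (real (Suc n) * (x \<bullet> i - a \<bullet> i)) * flat 1 (real (Suc n) * (b \<bullet> i - x \<bullet> i)))"

lemma box_bump_bounds: "0 \<le> box_bump a b n x" "box_bump a b n x \<le> 1"
  unfolding box_bump_def
  by (auto intro!: prod_nonneg prod_le_1 mult_le_one flat_1_nonneg flat_1_le_1 mult_nonneg_nonneg)

lemma box_bump_zero: "x \<notin> box a b \<Longrightarrow> box_bump a b n x = 0"
  by (force simp: box_bump_def box_def flat_nonpos mult_le_0_iff not_less)

lemma box_bump_tendsto: "(\<lambda>n. box_bump a b n x) \<longlonglongrightarrow> indicator (box a b) x"
proof (cases "x \<in> box a b")
  case True
  then have "(\<lambda>n. box_bump a b n x) \<longlonglongrightarrow> (\<Prod>i\<in>(Basis::'a set). 1 * 1)"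
    unfolding box_bump_def by (intro tendsto_prod tendsto_mult flat_1_tendsto_1) (auto simp: box_def)
  then show ?thesis using True by simp
qed (simp add: box_bump_zero)

lemma box_bump_Cc: "box_bump a b n \<in> Cc_infty UNIV"
proof -
  have flat: "Ck_on k UNIV (\<lambda>x. flat 1 (g x))" if "Ck_on k UNIV g" for k and g :: "'a \<Rightarrow> real"
    using Ck_on_compose[OF _ Ck_on_flat[of k UNIV] that] by simp
  have "Ck_on k UNIV (box_bump a b n)" for k
    unfolding box_bump_def[abs_def]
    by (intro Ck_on_prod Ck_on_mult flat Ck_on_diff Ck_on_const Ck_on_inner Ck_on_id)
  moreover have "box a b \<subseteq> cbox a b" by (rule box_subset_cbox)
  ultimately show ?thesis
    using box_bump_zero[of _ a b n] by (auto simp: Cc_infty_def smooth_on_def intro!: exI[of _ "cbox a b"])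
qed

lemma Cc_inftyD:
  assumes "\<phi> \<in> Cc_infty UNIV"
  shows "Ck_on k UNIV \<phi>" "continuous_on UNIV \<phi>" "\<And>x. (\<phi> has_derivative frechet_derivative \<phi> (at x)) (at x)"
    "\<And>b. b \<in> Basis \<Longrightarrow> continuous_on UNIV (\<lambda>x. frechet_derivative \<phi> (at x) b)"
    "\<exists>K. compact K \<and> (\<forall>x. x \<notin> K \<longrightarrow> \<phi> x = 0 \<and> frechet_derivative \<phi> (at x) = (\<lambda>h. 0))"
proof -
  show c: "Ck_on k UNIV \<phi>" for k using assms by (auto simp: Cc_infty_def smooth_on_def)
  show "continuous_on UNIV \<phi>" using c by (rule Ck_on_imp_continuous)
  show d: "(\<phi> has_derivative frechet_derivative \<phi> (at x)) (at x)" for x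
    using c[of "Suc 0"] unfolding Ck_on_Suc_open[OF open_UNIV] by (auto simp: frechet_derivative_works)
  show "continuous_on UNIV (\<lambda>x. frechet_derivative \<phi> (at x) b)" if "b \<in> Basis" for b
    using c[of "Suc 0"] that unfolding Ck_on_Suc_open[OF open_UNIV] by auto
  obtain K where K: "compact K" "\<And>x. x \<notin> K \<Longrightarrow> \<phi> x = 0" using assms by (auto simp: Cc_infty_def)
  have "frechet_derivative \<phi> (at x) = (\<lambda>h. 0)" if "x \<notin> K" for x
  proof -
    have "((\<lambda>x. 0) has_derivative (\<lambda>h. 0)) (at x)" by simp
    then have "(\<phi> has_derivative (\<lambda>h. 0)) (at x)"
      by (rule has_derivative_transform_within_open[of _ _ _ _ "- K"])
        (use that K in \<open>auto intro: compact_imp_closed\<close>)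
    then show ?thesis using has_derivative_unique[OF d] by metis
  qed
  then show "\<exists>K. compact K \<and> (\<forall>x. x \<notin> K \<longrightarrow> \<phi> x = 0 \<and> frechet_derivative \<phi> (at x) = (\<lambda>h. 0))"
    using K by blast
qed

text \<open>Global measurability comes from the truncations to balls of radius n, which are
  integrable and converge pointwise.\<close>

lemma L1_locD:
  assumes "u \<in> L1_loc UNIV"
  shows "u \<in> borel_measurable lebesgue" "compact K \<Longrightarrow> integrable lebesgue (\<lambda>x. indicator K x *\<^sub>R u x)"
proof -
  show i: "integrable lebesgue (\<lambda>x. indicator K x *\<^sub>R u x)" if "compact K" for K
    using assms that by (auto simp: L1_loc_def set_integrable_def)
  have "(\<lambda>x. indicator (cball 0 (real n)) x *\<^sub>R u x) \<in> borel_measurable lebesgue" for n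
    using i[of "cball 0 (real n)"] by (intro borel_measurable_integrable) auto
  moreover have "(\<lambda>n. indicator (cball 0 (real n)) x *\<^sub>R u x) \<longlonglongrightarrow> u x" for x
  proof (rule tendsto_eventually)
    obtain N where "norm x \<le> real N" using real_arch_simple by blast
    then show "\<forall>\<^sub>F n in sequentially. indicator (cball 0 (real n)) x *\<^sub>R u x = u x"
      by (intro eventually_sequentiallyI[of N]) (auto simp: indicator_def)
  qed
  ultimately show "u \<in> borel_measurable lebesgue"
    by (rule borel_measurable_LIMSEQ_metric)
qed

lemma integrable_bounded_mult_L1_loc:
  fixes u :: "'a::euclidean_space \<Rightarrow> 'b::euclidean_space"
  assumes "u \<in> L1_loc UNIV" "\<eta> \<in> borel_measurable lebesgue" "compact K"
    "\<And>x. x \<notin> K \<Longrightarrow> \<eta> x = 0" "\<And>x. \<bar>\<eta> x\<bar> \<le> C"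
  shows "integrable lebesgue (\<lambda>x. \<eta> x *\<^sub>R u x)"
proof (rule Bochner_Integration.integrable_bound)
  show "integrable lebesgue (\<lambda>x. C *\<^sub>R (indicator K x *\<^sub>R u x))"
    by (intro integrable_scaleR_right L1_locD assms)
  show "(\<lambda>x. \<eta> x *\<^sub>R u x) \<in> borel_measurable lebesgue"
    using L1_locD(1)[OF assms(1)] assms(2) by measurable
  have C: "C \<ge> 0" using assms(5)[of undefined] by linarith
  show "AE x in lebesgue. norm (\<eta> x *\<^sub>R u x) \<le> norm (C *\<^sub>R (indicator K x *\<^sub>R u x))"
  proof (rule AE_I2)
    fix x show "norm (\<eta> x *\<^sub>R u x) \<le> norm (C *\<^sub>R (indicator K x *\<^sub>R u x))"
      using assms(4)[of x] assms(5)[of x] C by (cases "x \<in> K") (auto intro: mult_right_mono)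
  qed
qed

lemma integrable_continuous_mult_L1_loc:
  fixes u :: "'a::euclidean_space \<Rightarrow> 'b::euclidean_space" and \<eta> :: "'a \<Rightarrow> real"
  assumes "u \<in> L1_loc UNIV" "continuous_on UNIV \<eta>" "compact K" "\<And>x. x \<notin> K \<Longrightarrow> \<eta> x = 0"
  shows "integrable lebesgue (\<lambda>x. \<eta> x *\<^sub>R u x)"
proof -
  have "bounded (\<eta> ` K)"
    by (intro compact_imp_bounded compact_continuous_image assms continuous_on_subset[OF assms(2)]) auto
  then obtain C where "C > 0" "\<And>x. x \<in> K \<Longrightarrow> \<bar>\<eta> x\<bar> \<le> C" by (auto simp: bounded_pos)
  then have "\<bar>\<eta> x\<bar> \<le> C" for x using assms(4)[of x] by (cases "x \<in> K") auto
  moreover have "\<eta> \<in> borel_measurable lebesgue"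
    using borel_measurable_continuous_onI[OF assms(2)] by (intro measurable_completion) simp
  ultimately show ?thesis using assms by (intro integrable_bounded_mult_L1_loc[where K=K and C=C]) auto
qed

lemma L1_loc_continuous:
  fixes u :: "'a::euclidean_space \<Rightarrow> 'b::euclidean_space"
  assumes "continuous_on UNIV u"
  shows "u \<in> L1_loc UNIV"
proof -
  have "integrable lebesgue (\<lambda>x. indicator K x *\<^sub>R u x)" if "compact K" for K
  proof -
    have "integrable lborel (\<lambda>x. indicator K x *\<^sub>R u x)"
      by (intro borel_integrable_compact that continuous_on_subset[OF assms]) auto
    then show ?thesis using integrable_completion[of "\<lambda>x. indicator K x *\<^sub>R u x" lborel] by auto
  qed
  then show ?thesis by (auto simp: L1_loc_def set_integrable_def)
qed

lemma weak_pderiv_classical: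
  fixes u :: "'a::euclidean_space \<Rightarrow> 'b::euclidean_space"
  assumes "\<And>x. (u has_derivative u' x) (at x)" "continuous_on UNIV (\<lambda>x. u' x b)" "b \<in> Basis"
  shows "weak_pderiv b u (\<lambda>x. u' x b)"
proof -
  have cu: "continuous_on UNIV u"
    using assms(1) by (auto intro!: continuous_at_imp_continuous_on has_derivative_continuous)
  have L: "u \<in> L1_loc UNIV" "(\<lambda>x. u' x b) \<in> L1_loc UNIV"
    using cu assms(2) by (auto intro: L1_loc_continuous)
  have "(LINT x|lebesgue. frechet_derivative \<phi> (at x) b *\<^sub>R u x) = - (LINT x|lebesgue. \<phi> x *\<^sub>R u' x b)"
    if \<phi>: "\<phi> \<in> Cc_infty UNIV" for \<phi> :: "'a \<Rightarrow> real"
  proof -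
    obtain K where K: "compact K" "\<And>x. x \<notin> K \<Longrightarrow> \<phi> x = 0 \<and> frechet_derivative \<phi> (at x) = (\<lambda>h. 0)"
      using Cc_inftyD(5)[OF \<phi>] by blast
    show ?thesis
      by (rule integral_by_parts_compact[OF bounded_bilinear_scaleR Cc_inftyD(3)[OF \<phi>] assms(1)
            Cc_inftyD(4)[OF \<phi> assms(3)] assms(2) K(1) _ assms(3)])
        (use K Cc_inftyD(2,4)[OF \<phi>] assms(3) L in \<open>auto intro!: integrable_continuous_mult_L1_loc[where K=K]\<close>)
  qed
  then show ?thesis using L by (auto simp: weak_pderiv_def)
qed

text \<open>The positive and negative parts of \<open>g\<close> are densities of two measures that
  agree on all boxes. Boxes are an intersection-stable generator of the Borel sets, so the measures
  coincide, and then so do the densities.\<close>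

lemma AE_zero_if_box_integrals_zero_real:
  fixes g :: "'a::euclidean_space \<Rightarrow> real"
  assumes m [measurable]: "g \<in> borel_measurable borel"
    and i: "\<And>a b. integrable lborel (\<lambda>x. indicator (box a b) x * g x)"
    and z: "\<And>a b. (LINT x|lborel. indicator (box a b) x * g x) = 0"
  shows "AE x in lborel. g x = 0"
proof -
  let ?M = "density lborel (\<lambda>x. ennreal (g x))" and ?N = "density lborel (\<lambda>x. ennreal (- g x))"
  have fin: "(\<integral>\<^sup>+x. ennreal (g x) * indicator (box a b) x \<partial>lborel) < \<infinity>"
    "(\<integral>\<^sup>+x. ennreal (- g x) * indicator (box a b) x \<partial>lborel) < \<infinity>" for a b
  proof -
    have *: "(\<integral>\<^sup>+x. ennreal (norm (indicator (box a b) x * g x)) \<partial>lborel) < \<infinity>"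
      using i[of a b] by (simp add: integrable_iff_bounded)
    show "(\<integral>\<^sup>+x. ennreal (g x) * indicator (box a b) x \<partial>lborel) < \<infinity>"
      by (rule le_less_trans[OF nn_integral_mono *]) (auto simp: indicator_def intro!: ennreal_leI)
    show "(\<integral>\<^sup>+x. ennreal (- g x) * indicator (box a b) x \<partial>lborel) < \<infinity>"
      by (rule le_less_trans[OF nn_integral_mono *]) (auto simp: indicator_def intro!: ennreal_leI)
  qed
  have eq: "emeasure ?M (box a b) = emeasure ?N (box a b)" for a b
  proof -
    let ?p = "\<integral>\<^sup>+x. ennreal (indicator (box a b) x * g x) \<partial>lborel"
    let ?n = "\<integral>\<^sup>+x. ennreal (- (indicator (box a b) x * g x)) \<partial>lborel"
    have p: "?p = (\<integral>\<^sup>+x. ennreal (g x) * indicator (box a b) x \<partial>lborel)"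
      and n: "?n = (\<integral>\<^sup>+x. ennreal (- g x) * indicator (box a b) x \<partial>lborel)"
      by (auto intro!: nn_integral_cong simp: indicator_def)
    have "enn2real ?p - enn2real ?n = 0"
      using z[of a b] i[of a b] by (subst (asm) real_lebesgue_integral_def) auto
    then have "?p = ?n" using fin[of a b] unfolding p[symmetric] n[symmetric]
      by (metis ennreal_enn2real eq_iff_diff_eq_0 infinity_ennreal_def)
    then show ?thesis using p n by (simp add: emeasure_density)
  qed
  have "?M = ?N"
  proof (rule measure_eqI_generator_eq[where E="range (\<lambda>(a, b). box a b)" and \<Omega>=UNIV
        and A="\<lambda>i. box (- (real i *\<^sub>R One)) (real i *\<^sub>R One)"])
    show "Int_stable (range (\<lambda>(a, b). box a b :: 'a set))"
      by (auto simp: Int_stable_def box_Int_box)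
    show "sets ?M = sigma_sets UNIV (range (\<lambda>(a, b). box a b))"
      "sets ?N = sigma_sets UNIV (range (\<lambda>(a, b). box a b))"
      by (auto simp: borel_eq_box)
    show "(\<Union>i. box (- (real i *\<^sub>R One)) (real i *\<^sub>R One)) = (UNIV :: 'a set)"
      by (rule UN_box_eq_UNIV)
    show "emeasure ?M (box (- (real i *\<^sub>R One)) (real i *\<^sub>R One)) \<noteq> \<infinity>" for i
      using fin(1) by (simp add: emeasure_density less_top)
  qed (use eq in auto)
  then have "AE x in lborel. ennreal (g x) = ennreal (- g x)"
    by (intro sigma_finite_measure.density_unique[OF sigma_finite_lborel]) auto
  then show ?thesis
  proof eventually_elim
    case (elim x) then show ?case by (cases "g x \<ge> 0") (auto simp: ennreal_neg)
  qed
qed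

lemma box_bump_integral_tendsto:
  fixes g :: "'a::euclidean_space \<Rightarrow> 'b::euclidean_space"
  assumes g: "g \<in> L1_loc UNIV"
  shows "integrable lebesgue (\<lambda>x. indicator (box a b) x *\<^sub>R g x)"
    "(\<lambda>n. LINT x|lebesgue. box_bump a b n x *\<^sub>R g x) \<longlonglongrightarrow> (LINT x|lebesgue. indicator (box a b) x *\<^sub>R g x)"
proof -
  show i: "integrable lebesgue (\<lambda>x. indicator (box a b) x *\<^sub>R g x)"
    by (rule integrable_bounded_mult_L1_loc[OF g, where K="cbox a b" and C=1])
      (use box_subset_cbox[of a b] in \<open>auto split: split_indicator intro!: borel_measurable_indicator\<close>)
  show "(\<lambda>n. LINT x|lebesgue. box_bump a b n x *\<^sub>R g x) \<longlonglongrightarrow> (LINT x|lebesgue. indicator (box a b) x *\<^sub>R g x)"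
  proof (rule integral_dominated_convergence[where w="\<lambda>x. norm (indicator (box a b) x *\<^sub>R g x)"])
    show "(\<lambda>x. box_bump a b n x *\<^sub>R g x) \<in> borel_measurable lebesgue" for n
      by (intro borel_measurable_scaleR measurable_lebesgue_continuous Cc_inftyD(2)[OF box_bump_Cc] L1_locD(1)[OF g])
    show "AE x in lebesgue. (\<lambda>n. box_bump a b n x *\<^sub>R g x) \<longlonglongrightarrow> indicator (box a b) x *\<^sub>R g x"
      by (intro AE_I2 tendsto_intros box_bump_tendsto)
    show "AE x in lebesgue. norm (box_bump a b n x *\<^sub>R g x) \<le> norm (indicator (box a b) x *\<^sub>R g x)" for n
    proof (rule AE_I2)
      fix x show "norm (box_bump a b n x *\<^sub>R g x) \<le> norm (indicator (box a b) x *\<^sub>R g x)"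
        using box_bump_bounds[of a b n x] box_bump_zero[of x a b n]
        by (cases "x \<in> box a b") (auto intro: mult_left_le_one_le)
    qed
  qed (use i in \<open>auto simp del: norm_scaleR\<close>)
qed

text \<open>The fundamental lemma of the calculus of variations. Testing with
  \<open>box_bump\<close> and passing to the limit gives vanishing integrals over boxes, and these
  decide each component.\<close>

lemma AE_zero_if_test_integrals_zero:
  fixes g :: "'a::euclidean_space \<Rightarrow> 'b::euclidean_space"
  assumes g: "g \<in> L1_loc UNIV"
    and z: "\<And>\<phi>::'a \<Rightarrow> real. \<phi> \<in> Cc_infty UNIV \<Longrightarrow> (LINT x|lebesgue. \<phi> x *\<^sub>R g x) = 0"
  shows "AE x in lebesgue. g x = 0"
proof -
  have box: "integrable lebesgue (\<lambda>x. indicator (box a b) x *\<^sub>R g x)"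
    "(LINT x|lebesgue. indicator (box a b) x *\<^sub>R g x) = 0" for a b :: 'a
    using box_bump_integral_tendsto[OF g, of a b] by (simp_all add: z[OF box_bump_Cc] LIMSEQ_const_iff)
  have "AE x in lebesgue. g x \<bullet> c = 0" for c
  proof -
    have "(\<lambda>x. g x \<bullet> c) \<in> borel_measurable lebesgue" using L1_locD(1)[OF g] by measurable
    \<comment> \<open>The lemma on box integrals compares densities of Borel measures, so the
      component is replaced by a Borel representative.\<close>
    then obtain h where h [measurable]: "h \<in> borel_measurable borel" and gh: "AE x in lborel. g x \<bullet> c = h x"
      using completion_ex_borel_measurable_real[of "\<lambda>x. g x \<bullet> c" lborel] by auto
    have gh': "AE x in lebesgue. g x \<bullet> c = h x" using gh by (rule AE_completion)
    have hm: "(\<lambda>x. indicator (box a b) x * h x) \<in> borel_measurable lebesgue" for a b :: 'a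
      by (intro measurable_lebesgue_borel) measurable
    have i: "integrable lebesgue (\<lambda>x. indicator (box a b) x * h x)" for a b :: 'a
    proof -
      have "integrable lebesgue (\<lambda>x. (indicator (box a b) x *\<^sub>R g x) \<bullet> c)" by (intro integrable_inner_left box(1))
      then show ?thesis
        by (rule integrable_cong_AE_imp) (use gh' hm in \<open>auto elim!: eventually_mono\<close>)
    qed
    have z: "(LINT x|lebesgue. indicator (box a b) x * h x) = 0" for a b :: 'a
    proof -
      have "(LINT x|lebesgue. indicator (box a b) x * h x) = (LINT x|lebesgue. (indicator (box a b) x *\<^sub>R g x) \<bullet> c)"
        by (rule integral_cong_AE) (use gh' hm borel_measurable_integrable[OF integrable_inner_left[OF box(1)]] in \<open>auto elim!: eventually_mono\<close>)
      also have "\<dots> = 0" by (simp only: integral_inner_left[OF box(1)] box(2)) simp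
      finally show ?thesis .
    qed
    have "AE x in lborel. h x = 0"
      by (rule AE_zero_if_box_integrals_zero_real) (use i z in \<open>auto simp: integrable_completion integral_completion\<close>)
    from AE_completion[OF this] gh' show ?thesis by eventually_elim simp
  qed
  then have "AE x in lebesgue. \<forall>c\<in>Basis. g x \<bullet> c = 0" by (intro AE_finite_allI) auto
  then show ?thesis by eventually_elim (auto intro: euclidean_eqI)
qed

lemma weak_pderiv_unique:
  assumes "weak_pderiv b u g" "weak_pderiv b u h"
  shows "AE x in lebesgue. g x = h x"
proof -
  have L: "g \<in> L1_loc UNIV" "h \<in> L1_loc UNIV" using assms by (auto simp: weak_pderiv_def)
  have "AE x in lebesgue. g x - h x = 0"
  proof (rule AE_zero_if_test_integrals_zero)
    show "(\<lambda>x. g x - h x) \<in> L1_loc UNIV"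
      using L by (auto simp: L1_loc_def set_integrable_def scaleR_diff_right)
  next
    fix \<phi> :: "'a \<Rightarrow> real" assume \<phi>: "\<phi> \<in> Cc_infty UNIV"
    obtain K where K: "compact K" "\<And>x. x \<notin> K \<Longrightarrow> \<phi> x = 0" using Cc_inftyD(5)[OF \<phi>] by blast
    have i: "integrable lebesgue (\<lambda>x. \<phi> x *\<^sub>R g x)" "integrable lebesgue (\<lambda>x. \<phi> x *\<^sub>R h x)"
      using L K Cc_inftyD(2)[OF \<phi>] by (auto intro: integrable_continuous_mult_L1_loc[where K=K])
    have "(LINT x|lebesgue. \<phi> x *\<^sub>R g x) = (LINT x|lebesgue. \<phi> x *\<^sub>R h x)"
    proof -
      have "- (LINT x|lebesgue. \<phi> x *\<^sub>R g x) = - (LINT x|lebesgue. \<phi> x *\<^sub>R h x)"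
        using assms \<phi> unfolding weak_pderiv_def by simp
      then show ?thesis by simp
    qed
    then show "(LINT x|lebesgue. \<phi> x *\<^sub>R (g x - h x)) = 0" using i by (simp add: scaleR_diff_right)
  qed
  then show ?thesis by simp
qed

section \<open>Measurability in time\<close>

text \<open>Lebesgue measure is complete: the set where \<open>f\<close> and \<open>g\<close> differ
  is measurable together with all its subsets. This serves functions built from
  \<open>weak_jacobian\<close>, which are only determined almost everywhere.\<close>

lemma measurable_AE_lebesgue:
  fixes f g :: "'a::euclidean_space \<Rightarrow> 'b::euclidean_space"
  assumes f: "f \<in> borel_measurable (lebesgue_on A)" and A: "A \<in> sets lebesgue"
    and eq: "AE x in lebesgue_on A. f x = g x"
  shows "g \<in> borel_measurable (lebesgue_on A)"
proof -
  have A': "A \<inter> space lebesgue \<in> sets lebesgue" using A by simp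
  define F where "F = (\<lambda>x. indicator A x *\<^sub>R f x)"
  define G where "G = (\<lambda>x. indicator A x *\<^sub>R g x)"
  have [measurable]: "F \<in> borel_measurable lebesgue"
    using f unfolding F_def by (simp add: borel_measurable_restrict_space_iff[OF A'])
  have "AE x in lebesgue. x \<in> A \<longrightarrow> f x = g x" using eq by (simp add: AE_restrict_space_iff[OF A'])
  then have "AE x in lebesgue. F x = G x"
    by eventually_elim (auto simp: F_def G_def indicator_def)
  then have "AE x in lborel. \<not> (F x \<noteq> G x)" unfolding AE_completion_iff by simp
  then have [measurable]: "Measurable.pred lebesgue (\<lambda>x. F x \<noteq> G x)" by (rule sets_completion_AE)
  have "G \<in> borel_measurable lebesgue"
  proof (rule measurableI)
    fix U :: "'b set" assume [measurable]: "U \<in> sets borel"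
    have "AE x in lborel. \<not> (F x \<noteq> G x \<and> G x \<in> U)"
      using \<open>AE x in lborel. \<not> (F x \<noteq> G x)\<close> by eventually_elim auto
    then have [measurable]: "Measurable.pred lebesgue (\<lambda>x. F x \<noteq> G x \<and> G x \<in> U)" by (rule sets_completion_AE)
    have "G -` U \<inter> space lebesgue = {x \<in> space lebesgue. (F x \<in> U \<and> \<not> F x \<noteq> G x) \<or> (F x \<noteq> G x \<and> G x \<in> U)}"
      by auto
    also have "\<dots> \<in> sets lebesgue" by measurable
    finally show "G -` U \<inter> space lebesgue \<in> sets lebesgue" .
  qed auto
  then show ?thesis unfolding G_def by (simp add: borel_measurable_restrict_space_iff[OF A'])
qed

lemma completion_ex_borel_measurable_euclidean:
  fixes g :: "'a \<Rightarrow> 'b::euclidean_space"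
  assumes g: "g \<in> borel_measurable (completion M)"
  shows "\<exists>h \<in> borel_measurable M. AE x in M. g x = h x"
proof -
  have "\<exists>h. h \<in> borel_measurable M \<and> (AE x in M. g x \<bullet> b = h x)" for b
    using completion_ex_borel_measurable_real[of "\<lambda>x. g x \<bullet> b" M] g by auto
  then obtain h where h: "\<And>b. h b \<in> borel_measurable M" "\<And>b. AE x in M. g x \<bullet> b = h b x" by metis
  have "AE x in M. \<forall>b\<in>Basis. g x \<bullet> b = h b x" by (intro AE_finite_allI h) auto
  then have "AE x in M. g x = (\<Sum>b\<in>Basis. h b x *\<^sub>R b)"
  proof eventually_elim
    case (elim x)
    have "g x = (\<Sum>b\<in>Basis. (g x \<bullet> b) *\<^sub>R b)" by (simp add: euclidean_representation)
    also have "\<dots> = (\<Sum>b\<in>Basis. h b x *\<^sub>R b)" using elim by simp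
    finally show ?case .
  qed
  moreover have "(\<lambda>x. \<Sum>b\<in>Basis. h b x *\<^sub>R b) \<in> borel_measurable M"
    by (intro borel_measurable_sum borel_measurable_scaleR h(1) borel_measurable_const)
  ultimately show ?thesis by (rule bexI)
qed

text \<open>Lebesgue measurability on the slab says nothing about the section at one particular
  time, and Fubini is applied on the product sigma-algebra. A Borel version is well behaved in both
  respects and agrees with \<open>F\<close> on almost every time slice.\<close>

lemma joint_borel_representative:
  fixes F :: "real \<Rightarrow> 'a::euclidean_space \<Rightarrow> 'b::euclidean_space"
  assumes "(\<lambda>(t, x). F t x) \<in> borel_measurable (lebesgue_on ({0<..<S} \<times> UNIV))"
  obtains F' where "(\<lambda>(t, x). F' t x) \<in> borel_measurable (borel \<Otimes>\<^sub>M borel)"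
    "AE t in time S. AE x in lebesgue. F t x = F' t x"
proof -
  let ?A = "{0<..<S} \<times> UNIV :: (real \<times> 'a) set"
  have A: "?A \<in> sets lebesgue" by (intro sets_completionI_sets) (simp add: open_Times)
  have "(\<lambda>z. indicator ?A z *\<^sub>R (case z of (t, x) \<Rightarrow> F t x)) \<in> borel_measurable lebesgue"
    using assms A by (simp add: borel_measurable_restrict_space_iff)
  from completion_ex_borel_measurable_euclidean[OF this] obtain h where
    h: "h \<in> borel_measurable lborel" "AE z in lborel. indicator ?A z *\<^sub>R (case z of (t, x) \<Rightarrow> F t x) = h z" by blast
  have "AE z in lborel \<Otimes>\<^sub>M lborel. indicator ?A z *\<^sub>R (case z of (t, x) \<Rightarrow> F t x) = h z"
    using h(2) unfolding lborel_prod .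
  from lborel_pair.AE_pair[OF this]
  have "AE t in lborel. AE x in lborel. indicator ?A (t, x) *\<^sub>R F t x = h (t, x)" by simp
  then have "AE t in lebesgue. AE x in lborel. indicator ?A (t, x) *\<^sub>R F t x = h (t, x)"
    by (rule AE_completion)
  then have "AE t in lebesgue. t \<in> {0<..<S} \<longrightarrow> (AE x in lebesgue. F t x = h (t, x))"
  proof eventually_elim
    case (elim t)
    from AE_completion[OF this] show ?case by (auto elim!: eventually_mono simp: indicator_def)
  qed
  then have "AE t in time S. AE x in lebesgue. F t x = h (t, x)"
    by (subst AE_restrict_space_iff) auto
  moreover have "(\<lambda>(t, x). h (t, x)) \<in> borel_measurable (borel \<Otimes>\<^sub>M borel)" using h(1) by (simp add: borel_prod)
  ultimately show thesis by (rule that[of "\<lambda>t x. h (t, x)", rotated])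
qed

lemma joint_measurable_lebesgue_on:
  fixes F :: "real \<Rightarrow> 'a::euclidean_space \<Rightarrow> 'b::euclidean_space"
  assumes "(\<lambda>(t, x). F t x) \<in> borel_measurable (borel \<Otimes>\<^sub>M borel)"
  shows "(\<lambda>(t, x). F t x) \<in> borel_measurable (lebesgue_on A)"
  using assms unfolding borel_prod by (intro measurable_restrict_space1 measurable_lebesgue_borel)

lemma section_measurable:
  fixes F :: "real \<Rightarrow> 'a::euclidean_space \<Rightarrow> 'b::euclidean_space"
  assumes "(\<lambda>(t, x). F t x) \<in> borel_measurable (borel \<Otimes>\<^sub>M borel)"
  shows "F t \<in> borel_measurable borel" "F t \<in> borel_measurable lebesgue"
proof -
  show "F t \<in> borel_measurable borel"
    using measurable_compose[OF measurable_Pair1' assms, of t] by simp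
  then show "F t \<in> borel_measurable lebesgue" by (rule measurable_lebesgue_borel)
qed

lemma time_integral_measurable:
  fixes F :: "real \<Rightarrow> 'a::euclidean_space \<Rightarrow> 'b::euclidean_space"
  assumes F: "(\<lambda>(t, x). F t x) \<in> borel_measurable (borel \<Otimes>\<^sub>M borel)"
  shows "(\<lambda>t. LINT x|lebesgue. F t x) \<in> borel_measurable borel"
proof -
  have "(\<lambda>t. LINT x|lborel. F t x) \<in> borel_measurable borel"
    using F by (intro lborel.borel_measurable_lebesgue_integral) (simp cong: measurable_cong_sets)
  moreover have "(LINT x|lebesgue. F t x) = (LINT x|lborel. F t x)" for t
    using section_measurable(1)[OF F] by (simp add: integral_completion)
  ultimately show ?thesis by simp
qed

lemma time_measurable: "g \<in> borel_measurable borel \<Longrightarrow> g \<in> borel_measurable (time S)"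
  by (intro measurable_restrict_space1 measurable_lebesgue_borel)

lemma time_integral_lborel:
  fixes g :: "real \<Rightarrow> 'b::euclidean_space"
  assumes "g \<in> borel_measurable borel"
  shows "(LINT t|time S. g t) = (LINT t|lborel. indicator {0<..<S} t *\<^sub>R g t)"
    "integrable (time S) g \<longleftrightarrow> integrable lborel (\<lambda>t. indicator {0<..<S} t *\<^sub>R g t)"
proof -
  have m: "(\<lambda>t. indicator {0<..<S} t *\<^sub>R g t) \<in> borel_measurable lborel" using assms by measurable
  show "(LINT t|time S. g t) = (LINT t|lborel. indicator {0<..<S} t *\<^sub>R g t)"
    using m by (simp add: integral_restrict_space integral_completion)
  show "integrable (time S) g \<longleftrightarrow> integrable lborel (\<lambda>t. indicator {0<..<S} t *\<^sub>R g t)"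
    using m by (simp add: integrable_restrict_space integrable_completion)
qed

lemma emeasure_Ioo_finite: "emeasure lborel {a<..<b::real} < \<infinity>"
  by (cases "a \<le> b") auto

lemma finite_measure_time: "finite_measure (time S)"
  using emeasure_Ioo_finite[of 0 S]
  by (intro finite_measureI) (simp add: emeasure_restrict_space space_restrict_space)

lemma AE_timeI: "(\<And>t. 0 < t \<Longrightarrow> t < S \<Longrightarrow> P t) \<Longrightarrow> AE t in time S. P t"
  by (intro AE_I2) (simp add: space_restrict_space)

lemma integrable_time_bounded:
  fixes g :: "real \<Rightarrow> 'b::euclidean_space"
  assumes "g \<in> borel_measurable (time S)" "AE t in time S. norm (g t) \<le> C"
  shows "integrable (time S) g"
  using finite_measure.integrable_const_bound[OF finite_measure_time assms(2,1)] .

lemma slab_integrable: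
  fixes h :: "real \<Rightarrow> 'a::euclidean_space \<Rightarrow> 'b::euclidean_space"
  assumes h [measurable]: "(\<lambda>(t, x). h t x) \<in> borel_measurable (borel \<Otimes>\<^sub>M borel)"
    and i: "\<And>t. 0 < t \<Longrightarrow> t < S \<Longrightarrow> integrable lebesgue (h t)"
    and K: "\<And>t. 0 < t \<Longrightarrow> t < S \<Longrightarrow> (LINT x|lebesgue. norm (h t x)) \<le> K"
  shows "integrable (lborel \<Otimes>\<^sub>M lborel) (\<lambda>(t, x). indicator {0<..<S} t *\<^sub>R h t x)"
proof (rule lborel_pair.Fubini_integrable)
  have sm: "h t \<in> borel_measurable borel" for t by (rule section_measurable(1)[OF h])
  have i': "integrable lborel (h t)" if "0 < t" "t < S" for t
    using i[OF that] sm by (simp add: integrable_completion)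
  have K': "(LINT x|lborel. norm (h t x)) \<le> K" if "0 < t" "t < S" for t
    using K[OF that] sm by (simp add: integral_completion)
  show "(\<lambda>(t, x). indicator {0<..<S} t *\<^sub>R h t x) \<in> borel_measurable (lborel \<Otimes>\<^sub>M lborel)"
    using h by (simp add: measurable_split_conv cong: measurable_cong_sets) measurable
  have gm: "(\<lambda>t. LINT x|lborel. norm (h t x)) \<in> borel_measurable borel"
    by (intro lborel.borel_measurable_lebesgue_integral) (use h in \<open>simp cong: measurable_cong_sets\<close>)
  have "integrable lborel (\<lambda>t. indicator {0<..<S} t *\<^sub>R (LINT x|lborel. norm (h t x)))"
  proof (rule Bochner_Integration.integrable_bound)
    show "integrable lborel (\<lambda>t. indicator {0<..<S} t * \<bar>K\<bar>)"
      by (intro integrable_mult_left integrable_real_indicator emeasure_Ioo_finite) auto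
    show "(\<lambda>t. indicator {0<..<S} t *\<^sub>R (LINT x|lborel. norm (h t x))) \<in> borel_measurable lborel"
      using gm by measurable
    show "AE t in lborel. norm (indicator {0<..<S} t *\<^sub>R (LINT x|lborel. norm (h t x))) \<le> norm (indicator {0<..<S} t * \<bar>K\<bar>)"
      using K' by (intro AE_I2) (force simp: indicator_def)
  qed
  moreover have "(\<integral>y. norm (case (t, y) of (t, x) \<Rightarrow> indicator {0<..<S} t *\<^sub>R h t x) \<partial>lborel)
    = indicator {0<..<S} t *\<^sub>R (LINT x|lborel. norm (h t x))" for t
    by (simp add: indicator_def)
  ultimately show "integrable lborel (\<lambda>t. \<integral>y. norm (case (t, y) of (t, x) \<Rightarrow> indicator {0<..<S} t *\<^sub>R h t x) \<partial>lborel)"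
    by simp
  show "AE t in lborel. integrable lborel (\<lambda>y. case (t, y) of (t, x) \<Rightarrow> indicator {0<..<S} t *\<^sub>R h t x)"
    using i' by (intro AE_I2) (auto simp: indicator_def)
qed

text \<open>Fubini moves the time integral inside, where the fundamental theorem of calculus applies
  for fixed \<open>x\<close>. Differentiability inside the interval and continuity up to its ends
  are enough, which suits test fields that are only controlled on the open time interval.\<close>

lemma time_FTC:
  fixes H :: "real \<Rightarrow> 'a::euclidean_space \<Rightarrow> real"
  assumes S: "0 \<le> S" and Ht: "(\<lambda>(t, x). Ht t x) \<in> borel_measurable (borel \<Otimes>\<^sub>M borel)"
    and i: "\<And>t. 0 < t \<Longrightarrow> t < S \<Longrightarrow> integrable lebesgue (Ht t)"
    and K: "\<And>t. 0 < t \<Longrightarrow> t < S \<Longrightarrow> (LINT x|lebesgue. norm (Ht t x)) \<le> K"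
    and c: "\<And>x. continuous_on {0..S} (\<lambda>t. H t x)"
    and d: "\<And>t x. 0 < t \<Longrightarrow> t < S \<Longrightarrow> ((\<lambda>s. H s x) has_real_derivative Ht t x) (at t)"
  shows "(LINT t|time S. LINT x|lebesgue. Ht t x) = (LINT x|lebesgue. H S x - H 0 x)"
proof -
  let ?h = "\<lambda>t x. indicator {0<..<S} t *\<^sub>R Ht t x"
  have I: "integrable (lborel \<Otimes>\<^sub>M lborel) (\<lambda>(t, x). ?h t x)"
    by (rule slab_integrable[OF Ht i K])
  have sm: "Ht t \<in> borel_measurable borel" for t by (rule section_measurable(1)[OF Ht])
  have "(LINT t|time S. LINT x|lebesgue. Ht t x) = (LINT t|lborel. indicator {0<..<S} t *\<^sub>R (LINT x|lebesgue. Ht t x))"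
    by (rule time_integral_lborel(1)[OF time_integral_measurable[OF Ht]])
  also have "\<dots> = (LINT t|lborel. LINT x|lborel. ?h t x)"
    using sm by (simp add: integral_completion)
  also have "\<dots> = (LINT x|lborel. LINT t|lborel. ?h t x)"
    using lborel_pair.Fubini_integral[OF I] by simp
  also have "\<dots> = (LINT x|lebesgue. LINT t|lborel. ?h t x)"
    by (intro integral_completion[symmetric])
      (use lborel_pair.integrable_snd[OF I] in \<open>auto dest: borel_measurable_integrable\<close>)
  also have "\<dots> = (LINT x|lebesgue. H S x - H 0 x)"
  proof -
    have "AE x in lborel. integrable lborel (\<lambda>t. ?h t x)" by (rule lborel_pair.AE_integrable_snd[OF I])
    then have "AE x in lborel. (LINT t|lborel. ?h t x) = H S x - H 0 x"
    proof eventually_elim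
      case (elim x)
      \<comment> \<open>Integrability in time, known for almost every \<open>x\<close> from Fubini,
        identifies the Lebesgue integral with the gauge integral in which the fundamental theorem is
        stated.\<close>
      have "((\<lambda>t. ?h t x) has_integral (LINT t|lborel. ?h t x)) UNIV"
        using has_integral_integral_lborel[OF elim] .
      moreover have "((\<lambda>t. Ht t x) has_integral (H S x - H 0 x)) {0..S}"
        by (rule fundamental_theorem_of_calculus_interior[OF S c])
          (use d in \<open>auto simp: has_real_derivative_iff_has_vector_derivative\<close>)
      then have "((\<lambda>t. Ht t x) has_integral (H S x - H 0 x)) {0<..<S}"
        using has_integral_open_interval[of "\<lambda>t. Ht t x" "H S x - H 0 x" 0 S] by simp
      then have "((\<lambda>t. if t \<in> {0<..<S} then Ht t x else 0) has_integral (H S x - H 0 x)) UNIV"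
        by (simp only: has_integral_restrict_UNIV)
      moreover have "(\<lambda>t. ?h t x) = (\<lambda>t. if t \<in> {0<..<S} then Ht t x else 0)" by auto
      ultimately show ?case using has_integral_unique[of "\<lambda>t. ?h t x"] by simp
    qed
    then have eq: "AE x in lebesgue. (LINT t|lborel. ?h t x) = H S x - H 0 x" by (rule AE_completion)
    have m: "(\<lambda>x. LINT t|lborel. ?h t x) \<in> borel_measurable lebesgue"
      using lborel_pair.integrable_snd[OF I] by (intro measurable_completion) (auto dest: borel_measurable_integrable)
    moreover have "(\<lambda>x. H S x - H 0 x) \<in> borel_measurable lebesgue"
      by (rule measurable_AE_lebesgue[of _ UNIV, unfolded lebesgue_on_UNIV_eq, OF m _ eq]) simp
    ultimately show ?thesis using eq by (rule integral_cong_AE)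
  qed
  finally show ?thesis .
qed

text \<open>A function that is only known to be weakly measurable in time is paired with a jointly
  measurable one; by a monotone class argument it suffices to consider indicators of boxes.\<close>

lemma measurable_pairing:
  fixes G g :: "real \<Rightarrow> 'a::euclidean_space \<Rightarrow> real"
  assumes L: "\<And>t. G t \<in> L1_loc UNIV"
    and M: "\<And>\<phi>. \<phi> \<in> Cc_infty UNIV \<Longrightarrow> (\<lambda>t. LINT x|lebesgue. \<phi> x * G t x) \<in> borel_measurable N"
    and g: "(\<lambda>(t, x). g t x) \<in> borel_measurable (N \<Otimes>\<^sub>M borel)"
    and supp: "\<And>t x. x \<notin> box c d \<Longrightarrow> g t x = 0"
    and i: "\<And>t. integrable lebesgue (\<lambda>x. g t x * G t x)"
  shows "(\<lambda>t. LINT x|lebesgue. g t x * G t x) \<in> borel_measurable N"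
proof -
  have box: "(\<lambda>t. LINT x|lebesgue. indicator (box a b) x * G t x) \<in> borel_measurable N" for a b
    by (rule borel_measurable_LIMSEQ_real[of _ "\<lambda>n t. LINT x|lebesgue. box_bump a b n x * G t x"])
      (use box_bump_integral_tendsto(2)[OF L] M[OF box_bump_Cc] in auto)
  \<comment> \<open>Intersecting with \<open>box c d\<close>, outside which \<open>g\<close>
    vanishes, keeps the integrals finite although \<open>G t\<close> is only locally
    integrable.\<close>
  have int: "integrable lebesgue (\<lambda>x. indicator (B \<inter> box c d) x * G t x)" if "B \<in> sets borel" for B t
  proof -
    have "integrable lebesgue (\<lambda>x. indicator (B \<inter> box c d) x *\<^sub>R G t x)"
      by (rule integrable_bounded_mult_L1_loc[OF L, where K="cbox c d" and C=1])
        (use box_subset_cbox[of c d] that in \<open>auto split: split_indicator intro!: borel_measurable_indicator sets_completionI_sets\<close>)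
    then show ?thesis by simp
  qed
  have disjoint_union: "(LINT x|lebesgue. indicator ((\<Union>i. A i) \<inter> box c d) x * G t x)
      = (\<Sum>i. LINT x|lebesgue. indicator (A i \<inter> box c d) x * G t x)"
    if dis: "disjoint_family A" and A: "\<And>i. A i \<in> sets borel" for A :: "nat \<Rightarrow> 'a set" and t
  proof -
    let ?f = "\<lambda>i x. indicator (A i \<inter> box c d) x * G t x"
    have sum: "(\<lambda>n. \<Sum>i<n. ?f i x) \<longlonglongrightarrow> indicator ((\<Union>i. A i) \<inter> box c d) x * G t x" for x
    proof -
      have "disjoint_family (\<lambda>i. A i \<inter> box c d)" using dis by (auto simp: disjoint_family_on_def)
      then have "(\<lambda>i. indicator (A i \<inter> box c d) x :: real) sums indicator (\<Union>i. A i \<inter> box c d) x"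
        by (intro indicator_sums) (auto simp: disjoint_family_on_def)
      then have "(\<lambda>i. ?f i x) sums (indicator (\<Union>i. A i \<inter> box c d) x * G t x)" by (rule sums_mult2)
      then show ?thesis by (simp add: sums_def Int_UN_distrib2 Int_commute)
    qed
    have "(\<lambda>n. LINT x|lebesgue. (\<Sum>i<n. ?f i x)) \<longlonglongrightarrow> (LINT x|lebesgue. indicator ((\<Union>i. A i) \<inter> box c d) x * G t x)"
    proof (rule integral_dominated_convergence[where w="\<lambda>x. norm (indicator (UNIV \<inter> box c d) x * G t x)"])
      show "integrable lebesgue (\<lambda>x. norm (indicator (UNIV \<inter> box c d) x * G t x))"
        by (intro integrable_norm int) auto
      show "(\<lambda>x. \<Sum>i<n. ?f i x) \<in> borel_measurable lebesgue" for n
        by (intro borel_measurable_sum borel_measurable_integrable int A)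
      show "(\<lambda>x. indicator ((\<Union>i. A i) \<inter> box c d) x * G t x) \<in> borel_measurable lebesgue"
        by (intro borel_measurable_integrable int) (use A in auto)
      show "AE x in lebesgue. norm (\<Sum>i<n. ?f i x) \<le> norm (indicator (UNIV \<inter> box c d) x * G t x)" for n
      proof (rule AE_I2)
        fix x
        have dn: "disjoint_family_on (\<lambda>i. A i \<inter> box c d) {..<n}" using dis by (auto simp: disjoint_family_on_def)
        have "(\<Sum>i<n. indicator (A i \<inter> box c d) x :: real) = indicator (\<Union>i<n. A i \<inter> box c d) x"
          by (rule indicator_UN_disjoint[OF _ dn, symmetric]) simp
        also have "\<dots> \<le> indicator (UNIV \<inter> box c d) x" by (auto split: split_indicator)
        finally have le: "(\<Sum>i<n. indicator (A i \<inter> box c d) x :: real) \<le> indicator (UNIV \<inter> box c d) x" .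
        have "norm (\<Sum>i<n. ?f i x) = (\<Sum>i<n. indicator (A i \<inter> box c d) x) * \<bar>G t x\<bar>"
          by (simp add: sum_distrib_right[symmetric] abs_mult sum_nonneg)
        also have "\<dots> \<le> indicator (UNIV \<inter> box c d) x * \<bar>G t x\<bar>" by (intro mult_right_mono le) auto
        finally show "norm (\<Sum>i<n. ?f i x) \<le> norm (indicator (UNIV \<inter> box c d) x * G t x)" by (simp add: abs_mult)
      qed
    qed (use sum in auto)
    then have "(\<lambda>i. LINT x|lebesgue. ?f i x) sums (LINT x|lebesgue. indicator ((\<Union>i. A i) \<inter> box c d) x * G t x)"
      unfolding sums_def by (subst (asm) Bochner_Integration.integral_sum) (intro int A)
    then show ?thesis by (simp only: sums_iff)
  qed
  have complement: "(LINT x|lebesgue. indicator ((- B) \<inter> box c d) x * G t x)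
      = (LINT x|lebesgue. indicator (box c d) x * G t x) - (LINT x|lebesgue. indicator (B \<inter> box c d) x * G t x)"
    if "B \<in> sets borel" for B t
  proof -
    have "(LINT x|lebesgue. indicator (UNIV \<inter> box c d) x * G t x) - (LINT x|lebesgue. indicator (B \<inter> box c d) x * G t x)
      = (LINT x|lebesgue. indicator (UNIV \<inter> box c d) x * G t x - indicator (B \<inter> box c d) x * G t x)"
      by (rule Bochner_Integration.integral_diff[symmetric]; rule int) (use that in auto)
    also have "\<dots> = (LINT x|lebesgue. indicator ((- B) \<inter> box c d) x * G t x)"
      by (intro Bochner_Integration.integral_cong) (auto split: split_indicator)
    finally show ?thesis by simp
  qed
  have B: "(\<lambda>t. LINT x|lebesgue. indicator (B \<inter> box c d) x * G t x) \<in> borel_measurable N" if "B \<in> sets borel" for B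
  proof -
    have IS: "Int_stable (range (\<lambda>(a, b). box a b :: 'a set))"
      by (auto simp: Int_stable_def box_Int_box)
    have sub: "range (\<lambda>(a, b). box a b :: 'a set) \<subseteq> Pow UNIV" by simp
    have "B \<in> sigma_sets UNIV (range (\<lambda>(a, b). box a b))" using that unfolding borel_eq_box by simp
    with IS sub show ?thesis
    proof (induction rule: sigma_sets_induct_disjoint)
      case (basic A)
      then obtain a b where "A = box a b" by auto
      then have "\<exists>a b. A \<inter> box c d = box a b" by (auto simp: box_Int_box)
      then show ?case using box by auto
    next
      case empty then show ?case by simp
    next
      case (compl A)
      then have "A \<in> sets borel" unfolding borel_eq_box by simp
      from complement[OF this] show ?case
        using compl box by (simp add: Compl_eq_Diff_UNIV[symmetric])
    next
      case (union A)
      then have "\<And>i. A i \<in> sets borel" unfolding borel_eq_box by auto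
      from disjoint_union[OF union(1) this] show ?case
        using union by (simp add: borel_measurable_suminf)
    qed
  qed
  have cut: "Pair t -` E \<in> sets borel" if "E \<in> sets (N \<Otimes>\<^sub>M (borel :: 'a measure))" for E t
    using that by (rule sets_Pair1)
  \<comment> \<open>The second monotone class argument, now on the product space: the sets with
    measurable pairing contain the rectangles and are closed under complements and disjoint
    unions.\<close>
  have E: "(\<lambda>t. LINT x|lebesgue. indicator (Pair t -` E \<inter> box c d) x * G t x) \<in> borel_measurable N"
    if "E \<in> sets (N \<Otimes>\<^sub>M borel)" for E
  proof -
    let ?\<G> = "{a \<times> b | a b. a \<in> sets N \<and> b \<in> sets (borel :: 'a measure)}"
    have sub: "?\<G> \<subseteq> Pow (space N \<times> UNIV)" using sets.sets_into_space by fastforce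
    have "E \<in> sigma_sets (space N \<times> UNIV) ?\<G>" using that unfolding sets_pair_measure by simp
    with Int_stable_pair_measure_generator sub show ?thesis
    proof (induction rule: sigma_sets_induct_disjoint)
      case (basic E)
      then obtain A C where AC: "E = A \<times> C" "A \<in> sets N" "C \<in> sets (borel :: 'a measure)" by auto
      have "(LINT x|lebesgue. indicator (Pair t -` E \<inter> box c d) x * G t x)
        = indicator A t * (LINT x|lebesgue. indicator (C \<inter> box c d) x * G t x)" for t
        unfolding AC by (auto simp: indicator_def vimage_def)
      then show ?case using B[OF AC(3)] AC(2) by simp
    next
      case empty then show ?case by simp
    next
      case (compl E)
      then have E: "E \<in> sets (N \<Otimes>\<^sub>M borel)" unfolding sets_pair_measure by simp
      have "Pair t -` (space N \<times> UNIV - E) = - (Pair t -` E)" if "t \<in> space N" for t using that by auto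
      then have "(LINT x|lebesgue. indicator (Pair t -` (space N \<times> UNIV - E) \<inter> box c d) x * G t x)
        = (LINT x|lebesgue. indicator (box c d) x * G t x) - (LINT x|lebesgue. indicator (Pair t -` E \<inter> box c d) x * G t x)"
        if "t \<in> space N" for t using that complement[OF cut[OF E]] by simp
      then show ?case using compl box by (simp cong: measurable_cong)
    next
      case (union E)
      then have E: "E i \<in> sets (N \<Otimes>\<^sub>M borel)" for i unfolding sets_pair_measure by auto
      have "(LINT x|lebesgue. indicator (Pair t -` (\<Union>i. E i) \<inter> box c d) x * G t x)
        = (\<Sum>i. LINT x|lebesgue. indicator (Pair t -` E i \<inter> box c d) x * G t x)" for t
        using disjoint_union[of "\<lambda>i. Pair t -` E i" t] union(1) cut[OF E] unfolding vimage_UN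
        by (auto simp: disjoint_family_on_def)
      then show ?case using union by (simp add: borel_measurable_suminf)
    qed
  qed
  \<comment> \<open>Simple functions converging to \<open>g\<close> and bounded by 2 |g|, so that 2
    |g G| dominates the pairings.\<close>
  obtain F where F: "\<And>n. simple_function (N \<Otimes>\<^sub>M borel) (F n)"
    and Flim: "\<And>z. z \<in> space (N \<Otimes>\<^sub>M borel) \<Longrightarrow> (\<lambda>n. F n z) \<longlonglongrightarrow> (case z of (t, x) \<Rightarrow> g t x)"
    and Fb: "\<And>n z. z \<in> space (N \<Otimes>\<^sub>M borel) \<Longrightarrow> dist (F n z) 0 \<le> 2 * dist (case z of (t, x) \<Rightarrow> g t x) 0"
    using borel_measurable_implies_sequence_metric[OF g, of 0] by blast
  have sp: "(t, x) \<in> space (N \<Otimes>\<^sub>M borel) \<longleftrightarrow> t \<in> space N" for t x by (simp add: space_pair_measure)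
  have Fb': "\<bar>F n (t, x)\<bar> \<le> 2 * \<bar>g t x\<bar>" if "t \<in> space N" for n t x
    using Fb[of "(t, x)" n] that by (simp add: sp)
  define Y where "Y = (\<lambda>n. F n ` space (N \<Otimes>\<^sub>M borel))"
  define P where "P = (\<lambda>n y. F n -` {y} \<inter> space (N \<Otimes>\<^sub>M borel))"
  have Yf: "finite (Y n)" and Ps: "y \<in> Y n \<Longrightarrow> P n y \<in> sets (N \<Otimes>\<^sub>M borel)" for n y
    using simple_functionD[OF F[of n]] by (auto simp: Y_def P_def)
  have Frep: "F n (t, x) = (\<Sum>y\<in>Y n. y * indicator (Pair t -` P n y \<inter> box c d) x)" if t: "t \<in> space N" for n t x
  proof (cases "x \<in> box c d")
    case True
    have "(\<Sum>y\<in>Y n. y * indicator (Pair t -` P n y \<inter> box c d) x) = (\<Sum>y\<in>Y n. if y = F n (t, x) then y else 0)"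
      using True t by (intro sum.cong) (auto simp: P_def sp indicator_def)
    also have "\<dots> = F n (t, x)" using Yf t by (auto simp: Y_def sp)
    finally show ?thesis by simp
  next
    case False
    then show ?thesis using Fb'[OF t, of n x] supp[OF False] by simp
  qed
  have FI: "(LINT x|lebesgue. F n (t, x) * G t x) = (\<Sum>y\<in>Y n. y * (LINT x|lebesgue. indicator (Pair t -` P n y \<inter> box c d) x * G t x))"
    and Fm: "(\<lambda>x. F n (t, x) * G t x) \<in> borel_measurable lebesgue" if t: "t \<in> space N" for n t
  proof -
    have eq: "F n (t, x) * G t x = (\<Sum>y\<in>Y n. y * (indicator (Pair t -` P n y \<inter> box c d) x * G t x))" for x
      unfolding Frep[OF t] by (simp add: sum_distrib_right mult.assoc)
    have ii: "y \<in> Y n \<Longrightarrow> integrable lebesgue (\<lambda>x. y * (indicator (Pair t -` P n y \<inter> box c d) x * G t x))" for y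
      by (intro integrable_mult_right int cut Ps)
    show "(LINT x|lebesgue. F n (t, x) * G t x) = (\<Sum>y\<in>Y n. y * (LINT x|lebesgue. indicator (Pair t -` P n y \<inter> box c d) x * G t x))"
      unfolding eq by (subst Bochner_Integration.integral_sum[OF ii]) auto
    show "(\<lambda>x. F n (t, x) * G t x) \<in> borel_measurable lebesgue"
      unfolding eq by (intro borel_measurable_sum borel_measurable_integrable ii)
  qed
  show ?thesis
  proof (rule borel_measurable_LIMSEQ_real[of N "\<lambda>n t. LINT x|lebesgue. F n (t, x) * G t x"])
    fix n show "(\<lambda>t. LINT x|lebesgue. F n (t, x) * G t x) \<in> borel_measurable N"
      using E[OF Ps] by (subst measurable_cong[OF FI]) (auto intro!: borel_measurable_sum borel_measurable_times)
  next
    fix t assume t: "t \<in> space N"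
    show "(\<lambda>n. LINT x|lebesgue. F n (t, x) * G t x) \<longlonglongrightarrow> (LINT x|lebesgue. g t x * G t x)"
    proof (rule integral_dominated_convergence[where w="\<lambda>x. 2 * norm (g t x * G t x)"])
      show "integrable lebesgue (\<lambda>x. 2 * norm (g t x * G t x))" using i by (intro integrable_mult_right integrable_norm)
      show "(\<lambda>x. g t x * G t x) \<in> borel_measurable lebesgue" using i by (rule borel_measurable_integrable)
      show "(\<lambda>x. F n (t, x) * G t x) \<in> borel_measurable lebesgue" for n by (rule Fm[OF t])
      show "AE x in lebesgue. (\<lambda>n. F n (t, x) * G t x) \<longlonglongrightarrow> g t x * G t x"
        using Flim[of "(t, _)"] t by (intro AE_I2 tendsto_mult tendsto_const) (simp add: sp)
      show "AE x in lebesgue. norm (F n (t, x) * G t x) \<le> 2 * norm (g t x * G t x)" for n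
      proof (rule AE_I2)
        fix x show "norm (F n (t, x) * G t x) \<le> 2 * norm (g t x * G t x)"
          using mult_right_mono[OF Fb'[OF t, of n x], of "\<bar>G t x\<bar>"] by (simp add: abs_mult)
      qed
    qed
  qed
qed

text \<open>Integration by parts against the primitive of a merely integrable \<open>g\<close>. By
  Fubini on the triangle 0 < s < t < S the left side is the integral of g(s) (\<kappa>(S) -
  \<kappa>(s)), and \<kappa>(S) = 0. It serves to average the energy inequality over time.\<close>

lemma time_integral_weight:
  fixes g \<kappa> \<kappa>' :: "real \<Rightarrow> real"
  assumes S: "S > 0" and g: "integrable (time S) g"
    and d: "\<And>t. (\<kappa> has_real_derivative \<kappa>' t) (at t)" and c: "continuous_on UNIV \<kappa>'" and z: "\<kappa> S = 0"
  shows "(LINT t|time S. \<kappa>' t * (LINT s|time t. g s)) = - (LINT s|time S. \<kappa> s * g s)"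
    and "integrable (time S) (\<lambda>t. \<kappa>' t * (LINT s|time t. g s))"
proof -
  have c\<kappa>: "continuous_on UNIV \<kappa>" using d by (auto intro!: continuous_at_imp_continuous_on DERIV_isCont)
  have [measurable]: "\<kappa>' \<in> borel_measurable borel" "\<kappa> \<in> borel_measurable borel"
    by (intro borel_measurable_continuous_onI c c\<kappa>)+
  have S': "{0<..<S} \<inter> space lebesgue \<in> sets lebesgue" for S :: real by simp
  have gm: "(\<lambda>t. indicator {0<..<S} t *\<^sub>R g t) \<in> borel_measurable lebesgue"
    using borel_measurable_integrable[OF g] by (simp only: borel_measurable_restrict_space_iff[OF S'])
  then obtain h where h [measurable]: "h \<in> borel_measurable lborel"
    and gh: "AE t in lborel. indicator {0<..<S} t *\<^sub>R g t = h t"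
    using completion_ex_borel_measurable_euclidean by blast
  have gh': "AE t in lebesgue. indicator {0<..<S} t *\<^sub>R g t = h t" using gh by (rule AE_completion)
  have hi: "integrable lborel h"
  proof -
    have "integrable lebesgue (\<lambda>t. indicator {0<..<S} t *\<^sub>R g t)" using g by (simp only: integrable_restrict_space[OF S'])
    then have "integrable lebesgue h" by (rule integrable_cong_AE_imp) (use gh' in \<open>auto intro: measurable_completion\<close>)
    then show ?thesis by (simp add: integrable_completion)
  qed
  obtain C where C: "\<And>t. t \<in> {0..S} \<Longrightarrow> \<bar>\<kappa>' t\<bar> \<le> C"
  proof -
    have "bounded (\<kappa>' ` {0..S})"
      by (intro compact_imp_bounded compact_continuous_image continuous_on_subset[OF c]) auto
    then obtain a where "\<forall>x\<in>{0..S}. \<bar>\<kappa>' x\<bar> \<le> a" by (auto simp: bounded_iff)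
    then show thesis by (intro that[of a]) auto
  qed
  have inner: "(LINT s|time t. g s) = (LINT s|lborel. indicator {0<..<t} s * h s)" if "t \<in> {0<..<S}" for t
  proof -
    have "(LINT s|time t. g s) = (LINT s|lebesgue. indicator {0<..<t} s *\<^sub>R g s)"
      by (rule integral_restrict_space[OF S'])
    also have "\<dots> = (LINT s|lebesgue. indicator {0<..<t} s * (indicator {0<..<S} s *\<^sub>R g s))"
      using that by (intro Bochner_Integration.integral_cong) (auto simp: indicator_def)
    also have "\<dots> = (LINT s|lebesgue. indicator {0<..<t} s * h s)"
    proof (rule integral_cong_AE)
      show "AE s in lebesgue. indicator {0<..<t} s * (indicator {0<..<S} s *\<^sub>R g s) = indicator {0<..<t} s * h s"
        using gh' by eventually_elim simp
      show "(\<lambda>s. indicator {0<..<t} s * (indicator {0<..<S} s *\<^sub>R g s)) \<in> borel_measurable lebesgue"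
        by (intro borel_measurable_times borel_measurable_indicator gm) simp
      show "(\<lambda>s. indicator {0<..<t} s * h s) \<in> borel_measurable lebesgue"
        by (intro measurable_completion) measurable
    qed
    also have "\<dots> = (LINT s|lborel. indicator {0<..<t} s * h s)" by (intro integral_completion) measurable
    finally show ?thesis .
  qed
  let ?k = "\<lambda>t s. indicator {0<..<S} t * \<kappa>' t * (indicator {0<..<t} s * h s)"
  have km: "(\<lambda>(t, s). ?k t s) \<in> borel_measurable (lborel \<Otimes>\<^sub>M lborel)"
  proof -
    have "{z \<in> space (borel \<Otimes>\<^sub>M borel :: (real \<times> real) measure). 0 < snd z \<and> snd z < fst z}
      \<in> sets (borel \<Otimes>\<^sub>M borel)" by measurable
    then have "{z :: real \<times> real. 0 < snd z \<and> snd z < fst z} \<in> sets (borel \<Otimes>\<^sub>M borel)"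
      by (simp add: space_pair_measure)
    then have "indicator {z :: real \<times> real. 0 < snd z \<and> snd z < fst z} \<in> borel_measurable (lborel \<Otimes>\<^sub>M lborel)"
      by (intro borel_measurable_indicator) (simp cong: sets_pair_measure_cong)
    then have "(\<lambda>z. indicator {0<..<S} (fst z) * \<kappa>' (fst z) * (indicator {z. 0 < snd z \<and> snd z < fst z} z * h (snd z)))
      \<in> borel_measurable (lborel \<Otimes>\<^sub>M lborel :: (real \<times> real) measure)" by measurable
    then show ?thesis by (rule measurable_cong[THEN iffD1, rotated]) (auto simp: indicator_def)
  qed
  have kb: "\<bar>?k t s\<bar> \<le> indicator {0<..<S} t * C * \<bar>h s\<bar>" for t s
    using C[of t] by (auto simp: indicator_def abs_mult mult_right_mono)
  have I: "integrable (lborel \<Otimes>\<^sub>M lborel) (\<lambda>(t, s). ?k t s)"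
  proof (rule Bochner_Integration.integrable_bound[OF _ km])
    have "integrable (lborel \<Otimes>\<^sub>M lborel) (\<lambda>(t, s). (indicator {0<..<S} t * C) * \<bar>h s\<bar>)"
    proof (rule lborel_pair.Fubini_integrable)
      show "(\<lambda>(t, s). (indicator {0<..<S} t * C) * \<bar>h s\<bar>) \<in> borel_measurable (lborel \<Otimes>\<^sub>M lborel)" by measurable
      have "(\<integral>y. norm (case (t, y) of (t, s) \<Rightarrow> (indicator {0<..<S} t * C) * \<bar>h s\<bar>) \<partial>lborel)
        = indicator {0<..<S} t * (\<bar>C\<bar> * (\<integral>s. \<bar>h s\<bar> \<partial>lborel))" for t :: real
        by (simp add: abs_mult)
      then show "integrable lborel (\<lambda>t. \<integral>y. norm (case (t, y) of (t, s) \<Rightarrow> (indicator {0<..<S} t * C) * \<bar>h s\<bar>) \<partial>lborel)"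
        by (simp only:) (intro integrable_mult_left integrable_real_indicator emeasure_Ioo_finite, auto)
      show "AE t in lborel. integrable lborel (\<lambda>y. case (t, y) of (t, s) \<Rightarrow> (indicator {0<..<S} t * C) * \<bar>h s\<bar>)"
        using hi by (auto intro!: AE_I2)
    qed
    then show "integrable (lborel \<Otimes>\<^sub>M lborel) (\<lambda>(t, s). (indicator {0<..<S} t * C) * \<bar>h s\<bar>)" .
    show "AE z in lborel \<Otimes>\<^sub>M lborel. norm (case z of (t, s) \<Rightarrow> ?k t s) \<le> norm (case z of (t, s) \<Rightarrow> (indicator {0<..<S} t * C) * \<bar>h s\<bar>)"
    proof (rule AE_I2)
      fix z :: "real \<times> real"
      obtain t s where z: "z = (t, s)" by (cases z)
      show "norm (case z of (t, s) \<Rightarrow> ?k t s) \<le> norm (case z of (t, s) \<Rightarrow> (indicator {0<..<S} t * C) * \<bar>h s\<bar>)"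
        unfolding z prod.case real_norm_def by (rule order_trans[OF kb abs_ge_self])
    qed
  qed
  have *: "(\<lambda>t. indicator {0<..<S} t *\<^sub>R (\<kappa>' t * (LINT s|time t. g s))) = (\<lambda>t. LINT s|lborel. ?k t s)"
    using inner by (auto simp: fun_eq_iff indicator_def mult.assoc)
  have "integrable lebesgue (\<lambda>t. LINT s|lborel. ?k t s)"
    using lborel_pair.integrable_fst[OF I] by (subst integrable_completion) (auto dest: borel_measurable_integrable)
  then show "integrable (time S) (\<lambda>t. \<kappa>' t * (LINT s|time t. g s))"
    unfolding integrable_restrict_space[OF S'] * .
  have "(LINT t|time S. \<kappa>' t * (LINT s|time t. g s)) = (LINT t|lebesgue. indicator {0<..<S} t *\<^sub>R (\<kappa>' t * (LINT s|time t. g s)))"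
    by (rule integral_restrict_space[OF S'])
  also have "\<dots> = (LINT t|lebesgue. LINT s|lborel. ?k t s)"
    using inner by (intro Bochner_Integration.integral_cong) (auto simp: indicator_def mult.assoc)
  also have "\<dots> = (LINT t|lborel. LINT s|lborel. ?k t s)"
    using lborel_pair.integrable_fst[OF I] by (intro integral_completion) (auto dest: borel_measurable_integrable)
  also have "\<dots> = (LINT s|lborel. LINT t|lborel. ?k t s)"
    using lborel_pair.Fubini_integral[OF I] by simp
  also have "\<dots> = (LINT s|lborel. - (indicator {0<..<S} s * \<kappa> s * h s))"
  proof (rule Bochner_Integration.integral_cong[OF refl])
    fix s :: real
    show "(LINT t|lborel. ?k t s) = - (indicator {0<..<S} s * \<kappa> s * h s)"
    proof (cases "s \<in> {0<..<S}")
      case True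
      have "(LINT t|lborel. ?k t s) = (LINT t|lborel. (indicator {s..S} t *\<^sub>R \<kappa>' t) * h s)"
      proof (rule integral_cong_AE)
        have "AE t in lborel. t \<noteq> s \<and> t \<noteq> S" using AE_lborel_singleton[of s] AE_lborel_singleton[of S] by eventually_elim auto
        then show "AE t in lborel. ?k t s = (indicator {s..S} t *\<^sub>R \<kappa>' t) * h s"
          by eventually_elim (use True in \<open>auto simp: indicator_def\<close>)
        have "(\<lambda>t. indicator {0<..<S} t * \<kappa>' t * (indicator {s<..} t * (indicator {0<..} s * h s))) \<in> borel_measurable lborel"
          by measurable
        then show "(\<lambda>t. ?k t s) \<in> borel_measurable lborel"
          by (rule measurable_cong[THEN iffD1, rotated]) (auto simp: indicator_def)
      qed measurable
      also have "\<dots> = (LINT t|lborel. indicator {s..S} t *\<^sub>R \<kappa>' t) * h s" by simp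
      also have "(LINT t|lborel. indicator {s..S} t *\<^sub>R \<kappa>' t) = \<kappa> S - \<kappa> s"
        by (rule integral_FTC_Icc)
          (use True d c in \<open>auto intro: has_field_derivative_at_within continuous_on_subset simp: has_real_derivative_iff_has_vector_derivative[symmetric]\<close>)
      finally show ?thesis using True z by simp
    next
      case False
      then have *: "(\<lambda>t. ?k t s) = (\<lambda>t. 0)" by (auto simp: indicator_def)
      show ?thesis unfolding * using False by simp
    qed
  qed
  also have "\<dots> = - (LINT s|lebesgue. indicator {0<..<S} s * \<kappa> s * h s)"
    by (subst integral_completion) auto
  also have "(LINT s|lebesgue. indicator {0<..<S} s * \<kappa> s * h s) = (LINT s|lebesgue. indicator {0<..<S} s *\<^sub>R (\<kappa> s * g s))"
  proof (rule integral_cong_AE)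
    show "AE s in lebesgue. indicator {0<..<S} s * \<kappa> s * h s = indicator {0<..<S} s *\<^sub>R (\<kappa> s * g s)"
      using gh' by eventually_elim (auto simp: indicator_def split: if_splits)
    have "(\<lambda>s. \<kappa> s * (indicator {0<..<S} s *\<^sub>R g s)) \<in> borel_measurable lebesgue"
      by (intro borel_measurable_times gm measurable_lebesgue_continuous c\<kappa>)
    then show "(\<lambda>s. indicator {0<..<S} s *\<^sub>R (\<kappa> s * g s)) \<in> borel_measurable lebesgue" by (simp add: mult_ac)
    show "(\<lambda>s. indicator {0<..<S} s * \<kappa> s * h s) \<in> borel_measurable lebesgue"
      by (intro measurable_completion) measurable
  qed
  also have "\<dots> = (LINT s|time S. \<kappa> s * g s)" by (rule integral_restrict_space[OF S', symmetric])
  finally show "(LINT t|time S. \<kappa>' t * (LINT s|time t. g s)) = - (LINT s|time S. \<kappa> s * g s)" .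
qed

section \<open>The swirl profile\<close>

lemma Ck_on_flat_comp: "Ck_on k A g \<Longrightarrow> Ck_on k A (\<lambda>x. flat p (g x))"
  using Ck_on_compose[where f="flat p" and B=UNIV and g=g and A=A, OF _ Ck_on_flat] by simp

lemma has_derivative_flat_comp:
  assumes "(g has_derivative g') (at x within A)"
  shows "((\<lambda>x. flat p (g x)) has_derivative (\<lambda>h. flat (flat_deriv p) (g x) * g' h)) (at x within A)"
  by (rule has_derivative_compose[OF assms DERIV_flat[unfolded has_field_derivative_def]])

text \<open>The cross product of the third unit vector with \<open>x\<close>: the velocity field of
  a rigid rotation.\<close>

definition rot :: "real^3 \<Rightarrow> real^3" where
  "rot x = vector [- (x $ 2), x $ 1, 0]"

lemma rot_nth: "rot x $ 1 = - (x $ 2)" "rot x $ 2 = x $ 1" "rot x $ 3 = 0"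
  by (simp_all add: rot_def)

lemma linear_rot: "linear rot"
  by (rule linearI) (auto simp: vec_eq_iff forall_3 rot_nth)

lemma bounded_linear_rot: "bounded_linear rot"
  using linear_rot by (rule linear_conv_bounded_linear[THEN iffD1])

lemma norm_rot_le: "norm (rot x) \<le> norm x"
  by (simp add: norm_le_square norm_eq_sqrt_inner inner_vec_def sum_3 rot_nth)

lemma inner_rot: "x \<bullet> rot x = 0" "rot x \<bullet> x = 0"
  by (simp_all add: inner_vec_def sum_3 rot_nth)

lemma Basis_vec3: "(Basis :: (real^3) set) = range (\<lambda>j. axis j 1)"
  by (auto simp: Basis_vec_def)

lemma axis_in_Basis: "axis j (1::real) \<in> Basis"
  by (auto simp: Basis_vec_def)

lemma sum_Basis_vec3: "(\<Sum>b\<in>(Basis :: (real^3) set). F b) = (\<Sum>j\<in>UNIV. F (axis j 1))"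
  unfolding Basis_vec3 by (subst sum.reindex) (auto intro!: injI simp: axis_eq_axis)

text \<open>The profile is a function of \<open>y \<bullet> y\<close>, hence smooth at the centre as
  well. The parameter \<open>\<theta>\<close> is the inverse square of the radius. The derivatives
  that follow are written out in closed form so that they can be estimated term by term.\<close>

definition swirl :: "real \<Rightarrow> real \<Rightarrow> real^3 \<Rightarrow> real^3" where
  "swirl a \<theta> y = (a * flat 1 (1 - \<theta> * (y \<bullet> y))) *\<^sub>R rot y"

definition swirl_d :: "real \<Rightarrow> real \<Rightarrow> real^3 \<Rightarrow> real^3 \<Rightarrow> real^3" where
  "swirl_d a \<theta> y h = (a * (- 2 * \<theta> * (y \<bullet> h) * flat (flat_deriv 1) (1 - \<theta> * (y \<bullet> y)))) *\<^sub>R rot y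
    + (a * flat 1 (1 - \<theta> * (y \<bullet> y))) *\<^sub>R rot h"

definition swirl_d2 :: "real \<Rightarrow> real \<Rightarrow> real^3 \<Rightarrow> real^3 \<Rightarrow> real^3 \<Rightarrow> real^3" where
  "swirl_d2 a \<theta> y b h =
    (a * (- 2 * \<theta> * (h \<bullet> b) * flat (flat_deriv 1) (1 - \<theta> * (y \<bullet> y))
      + 4 * \<theta>\<^sup>2 * (y \<bullet> b) * (y \<bullet> h) * flat (flat_deriv (flat_deriv 1)) (1 - \<theta> * (y \<bullet> y)))) *\<^sub>R rot y
    + (a * (- 2 * \<theta> * (y \<bullet> b) * flat (flat_deriv 1) (1 - \<theta> * (y \<bullet> y)))) *\<^sub>R rot h
    + (a * (- 2 * \<theta> * (y \<bullet> h) * flat (flat_deriv 1) (1 - \<theta> * (y \<bullet> y)))) *\<^sub>R rot b"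

text \<open>The 10 is 6 + 4: the Laplacian of \<open>y \<bullet> y\<close> contributes 2 * 3, and
  twice the gradient of the profile acting on the linear field \<open>rot\<close> contributes
  4.\<close>

definition swirl_lap :: "real \<Rightarrow> real \<Rightarrow> real^3 \<Rightarrow> real^3" where
  "swirl_lap a \<theta> y = (a * (4 * \<theta>\<^sup>2 * (y \<bullet> y) * flat (flat_deriv (flat_deriv 1)) (1 - \<theta> * (y \<bullet> y))
    - 10 * \<theta> * flat (flat_deriv 1) (1 - \<theta> * (y \<bullet> y)))) *\<^sub>R rot y"

definition swirl_t :: "real \<Rightarrow> real \<Rightarrow> real \<Rightarrow> real \<Rightarrow> real^3 \<Rightarrow> real^3" where
  "swirl_t a a' \<theta> \<theta>' y = (a' * flat 1 (1 - \<theta> * (y \<bullet> y))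
    - a * \<theta>' * (y \<bullet> y) * flat (flat_deriv 1) (1 - \<theta> * (y \<bullet> y))) *\<^sub>R rot y"

lemma has_derivative_radial:
  "((\<lambda>y. flat p (1 - \<theta> * ((y - c) \<bullet> (y - c)))) has_derivative
    (\<lambda>h. flat (flat_deriv p) (1 - \<theta> * ((y - c) \<bullet> (y - c))) * (- 2 * \<theta> * ((y - c) \<bullet> h)))) (at y)"
  by (rule has_derivative_eq_rhs[OF has_derivative_flat_comp])
    (auto intro!: derivative_eq_intros simp: inner_commute algebra_simps)

lemmas has_derivative_rot = bounded_linear.has_derivative[OF bounded_linear_rot]

lemma has_derivative_swirl:
  "((\<lambda>y. swirl a \<theta> (y - c)) has_derivative swirl_d a \<theta> (y - c)) (at y)"
  unfolding swirl_def
  by (rule has_derivative_eq_rhs, (rule has_derivative_scaleR has_derivative_mult has_derivative_radial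
        has_derivative_rot has_derivative_diff has_derivative_ident has_derivative_const)+)
    (auto simp: swirl_d_def fun_eq_iff algebra_simps)

lemma has_derivative_swirl_d:
  "((\<lambda>y. swirl_d a \<theta> (y - c) b) has_derivative swirl_d2 a \<theta> (y - c) b) (at y)"
proof -
  have *: "((\<lambda>y. (y - c) \<bullet> b) has_derivative (\<lambda>h. h \<bullet> b)) (at y)"
    by (auto intro!: derivative_eq_intros)
  show ?thesis
    unfolding swirl_d_def
    by (rule has_derivative_eq_rhs, (rule has_derivative_add has_derivative_scaleR has_derivative_mult has_derivative_radial *
        has_derivative_rot has_derivative_diff has_derivative_ident has_derivative_const)+)
      (auto simp: swirl_d2_def fun_eq_iff algebra_simps power2_eq_square)
qed

lemma swirl_lap_eq: "(\<Sum>b\<in>Basis. swirl_d2 a \<theta> y b b) = swirl_lap a \<theta> y"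
proof -
  have y: "(\<Sum>b\<in>Basis. (y \<bullet> b) * (y \<bullet> b)) = y \<bullet> y"
    by (simp add: euclidean_inner[of y y])
  have r: "(\<Sum>b\<in>Basis. (y \<bullet> b) *\<^sub>R rot b) = rot y" by (rule linear_sum_Basis[OF linear_rot])
  let ?p = "flat (flat_deriv 1) (1 - \<theta> * (y \<bullet> y))"
  let ?q = "flat (flat_deriv (flat_deriv 1)) (1 - \<theta> * (y \<bullet> y))"
  have "(\<Sum>b\<in>Basis. swirl_d2 a \<theta> y b b) = (\<Sum>b\<in>Basis. (a * (- 2 * \<theta> * ?p)) *\<^sub>R rot y
      + ((y \<bullet> b) * (y \<bullet> b)) *\<^sub>R ((a * 4 * \<theta>\<^sup>2 * ?q) *\<^sub>R rot y) + (a * (- 4 * \<theta> * ?p)) *\<^sub>R ((y \<bullet> b) *\<^sub>R rot b))"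
    by (rule sum.cong) (auto simp: swirl_d2_def vec_eq_iff algebra_simps)
  also have "\<dots> = 3 *\<^sub>R ((a * (- 2 * \<theta> * ?p)) *\<^sub>R rot y) + (y \<bullet> y) *\<^sub>R ((a * 4 * \<theta>\<^sup>2 * ?q) *\<^sub>R rot y)
      + (a * (- 4 * \<theta> * ?p)) *\<^sub>R rot y"
    by (simp only: sum.distrib scaleR_sum_left[symmetric] scaleR_sum_right[symmetric] y r sum_constant_scaleR) simp
  also have "\<dots> = swirl_lap a \<theta> y" by (simp add: swirl_lap_def vec_eq_iff algebra_simps)
  finally show ?thesis .
qed

text \<open>The gradient of the radial factor is parallel to \<open>y\<close>, hence orthogonal to
  \<open>rot y\<close>, and the linear map \<open>rot\<close> has trace 0.\<close>

lemma swirl_div: "(\<Sum>i\<in>UNIV. swirl_d a \<theta> y (axis i 1) $ i) = 0"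
  unfolding swirl_d_def inner_axis by (simp add: sum_3 rot_nth axis_def)

lemma swirl_outside:
  assumes "\<theta> * (y \<bullet> y) \<ge> 1"
  shows "swirl a \<theta> y = 0" "swirl_d a \<theta> y h = 0" "swirl_lap a \<theta> y = 0" "swirl_t a a' \<theta> \<theta>' y = 0" "swirl_d2 a \<theta> y b h = 0"
  using assms by (simp_all add: swirl_def swirl_d_def swirl_lap_def swirl_t_def swirl_d2_def flat_nonpos)

lemma swirl_zero [simp]:
  "swirl 0 \<theta> y = 0" "swirl_d 0 \<theta> y h = 0" "swirl_lap 0 \<theta> y = 0" "swirl_t 0 0 \<theta> \<theta>' y = 0" "swirl_d2 0 \<theta> y b h = 0"
  by (simp_all add: swirl_def swirl_d_def swirl_lap_def swirl_t_def swirl_d2_def)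

lemma swirl_origin: "swirl a \<theta> 0 = 0" "swirl_t a a' \<theta> \<theta>' 0 = 0"
  using linear_0[OF linear_rot] by (simp_all add: swirl_def swirl_t_def)

lemma Ck_on_rot: "Ck_on k A g \<Longrightarrow> Ck_on k A (\<lambda>x. rot (g x))"
  using Ck_on_compose[where f=rot and B=UNIV and g=g and A=A, OF _ Ck_on_linear[OF bounded_linear_rot]] by simp

lemma Ck_on_swirl:
  assumes "Ck_on k A a" "Ck_on k A a'" "Ck_on k A \<theta>" "Ck_on k A \<theta>'" "Ck_on k A y"
  shows "Ck_on k A (\<lambda>z. swirl (a z) (\<theta> z) (y z))" "Ck_on k A (\<lambda>z. swirl_d (a z) (\<theta> z) (y z) h)"
    "Ck_on k A (\<lambda>z. swirl_lap (a z) (\<theta> z) (y z))" "Ck_on k A (\<lambda>z. swirl_t (a z) (a' z) (\<theta> z) (\<theta>' z) (y z))"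
  unfolding swirl_def swirl_d_def swirl_lap_def swirl_t_def
  by (intro Ck_on_add Ck_on_diff Ck_on_scaleR Ck_on_mult Ck_on_flat_comp Ck_on_rot Ck_on_inner Ck_on_const Ck_on_power assms)+

lemma Ck_on_swirl_space:
  "Ck_on k UNIV (\<lambda>y. swirl a \<theta> (y - c))" "Ck_on k UNIV (\<lambda>y. swirl_d a \<theta> (y - c) h)"
  "Ck_on k UNIV (\<lambda>y. swirl_lap a \<theta> (y - c))" "Ck_on k UNIV (\<lambda>y. swirl_t a a' \<theta> \<theta>' (y - c))"
  by (intro Ck_on_swirl[where a'="\<lambda>_. a'" and \<theta>'="\<lambda>_. \<theta>'" and a="\<lambda>_. a" and \<theta>="\<lambda>_. \<theta>"] Ck_on_const Ck_on_diff Ck_on_id)+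

lemma has_vector_derivative_swirl:
  assumes a: "(a has_real_derivative a') (at t)" and \<theta>: "(\<theta> has_real_derivative \<theta>') (at t)"
  shows "((\<lambda>t. swirl (a t) (\<theta> t) y) has_vector_derivative swirl_t (a t) a' (\<theta> t) \<theta>' y) (at t)"
proof -
  have 1: "((\<lambda>t. 1 - \<theta> t * (y \<bullet> y)) has_real_derivative - (\<theta>' * (y \<bullet> y))) (at t)"
    by (auto intro!: derivative_eq_intros \<theta>)
  have "((\<lambda>t. a t * flat 1 (1 - \<theta> t * (y \<bullet> y))) has_real_derivative
    (a' * flat 1 (1 - \<theta> t * (y \<bullet> y)) + (flat (flat_deriv 1) (1 - \<theta> t * (y \<bullet> y)) * - (\<theta>' * (y \<bullet> y))) * a t)) (at t)"
    by (intro DERIV_mult a DERIV_chain2[OF DERIV_flat 1])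
  from has_vector_derivative_scaleR[OF this has_vector_derivative_const[of "rot y"]]
  show ?thesis by (simp add: swirl_def swirl_t_def algebra_simps)
qed

text \<open>One constant for the first two derivatives. Being at least 1, it also absorbs the bound
  1 of \<open>flat 1\<close> itself, so that only one constant appears in the estimates.\<close>

definition flat_const :: real where
  "flat_const = (SOME C. C \<ge> 1 \<and> (\<forall>s\<le>1. \<bar>flat (flat_deriv 1) s\<bar> \<le> C \<and> \<bar>flat (flat_deriv (flat_deriv 1)) s\<bar> \<le> C))"

lemma flat_const: "flat_const \<ge> 1" "s \<le> 1 \<Longrightarrow> \<bar>flat (flat_deriv 1) s\<bar> \<le> flat_const"
  "s \<le> 1 \<Longrightarrow> \<bar>flat (flat_deriv (flat_deriv 1)) s\<bar> \<le> flat_const"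
proof -
  obtain C1 C2 where "\<forall>s\<le>1. \<bar>flat (flat_deriv 1) s\<bar> \<le> C1" "\<forall>s\<le>1. \<bar>flat (flat_deriv (flat_deriv 1)) s\<bar> \<le> C2"
    using flat_bound by metis
  then have "\<exists>C. C \<ge> 1 \<and> (\<forall>s\<le>1. \<bar>flat (flat_deriv 1) s\<bar> \<le> C \<and> \<bar>flat (flat_deriv (flat_deriv 1)) s\<bar> \<le> C)"
    by (intro exI[of _ "max 1 (max C1 C2)"]) (simp add: le_max_iff_disj)
  from someI_ex[OF this]
  show "flat_const \<ge> 1" "s \<le> 1 \<Longrightarrow> \<bar>flat (flat_deriv 1) s\<bar> \<le> flat_const"
    "s \<le> 1 \<Longrightarrow> \<bar>flat (flat_deriv (flat_deriv 1)) s\<bar> \<le> flat_const"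
    unfolding flat_const_def by auto
qed

text \<open>With \<open>\<theta> = r\<^sup>-\<^sup>2\<close> the swirl lives on the ball of radius \<open>r\<close>, and each spatial derivative
  costs a factor \<open>r\<^sup>-\<^sup>1\<close>.\<close>

lemma swirl_bounds:
  assumes r: "r > 0" "\<theta> = 1 / r\<^sup>2"
  shows "norm (swirl a \<theta> y) \<le> \<bar>a\<bar> * r"
    "norm (swirl_d a \<theta> y h) \<le> 3 * flat_const * \<bar>a\<bar> * norm h"
    "norm (swirl_lap a \<theta> y) \<le> 14 * flat_const * \<bar>a\<bar> / r"
    "norm (swirl_t a a' \<theta> \<theta>' y) \<le> (\<bar>a'\<bar> + flat_const * \<bar>a\<bar> * \<bar>\<theta>'\<bar> * r\<^sup>2) * r"
proof -
  note C = flat_const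
  have th: "\<theta> > 0" using r by simp
  have "norm (swirl a \<theta> y) \<le> \<bar>a\<bar> * r \<and> norm (swirl_d a \<theta> y h) \<le> 3 * flat_const * \<bar>a\<bar> * norm h
    \<and> norm (swirl_lap a \<theta> y) \<le> 14 * flat_const * \<bar>a\<bar> / r
    \<and> norm (swirl_t a a' \<theta> \<theta>' y) \<le> (\<bar>a'\<bar> + flat_const * \<bar>a\<bar> * \<bar>\<theta>'\<bar> * r\<^sup>2) * r"
  proof (cases "\<theta> * (y \<bullet> y) \<ge> 1")
    case True
    show ?thesis unfolding swirl_outside[OF True] using r C(1) by simp
  next
    case False
    then have y2: "(norm y)\<^sup>2 \<le> r\<^sup>2" using r by (simp add: power2_norm_eq_inner field_simps)
    then have y: "norm y \<le> r" by (rule power2_le_imp_le) (use r in simp)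
    have yy: "y \<bullet> y \<le> r\<^sup>2" "0 \<le> y \<bullet> y" using y2 by (auto simp: power2_norm_eq_inner)
    have s1: "1 - \<theta> * (y \<bullet> y) \<le> 1" using th by simp
    define p0 where "p0 = flat 1 (1 - \<theta> * (y \<bullet> y))"
    define p1 where "p1 = flat (flat_deriv 1) (1 - \<theta> * (y \<bullet> y))"
    define p2 where "p2 = flat (flat_deriv (flat_deriv 1)) (1 - \<theta> * (y \<bullet> y))"
    have p0: "\<bar>p0\<bar> \<le> 1" unfolding p0_def abs_of_nonneg[OF flat_1_nonneg] by (rule flat_1_le_1)
    have p1: "\<bar>p1\<bar> \<le> flat_const" and p2: "\<bar>p2\<bar> \<le> flat_const" using C s1 by (auto simp: p1_def p2_def)
    have ry: "norm (rot y) \<le> r" using norm_rot_le[of y] y by linarith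
    have 1: "norm (swirl a \<theta> y) \<le> \<bar>a\<bar> * r"
    proof -
      have "\<bar>a * p0\<bar> * norm (rot y) \<le> (\<bar>a\<bar> * 1) * r"
        unfolding abs_mult using p0 ry by (intro mult_mono) auto
      then show ?thesis by (simp add: swirl_def p0_def)
    qed
    have 2: "norm (swirl_d a \<theta> y h) \<le> 3 * flat_const * \<bar>a\<bar> * norm h"
    proof -
      have yh: "\<bar>y \<bullet> h\<bar> \<le> r * norm h"
        using Cauchy_Schwarz_ineq2[of y h] mult_right_mono[OF y, of "norm h"] by simp
      have "norm ((a * (- 2 * \<theta> * (y \<bullet> h) * p1)) *\<^sub>R rot y) = \<bar>a\<bar> * (2 * \<theta> * \<bar>y \<bullet> h\<bar> * \<bar>p1\<bar>) * norm (rot y)"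
        using th by (simp add: abs_mult)
      also have "\<dots> \<le> \<bar>a\<bar> * (2 * \<theta> * (r * norm h) * flat_const) * r"
        using th p1 ry yh r by (intro mult_mono mult_left_mono) auto
      also have "\<dots> = 2 * flat_const * \<bar>a\<bar> * norm h" using r by (simp add: power2_eq_square)
      finally have A: "norm ((a * (- 2 * \<theta> * (y \<bullet> h) * p1)) *\<^sub>R rot y) \<le> 2 * flat_const * \<bar>a\<bar> * norm h" .
      have "norm ((a * p0) *\<^sub>R rot h) \<le> (\<bar>a\<bar> * 1) * norm h"
        unfolding norm_scaleR abs_mult using p0 norm_rot_le[of h] by (intro mult_mono) auto
      also have "\<dots> \<le> flat_const * \<bar>a\<bar> * norm h"
        using C(1) mult_right_mono[OF C(1), of "\<bar>a\<bar> * norm h"] by (simp add: mult.assoc)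
      finally have B: "norm ((a * p0) *\<^sub>R rot h) \<le> flat_const * \<bar>a\<bar> * norm h" .
      have "norm (swirl_d a \<theta> y h) \<le> norm ((a * (- 2 * \<theta> * (y \<bullet> h) * p1)) *\<^sub>R rot y) + norm ((a * p0) *\<^sub>R rot h)"
        unfolding swirl_d_def p0_def p1_def by (rule norm_triangle_ineq)
      with A B show ?thesis by simp
    qed
    \<comment> \<open>14 = 4 + 10, the two coefficients of \<open>swirl_lap\<close>.\<close>
    have 3: "norm (swirl_lap a \<theta> y) \<le> 14 * flat_const * \<bar>a\<bar> / r"
    proof -
      have "\<bar>4 * \<theta>\<^sup>2 * (y \<bullet> y) * p2 - 10 * \<theta> * p1\<bar> \<le> 4 * \<theta>\<^sup>2 * (y \<bullet> y) * \<bar>p2\<bar> + 10 * \<theta> * \<bar>p1\<bar>"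
        using abs_triangle_ineq4[of "4 * \<theta>\<^sup>2 * (y \<bullet> y) * p2" "10 * \<theta> * p1"] th yy by (simp add: abs_mult)
      also have "\<dots> \<le> 4 * \<theta>\<^sup>2 * r\<^sup>2 * flat_const + 10 * \<theta> * flat_const"
        using p1 p2 th yy by (intro add_mono mult_mono mult_left_mono) auto
      also have "\<dots> = (4 * (\<theta> * r\<^sup>2) + 10) * (\<theta> * flat_const)" by (simp add: algebra_simps power2_eq_square)
      also have "\<theta> * r\<^sup>2 = 1" using r by simp
      also have "(4 * 1 + 10) * (\<theta> * flat_const) = 14 * flat_const / r\<^sup>2" unfolding r(2) by simp
      finally have "\<bar>4 * \<theta>\<^sup>2 * (y \<bullet> y) * p2 - 10 * \<theta> * p1\<bar> \<le> 14 * flat_const / r\<^sup>2" .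
      then have "\<bar>a * (4 * \<theta>\<^sup>2 * (y \<bullet> y) * p2 - 10 * \<theta> * p1)\<bar> * norm (rot y) \<le> (\<bar>a\<bar> * (14 * flat_const / r\<^sup>2)) * r"
        unfolding abs_mult[of a] using ry C(1) by (intro mult_mono mult_left_mono) auto
      also have "\<dots> = 14 * flat_const * \<bar>a\<bar> / r" using r by (simp add: power2_eq_square)
      finally show ?thesis by (simp add: swirl_lap_def p1_def p2_def)
    qed
    have 4: "norm (swirl_t a a' \<theta> \<theta>' y) \<le> (\<bar>a'\<bar> + flat_const * \<bar>a\<bar> * \<bar>\<theta>'\<bar> * r\<^sup>2) * r"
    proof -
      have "\<bar>a' * p0 - a * \<theta>' * (y \<bullet> y) * p1\<bar> \<le> \<bar>a'\<bar> * \<bar>p0\<bar> + \<bar>a\<bar> * \<bar>\<theta>'\<bar> * (y \<bullet> y) * \<bar>p1\<bar>"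
        using abs_triangle_ineq4[of "a' * p0" "a * \<theta>' * (y \<bullet> y) * p1"] yy by (simp add: abs_mult)
      also have "\<dots> \<le> \<bar>a'\<bar> * 1 + \<bar>a\<bar> * \<bar>\<theta>'\<bar> * r\<^sup>2 * flat_const"
        using p0 p1 yy by (intro add_mono mult_mono mult_left_mono) auto
      finally have "\<bar>a' * p0 - a * \<theta>' * (y \<bullet> y) * p1\<bar> * norm (rot y)
        \<le> (\<bar>a'\<bar> * 1 + \<bar>a\<bar> * \<bar>\<theta>'\<bar> * r\<^sup>2 * flat_const) * r" using ry by (intro mult_mono) auto
      then show ?thesis by (simp add: swirl_t_def p0_def p1_def mult_ac)
    qed
    show ?thesis using 1 2 3 4 by blast
  qed
  then show "norm (swirl a \<theta> y) \<le> \<bar>a\<bar> * r"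
    "norm (swirl_d a \<theta> y h) \<le> 3 * flat_const * \<bar>a\<bar> * norm h"
    "norm (swirl_lap a \<theta> y) \<le> 14 * flat_const * \<bar>a\<bar> / r"
    "norm (swirl_t a a' \<theta> \<theta>' y) \<le> (\<bar>a'\<bar> + flat_const * \<bar>a\<bar> * \<bar>\<theta>'\<bar> * r\<^sup>2) * r" by auto
qed

section \<open>A sequence of vortices\<close>

text \<open>A positive \<open>\<gamma>\<close> makes the gradient blow up. The bound 1/4 gives 2 + 4
  \<gamma> \<le> 3, so that the squared force, of order R^(-2-4\<gamma>), is compensated by the
  volume R^3. It also gives 1 - 2 \<gamma> > 0, so that the velocity tends to 0 at the singular
  points.\<close>

locale swirl_flow =
  fixes \<gamma> T :: real
  assumes gam: "0 < \<gamma>" "\<gamma> \<le> 1 / 4" and T: "T > 0"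
begin

text \<open>\<open>dl m\<close> is both half the lifetime of the m-th vortex and the bound of its
  amplitude. From \<open>tm m\<close> to any later singular time there are at least T / 2^(m+2),
  twice the bound T / 2^(m+3) on the half lifetimes involved, so the lifetimes are disjoint. Since
  \<open>dl m \<le> T / 8\<close> and \<open>tm m \<ge> T / 2\<close>, nothing happens before T / 4;
  geometric decay makes the vortices summable. The centres are 4 apart, against radii at most
  1.\<close>

definition dl :: "nat \<Rightarrow> real" where "dl m = min 1 T / 2 ^ (m + 3)"
definition tm :: "nat \<Rightarrow> real" where "tm m = T * (1 - 1 / 2 ^ (m + 1))"
definition xm :: "nat \<Rightarrow> real^3" where "xm m = (4 * real m) *\<^sub>R axis 1 1"

text \<open>Selecting one index instead of summing over all vortices reduces the pointwise algebra
  to a single swirl. When no vortex is alive the default 0 is harmless, because vortex 0 vanishes at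
  such times too.\<close>

definition idx :: "real \<Rightarrow> nat" where
  "idx t = (if \<exists>m. \<bar>t - tm m\<bar> < dl m then SOME m. \<bar>t - tm m\<bar> < dl m else 0)"

text \<open>At time \<open>t\<close> only the vortex with index \<open>idx t\<close> is alive. \<open>ca\<close> and \<open>cth\<close> are its amplitude \<open>a\<close> and
  its parameter \<open>\<theta>\<close>, primes are time derivatives, and the suffixes d, l, t (also D, L, t on \<open>V\<close>) mark
  spatial derivative, Laplacian and time derivative. The weights \<open>b\<close> are \<open>dl\<close> for the solution and
  truncated to finitely many vortices for the approximations.

  The solution is the case \<open>\<epsilon> = 0\<close>; for \<open>\<epsilon> > 0\<close> the singularity at \<open>tm m\<close> is smoothed out. At
  \<open>t = tm m\<close> and \<open>\<epsilon> = 0\<close> the junk value \<open>0 powr _ = 0\<close> makes all fields vanish, as they should.\<close>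

definition rho :: "real \<Rightarrow> nat \<Rightarrow> real \<Rightarrow> real" where
  "rho \<epsilon> m t = (t - tm m)\<^sup>2 + \<epsilon> * (dl m)\<^sup>2"
definition rad :: "real \<Rightarrow> nat \<Rightarrow> real \<Rightarrow> real" where
  "rad \<epsilon> m t = rho \<epsilon> m t powr (1 / 4)"
definition ca :: "(nat \<Rightarrow> real) \<Rightarrow> real \<Rightarrow> nat \<Rightarrow> real \<Rightarrow> real" where
  "ca b \<epsilon> m t = b m * flat 1 (1 - ((t - tm m) / dl m)\<^sup>2) * rho \<epsilon> m t powr (- \<gamma> / 2)"
definition ca' :: "(nat \<Rightarrow> real) \<Rightarrow> real \<Rightarrow> nat \<Rightarrow> real \<Rightarrow> real" where
  "ca' b \<epsilon> m t = b m * (flat (flat_deriv 1) (1 - ((t - tm m) / dl m)\<^sup>2) * (- 2 * (t - tm m) / (dl m)\<^sup>2)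
      * rho \<epsilon> m t powr (- \<gamma> / 2)
    + flat 1 (1 - ((t - tm m) / dl m)\<^sup>2) * (- \<gamma> * (t - tm m)) * rho \<epsilon> m t powr (- \<gamma> / 2 - 1))"
definition cth :: "real \<Rightarrow> nat \<Rightarrow> real \<Rightarrow> real" where
  "cth \<epsilon> m t = rho \<epsilon> m t powr (- 1 / 2)"
definition cth' :: "real \<Rightarrow> nat \<Rightarrow> real \<Rightarrow> real" where
  "cth' \<epsilon> m t = - (t - tm m) * rho \<epsilon> m t powr (- 3 / 2)"

definition w where "w b \<epsilon> m t x = swirl (ca b \<epsilon> m t) (cth \<epsilon> m t) (x - xm m)"
definition wd where "wd b \<epsilon> m t x h = swirl_d (ca b \<epsilon> m t) (cth \<epsilon> m t) (x - xm m) h"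
definition wl where "wl b \<epsilon> m t x = swirl_lap (ca b \<epsilon> m t) (cth \<epsilon> m t) (x - xm m)"
definition wt where "wt b \<epsilon> m t x = swirl_t (ca b \<epsilon> m t) (ca' b \<epsilon> m t) (cth \<epsilon> m t) (cth' \<epsilon> m t) (x - xm m)"

definition V where "V b \<epsilon> t = w b \<epsilon> (idx t) t"
definition DV where "DV b \<epsilon> t = wd b \<epsilon> (idx t) t"
definition LV where "LV b \<epsilon> t = wl b \<epsilon> (idx t) t"
definition Vt where "Vt b \<epsilon> t = wt b \<epsilon> (idx t) t"

section \<open>Times, lifetimes and selection of the vortices\<close>

lemma dl_pos: "dl m > 0" using T by (simp add: dl_def)

lemma dl_le: "dl m \<le> T / 2 ^ (m + 3)" "dl m \<le> 1 / 2 ^ (m + 3)" "dl m \<le> 1 / 8" "dl m \<le> T / 8"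
proof -
  show A: "dl m \<le> T / 2 ^ (m + 3)" "dl m \<le> 1 / 2 ^ (m + 3)"
    unfolding dl_def by (intro divide_right_mono; simp)+
  have p: "(2::real) ^ 3 \<le> 2 ^ (m + 3)" by (intro power_increasing) auto
  have "1 / 2 ^ (m + 3) \<le> (1::real) / 2 ^ 3" using p by (intro divide_left_mono) auto
  with A(2) have "dl m \<le> 1 / 2 ^ 3" by (rule order_trans)
  then show "dl m \<le> 1 / 8" by simp
  have "T / 2 ^ (m + 3) \<le> T / 2 ^ 3" using p T by (intro divide_left_mono) auto
  with A(1) have "dl m \<le> T / 2 ^ 3" by (rule order_trans)
  then show "dl m \<le> T / 8" by simp
qed

lemma tm_gap: "m < n \<Longrightarrow> tm n - tm m \<ge> T / 2 ^ (m + 2)"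
proof -
  assume "m < n"
  then have "(2::real) ^ (m + 2) \<le> 2 ^ (n + 1)" by (intro power_increasing) auto
  then have "1 / (2::real) ^ (n + 1) \<le> 1 / 2 ^ (m + 2)" by (intro divide_left_mono) auto
  then have "T * (1 / 2 ^ (m + 1) - 1 / 2 ^ (n + 1)) \<ge> T * (1 / 2 ^ (m + 1) - 1 / 2 ^ (m + 2))"
    using T by (intro mult_left_mono) auto
  then show ?thesis by (simp add: tm_def algebra_simps)
qed

lemma tm_strict_mono: "strict_mono tm"
proof (rule strict_monoI)
  fix m n :: nat assume "m < n"
  moreover have "T / 2 ^ (m + 2) > 0" using T by simp
  ultimately show "tm m < tm n" using tm_gap[of m n] by linarith
qed

lemma tm_bounds: "T / 2 \<le> tm m" "tm m < T"
proof -
  have "(1::real) / 2 ^ (m + 1) \<le> 1 / 2 ^ 1" by (intro divide_left_mono power_increasing) auto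
  then have "T * (1 - 1 / 2 ^ (m + 1)) \<ge> T * (1 - 1 / 2)" using T by (intro mult_left_mono) auto
  then show "T / 2 \<le> tm m" by (simp add: tm_def)
  have "T * (1 - 1 / 2 ^ (m + 1)) < T * 1" using T by (intro mult_strict_left_mono) auto
  then show "tm m < T" by (simp add: tm_def)
qed

lemma window_unique:
  assumes "\<bar>t - tm m\<bar> < dl m" "\<bar>t - tm n\<bar> < dl n" shows "m = n"
proof -
  have False if "m < n" "\<bar>t - tm m\<bar> < dl m" "\<bar>t - tm n\<bar> < dl n" for m n
  proof -
    have "(2::real) ^ (m + 3) \<le> 2 ^ (n + 3)" using that(1) by (intro power_increasing) auto
    then have "T / 2 ^ (n + 3) \<le> T / 2 ^ (m + 3)" using T by (intro divide_left_mono) auto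
    then have "dl n \<le> T / 2 ^ (m + 3)" using dl_le(1)[of n] by linarith
    moreover have "T / 2 ^ (m + 2) = 2 * (T / 2 ^ (m + 3))" by (simp add: power_add)
    ultimately have "dl m + dl n \<le> T / 2 ^ (m + 2)" using dl_le(1)[of m] by linarith
    then show False using tm_gap[OF that(1)] that(2,3) by linarith
  qed
  then show ?thesis using assms by (cases m n rule: linorder_cases) blast+
qed

lemma idx_eq: "\<bar>t - tm m\<bar> < dl m \<Longrightarrow> idx t = m"
proof -
  assume *: "\<bar>t - tm m\<bar> < dl m"
  then have "\<bar>t - tm (SOME m. \<bar>t - tm m\<bar> < dl m)\<bar> < dl (SOME m. \<bar>t - tm m\<bar> < dl m)" by (rule someI)
  then show ?thesis using window_unique[OF _ *] * by (auto simp: idx_def)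
qed

lemma idx_0: "(\<And>m. \<not> \<bar>t - tm m\<bar> < dl m) \<Longrightarrow> idx t = 0"
  by (auto simp: idx_def)

lemma measurable_idx [measurable]: "idx \<in> measurable borel (count_space UNIV)"
proof (rule measurableI)
  fix A :: "nat set"
  define W where "W = (\<lambda>m. {t. \<bar>t - tm m\<bar> < dl m})"
  have W [measurable]: "W m \<in> sets borel" for m
    unfolding W_def by measurable
  have "idx -` A = (\<Union>m\<in>A. W m) \<union> (if 0 \<in> A then - (\<Union>m. W m) else {})"
  proof (intro set_eqI iffI)
    fix t assume t: "t \<in> idx -` A"
    show "t \<in> (\<Union>m\<in>A. W m) \<union> (if 0 \<in> A then - (\<Union>m. W m) else {})"
    proof (cases "\<exists>m. t \<in> W m")
      case True then obtain m where m: "t \<in> W m" by blast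
      then have "idx t = m" using idx_eq by (simp add: W_def)
      then show ?thesis using m t by auto
    next
      case False
      then have "idx t = 0" using idx_0 by (auto simp: W_def)
      then show ?thesis using False t by auto
    qed
  next
    fix t assume "t \<in> (\<Union>m\<in>A. W m) \<union> (if 0 \<in> A then - (\<Union>m. W m) else {})"
    then show "t \<in> idx -` A" using idx_eq idx_0 by (auto simp: W_def split: if_splits)
  qed
  moreover have "\<dots> \<in> sets borel" by auto
  ultimately show "idx -` A \<inter> space borel \<in> sets borel" by simp
qed auto

section \<open>Size and support of a single vortex\<close>

lemma rho_nonneg: "0 \<le> \<epsilon> \<Longrightarrow> 0 \<le> rho \<epsilon> m t"
  by (simp add: rho_def)

lemma rad_nonneg: "0 \<le> rad \<epsilon> m t" by (simp add: rad_def)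

lemma coeff_zero:
  assumes "\<not> \<bar>t - tm m\<bar> < dl m \<or> rho \<epsilon> m t = 0"
  shows "ca b \<epsilon> m t = 0" "ca' b \<epsilon> m t = 0"
proof -
  have "1 - ((t - tm m) / dl m)\<^sup>2 \<le> 0" if "\<not> \<bar>t - tm m\<bar> < dl m"
  proof -
    have "1 \<le> \<bar>(t - tm m) / dl m\<bar>" using that dl_pos[of m] by simp
    then have "1 \<le> \<bar>(t - tm m) / dl m\<bar> ^ 2" by (rule one_le_power)
    then show ?thesis unfolding power2_abs by simp
  qed
  then show "ca b \<epsilon> m t = 0" "ca' b \<epsilon> m t = 0"
    using assms by (auto simp: ca_def ca'_def flat_nonpos)
qed

lemma field_zero:
  assumes "\<not> \<bar>t - tm m\<bar> < dl m \<or> rho \<epsilon> m t = 0"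
  shows "w b \<epsilon> m t x = 0" "wd b \<epsilon> m t x h = 0" "wl b \<epsilon> m t x = 0" "wt b \<epsilon> m t x = 0"
  unfolding w_def wd_def wl_def wt_def coeff_zero[OF assms] by simp_all

lemma rho_eq_rad: "0 \<le> \<epsilon> \<Longrightarrow> rho \<epsilon> m t = rad \<epsilon> m t ^ 4"
  using rho_nonneg[of \<epsilon> m t] by (cases "rho \<epsilon> m t = 0") (auto simp: rad_def powr_powr simp flip: powr_numeral)

lemma cth_eq: "rho \<epsilon> m t > 0 \<Longrightarrow> cth \<epsilon> m t = 1 / (rad \<epsilon> m t)\<^sup>2"
  by (simp add: cth_def rad_def powr_powr powr_minus_divide flip: powr_numeral)

text \<open>During the lifetime \<open>rho\<close> is at most 2 (dl m)^2, because \<epsilon> \<le>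
  1. As \<open>dl m \<le> 1 / 8\<close>, the radius stays below 1, with and without
  regularisation.\<close>

lemma rad_le:
  assumes "0 \<le> \<epsilon>" "\<epsilon> \<le> 1" "\<bar>t - tm m\<bar> < dl m"
  shows "(rad \<epsilon> m t)\<^sup>2 \<le> 2 * dl m" "rad \<epsilon> m t \<le> 1" "\<bar>t - tm m\<bar> \<le> (rad \<epsilon> m t)\<^sup>2"
proof -
  have "(t - tm m)\<^sup>2 \<le> (dl m)\<^sup>2" using assms(3) by (simp add: abs_le_square_iff[symmetric])
  moreover have "\<epsilon> * (dl m)\<^sup>2 \<le> 1 * (dl m)\<^sup>2" using assms by (intro mult_right_mono) auto
  ultimately have "rho \<epsilon> m t \<le> 2 * (dl m)\<^sup>2" by (simp add: rho_def)
  also have "\<dots> \<le> (2 * dl m)\<^sup>2" by (simp add: power_mult_distrib)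
  finally have *: "((rad \<epsilon> m t)\<^sup>2)\<^sup>2 \<le> (2 * dl m)\<^sup>2" using assms(1) by (simp add: rho_eq_rad flip: power_mult)
  then show 1: "(rad \<epsilon> m t)\<^sup>2 \<le> 2 * dl m" by (rule power2_le_imp_le) (use dl_pos[of m] in simp)
  then have "(rad \<epsilon> m t)\<^sup>2 \<le> 1\<^sup>2" using dl_le(3)[of m] by simp
  then show "rad \<epsilon> m t \<le> 1" by (rule power2_le_imp_le) simp
  have "(t - tm m)\<^sup>2 \<le> rho \<epsilon> m t" using assms(1) by (simp add: rho_def)
  then have "\<bar>t - tm m\<bar>\<^sup>2 \<le> ((rad \<epsilon> m t)\<^sup>2)\<^sup>2"
    unfolding rho_eq_rad[OF assms(1)] by (simp flip: power_mult)
  then show "\<bar>t - tm m\<bar> \<le> (rad \<epsilon> m t)\<^sup>2" by (rule power2_le_imp_le) simp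
qed

lemma ca_le:
  assumes "0 \<le> b m" "b m \<le> dl m" "0 \<le> \<epsilon>" "rho \<epsilon> m t > 0"
  shows "\<bar>ca b \<epsilon> m t\<bar> \<le> dl m * rad \<epsilon> m t powr (- 2 * \<gamma>)"
proof -
  have "\<bar>ca b \<epsilon> m t\<bar> = b m * flat 1 (1 - ((t - tm m) / dl m)\<^sup>2) * rho \<epsilon> m t powr (- \<gamma> / 2)"
    using assms flat_1_nonneg by (simp add: ca_def abs_mult)
  also have "\<dots> \<le> dl m * 1 * rho \<epsilon> m t powr (- \<gamma> / 2)"
    using assms by (intro mult_mono flat_1_le_1) (auto intro: flat_1_nonneg)
  also have "rho \<epsilon> m t powr (- \<gamma> / 2) = rad \<epsilon> m t powr (- 2 * \<gamma>)" by (simp add: rad_def powr_powr)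
  finally show ?thesis by simp
qed

text \<open>A time derivative costs R^(-2), as parabolic scaling predicts. Up to
  \<open>flat_const\<close>, the cutoff in time contributes 4 / R^2, because R^2 \<le> 2 dl turns
  its 1 / dl into 1 / R^2, and the power of \<open>rho\<close> contributes 1 / R^2; hence the
  5.\<close>

lemma ca'_le:
  assumes b: "0 \<le> b m" "b m \<le> dl m" and e: "0 \<le> \<epsilon>" "\<epsilon> \<le> 1" and r: "rho \<epsilon> m t > 0" and w: "\<bar>t - tm m\<bar> < dl m"
  shows "\<bar>ca' b \<epsilon> m t\<bar> \<le> dl m * (5 * flat_const * rad \<epsilon> m t powr (- 2 * \<gamma>) / (rad \<epsilon> m t)\<^sup>2)"
proof -
  define R where "R = rad \<epsilon> m t"
  have R: "R > 0" using r by (simp add: R_def rad_def)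
  have rr: "rho \<epsilon> m t = R ^ 4" using rho_eq_rad[OF e(1)] by (simp add: R_def)
  have p: "rho \<epsilon> m t powr (- \<gamma> / 2) = R powr (- 2 * \<gamma>)" by (simp add: R_def rad_def powr_powr)
  have p1: "rho \<epsilon> m t powr (- \<gamma> / 2 - 1) = R powr (- 2 * \<gamma>) / R ^ 4"
  proof -
    have "rho \<epsilon> m t powr (- \<gamma> / 2 - 1) = rho \<epsilon> m t powr (- \<gamma> / 2) / rho \<epsilon> m t" using r by (simp add: powr_diff)
    then show ?thesis unfolding p unfolding rr .
  qed
  note rl = rad_le[OF e w, folded R_def]
  define q0 where "q0 = flat 1 (1 - ((t - tm m) / dl m)\<^sup>2)"
  define q1 where "q1 = flat (flat_deriv 1) (1 - ((t - tm m) / dl m)\<^sup>2)"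
  have q0: "0 \<le> q0" "q0 \<le> 1" by (auto simp: q0_def flat_1_nonneg flat_1_le_1)
  have q1: "\<bar>q1\<bar> \<le> flat_const" unfolding q1_def by (rule flat_const) simp
  have 1: "\<bar>q1 * (- 2 * (t - tm m) / (dl m)\<^sup>2)\<bar> \<le> 4 * flat_const / R\<^sup>2"
  proof -
    have "2 * \<bar>t - tm m\<bar> / (dl m)\<^sup>2 \<le> 2 * dl m / (dl m)\<^sup>2" using w by (intro divide_right_mono) auto
    also have "\<dots> = 2 / dl m" using dl_pos[of m] by (simp add: power2_eq_square)
    also have "\<dots> \<le> 4 / R\<^sup>2" using rl(1) R dl_pos[of m] by (simp add: field_simps)
    finally have "\<bar>q1\<bar> * (2 * \<bar>t - tm m\<bar> / (dl m)\<^sup>2) \<le> flat_const * (4 / R\<^sup>2)"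
      using q1 by (intro mult_mono) auto
    moreover have "\<bar>q1 * (- 2 * (t - tm m) / (dl m)\<^sup>2)\<bar> = \<bar>q1\<bar> * (2 * \<bar>t - tm m\<bar> / (dl m)\<^sup>2)"
      unfolding abs_mult abs_divide by simp
    ultimately show ?thesis by (simp only: mult.commute[of flat_const] times_divide_eq_left)
  qed
  have 2: "\<bar>q0 * (- \<gamma> * (t - tm m)) / R ^ 4\<bar> \<le> 1 / R\<^sup>2"
  proof -
    have "q0 * (\<gamma> * \<bar>t - tm m\<bar>) \<le> 1 * (1 * R\<^sup>2)" using q0 gam rl(3) by (intro mult_mono) auto
    then have "q0 * (\<gamma> * \<bar>t - tm m\<bar>) / R ^ 4 \<le> R\<^sup>2 / R ^ 4" by (intro divide_right_mono) auto
    also have "\<dots> = 1 / R\<^sup>2" using R by (simp add: field_simps flip: power_add)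
    finally show ?thesis using q0 gam by (simp add: abs_mult)
  qed
  have "ca' b \<epsilon> m t = b m * (R powr (- 2 * \<gamma>) * (q1 * (- 2 * (t - tm m) / (dl m)\<^sup>2) + q0 * (- \<gamma> * (t - tm m)) / R ^ 4))"
    unfolding ca'_def p p1 q0_def q1_def by (simp add: algebra_simps add_divide_distrib diff_divide_distrib)
  then have "\<bar>ca' b \<epsilon> m t\<bar> = b m * (R powr (- 2 * \<gamma>) * \<bar>q1 * (- 2 * (t - tm m) / (dl m)\<^sup>2) + q0 * (- \<gamma> * (t - tm m)) / R ^ 4\<bar>)"
    using b by (simp only: abs_mult) simp
  also have "\<dots> \<le> dl m * (R powr (- 2 * \<gamma>) * (4 * flat_const / R\<^sup>2 + 1 / R\<^sup>2))"
    using b 1 2 by (intro mult_mono order_trans[OF abs_triangle_ineq] add_mono) auto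
  also have "\<dots> \<le> dl m * (R powr (- 2 * \<gamma>) * (5 * flat_const / R\<^sup>2))"
  proof -
    have "4 * flat_const / R\<^sup>2 + 1 / R\<^sup>2 \<le> 5 * flat_const / R\<^sup>2"
      unfolding add_divide_distrib[symmetric] using flat_const(1) by (intro divide_right_mono) auto
    then show ?thesis using dl_pos[of m] by (intro mult_left_mono) auto
  qed
  finally show ?thesis by (simp add: R_def mult_ac)
qed

text \<open>The exponents are those of parabolic scaling: amplitude R^(-2\<gamma>) times length R
  for the field, one power less for each space derivative, two less for a time derivative. Time
  derivative and Laplacian are therefore of the same order. In the last bound, 6 is 5 from
  \<open>ca'\<close> plus 1 from the moving radius.\<close>

lemma field_bounds:
  assumes b: "0 \<le> b m" "b m \<le> dl m" and e: "0 \<le> \<epsilon>" "\<epsilon> \<le> 1"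
  shows "norm (w b \<epsilon> m t x) \<le> dl m * rad \<epsilon> m t powr (1 - 2 * \<gamma>)"
    "norm (wd b \<epsilon> m t x h) \<le> 3 * flat_const * dl m * rad \<epsilon> m t powr (- 2 * \<gamma>) * norm h"
    "norm (wl b \<epsilon> m t x) \<le> 14 * flat_const * dl m * rad \<epsilon> m t powr (- 1 - 2 * \<gamma>)"
    "norm (wt b \<epsilon> m t x) \<le> 6 * flat_const * dl m * rad \<epsilon> m t powr (- 1 - 2 * \<gamma>)"
proof -
  define R where "R = rad \<epsilon> m t"
  note C = flat_const(1)
  have "norm (w b \<epsilon> m t x) \<le> dl m * R powr (1 - 2 * \<gamma>) \<and>
    norm (wd b \<epsilon> m t x h) \<le> 3 * flat_const * dl m * R powr (- 2 * \<gamma>) * norm h \<and>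
    norm (wl b \<epsilon> m t x) \<le> 14 * flat_const * dl m * R powr (- 1 - 2 * \<gamma>) \<and>
    norm (wt b \<epsilon> m t x) \<le> 6 * flat_const * dl m * R powr (- 1 - 2 * \<gamma>)"
  proof (cases "\<not> \<bar>t - tm m\<bar> < dl m \<or> rho \<epsilon> m t = 0")
    case True
    then show ?thesis using dl_pos[of m] C by (simp add: field_zero)
  next
    case False
    then have win: "\<bar>t - tm m\<bar> < dl m" and r: "rho \<epsilon> m t > 0" using rho_nonneg[OF e(1), of m t] by auto
    have R: "R > 0" using r by (simp add: R_def rad_def)
    note sb = swirl_bounds[OF R cth_eq[OF r, folded R_def]]
    note a = ca_le[where b=b, OF b e(1) r, folded R_def]
    note a' = ca'_le[where b=b, OF b e r win, folded R_def]
    have pR: "R powr (- 2 * \<gamma>) * R = R powr (1 - 2 * \<gamma>)" "R powr (- 2 * \<gamma>) / R = R powr (- 1 - 2 * \<gamma>)"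
      using R by (simp_all add: powr_diff powr_minus powr_add field_simps)
    have "norm (w b \<epsilon> m t x) \<le> (dl m * R powr (- 2 * \<gamma>)) * R"
      unfolding w_def using a R by (intro order_trans[OF sb(1)] mult_right_mono) auto
    then have 1: "norm (w b \<epsilon> m t x) \<le> dl m * R powr (1 - 2 * \<gamma>)" by (simp only: mult.assoc pR)
    have "norm (wd b \<epsilon> m t x h) \<le> 3 * flat_const * (dl m * R powr (- 2 * \<gamma>)) * norm h"
      unfolding wd_def using a C by (intro order_trans[OF sb(2)] mult_right_mono mult_left_mono) auto
    then have 2: "norm (wd b \<epsilon> m t x h) \<le> 3 * flat_const * dl m * R powr (- 2 * \<gamma>) * norm h" by (simp only: mult.assoc)
    have "norm (wl b \<epsilon> m t x) \<le> 14 * flat_const * (dl m * R powr (- 2 * \<gamma>)) / R"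
      unfolding wl_def using a C R by (intro order_trans[OF sb(3)] divide_right_mono mult_left_mono) auto
    then have 3: "norm (wl b \<epsilon> m t x) \<le> 14 * flat_const * dl m * R powr (- 1 - 2 * \<gamma>)"
      by (simp only: mult.assoc times_divide_eq_right[symmetric] pR)
    have th': "\<bar>cth' \<epsilon> m t\<bar> * R\<^sup>2 \<le> 1 / R\<^sup>2"
    proof -
      have "rho \<epsilon> m t powr (- 3 / 2) = R powr (- 6)" by (simp add: R_def rad_def powr_powr)
      also have "\<dots> = 1 / R ^ 6" using R by (simp add: powr_minus_divide flip: powr_numeral)
      finally have "\<bar>cth' \<epsilon> m t\<bar> * R\<^sup>2 = \<bar>t - tm m\<bar> * (1 / R ^ 6) * R\<^sup>2" using R by (simp add: cth'_def abs_mult)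
      also have "\<dots> \<le> R\<^sup>2 * (1 / R ^ 6) * R\<^sup>2" using rad_le(3)[OF e win, folded R_def] R by (intro mult_right_mono) auto
      also have "\<dots> = 1 / R\<^sup>2" using R by (simp add: field_simps flip: power_add)
      finally show ?thesis .
    qed
    have "norm (wt b \<epsilon> m t x) \<le> (\<bar>ca' b \<epsilon> m t\<bar> + flat_const * \<bar>ca b \<epsilon> m t\<bar> * \<bar>cth' \<epsilon> m t\<bar> * R\<^sup>2) * R"
      unfolding wt_def by (rule sb(4))
    also have "\<dots> \<le> (dl m * (5 * flat_const * R powr (- 2 * \<gamma>) / R\<^sup>2) + flat_const * (dl m * R powr (- 2 * \<gamma>)) * (1 / R\<^sup>2)) * R"
      using a a' th' C R dl_pos[of m] unfolding mult.assoc[of _ "\<bar>cth' \<epsilon> m t\<bar>"]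
      by (intro mult_right_mono add_mono mult_mono) auto
    also have "\<dots> = 6 * flat_const * dl m * (R powr (- 2 * \<gamma>) / R)"
      using R by (simp add: field_simps power2_eq_square)
    finally have 4: "norm (wt b \<epsilon> m t x) \<le> 6 * flat_const * dl m * R powr (- 1 - 2 * \<gamma>)" by (simp only: pR)
    show ?thesis using 1 2 3 4 by blast
  qed
  then show "norm (w b \<epsilon> m t x) \<le> dl m * rad \<epsilon> m t powr (1 - 2 * \<gamma>)"
    "norm (wd b \<epsilon> m t x h) \<le> 3 * flat_const * dl m * rad \<epsilon> m t powr (- 2 * \<gamma>) * norm h"
    "norm (wl b \<epsilon> m t x) \<le> 14 * flat_const * dl m * rad \<epsilon> m t powr (- 1 - 2 * \<gamma>)"
    "norm (wt b \<epsilon> m t x) \<le> 6 * flat_const * dl m * rad \<epsilon> m t powr (- 1 - 2 * \<gamma>)"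
    by (auto simp: R_def)
qed

lemma field_support:
  assumes e: "0 \<le> \<epsilon>" and x: "norm (x - xm m) \<ge> rad \<epsilon> m t"
  shows "w b \<epsilon> m t x = 0" "wd b \<epsilon> m t x h = 0" "wl b \<epsilon> m t x = 0" "wt b \<epsilon> m t x = 0"
proof -
  have "w b \<epsilon> m t x = 0 \<and> wd b \<epsilon> m t x h = 0 \<and> wl b \<epsilon> m t x = 0 \<and> wt b \<epsilon> m t x = 0"
  proof (cases "rho \<epsilon> m t = 0")
    case True then show ?thesis by (simp add: field_zero)
  next
    case False
    then have r: "rho \<epsilon> m t > 0" using rho_nonneg[OF e, of m t] by simp
    then have R: "rad \<epsilon> m t > 0" by (simp add: rad_def)
    have "(rad \<epsilon> m t)\<^sup>2 \<le> (norm (x - xm m))\<^sup>2" using x R by (intro power_mono) auto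
    then have "cth \<epsilon> m t * ((x - xm m) \<bullet> (x - xm m)) \<ge> 1"
      using R by (simp add: cth_eq[OF r] power2_norm_eq_inner)
    then show ?thesis by (simp add: w_def wd_def wl_def wt_def swirl_outside)
  qed
  then show "w b \<epsilon> m t x = 0" "wd b \<epsilon> m t x h = 0" "wl b \<epsilon> m t x = 0" "wt b \<epsilon> m t x = 0" by auto
qed

definition local_field :: "(nat \<Rightarrow> real \<Rightarrow> real^3 \<Rightarrow> 'b::zero) \<Rightarrow> bool" where
  "local_field F \<longleftrightarrow> (\<forall>m t x. F m t x \<noteq> 0 \<longrightarrow> \<bar>t - tm m\<bar> < dl m \<and> norm (x - xm m) < 1)"

lemma local_fields:
  assumes "0 \<le> \<epsilon>" "\<epsilon> \<le> 1"
  shows "local_field (w b \<epsilon>)" "local_field (\<lambda>m t x. wd b \<epsilon> m t x h)" "local_field (wl b \<epsilon>)" "local_field (wt b \<epsilon>)"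
proof -
  have "norm (x - xm m) < 1" if "\<bar>t - tm m\<bar> < dl m" "\<not> rad \<epsilon> m t \<le> norm (x - xm m)" for x m t
    using rad_le(2)[OF assms that(1)] that(2) by linarith
  then show "local_field (w b \<epsilon>)" "local_field (\<lambda>m t x. wd b \<epsilon> m t x h)" "local_field (wl b \<epsilon>)" "local_field (wt b \<epsilon>)"
    unfolding local_field_def using field_zero field_support[OF assms(1)] by metis+
qed

section \<open>Separation of the vortices in space\<close>

lemma norm_xm_diff: "norm (xm m - xm n) = 4 * \<bar>real m - real n\<bar>"
proof -
  have *: "xm m - xm n = (4 * (real m - real n)) *\<^sub>R axis 1 1" by (simp add: xm_def algebra_simps)
  show ?thesis unfolding * norm_scaleR norm_axis_1 abs_mult by simp
qed

definition cell :: "real^3 \<Rightarrow> nat" where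
  "cell x = (if \<exists>m. norm (x - xm m) < 3 / 2 then SOME m. norm (x - xm m) < 3 / 2 else 0)"

text \<open>As t tends to T the index \<open>idx t\<close> changes infinitely often, so it is of no
  use for regularity near time T. Near a fixed \<open>x\<close> it may be replaced by an index
  depending on \<open>x\<close> alone: 3/2 exceeds 1 + 1/4 and the centres are 4 apart, so all other
  vortices miss the ball of radius 1/4. Local statements are thereby reduced to one vortex.\<close>

lemma cell:
  assumes "local_field F" "y \<in> ball x (1 / 4)"
  shows "F (idx t) t y = F (cell x) t y"
proof (cases "\<exists>m. norm (x - xm m) < 3 / 2")
  case True
  define m where "m = cell x"
  have m: "norm (x - xm m) < 3 / 2"
    using someI_ex[OF True] True by (simp add: cell_def m_def)
  show ?thesis
  proof (cases "idx t = m")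
    case False
    have "norm (xm (idx t) - xm m) \<ge> 4"
    proof -
      have "\<bar>real (idx t) - real m\<bar> \<ge> 1" using False by linarith
      then show ?thesis by (simp add: norm_xm_diff)
    qed
    moreover have "norm (xm (idx t) - xm m) \<le> norm (xm (idx t) - y) + norm (y - x) + norm (x - xm m)"
      by norm
    moreover have "norm (y - x) < 1 / 4" using assms(2) by (simp add: dist_norm norm_minus_commute)
    ultimately have "norm (y - xm (idx t)) > 1" using m by (simp add: norm_minus_commute)
    then have "F (idx t) t y = 0" using assms(1) by (force simp: local_field_def)
    moreover have "F m t y = 0" using assms(1) idx_eq False by (force simp: local_field_def)
    ultimately show ?thesis by (simp add: m_def)
  qed (simp add: m_def)
next
  case False
  have "F m t y = 0" for m
  proof -
    have "norm (x - xm m) \<ge> 3 / 2" using False by (simp add: not_less)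
    moreover have "norm (y - x) < 1 / 4" using assms(2) by (simp add: dist_norm norm_minus_commute)
    moreover have "norm (x - xm m) \<le> norm (y - xm m) + norm (y - x)" by norm
    ultimately have "norm (y - xm m) > 1" by linarith
    then show ?thesis using assms(1) by (force simp: local_field_def)
  qed
  then show ?thesis by simp
qed

lemma local_field_early:
  assumes "local_field F" "t \<le> T / 4"
  shows "F m t x = 0"
proof -
  have "\<not> \<bar>t - tm m\<bar> < dl m" using tm_bounds(1)[of m] dl_le(4)[of m] assms(2) T by linarith
  then show ?thesis using assms(1) by (auto simp: local_field_def)
qed

section \<open>Regularity in time and in space-time\<close>

lemma rho_derivative: "(rho \<epsilon> m has_real_derivative 2 * (t - tm m)) (at t)"
  unfolding rho_def[abs_def] by (auto intro!: derivative_eq_intros)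

lemma ca_derivative:
  assumes r: "rho \<epsilon> m t > 0"
  shows "(ca b \<epsilon> m has_real_derivative ca' b \<epsilon> m t) (at t)"
proof -
  have 1: "((\<lambda>t. 1 - ((t - tm m) / dl m)\<^sup>2) has_real_derivative (- 2 * (t - tm m) / (dl m)\<^sup>2)) (at t)"
    using dl_pos[of m] by (auto intro!: derivative_eq_intros simp: power2_eq_square field_simps)
  have 2: "((\<lambda>t. rho \<epsilon> m t powr (- \<gamma> / 2)) has_real_derivative (- \<gamma> * (t - tm m)) * rho \<epsilon> m t powr (- \<gamma> / 2 - 1)) (at t)"
    by (rule DERIV_cong[OF DERIV_chain2[OF has_real_derivative_powr[OF r] rho_derivative]]) simp
  have "(ca b \<epsilon> m has_real_derivative b m * (flat (flat_deriv 1) (1 - ((t - tm m) / dl m)\<^sup>2) * (- 2 * (t - tm m) / (dl m)\<^sup>2)) * rho \<epsilon> m t powr (- \<gamma> / 2)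
    + (- \<gamma> * (t - tm m)) * rho \<epsilon> m t powr (- \<gamma> / 2 - 1) * (b m * flat 1 (1 - ((t - tm m) / dl m)\<^sup>2))) (at t)"
    unfolding ca_def[abs_def] by (intro DERIV_mult DERIV_cmult DERIV_chain2[OF DERIV_flat 1] 2)
  then show ?thesis by (rule DERIV_cong) (simp add: ca'_def algebra_simps)
qed

lemma cth_derivative:
  assumes r: "rho \<epsilon> m t > 0"
  shows "(cth \<epsilon> m has_real_derivative cth' \<epsilon> m t) (at t)"
proof -
  have "((\<lambda>t. rho \<epsilon> m t powr (- 1 / 2)) has_real_derivative (- 1 / 2 * rho \<epsilon> m t powr (- 1 / 2 - 1)) * (2 * (t - tm m))) (at t)"
    by (rule DERIV_chain2[OF has_real_derivative_powr[OF r] rho_derivative])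
  moreover have "- 1 / 2 - 1 = (- 3 / 2 :: real)" by simp
  ultimately show ?thesis unfolding cth_def[abs_def] cth'_def by (simp only:) (erule DERIV_cong, simp add: field_simps)
qed

lemma continuous_rho: "continuous_on A (rho \<epsilon> m)"
  unfolding rho_def by (intro continuous_intros)

text \<open>Differentiability includes the singular time. Off the centre the vortex has shrunk past
  \<open>x\<close> before that time, so the field is 0 for all nearby times; at the centre it is 0
  throughout.\<close>

lemma w_time_derivative:
  assumes e: "0 \<le> \<epsilon>" "\<epsilon> \<le> 1"
  shows "((\<lambda>t. w b \<epsilon> m t x) has_vector_derivative wt b \<epsilon> m t x) (at t)"
proof (cases "rho \<epsilon> m t > 0")
  case True
  then show ?thesis unfolding w_def wt_def
    by (intro has_vector_derivative_swirl ca_derivative cth_derivative)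
next
  case False
  then have r: "rho \<epsilon> m t = 0" using rho_nonneg[OF e(1), of m t] by simp
  have 0: "wt b \<epsilon> m t x = 0" using r by (simp add: field_zero)
  show ?thesis
  proof (cases "x = xm m")
    case True then show ?thesis by (simp add: w_def wt_def swirl_origin)
  next
    case False
    have "open {s. rho \<epsilon> m s < norm (x - xm m) ^ 4}"
      by (intro open_Collect_less continuous_rho continuous_on_const)
    moreover have "w b \<epsilon> m s x = 0" if "rho \<epsilon> m s < norm (x - xm m) ^ 4" for s
    proof (rule field_support(1)[OF e(1)])
      have "rad \<epsilon> m s ^ 4 \<le> norm (x - xm m) ^ 4" using that rho_eq_rad[OF e(1)] by simp
      then show "rad \<epsilon> m s \<le> norm (x - xm m)" by (simp add: power_mono_iff rad_nonneg)
    qed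
    moreover have "((\<lambda>t. 0) has_vector_derivative 0) (at t)" by simp
    ultimately show ?thesis unfolding 0
      using has_vector_derivative_transform_within_open[of "\<lambda>t. 0" 0 t "{s. rho \<epsilon> m s < norm (x - xm m) ^ 4}" "\<lambda>t. w b \<epsilon> m t x"]
        r False by simp
  qed
qed

lemma V_time_derivative:
  assumes e: "0 \<le> \<epsilon>" "\<epsilon> \<le> 1"
  shows "((\<lambda>t. V b \<epsilon> t x) has_vector_derivative Vt b \<epsilon> t x) (at t)"
proof -
  have x: "x \<in> ball x (1 / 4)" by simp
  show ?thesis unfolding V_def Vt_def
    using w_time_derivative[OF e] cell[OF local_fields(1)[OF e] x] cell[OF local_fields(4)[OF e] x] by simp
qed

lemma Ck_on_rho_powr:
  "Ck_on k {z :: real \<times> (real^3). rho \<epsilon> m (fst z) > 0} (\<lambda>z. rho \<epsilon> m (fst z) powr e)"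
proof (rule Ck_on_compose[where f="\<lambda>x. x powr e" and B="{0<..}"])
  show "Ck_on k {z :: real \<times> (real^3). rho \<epsilon> m (fst z) > 0} (\<lambda>z. rho \<epsilon> m (fst z))"
    unfolding rho_def
    by (intro Ck_on_add Ck_on_power Ck_on_diff Ck_on_const Ck_on_linear bounded_linear_fst)
qed (auto intro: Ck_on_powr)

lemma Ck_on_w_regular:
  "Ck_on k {z :: real \<times> (real^3). rho \<epsilon> m (fst z) > 0} (\<lambda>z. w b \<epsilon> m (fst z) (snd z))"
proof -
  have d: "Ck_on k {z :: real \<times> (real^3). rho \<epsilon> m (fst z) > 0} (\<lambda>z. fst z - tm m)"
    by (intro Ck_on_diff Ck_on_const Ck_on_linear bounded_linear_fst)
  have "(\<lambda>z. w b \<epsilon> m (fst z) (snd z)) = (\<lambda>z :: real \<times> (real^3). swirl (b m * flat 1 (1 - ((fst z - tm m) * (1 / dl m))\<^sup>2) *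
      rho \<epsilon> m (fst z) powr (- \<gamma> / 2)) (rho \<epsilon> m (fst z) powr (- 1 / 2)) (snd z - xm m))"
    by (simp add: w_def ca_def cth_def)
  moreover have "Ck_on k {z :: real \<times> (real^3). rho \<epsilon> m (fst z) > 0} \<dots>"
    by (rule Ck_on_swirl(1)[where a'="\<lambda>_. 0" and \<theta>'="\<lambda>_. 0"];
      intro Ck_on_mult Ck_on_const Ck_on_flat_comp Ck_on_diff Ck_on_power d Ck_on_rho_powr Ck_on_linear bounded_linear_snd)
  ultimately show ?thesis by simp
qed

lemma open_rho: "open {z :: real \<times> (real^3). rho \<epsilon> m (fst z) > 0}"
  by (intro open_Collect_less continuous_on_const continuous_on_compose2[OF continuous_rho[of UNIV]] continuous_intros) auto

lemma Ck_on_w_pos: "0 < \<epsilon> \<Longrightarrow> Ck_on k A (\<lambda>z. w b \<epsilon> m (fst z) (snd z))"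
proof -
  assume "0 < \<epsilon>"
  then have "rho \<epsilon> m t > 0" for t
    using dl_pos[of m] by (auto simp: rho_def intro!: add_nonneg_pos)
  then show ?thesis using Ck_on_w_regular[of k \<epsilon> m b] by (auto intro: Ck_on_subset)
qed

text \<open>Two open sets cover everything but the singular point. Where \<open>rho\<close> is
  positive the coefficients are smooth; where it is below |x - xm m|^4 the point lies outside the
  shrinking vortex and the field is 0.\<close>

lemma Ck_on_w_0: "Ck_on k (- {(tm m, xm m)}) (\<lambda>z. w b 0 m (fst z) (snd z))"
proof -
  let ?A = "{z :: real \<times> (real^3). rho 0 m (fst z) > 0}"
  let ?B = "{z :: real \<times> (real^3). rho 0 m (fst z) < norm (snd z - xm m) ^ 4}"
  have oB: "open ?B"
    by (intro open_Collect_less continuous_on_compose2[OF continuous_rho[of UNIV]] continuous_intros) auto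
  have "Ck_on k ?B (\<lambda>z. w b 0 m (fst z) (snd z))"
  proof (rule Ck_on_cong[OF Ck_on_const[of k ?B 0]])
    fix z assume "z \<in> ?B"
    then have "rad 0 m (fst z) ^ 4 \<le> norm (snd z - xm m) ^ 4" using rho_eq_rad[of 0] by simp
    then have "rad 0 m (fst z) \<le> norm (snd z - xm m)" by (simp add: power_mono_iff rad_nonneg)
    then show "0 = w b 0 m (fst z) (snd z)" by (simp add: field_support)
  qed
  from Ck_on_Un_open[OF open_rho oB Ck_on_w_regular this]
  have "Ck_on k (?A \<union> ?B) (\<lambda>z. w b 0 m (fst z) (snd z))" .
  moreover have "- {(tm m, xm m)} \<subseteq> ?A \<union> ?B"
    by (auto simp: rho_def)
  ultimately show ?thesis by (rule Ck_on_subset)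
qed

text \<open>The neighbourhoods are cylinders over small balls, containing all times at once, since
  \<open>cell\<close> fixes the index by position only.\<close>

lemma Ck_on_V_local:
  assumes e: "0 \<le> \<epsilon>" "\<epsilon> \<le> 1" and A: "open A"
    and s: "\<And>m. Ck_on k A (\<lambda>z. w b \<epsilon> m (fst z) (snd z))"
  shows "Ck_on k A (\<lambda>z. V b \<epsilon> (fst z) (snd z))"
proof (rule Ck_on_local[OF A])
  fix z assume "z \<in> A"
  let ?U = "UNIV \<times> ball (snd z) (1 / 4)"
  have "Ck_on k (A \<inter> ?U) (\<lambda>z'. V b \<epsilon> (fst z') (snd z'))"
    by (rule Ck_on_cong[OF Ck_on_subset[OF s[of "cell (snd z)"]]])
      (auto simp: V_def cell[OF local_fields(1)[OF e]])
  then show "\<exists>U. open U \<and> z \<in> U \<and> Ck_on k (A \<inter> U) (\<lambda>z. V b \<epsilon> (fst z) (snd z))"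
    by (intro exI[of _ ?U]) (auto simp: open_Times mem_Times_iff)
qed

text \<open>The singular times accumulate at T, but the centres are 4 apart, so the singular points
  form a discrete closed set of space-time.\<close>

lemma open_regular_set: "open (- (\<Union>m. {(tm m, xm m)}))"
proof -
  have "closed (range (\<lambda>m. (tm m, xm m)))"
  proof (rule discrete_imp_closed[of 1])
    show "\<forall>p\<in>range (\<lambda>m. (tm m, xm m)). \<forall>q\<in>range (\<lambda>m. (tm m, xm m)). dist q p < 1 \<longrightarrow> q = p"
    proof clarify
      fix m n :: nat assume *: "dist (tm n, xm n) (tm m, xm m) < 1"
      have "dist (xm n) (xm m) \<le> dist (tm n, xm n) (tm m, xm m)" using dist_snd_le[of "(tm n, xm n)" "(tm m, xm m)"] by simp
      then have "4 * \<bar>real n - real m\<bar> < 1" using * by (simp add: dist_norm norm_xm_diff)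
      have "n = m"
      proof (rule ccontr)
        assume "n \<noteq> m"
        then have "1 \<le> \<bar>real n - real m\<bar>" by linarith
        then have "4 * 1 \<le> 4 * \<bar>real n - real m\<bar>" by (rule mult_left_mono) simp
        with \<open>4 * \<bar>real n - real m\<bar> < 1\<close> show False by simp
      qed
      then show "tm n = tm m \<and> xm n = xm m" by simp
    qed
  qed simp
  moreover have "(\<Union>m. {(tm m, xm m)}) = range (\<lambda>m. (tm m, xm m))" by auto
  ultimately show ?thesis by (simp add: open_Compl)
qed

end

section \<open>Square integrable fields and weak Jacobians\<close>

lemma powr_2_norm: "norm x powr 2 = (norm x)\<^sup>2"
  by (cases "norm x = 0") (auto simp: powr_numeral)

lemma Lp_norm_2_sq: "(Lp_norm 2 f)\<^sup>2 = (LINT x|lebesgue. (norm (f x))\<^sup>2)"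
proof -
  have nn: "0 \<le> (LINT x|lebesgue. (norm (f x))\<^sup>2)" by (intro Bochner_Integration.integral_nonneg) simp
  have "Lp_norm 2 f = sqrt (LINT x|lebesgue. (norm (f x))\<^sup>2)"
    using nn by (simp add: Lp_norm_def powr_2_norm powr_half_sqrt)
  then show ?thesis using nn by simp
qed

lemma Lp_norm_nonneg: "0 \<le> Lp_norm p f"
  by (simp add: Lp_norm_def)

lemma Lp_space_2: "f \<in> Lp_space 2 M \<longleftrightarrow> f \<in> borel_measurable M \<and> integrable M (\<lambda>x. (norm (f x))\<^sup>2)"
  by (simp add: Lp_space_def powr_2_norm)

lemma Lp_space_ereal_2: "f \<in> Lp_space (ereal 2) M \<longleftrightarrow> f \<in> borel_measurable M \<and> integrable M (\<lambda>x. (norm (f x))\<^sup>2)"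
  by (simp add: Lp_space_def powr_2_norm)

lemma Lp_norm_cong:
  assumes "AE x in lebesgue. f x = g x" "f \<in> borel_measurable lebesgue"
  shows "Lp_norm p f = Lp_norm p g"
proof -
  have g: "g \<in> borel_measurable lebesgue"
    by (rule measurable_AE_lebesgue[of _ UNIV, unfolded lebesgue_on_UNIV_eq, OF assms(2) _ assms(1)]) simp
  have "(LINT x|lebesgue. norm (f x) powr p) = (LINT x|lebesgue. norm (g x) powr p)"
    by (rule integral_cong_AE) (use assms g in \<open>auto elim!: eventually_mono\<close>)
  then show ?thesis by (simp add: Lp_norm_def)
qed

lemma L2_imp_L1_loc:
  fixes f :: "'a::euclidean_space \<Rightarrow> 'b::euclidean_space"
  assumes "f \<in> Lp_space 2 lebesgue"
  shows "f \<in> L1_loc UNIV"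
proof -
  have m: "f \<in> borel_measurable lebesgue" and i: "integrable lebesgue (\<lambda>x. (norm (f x))\<^sup>2)"
    using assms by (auto simp: Lp_space_ereal_2)
  have "integrable lebesgue (\<lambda>x. indicator K x *\<^sub>R f x)" if K: "compact K" for K
  proof (rule Bochner_Integration.integrable_bound)
    have Ks: "K \<in> sets lebesgue" using K by (simp add: compact_imp_closed)
    have Kb: "K \<in> sets borel" using K by (simp add: compact_imp_closed)
    have "integrable lborel (indicator K :: 'a \<Rightarrow> real)"
      using Kb by (intro integrable_real_indicator emeasure_bounded_finite compact_imp_bounded K) simp
    then have "integrable lebesgue (indicator K :: 'a \<Rightarrow> real)"
      using Kb by (subst integrable_completion) auto
    then show "integrable lebesgue (\<lambda>x. indicator K x + (norm (f x))\<^sup>2)" using i by simp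
    show "(\<lambda>x. indicator K x *\<^sub>R f x) \<in> borel_measurable lebesgue"
      using Ks m by (intro borel_measurable_scaleR borel_measurable_indicator)
    show "AE x in lebesgue. norm (indicator K x *\<^sub>R f x) \<le> norm (indicator K x + (norm (f x))\<^sup>2)"
    proof (rule AE_I2)
      fix x
      have "0 \<le> (norm (f x) - 1)\<^sup>2" "0 \<le> (norm (f x))\<^sup>2" by auto
      then have "2 * norm (f x) \<le> 1 + (norm (f x))\<^sup>2" by (simp add: power2_diff)
      then have "norm (f x) \<le> 1 + (norm (f x))\<^sup>2" using norm_ge_zero[of "f x"] by linarith
      then show "norm (indicator K x *\<^sub>R f x) \<le> norm (indicator K x + (norm (f x))\<^sup>2)"
        by (auto simp: indicator_def abs_of_nonneg[OF add_nonneg_nonneg])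
    qed
  qed
  then show ?thesis by (auto simp: L1_loc_def set_integrable_def)
qed

lemma norm_mat_columns: "(norm (A :: real^3^3))\<^sup>2 = (\<Sum>j\<in>UNIV. (norm (column j A))\<^sup>2)"
  by (simp add: norm_eq_sqrt_inner inner_vec_def column_def sum_nonneg sum_3 algebra_simps)

lemma inner_mat_columns: "(A :: real^3^3) \<bullet> B = (\<Sum>j\<in>UNIV. column j A \<bullet> column j B)"
  by (simp add: inner_vec_def column_def sum_3 algebra_simps)

lemma matrix_vector_columns: "(A :: real^3^3) *v x = (\<Sum>j\<in>UNIV. (x $ j) *\<^sub>R column j A)"
  by (simp add: vec_eq_iff matrix_vector_mult_def column_def sum_3 mult.commute)

lemma norm_matrix_vector_le: "norm ((A :: real^3^3) *v x) \<le> norm A * norm x"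
proof -
  have "norm (A *v x) \<le> onorm ((*v) A) * norm x"
    by (rule onorm) (simp add: linear_conv_bounded_linear[symmetric] matrix_vector_mul_linear)
  moreover have "norm (A *v x) \<le> norm A * norm x"
  proof -
    have "(norm (A *v x))\<^sup>2 = (\<Sum>i\<in>UNIV. (row i A \<bullet> x)\<^sup>2)"
      by (simp add: norm_eq_sqrt_inner inner_vec_def matrix_vector_mult_def row_def sum_nonneg power2_eq_square)
    also have "\<dots> \<le> (\<Sum>i\<in>UNIV. (norm (row i A))\<^sup>2 * (norm x)\<^sup>2)"
      by (intro sum_mono) (simp add: power2_norm_eq_inner Cauchy_Schwarz_ineq)
    also have "\<dots> = (norm A * norm x)\<^sup>2"
      by (simp add: power_mult_distrib norm_eq_sqrt_inner inner_vec_def row_def sum_nonneg sum_distrib_right)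
    finally show ?thesis by (rule power2_le_imp_le) simp
  qed
  ultimately show ?thesis by simp
qed

lemma measurable_columns:
  fixes G :: "'a \<Rightarrow> real^3^3"
  assumes "\<And>j. (\<lambda>x. column j (G x)) \<in> borel_measurable M"
  shows "G \<in> borel_measurable M"
proof -
  have "(\<lambda>x. column j (G x) $ i) \<in> borel_measurable M" for i j
    by (rule measurable_compose[OF assms borel_measurable_continuous_onI]) (intro continuous_intros)
  then have ij: "(\<lambda>x. G x $ i $ j) \<in> borel_measurable M" for i j by (simp add: column_def)
  have "G x = (\<Sum>i\<in>UNIV. \<Sum>j\<in>UNIV. (G x $ i $ j) *\<^sub>R axis i (axis j 1))" for x
    by (simp add: vec_eq_iff axis_def if_distrib[of "\<lambda>x. x $ _"] sum_3 forall_3)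
  then have "G = (\<lambda>x. \<Sum>i\<in>UNIV. \<Sum>j\<in>UNIV. (G x $ i $ j) *\<^sub>R axis i (axis j 1))" by auto
  moreover have "\<dots> \<in> borel_measurable M"
    by (intro borel_measurable_sum borel_measurable_scaleR ij borel_measurable_const)
  ultimately show ?thesis by simp
qed

text \<open>\<open>weak_jacobian\<close> is an arbitrary choice among weak Jacobians; uniqueness of
  weak derivatives, column by column, ties it to any explicit one.\<close>

lemma weak_jacobian_AE:
  assumes "is_weak_jacobian u G"
  shows "AE x in lebesgue. weak_jacobian u x = G x"
proof -
  have "is_weak_jacobian u (weak_jacobian u)" unfolding weak_jacobian_def by (rule someI[of "is_weak_jacobian u", OF assms])
  then have "AE x in lebesgue. column j (weak_jacobian u x) = column j (G x)" for j
    using assms by (auto simp: is_weak_jacobian_def intro: weak_pderiv_unique)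
  then have "AE x in lebesgue. \<forall>j\<in>UNIV. column j (weak_jacobian u x) = column j (G x)"
    by (intro AE_finite_allI) auto
  then show ?thesis by eventually_elim (simp add: column_def vec_eq_iff)
qed

lemma is_weak_jacobian_weak_jacobian:
  assumes "is_weak_jacobian u G"
  shows "is_weak_jacobian u (weak_jacobian u)"
  unfolding weak_jacobian_def by (rule someI[of "is_weak_jacobian u", OF assms])

text \<open>The partial derivatives supplied separately by \<open>Sobolev\<close> are glued to one
  matrix field. It witnesses that the choice in \<open>weak_jacobian\<close> succeeds and passes its
  square integrability on to the chosen one.\<close>

lemma H1_weak_jacobian:
  assumes "u \<in> H1"
  shows "u \<in> Lp_space 2 lebesgue" "is_weak_jacobian u (weak_jacobian u)" "weak_jacobian u \<in> Lp_space 2 lebesgue"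
proof -
  show "u \<in> Lp_space 2 lebesgue" using assms by (simp add: H1_def One_nat_def)
  have "\<forall>j. \<exists>g \<in> Lp_space 2 lebesgue. weak_pderiv (axis j 1) u g"
    using assms axis_in_Basis by (auto simp: H1_def One_nat_def)
  then obtain g where g: "\<And>j. g j \<in> Lp_space 2 lebesgue" "\<And>j. weak_pderiv (axis j 1) u (g j)" by metis
  define G where "G = (\<lambda>x. \<chi> i j. g j x $ i)"
  have col: "column j (G x) = g j x" for j x by (simp add: G_def column_def vec_eq_iff)
  have G: "is_weak_jacobian u G" using g(2) by (simp add: is_weak_jacobian_def col)
  then show J: "is_weak_jacobian u (weak_jacobian u)" by (rule is_weak_jacobian_weak_jacobian)
  have gm: "g j \<in> borel_measurable lebesgue" for j using g(1) by (simp add: Lp_space_ereal_2)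
  have Gm: "G \<in> borel_measurable lebesgue" by (rule measurable_columns) (simp add: col gm)
  have Gi: "integrable lebesgue (\<lambda>x. (norm (G x))\<^sup>2)"
    unfolding norm_mat_columns col using g(1) by (simp add: Lp_space_ereal_2)
  have ae: "AE x in lebesgue. G x = weak_jacobian u x" using weak_jacobian_AE[OF G] by eventually_elim simp
  have m: "weak_jacobian u \<in> borel_measurable lebesgue"
    by (rule measurable_AE_lebesgue[of _ UNIV, unfolded lebesgue_on_UNIV_eq, OF Gm _ ae]) simp
  have "integrable lebesgue (\<lambda>x. (norm (weak_jacobian u x))\<^sup>2)"
    by (rule integrable_cong_AE_imp[OF Gi]) (use m ae in \<open>auto elim!: eventually_mono\<close>)
  then show "weak_jacobian u \<in> Lp_space 2 lebesgue" using m by (simp add: Lp_space_ereal_2)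
qed

lemma H1_norm_sq: "(H1_norm u)\<^sup>2 = (LINT x|lebesgue. (norm (u x))\<^sup>2) + (LINT x|lebesgue. (norm (weak_jacobian u x))\<^sup>2)"
  by (simp add: H1_norm_def Lp_norm_2_sq)

lemma weak_pderiv_scalar:
  fixes u :: "'a::euclidean_space \<Rightarrow> real^'n"
  assumes "weak_pderiv b u g" and b: "b \<in> Basis" and \<phi>: "\<phi> \<in> Cc_infty UNIV"
  shows "(LINT x|lebesgue. frechet_derivative \<phi> (at x) b * u x $ i) = - (LINT x|lebesgue. \<phi> x * g x $ i)"
    and "integrable lebesgue (\<lambda>x. frechet_derivative \<phi> (at x) b * u x $ i)"
    and "integrable lebesgue (\<lambda>x. \<phi> x * g x $ i)"
proof -
  have L: "u \<in> L1_loc UNIV" "g \<in> L1_loc UNIV" using assms by (auto simp: weak_pderiv_def)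
  obtain K where K: "compact K" "\<And>x. x \<notin> K \<Longrightarrow> \<phi> x = 0 \<and> frechet_derivative \<phi> (at x) = (\<lambda>h. 0)"
    using Cc_inftyD(5)[OF \<phi>] by blast
  have i2: "integrable lebesgue (\<lambda>x. \<phi> x *\<^sub>R g x)"
    by (rule integrable_continuous_mult_L1_loc[OF L(2) Cc_inftyD(2)[OF \<phi>] K(1)]) (use K in auto)
  have nth: "bounded_linear (\<lambda>v :: real^'n. v $ i)" by (rule bounded_linear_vec_nth)
  show i2': "integrable lebesgue (\<lambda>x. \<phi> x * g x $ i)"
    using integrable_bounded_linear[OF nth i2] by simp
  have i1: "integrable lebesgue (\<lambda>x. frechet_derivative \<phi> (at x) b *\<^sub>R u x)"
    by (rule integrable_continuous_mult_L1_loc[OF L(1) Cc_inftyD(4)[OF \<phi> b] K(1)]) (use K in auto)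
  show "integrable lebesgue (\<lambda>x. frechet_derivative \<phi> (at x) b * u x $ i)"
    using integrable_bounded_linear[OF nth i1] by simp
  have e: "(LINT x|lebesgue. frechet_derivative \<phi> (at x) b *\<^sub>R u x) = - (LINT x|lebesgue. \<phi> x *\<^sub>R g x)"
    using assms by (auto simp: weak_pderiv_def)
  show "(LINT x|lebesgue. frechet_derivative \<phi> (at x) b * u x $ i) = - (LINT x|lebesgue. \<phi> x * g x $ i)"
  proof -
    have "(LINT x|lebesgue. frechet_derivative \<phi> (at x) b * u x $ i) = (LINT x|lebesgue. frechet_derivative \<phi> (at x) b *\<^sub>R u x) $ i"
      using integral_bounded_linear[OF nth i1] by simp
    also have "\<dots> = - (LINT x|lebesgue. \<phi> x * g x $ i)"
      unfolding e using integral_bounded_linear[OF nth i2] by simp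
    finally show ?thesis .
  qed
qed

lemma ball_volume_bound:
  assumes "0 \<le> R"
  shows "measure lborel (cball (\<xi> :: real^3) R) \<le> 6 * R ^ 3"
proof -
  have "measure lborel (cball \<xi> R) = 4 / 3 * pi * R ^ 3"
    using assms by (simp add: content_cball unit_ball_vol_3)
  \<comment> \<open>4 pi / 3 < 16 / 3 < 6.\<close>
  also have "\<dots> \<le> 6 * R ^ 3" using assms pi_less_4 by (intro mult_right_mono) auto
  finally show ?thesis .
qed

lemma integral_ball_bound:
  fixes X :: "real^3 \<Rightarrow> 'b::euclidean_space"
  assumes X: "X \<in> borel_measurable borel" and p: "p \<ge> 1" and R: "0 \<le> R" and c: "0 \<le> c"
    and b: "\<And>x. norm (X x) \<le> c" and s: "\<And>x. R \<le> norm (x - \<xi>) \<Longrightarrow> X x = 0"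
  shows "integrable lebesgue (\<lambda>x. norm (X x) powr p)"
    "(LINT x|lebesgue. norm (X x) powr p) \<le> c powr p * (6 * R ^ 3)"
proof -
  have i: "integrable lborel (\<lambda>x. c powr p * indicator (cball \<xi> R) x)"
    by (intro integrable_mult_right integrable_real_indicator emeasure_bounded_finite bounded_cball) simp
  have le: "norm (X x) powr p \<le> c powr p * indicator (cball \<xi> R) x" for x
  proof (cases "x \<in> cball \<xi> R")
    case True then show ?thesis using b[of x] p by (simp add: powr_mono2)
  next
    case False then have "X x = 0" by (intro s) (simp add: dist_norm norm_minus_commute)
    then show ?thesis by simp
  qed
  have m: "(\<lambda>x. norm (X x) powr p) \<in> borel_measurable borel" using X by measurable
  have j: "integrable lborel (\<lambda>x. norm (X x) powr p)"
    by (rule Bochner_Integration.integrable_bound[OF i]) (use m le in auto)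
  then show "integrable lebesgue (\<lambda>x. norm (X x) powr p)" using m by (simp add: integrable_completion)
  have "(LINT x|lebesgue. norm (X x) powr p) = (LINT x|lborel. norm (X x) powr p)"
    using m by (simp add: integral_completion)
  also have "\<dots> \<le> (LINT x|lborel. c powr p * indicator (cball \<xi> R) x)"
    by (rule integral_mono[OF j i le])
  also have "\<dots> = c powr p * measure lborel (cball \<xi> R)" by simp
  also have "\<dots> \<le> c powr p * (6 * R ^ 3)" by (intro mult_left_mono ball_volume_bound R) auto
  finally show "(LINT x|lebesgue. norm (X x) powr p) \<le> c powr p * (6 * R ^ 3)" .
qed

section \<open>Bounds and regularity of the flow\<close>

lemma measurable_flat [measurable]: "flat p \<in> borel_measurable borel"
  by (intro borel_measurable_continuous_onI) (auto intro: continuous_intros)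

lemma measurable_rot [measurable]: "rot \<in> borel_measurable borel"
  by (intro borel_measurable_continuous_onI linear_continuous_on bounded_linear_rot)

lemma tendsto_flat [tendsto_intros]: "(g \<longlongrightarrow> l) F \<Longrightarrow> ((\<lambda>x. flat p (g x)) \<longlongrightarrow> flat p l) F"
  using isCont_tendsto_compose[OF DERIV_isCont[OF DERIV_flat]] .

context swirl_flow
begin

text \<open>Covers the solution, \<open>adm dl 0\<close>, and all its approximations at once, so
  that every estimate is proved a single time and holds uniformly along the approximation.\<close>

definition adm :: "(nat \<Rightarrow> real) \<Rightarrow> real \<Rightarrow> bool" where
  "adm b \<epsilon> \<longleftrightarrow> (\<forall>m. 0 \<le> b m \<and> b m \<le> dl m) \<and> 0 \<le> \<epsilon> \<and> \<epsilon> \<le> 1"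

definition D2V where
  "D2V b \<epsilon> t x h = swirl_d2 (ca b \<epsilon> (idx t) t) (cth \<epsilon> (idx t) t) (x - xm (idx t)) h"

text \<open>The convective term: the derivative of V in the direction of V.\<close>

definition VV :: "(nat \<Rightarrow> real) \<Rightarrow> real \<Rightarrow> real \<Rightarrow> real^3 \<Rightarrow> real^3" where
  "VV b \<epsilon> t x = DV b \<epsilon> t x (V b \<epsilon> t x)"

definition force :: "(nat \<Rightarrow> real) \<Rightarrow> real \<Rightarrow> real \<Rightarrow> real^3 \<Rightarrow> real^3" where
  "force b \<epsilon> t x = Vt b \<epsilon> t x - LV b \<epsilon> t x + VV b \<epsilon> t x"

lemma V_has_derivative: "(V b \<epsilon> t has_derivative DV b \<epsilon> t x) (at x)"
proof -
  have "V b \<epsilon> t = (\<lambda>x. swirl (ca b \<epsilon> (idx t) t) (cth \<epsilon> (idx t) t) (x - xm (idx t)))"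
    by (simp add: V_def w_def fun_eq_iff)
  moreover have "DV b \<epsilon> t x = swirl_d (ca b \<epsilon> (idx t) t) (cth \<epsilon> (idx t) t) (x - xm (idx t))"
    by (simp add: DV_def wd_def fun_eq_iff)
  ultimately show ?thesis using has_derivative_swirl by metis
qed

lemma DV_has_derivative: "((\<lambda>x. DV b \<epsilon> t x h) has_derivative D2V b \<epsilon> t x h) (at x)"
proof -
  have "D2V b \<epsilon> t x h = swirl_d2 (ca b \<epsilon> (idx t) t) (cth \<epsilon> (idx t) t) (x - xm (idx t)) h"
    by (simp add: D2V_def fun_eq_iff)
  then show ?thesis unfolding DV_def wd_def using has_derivative_swirl_d by metis
qed

lemma LV_eq: "(\<Sum>h\<in>Basis. D2V b \<epsilon> t x h h) = LV b \<epsilon> t x"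
  by (simp add: D2V_def LV_def wl_def swirl_lap_eq)

lemma linear_DV: "linear (DV b \<epsilon> t x)"
  using V_has_derivative by (rule has_derivative_linear)

lemma DV_divergence: "(\<Sum>i\<in>UNIV. DV b \<epsilon> t x (axis i 1) $ i) = 0"
  by (simp add: DV_def wd_def swirl_div)

lemma Ck_on_V_space: "Ck_on k UNIV (V b \<epsilon> t)" "Ck_on k UNIV (\<lambda>x. DV b \<epsilon> t x h)"
  "Ck_on k UNIV (LV b \<epsilon> t)" "Ck_on k UNIV (Vt b \<epsilon> t)"
proof -
  have "V b \<epsilon> t = (\<lambda>x. swirl (ca b \<epsilon> (idx t) t) (cth \<epsilon> (idx t) t) (x - xm (idx t)))"
    "LV b \<epsilon> t = (\<lambda>x. swirl_lap (ca b \<epsilon> (idx t) t) (cth \<epsilon> (idx t) t) (x - xm (idx t)))"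
    "Vt b \<epsilon> t = (\<lambda>x. swirl_t (ca b \<epsilon> (idx t) t) (ca' b \<epsilon> (idx t) t) (cth \<epsilon> (idx t) t) (cth' \<epsilon> (idx t) t) (x - xm (idx t)))"
    by (simp_all add: V_def w_def LV_def wl_def Vt_def wt_def fun_eq_iff)
  then show "Ck_on k UNIV (V b \<epsilon> t)" "Ck_on k UNIV (LV b \<epsilon> t)" "Ck_on k UNIV (Vt b \<epsilon> t)"
    using Ck_on_swirl_space by metis+
  show "Ck_on k UNIV (\<lambda>x. DV b \<epsilon> t x h)"
    unfolding DV_def wd_def by (rule Ck_on_swirl_space)
qed

lemma continuous_D2V: "h' \<in> Basis \<Longrightarrow> continuous_on UNIV (\<lambda>x. D2V b \<epsilon> t x h h')"
proof -
  assume h': "h' \<in> Basis"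
  have "Ck_on (Suc 0) UNIV (\<lambda>x. DV b \<epsilon> t x h)" by (rule Ck_on_V_space)
  then have "continuous_on UNIV (\<lambda>x. frechet_derivative (\<lambda>x. DV b \<epsilon> t x h) (at x) h')"
    using h' unfolding Ck_on_Suc_open[OF open_UNIV] by simp
  moreover have "frechet_derivative (\<lambda>x. DV b \<epsilon> t x h) (at x) = D2V b \<epsilon> t x h" for x
    using frechet_derivative_at[OF DV_has_derivative] by metis
  ultimately show ?thesis by simp
qed

lemmas continuous_V_space = Ck_on_V_space[where k=0, simplified]

lemma atom_measurable:
  "(\<lambda>z. w b \<epsilon> m (fst z) (snd z)) \<in> borel_measurable (borel \<Otimes>\<^sub>M borel)"
  "(\<lambda>z. wd b \<epsilon> m (fst z) (snd z) h) \<in> borel_measurable (borel \<Otimes>\<^sub>M borel)"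
  "(\<lambda>z. wl b \<epsilon> m (fst z) (snd z)) \<in> borel_measurable (borel \<Otimes>\<^sub>M borel)"
  "(\<lambda>z. wt b \<epsilon> m (fst z) (snd z)) \<in> borel_measurable (borel \<Otimes>\<^sub>M borel)"
proof -
  have [measurable]: "rho \<epsilon> m \<in> borel_measurable borel"
    by (rule borel_measurable_continuous_onI[OF continuous_rho])
  have [measurable]: "ca b \<epsilon> m \<in> borel_measurable borel" "ca' b \<epsilon> m \<in> borel_measurable borel"
    "cth \<epsilon> m \<in> borel_measurable borel" "cth' \<epsilon> m \<in> borel_measurable borel"
    unfolding ca_def[abs_def] ca'_def[abs_def] cth_def[abs_def] cth'_def[abs_def] by measurable
  show "(\<lambda>z. w b \<epsilon> m (fst z) (snd z)) \<in> borel_measurable (borel \<Otimes>\<^sub>M borel)"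
    unfolding w_def swirl_def by measurable
  show "(\<lambda>z. wd b \<epsilon> m (fst z) (snd z) h) \<in> borel_measurable (borel \<Otimes>\<^sub>M borel)"
    unfolding wd_def swirl_d_def by measurable
  show "(\<lambda>z. wl b \<epsilon> m (fst z) (snd z)) \<in> borel_measurable (borel \<Otimes>\<^sub>M borel)"
    unfolding wl_def swirl_lap_def by measurable
  show "(\<lambda>z. wt b \<epsilon> m (fst z) (snd z)) \<in> borel_measurable (borel \<Otimes>\<^sub>M borel)"
    unfolding wt_def swirl_t_def by measurable
qed

text \<open>\<open>idx\<close> is a measurable function with countably many values, so selecting a
  member of a family of jointly measurable fields preserves joint measurability.\<close>

lemma measurable_select:
  fixes F :: "nat \<Rightarrow> real \<Rightarrow> real^3 \<Rightarrow> 'b::euclidean_space"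
  assumes "\<And>m. (\<lambda>z. F m (fst z) (snd z)) \<in> borel_measurable (borel \<Otimes>\<^sub>M borel)"
  shows "(\<lambda>(t, x). F (idx t) t x) \<in> borel_measurable (borel \<Otimes>\<^sub>M borel)"
proof -
  have "(\<lambda>z. F (idx (fst z)) (fst z) (snd z)) \<in> borel_measurable (borel \<Otimes>\<^sub>M (borel :: (real^3) measure))"
    by (rule measurable_compose_countable[where f="\<lambda>m z. F m (fst z) (snd z)" and g="\<lambda>z. idx (fst z)"])
      (use assms in measurable)
  then show ?thesis by (simp add: case_prod_beta')
qed

lemma joint_measurable:
  shows "(\<lambda>(t, x). V b \<epsilon> t x) \<in> borel_measurable (borel \<Otimes>\<^sub>M borel)"
    "(\<lambda>(t, x). DV b \<epsilon> t x h) \<in> borel_measurable (borel \<Otimes>\<^sub>M borel)"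
    "(\<lambda>(t, x). LV b \<epsilon> t x) \<in> borel_measurable (borel \<Otimes>\<^sub>M borel)"
    "(\<lambda>(t, x). Vt b \<epsilon> t x) \<in> borel_measurable (borel \<Otimes>\<^sub>M borel)"
  unfolding V_def DV_def LV_def Vt_def by (intro measurable_select atom_measurable)+

lemma DV_expand: "DV b \<epsilon> t x v = (\<Sum>j\<in>UNIV. (v $ j) *\<^sub>R DV b \<epsilon> t x (axis j 1))"
  using linear_sum_Basis[OF linear_DV, of v b \<epsilon> t x] by (simp add: sum_Basis_vec3 inner_axis)

lemma joint_measurable_force:
  "(\<lambda>(t, x). VV b \<epsilon> t x) \<in> borel_measurable (borel \<Otimes>\<^sub>M borel)"
  "(\<lambda>(t, x). force b \<epsilon> t x) \<in> borel_measurable (borel \<Otimes>\<^sub>M borel)"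
proof -
  have m: "(\<lambda>z. V b \<epsilon> (fst z) (snd z)) \<in> borel_measurable (borel \<Otimes>\<^sub>M borel)"
    "(\<lambda>z. DV b \<epsilon> (fst z) (snd z) h) \<in> borel_measurable (borel \<Otimes>\<^sub>M borel)"
    "(\<lambda>z. LV b \<epsilon> (fst z) (snd z)) \<in> borel_measurable (borel \<Otimes>\<^sub>M borel)"
    "(\<lambda>z. Vt b \<epsilon> (fst z) (snd z)) \<in> borel_measurable (borel \<Otimes>\<^sub>M borel)" for h
    using joint_measurable by (simp_all add: case_prod_beta')
  have n: "(\<lambda>z. V b \<epsilon> (fst z) (snd z) $ j) \<in> borel_measurable (borel \<Otimes>\<^sub>M borel)" for j
    by (rule measurable_compose[OF m(1) borel_measurable_continuous_onI]) (intro continuous_intros)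
  have v: "(\<lambda>z. VV b \<epsilon> (fst z) (snd z)) \<in> borel_measurable (borel \<Otimes>\<^sub>M borel)"
    unfolding VV_def by (subst DV_expand) (intro borel_measurable_sum borel_measurable_scaleR n m)
  then show "(\<lambda>(t, x). VV b \<epsilon> t x) \<in> borel_measurable (borel \<Otimes>\<^sub>M borel)" by (simp add: case_prod_beta')
  have "(\<lambda>z. force b \<epsilon> (fst z) (snd z)) \<in> borel_measurable (borel \<Otimes>\<^sub>M borel)"
    unfolding force_def by (intro borel_measurable_add borel_measurable_diff m v)
  then show "(\<lambda>(t, x). force b \<epsilon> t x) \<in> borel_measurable (borel \<Otimes>\<^sub>M borel)" by (simp add: case_prod_beta')
qed

text \<open>The bound of the largest field, the force, used for all fields at a given time: 23 = 6 +
  14 + 3 adds the constants of time derivative, Laplacian and convective term. Since radii are at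
  most 1, the less singular fields satisfy it as well.\<close>

definition slice_bound :: "real \<Rightarrow> real \<Rightarrow> (real^3 \<Rightarrow> real^3) \<Rightarrow> bool" where
  "slice_bound \<epsilon> t X \<longleftrightarrow> X \<in> borel_measurable borel \<and>
    (\<forall>x. norm (X x) \<le> 23 * flat_const * dl (idx t) * rad \<epsilon> (idx t) t powr (- 1 - 2 * \<gamma>)) \<and>
    (\<forall>x. rad \<epsilon> (idx t) t \<le> norm (x - xm (idx t)) \<longrightarrow> X x = 0) \<and>
    (\<not> \<bar>t - tm (idx t)\<bar> < dl (idx t) \<longrightarrow> (\<forall>x. X x = 0))"

lemma rad_idx_le_1: "adm b \<epsilon> \<Longrightarrow> \<bar>t - tm (idx t)\<bar> < dl (idx t) \<Longrightarrow> rad \<epsilon> (idx t) t \<le> 1"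
  by (intro rad_le(2)) (auto simp: adm_def)

lemma V_norm_le:
  assumes "adm b \<epsilon>"
  shows "norm (V b \<epsilon> t x) \<le> dl (idx t)" "norm (V b \<epsilon> t x) \<le> 1"
proof -
  let ?m = "idx t"
  have a: "0 \<le> b ?m" "b ?m \<le> dl ?m" "0 \<le> \<epsilon>" "\<epsilon> \<le> 1" using assms by (auto simp: adm_def)
  show 1: "norm (V b \<epsilon> t x) \<le> dl ?m"
  proof (cases "\<bar>t - tm ?m\<bar> < dl ?m")
    case True
    have "norm (V b \<epsilon> t x) \<le> dl ?m * rad \<epsilon> ?m t powr (1 - 2 * \<gamma>)"
      unfolding V_def by (rule field_bounds(1)) (use a in auto)
    also have "\<dots> \<le> dl ?m * 1"
      using rad_idx_le_1[OF assms True] dl_pos[of ?m] gam rad_nonneg[of \<epsilon> ?m t] by (intro mult_left_mono powr_le1) auto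
    finally show ?thesis by simp
  next
    case False then show ?thesis using dl_pos[of ?m] by (simp add: V_def field_zero)
  qed
  then show "norm (V b \<epsilon> t x) \<le> 1" using dl_le(3)[of ?m] by linarith
qed

lemma slice_bound_fields:
  assumes ad: "adm b \<epsilon>"
  shows "slice_bound \<epsilon> t (V b \<epsilon> t)" "slice_bound \<epsilon> t (\<lambda>x. DV b \<epsilon> t x (axis j 1))" "slice_bound \<epsilon> t (LV b \<epsilon> t)"
    "slice_bound \<epsilon> t (Vt b \<epsilon> t)" "slice_bound \<epsilon> t (VV b \<epsilon> t)" "slice_bound \<epsilon> t (force b \<epsilon> t)"
proof -
  let ?m = "idx t" let ?R = "rad \<epsilon> (idx t) t"
  let ?B = "dl ?m * ?R powr (- 1 - 2 * \<gamma>)"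
  note C = flat_const(1)
  have a: "0 \<le> b ?m" "b ?m \<le> dl ?m" "0 \<le> \<epsilon>" "\<epsilon> \<le> 1" using ad by (auto simp: adm_def)
  note fb = field_bounds[where b=b and m="?m" and \<epsilon>=\<epsilon> and t=t, OF a]
  have mono: "?R powr (1 - 2 * \<gamma>) \<le> ?R powr (- 1 - 2 * \<gamma>)" "?R powr (- 2 * \<gamma>) \<le> ?R powr (- 1 - 2 * \<gamma>)"
    if "\<bar>t - tm ?m\<bar> < dl ?m"
    using rad_idx_le_1[OF ad that] rad_nonneg[of \<epsilon> ?m t] by (auto intro!: powr_mono')
  have B0: "0 \<le> ?B" using dl_pos[of ?m] by simp
  have zero: "V b \<epsilon> t x = 0" "DV b \<epsilon> t x h = 0" "LV b \<epsilon> t x = 0" "Vt b \<epsilon> t x = 0" "VV b \<epsilon> t x = 0" "force b \<epsilon> t x = 0"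
    if "\<not> \<bar>t - tm ?m\<bar> < dl ?m \<or> ?R \<le> norm (x - xm ?m)" for x h
    using that field_zero[of t ?m \<epsilon>] field_support[OF a(3), of ?m t x]
    by (auto simp: V_def DV_def LV_def Vt_def VV_def force_def)
  have 1: "norm (V b \<epsilon> t x) \<le> 1 * flat_const * ?B" for x
  proof (cases "\<bar>t - tm ?m\<bar> < dl ?m")
    case True
    have "norm (V b \<epsilon> t x) \<le> dl ?m * ?R powr (1 - 2 * \<gamma>)" unfolding V_def by (rule fb)
    also have "\<dots> \<le> ?B" using mono[OF True] dl_pos[of ?m] by (intro mult_left_mono) auto
    also have "\<dots> \<le> flat_const * ?B" using C B0 by (simp add: mult_le_cancel_right1)
    finally show ?thesis by simp
  qed (use B0 C zero in auto)
  have 2: "norm (DV b \<epsilon> t x h) \<le> 3 * flat_const * ?B * norm h" for x h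
  proof (cases "\<bar>t - tm ?m\<bar> < dl ?m")
    case True
    have "norm (DV b \<epsilon> t x h) \<le> 3 * flat_const * dl ?m * ?R powr (- 2 * \<gamma>) * norm h" unfolding DV_def by (rule fb)
    also have "\<dots> \<le> 3 * flat_const * dl ?m * ?R powr (- 1 - 2 * \<gamma>) * norm h"
      using mono[OF True] dl_pos[of ?m] C by (intro mult_right_mono mult_left_mono) auto
    finally show ?thesis by (simp add: mult.assoc)
  qed (use B0 C zero in auto)
  have 3: "norm (LV b \<epsilon> t x) \<le> 14 * flat_const * ?B" for x
    using fb(3)[of x] by (simp add: LV_def mult.assoc)
  have 4: "norm (Vt b \<epsilon> t x) \<le> 6 * flat_const * ?B" for x
    using fb(4)[of x] by (simp add: Vt_def mult.assoc)
  have 5: "norm (VV b \<epsilon> t x) \<le> 3 * flat_const * ?B" for x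
  proof -
    have "norm (VV b \<epsilon> t x) \<le> 3 * flat_const * ?B * norm (V b \<epsilon> t x)" unfolding VV_def by (rule 2)
    also have "\<dots> \<le> 3 * flat_const * ?B * 1" using V_norm_le(2)[OF ad] C B0 by (intro mult_left_mono) auto
    finally show ?thesis by simp
  qed
  have 6: "norm (force b \<epsilon> t x) \<le> 23 * flat_const * ?B" for x
  proof -
    have "norm (force b \<epsilon> t x) \<le> norm (Vt b \<epsilon> t x) + norm (LV b \<epsilon> t x) + norm (VV b \<epsilon> t x)"
      unfolding force_def by norm
    then show ?thesis using 3[of x] 4[of x] 5[of x] by linarith
  qed
  have up: "c * flat_const * ?B \<le> 23 * flat_const * ?B" if "c \<le> 23" for c
    using that C B0 by (intro mult_right_mono) auto
  have bnd: "norm (V b \<epsilon> t x) \<le> 23 * flat_const * ?B" "norm (DV b \<epsilon> t x (axis j 1)) \<le> 23 * flat_const * ?B"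
    "norm (LV b \<epsilon> t x) \<le> 23 * flat_const * ?B" "norm (Vt b \<epsilon> t x) \<le> 23 * flat_const * ?B"
    "norm (VV b \<epsilon> t x) \<le> 23 * flat_const * ?B" for x
    using order_trans[OF 1 up[of 1]] order_trans[OF 2 up[of 3, THEN mult_right_mono[of _ _ "norm (axis j (1::real) :: real^3)"]]]
      order_trans[OF 3 up[of 14]] order_trans[OF 4 up[of 6]] order_trans[OF 5 up[of 3]] by auto
  have ms: "V b \<epsilon> t \<in> borel_measurable borel" "(\<lambda>x. DV b \<epsilon> t x (axis j 1)) \<in> borel_measurable borel"
    "LV b \<epsilon> t \<in> borel_measurable borel" "Vt b \<epsilon> t \<in> borel_measurable borel"
    "VV b \<epsilon> t \<in> borel_measurable borel" "force b \<epsilon> t \<in> borel_measurable borel"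
    using section_measurable(1)[OF joint_measurable(1)] section_measurable(1)[OF joint_measurable(2)]
      section_measurable(1)[OF joint_measurable(3)] section_measurable(1)[OF joint_measurable(4)]
      section_measurable(1)[OF joint_measurable_force(1)] section_measurable(1)[OF joint_measurable_force(2)] by auto
  show "slice_bound \<epsilon> t (V b \<epsilon> t)" "slice_bound \<epsilon> t (\<lambda>x. DV b \<epsilon> t x (axis j 1))" "slice_bound \<epsilon> t (LV b \<epsilon> t)"
    "slice_bound \<epsilon> t (Vt b \<epsilon> t)" "slice_bound \<epsilon> t (VV b \<epsilon> t)" "slice_bound \<epsilon> t (force b \<epsilon> t)"
    unfolding slice_bound_def mult.assoc[of _ "dl (idx t)"] using ms bnd 6 zero by auto
qed

lemma slice_bound_integral:
  assumes X: "slice_bound \<epsilon> t X" and p: "p \<ge> 1"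
  shows "integrable lebesgue (\<lambda>x. norm (X x) powr p)"
    "(LINT x|lebesgue. norm (X x) powr p) \<le>
      (23 * flat_const * dl (idx t) * rad \<epsilon> (idx t) t powr (- 1 - 2 * \<gamma>)) powr p * (6 * rad \<epsilon> (idx t) t ^ 3)"
  using integral_ball_bound[of X p "rad \<epsilon> (idx t) t" "23 * flat_const * dl (idx t) * rad \<epsilon> (idx t) t powr (- 1 - 2 * \<gamma>)" "xm (idx t)"]
    X p rad_nonneg flat_const(1) dl_pos[of "idx t"] by (auto simp: slice_bound_def)

text \<open>For p \<le> 2 the bound \<open>\<gamma> \<le> 1 / 4\<close> gives (1 + 2 \<gamma>) p
  \<le> 3, so the size is at worst R^(-3) after taking the p-th power and the volume of order R^3
  compensates it. The result depends neither on time nor on the degree of regularisation.\<close>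

lemma slice_bound_norms:
  assumes X: "slice_bound \<epsilon> t X" and e: "0 \<le> \<epsilon>" "\<epsilon> \<le> 1"
  shows "integrable lebesgue X" "(LINT x|lebesgue. norm (X x)) \<le> 6 * (23 * flat_const)\<^sup>2"
    "integrable lebesgue (\<lambda>x. (norm (X x))\<^sup>2)" "(LINT x|lebesgue. (norm (X x))\<^sup>2) \<le> 6 * (23 * flat_const)\<^sup>2"
    "X \<in> Lp_space 2 lebesgue"
proof -
  let ?m = "idx t" let ?R = "rad \<epsilon> (idx t) t" let ?K = "23 * flat_const"
  have K: "1 \<le> ?K" using flat_const(1) by linarith
  have m: "X \<in> borel_measurable lebesgue" using X by (auto simp: slice_bound_def intro: measurable_lebesgue_borel)
  have "integrable lebesgue (\<lambda>x. norm (X x) powr 1)" by (rule slice_bound_integral[OF X]) simp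
  then show "integrable lebesgue X" using m by (simp add: integrable_norm_iff)
  have i2: "integrable lebesgue (\<lambda>x. norm (X x) powr 2)" by (rule slice_bound_integral[OF X]) simp
  then show i2': "integrable lebesgue (\<lambda>x. (norm (X x))\<^sup>2)" by (simp add: powr_2_norm)
  show "X \<in> Lp_space 2 lebesgue" using i2' m by (simp add: Lp_space_ereal_2)
  have bnd: "(LINT x|lebesgue. norm (X x) powr p) \<le> 6 * ?K\<^sup>2" if p: "1 \<le> p" "p \<le> 2" for p
  proof (cases "\<bar>t - tm ?m\<bar> < dl ?m \<and> ?R > 0")
    case False
    then have "X x = 0" for x
    proof (cases "\<bar>t - tm ?m\<bar> < dl ?m")
      case True
      then have "?R = 0" using False rad_nonneg[of \<epsilon> ?m t] by linarith
      then show ?thesis using X by (simp add: slice_bound_def)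
    qed (use X in \<open>simp add: slice_bound_def\<close>)
    then show ?thesis by simp
  next
    case True
    then have R: "0 < ?R" "?R \<le> 1" using rad_le(2)[OF e] by auto
    have "(?K * dl ?m * ?R powr (- 1 - 2 * \<gamma>)) powr p \<le> (?K * 1 * ?R powr (- 1 - 2 * \<gamma>)) powr p"
    proof (rule powr_mono2)
      show "?K * dl ?m * ?R powr (- 1 - 2 * \<gamma>) \<le> ?K * 1 * ?R powr (- 1 - 2 * \<gamma>)"
        using dl_le(3)[of ?m] K by (intro mult_right_mono mult_left_mono) auto
    qed (use p K dl_pos[of ?m] in auto)
    also have "\<dots> = ?K powr p * ?R powr ((- 1 - 2 * \<gamma>) * p)" using K by (simp add: powr_mult powr_powr)
    also have "\<dots> \<le> ?K powr 2 * ?R powr (- 3)"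
    proof (intro mult_mono)
      show "?K powr p \<le> ?K powr 2" using K p by (intro powr_mono) auto
      have "(1 + 2 * \<gamma>) * p \<le> (3 / 2) * 2" using gam p by (intro mult_mono) auto
      then have "- 3 \<le> (- 1 - 2 * \<gamma>) * p" by (simp add: algebra_simps)
      then show "?R powr ((- 1 - 2 * \<gamma>) * p) \<le> ?R powr (- 3)" using R by (intro powr_mono') auto
    qed auto
    finally have "(?K * dl ?m * ?R powr (- 1 - 2 * \<gamma>)) powr p * (6 * ?R ^ 3) \<le> (?K powr 2 * ?R powr (- 3)) * (6 * ?R ^ 3)"
      using R by (intro mult_right_mono) auto
    also have "\<dots> = 6 * ?K\<^sup>2" using R K by (simp add: powr_minus_divide powr_numeral)
    finally show ?thesis using slice_bound_integral(2)[OF X p(1)] by linarith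
  qed
  show "(LINT x|lebesgue. norm (X x)) \<le> 6 * (23 * flat_const)\<^sup>2" using bnd[of 1] by simp
  show "(LINT x|lebesgue. (norm (X x))\<^sup>2) \<le> 6 * (23 * flat_const)\<^sup>2" using bnd[of 2] by (simp add: powr_2_norm)
qed

lemma early_zero:
  assumes "adm b \<epsilon>" "t \<le> T / 4"
  shows "V b \<epsilon> t x = 0"
  using local_field_early[OF local_fields(1)] assms by (simp add: V_def adm_def)

text \<open>A test field has to be compactly supported and smooth. Keeping finitely many vortices
  secures the first, \<open>eps n > 0\<close> the second.\<close>

definition trunc :: "nat \<Rightarrow> nat \<Rightarrow> real" where "trunc n m = (if m < n then dl m else 0)"
definition eps :: "nat \<Rightarrow> real" where "eps n = 1 / real (Suc n)"

lemma adm_dl: "adm dl 0" using dl_pos by (auto simp: adm_def intro: less_imp_le)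

lemma adm_trunc: "adm (trunc n) (eps n)"
  using dl_pos by (auto simp: adm_def trunc_def eps_def intro: less_imp_le)

lemma eps_pos: "eps n > 0" by (simp add: eps_def)

text \<open>The singular times are excluded because there \<open>rho\<close> tends to 0 along the
  approximations and the negative powers of it blow up. They form a null set.\<close>

lemma regularized_tendsto:
  assumes "t \<noteq> tm (idx t)"
  shows "(\<lambda>n. V (trunc n) (eps n) t x) \<longlonglongrightarrow> V dl 0 t x"
    "(\<lambda>n. DV (trunc n) (eps n) t x h) \<longlonglongrightarrow> DV dl 0 t x h"
    "(\<lambda>n. Vt (trunc n) (eps n) t x) \<longlonglongrightarrow> Vt dl 0 t x"
proof -
  let ?m = "idx t"
  have e: "eps \<longlonglongrightarrow> 0" using LIMSEQ_inverse_real_of_nat by (simp add: eps_def[abs_def] inverse_eq_divide)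
  have b: "(\<lambda>n. trunc n ?m) \<longlonglongrightarrow> dl ?m"
    by (rule tendsto_eventually) (auto simp: trunc_def eventually_sequentially intro!: exI[of _ "Suc ?m"])
  have r: "(\<lambda>n. rho (eps n) ?m t) \<longlonglongrightarrow> rho 0 ?m t" unfolding rho_def by (intro tendsto_intros e)
  have rn: "rho 0 ?m t \<noteq> 0" using assms by (simp add: rho_def)
  have p: "(\<lambda>n. rho (eps n) ?m t powr c) \<longlonglongrightarrow> rho 0 ?m t powr c" for c
    by (intro tendsto_powr r tendsto_const rn)
  have c: "(\<lambda>n. ca (trunc n) (eps n) ?m t) \<longlonglongrightarrow> ca dl 0 ?m t" "(\<lambda>n. ca' (trunc n) (eps n) ?m t) \<longlonglongrightarrow> ca' dl 0 ?m t"
    "(\<lambda>n. cth (eps n) ?m t) \<longlonglongrightarrow> cth 0 ?m t" "(\<lambda>n. cth' (eps n) ?m t) \<longlonglongrightarrow> cth' 0 ?m t"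
    unfolding ca_def ca'_def cth_def cth'_def by (intro tendsto_mult tendsto_add tendsto_const b p)+
  show "(\<lambda>n. V (trunc n) (eps n) t x) \<longlonglongrightarrow> V dl 0 t x"
    "(\<lambda>n. DV (trunc n) (eps n) t x h) \<longlonglongrightarrow> DV dl 0 t x h"
    "(\<lambda>n. Vt (trunc n) (eps n) t x) \<longlonglongrightarrow> Vt dl 0 t x"
    unfolding V_def w_def DV_def wd_def Vt_def wt_def swirl_def swirl_d_def swirl_t_def
    by (intro tendsto_intros c)+
qed

text \<open>Away from the singular points this is smoothness of a single vortex; at a singular point
  the size is at most R^(1-2\<gamma>), and the exponent is positive.\<close>

lemma V_joint_continuous: "continuous_on UNIV (\<lambda>(t, x). V dl 0 t x)"
proof -
  have atom: "isCont (\<lambda>z. w dl 0 m (fst z) (snd z)) z" for m z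
  proof (cases "z = (tm m, xm m)")
    case False
    have o: "open (- {(tm m, xm m)})" by (simp add: open_Compl)
    show ?thesis
      using Ck_on_imp_continuous[OF Ck_on_w_0[of 0 m dl]] False
      unfolding continuous_on_eq_continuous_at[OF o] by simp
  next
    case True
    have le: "norm (w dl 0 m t x) \<le> rad 0 m t powr (1 - 2 * \<gamma>)" for t x
    proof -
      have "norm (w dl 0 m t x) \<le> dl m * rad 0 m t powr (1 - 2 * \<gamma>)"
        by (rule field_bounds(1)) (use dl_pos[of m] in auto)
      also have "\<dots> \<le> 1 * rad 0 m t powr (1 - 2 * \<gamma>)"
        using dl_le(3)[of m] by (intro mult_right_mono) auto
      finally show ?thesis by simp
    qed
    have "((\<lambda>z. rad 0 m (fst z) powr (1 - 2 * \<gamma>)) \<longlongrightarrow> rad 0 m (fst z) powr (1 - 2 * \<gamma>)) (at z)"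
    proof (intro tendsto_powr' tendsto_const)
      have "((\<lambda>z. rho 0 m (fst z) powr (1 / 4)) \<longlongrightarrow> rho 0 m (fst z) powr (1 / 4)) (at z)"
        unfolding rho_def by (intro tendsto_powr' tendsto_intros) auto
      then show "((\<lambda>z. rad 0 m (fst z)) \<longlongrightarrow> rad 0 m (fst z)) (at z)" by (simp add: rad_def)
      show "rad 0 m (fst z) \<noteq> 0 \<or> (0 < 1 - 2 * \<gamma> \<and> (\<forall>\<^sub>F z in at z. 0 \<le> rad 0 m (fst z)))"
        using gam rad_nonneg by auto
    qed
    then have "((\<lambda>z. rad 0 m (fst z) powr (1 - 2 * \<gamma>)) \<longlongrightarrow> 0) (at z)"
      using True by (simp add: rad_def rho_def)
    then have "((\<lambda>z. w dl 0 m (fst z) (snd z)) \<longlongrightarrow> 0) (at z)"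
      by (rule Lim_null_comparison[rotated]) (use le in auto)
    then show ?thesis using True by (simp add: isCont_def field_zero rho_def)
  qed
  have "isCont (\<lambda>z. V dl 0 (fst z) (snd z)) z" for z
  proof -
    have "open (UNIV \<times> ball (snd z) (1 / 4) :: (real \<times> (real^3)) set)" by (simp add: open_Times)
    moreover have "z \<in> UNIV \<times> ball (snd z) (1 / 4)" by (simp add: mem_Times_iff)
    ultimately have ev: "\<forall>\<^sub>F y in nhds z. V dl 0 (fst y) (snd y) = w dl 0 (cell (snd z)) (fst y) (snd y)"
      unfolding eventually_nhds V_def
      by (intro exI[of _ "UNIV \<times> ball (snd z) (1 / 4)"]) (auto intro!: cell[OF local_fields(1)])
    show ?thesis using isCont_cong[OF ev] atom by simp
  qed
  then show ?thesis by (intro continuous_at_imp_continuous_on) (auto simp: case_prod_beta')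
qed

lemma V_smooth: "smooth_on ({0..} \<times> UNIV - (\<Union>m. {(tm m, xm m)})) (\<lambda>(t, x). V dl 0 t x)"
proof -
  have "Ck_on k (- (\<Union>m. {(tm m, xm m)})) (\<lambda>z. V dl 0 (fst z) (snd z))" for k
    by (rule Ck_on_V_local[OF _ _ open_regular_set Ck_on_subset[OF Ck_on_w_0]]) auto
  then have "Ck_on k ({0..} \<times> UNIV - (\<Union>m. {(tm m, xm m)})) (\<lambda>z. V dl 0 (fst z) (snd z))" for k
    by (rule Ck_on_subset) auto
  then show ?thesis by (simp add: smooth_on_def case_prod_beta')
qed

lemma V_at_singular_time: "V dl 0 (tm m) x = 0"
proof -
  have "idx (tm m) = m" by (rule idx_eq) (simp add: dl_pos)
  then show ?thesis by (simp add: V_def field_zero rho_def)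
qed

end

section \<open>The flow as a Leray--Hopf solution\<close>

text \<open>Lebesgue measure is complete, so no measurability is needed to change an integrand on a null set.\<close>

lemma integral_cong_AE_lebesgue_on:
  fixes f g :: "'a::euclidean_space \<Rightarrow> 'b::euclidean_space"
  assumes A: "A \<in> sets lebesgue" and eq: "AE x in lebesgue_on A. f x = g x"
  shows "integral\<^sup>L (lebesgue_on A) f = integral\<^sup>L (lebesgue_on A) g" (is ?I)
    and "integrable (lebesgue_on A) f \<longleftrightarrow> integrable (lebesgue_on A) g" (is ?J)
proof -
  have eq': "AE x in lebesgue_on A. g x = f x" using eq by eventually_elim simp
  have m: "f \<in> borel_measurable (lebesgue_on A) \<longleftrightarrow> g \<in> borel_measurable (lebesgue_on A)"
    using measurable_AE_lebesgue[OF _ A eq] measurable_AE_lebesgue[OF _ A eq'] by blast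
  show J: ?J
  proof (cases "f \<in> borel_measurable (lebesgue_on A)")
    case True then show ?thesis using m eq by (intro integrable_cong_AE) auto
  qed (use m borel_measurable_integrable in blast)
  show ?I
  proof (cases "f \<in> borel_measurable (lebesgue_on A)")
    case True then show ?thesis using m eq by (intro integral_cong_AE) auto
  next
    case False
    then have "\<not> integrable (lebesgue_on A) f" "\<not> integrable (lebesgue_on A) g"
      using m borel_measurable_integrable by blast+
    then show ?thesis by (simp add: not_integrable_integral_eq)
  qed
qed

lemmas integral_cong_AE_lebesgue = integral_cong_AE_lebesgue_on[of UNIV, unfolded lebesgue_on_UNIV_eq, simplified]
lemmas integral_cong_AE_time = integral_cong_AE_lebesgue_on[of "{0<..<S}" for S :: real, simplified]

lemma L2_inner:
  fixes X Y :: "'a::euclidean_space \<Rightarrow> 'b::euclidean_space"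
  assumes "X \<in> Lp_space 2 lebesgue" "Y \<in> Lp_space 2 lebesgue"
  shows "integrable lebesgue (\<lambda>x. X x \<bullet> Y x)" "integrable lebesgue (\<lambda>x. norm (X x) * norm (Y x))"
    "\<bar>LINT x|lebesgue. X x \<bullet> Y x\<bar> \<le> (LINT x|lebesgue. (norm (X x))\<^sup>2) + (LINT x|lebesgue. (norm (Y x))\<^sup>2)"
proof -
  have m: "X \<in> borel_measurable lebesgue" "Y \<in> borel_measurable lebesgue"
    and i: "integrable lebesgue (\<lambda>x. (norm (X x))\<^sup>2)" "integrable lebesgue (\<lambda>x. (norm (Y x))\<^sup>2)"
    using assms by (auto simp: Lp_space_ereal_2)
  have isum: "integrable lebesgue (\<lambda>x. (norm (X x))\<^sup>2 + (norm (Y x))\<^sup>2)" using i by simp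
  have le: "norm (X x) * norm (Y x) \<le> (norm (X x))\<^sup>2 + (norm (Y x))\<^sup>2" for x
    using sum_squares_bound[of "norm (X x)" "norm (Y x)"] mult_nonneg_nonneg[OF norm_ge_zero norm_ge_zero, of "X x" "Y x"] by linarith
  show i2: "integrable lebesgue (\<lambda>x. norm (X x) * norm (Y x))"
    by (rule Bochner_Integration.integrable_bound[OF isum])
      (use m le in \<open>auto intro!: AE_I2 borel_measurable_times borel_measurable_norm simp: abs_of_nonneg\<close>)
  show i1: "integrable lebesgue (\<lambda>x. X x \<bullet> Y x)"
    by (rule Bochner_Integration.integrable_bound[OF i2])
      (use m Cauchy_Schwarz_ineq2 in \<open>auto intro!: AE_I2 borel_measurable_inner\<close>)
  have "\<bar>LINT x|lebesgue. X x \<bullet> Y x\<bar> \<le> (LINT x|lebesgue. \<bar>X x \<bullet> Y x\<bar>)" by (rule integral_abs_bound)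
  also have "\<dots> \<le> (LINT x|lebesgue. (norm (X x))\<^sup>2 + (norm (Y x))\<^sup>2)"
    by (rule integral_mono[OF integrable_abs[OF i1] isum]) (rule order_trans[OF Cauchy_Schwarz_ineq2 le])
  also have "\<dots> = (LINT x|lebesgue. (norm (X x))\<^sup>2) + (LINT x|lebesgue. (norm (Y x))\<^sup>2)" using i by simp
  finally show "\<bar>LINT x|lebesgue. X x \<bullet> Y x\<bar> \<le> (LINT x|lebesgue. (norm (X x))\<^sup>2) + (LINT x|lebesgue. (norm (Y x))\<^sup>2)" .
qed

lemma L1_bounded_inner:
  fixes X Y :: "'a::euclidean_space \<Rightarrow> 'b::euclidean_space"
  assumes "integrable lebesgue X" "Y \<in> borel_measurable lebesgue" "\<And>x. norm (Y x) \<le> C"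
  shows "integrable lebesgue (\<lambda>x. X x \<bullet> Y x)" "\<bar>LINT x|lebesgue. X x \<bullet> Y x\<bar> \<le> C * (LINT x|lebesgue. norm (X x))"
    "(LINT x|lebesgue. \<bar>X x \<bullet> Y x\<bar>) \<le> C * (LINT x|lebesgue. norm (X x))"
proof -
  have isum: "integrable lebesgue (\<lambda>x. C * norm (X x))" using assms(1) by simp
  have le: "\<bar>X x \<bullet> Y x\<bar> \<le> C * norm (X x)" for x
    using Cauchy_Schwarz_ineq2[of "X x" "Y x"] mult_left_mono[OF assms(3)[of x], of "norm (X x)"]
    by (simp add: mult.commute)
  show i: "integrable lebesgue (\<lambda>x. X x \<bullet> Y x)"
    by (rule Bochner_Integration.integrable_bound[OF isum])
      (use assms le in \<open>auto intro!: AE_I2 borel_measurable_inner intro: order_trans[OF le abs_ge_self]\<close>)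
  show *: "(LINT x|lebesgue. \<bar>X x \<bullet> Y x\<bar>) \<le> C * (LINT x|lebesgue. norm (X x))"
    using integral_mono[OF integrable_abs[OF i] isum le] by simp
  show "\<bar>LINT x|lebesgue. X x \<bullet> Y x\<bar> \<le> C * (LINT x|lebesgue. norm (X x))"
    using integral_abs_bound[of lebesgue "\<lambda>x. X x \<bullet> Y x"] * by linarith
qed

lemma Cc_infty_L2:
  fixes \<phi> :: "'a::euclidean_space \<Rightarrow> 'b::euclidean_space"
  assumes "\<phi> \<in> Cc_infty UNIV"
  shows "\<phi> \<in> Lp_space 2 lebesgue"
proof -
  obtain K where K: "compact K" "\<And>x. x \<notin> K \<Longrightarrow> \<phi> x = 0" using Cc_inftyD(5)[OF assms] by blast
  have "integrable lebesgue (\<lambda>x. (norm (\<phi> x))\<^sup>2)"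
    by (rule integrable_lebesgue_continuous_compact[OF _ K(1)])
      (use K Cc_inftyD(2)[OF assms] in \<open>auto intro!: continuous_intros\<close>)
  then show ?thesis using measurable_lebesgue_continuous[OF Cc_inftyD(2)[OF assms]] by (simp add: Lp_space_ereal_2)
qed

text \<open>Serves both weak formulations: the time interval of \<open>A\<close> is [0,S) for
  divergence-free test fields and (0,S) for the pressure equation. Derivatives within
  \<open>A\<close> are true derivatives on the open slab. The time derivative carries an indicator
  because \<open>vector_derivative\<close> is not controlled outside (0,S).\<close>

lemma test_field:
  fixes \<phi> :: "real \<Rightarrow> real^3 \<Rightarrow> real^3" and S :: real
  defines "\<phi>t \<equiv> \<lambda>t x. vector_derivative (\<lambda>s. \<phi> s x) (at t)"
  assumes A: "{0<..<S} \<times> UNIV \<subseteq> A" "A \<subseteq> {0..<S} \<times> UNIV" "A \<in> sets borel"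
    and \<phi>: "(\<lambda>(t, x). \<phi> t x) \<in> Cc_infty A" and S: "S > 0"
  obtains C S' where "S' < S" "C \<ge> 0" "\<And>t x. norm (\<phi> t x) \<le> C" "\<And>t x. S' \<le> t \<Longrightarrow> \<phi> t x = 0"
    "\<And>t x. 0 < t \<Longrightarrow> t < S \<Longrightarrow> norm (\<phi>t t x) \<le> C"
    "\<And>t x. 0 < t \<Longrightarrow> t < S \<Longrightarrow> ((\<lambda>s. \<phi> s x) has_vector_derivative \<phi>t t x) (at t)"
    "\<And>t. 0 < t \<Longrightarrow> t < S \<Longrightarrow> \<phi> t \<in> Cc_infty UNIV"
    "(\<lambda>(t, x). \<phi> t x) \<in> borel_measurable (borel \<Otimes>\<^sub>M borel)"
    "(\<lambda>(t, x). indicator {0<..<S} t *\<^sub>R \<phi>t t x) \<in> borel_measurable (borel \<Otimes>\<^sub>M borel)"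
proof -
  let ?f = "\<lambda>z. \<phi> (fst z) (snd z)"
  have f: "(\<lambda>(t, x). \<phi> t x) = ?f" by auto
  obtain K where K: "compact K" "K \<subseteq> A" "\<And>z. z \<notin> K \<Longrightarrow> ?f z = 0"
    using \<phi> unfolding f Cc_infty_def by auto
  have Ck: "Ck_on k A ?f" for k using \<phi> unfolding f Cc_infty_def smooth_on_def by auto
  let ?O = "{0<..<S} \<times> (UNIV :: (real^3) set)"
  have oO: "open ?O" by (simp add: open_Times)
  obtain F where F: "\<And>z. z \<in> A \<Longrightarrow> (?f has_derivative F z) (at z within A)"
    "\<And>b. b \<in> Basis \<Longrightarrow> Ck_on 0 A (\<lambda>z. F z b)" using Ck[of "Suc 0"] by (elim Ck_on_SucE) blast
  have Fat: "(?f has_derivative F z) (at z)" if "z \<in> ?O" for z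
  proof -
    have "(?f has_derivative F z) (at z within ?O)" using F(1)[of z] that A(1) by (auto intro: has_derivative_subset)
    then show ?thesis using at_within_open[OF that oO] by simp
  qed
  have b1: "(1, 0) \<in> (Basis :: (real \<times> (real^3)) set)" by (simp add: Basis_prod_def)
  have vd: "((\<lambda>s. \<phi> s x) has_vector_derivative F (t, x) (1, 0)) (at t)" if "0 < t" "t < S" for t x
  proof -
    have "((\<lambda>s. ?f (s, x)) has_derivative (\<lambda>h. F (t, x) (h, 0))) (at t)"
      by (rule has_derivative_compose[OF _ Fat]) (use that in \<open>auto intro!: derivative_eq_intros\<close>)
    then have D: "((\<lambda>s. \<phi> s x) has_derivative (\<lambda>h. F (t, x) (h, 0))) (at t)" by simp
    have lin: "linear (F (t, x))" using Fat[of "(t, x)"] that by (auto intro: has_derivative_linear)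
    have *: "F (t, x) (h, 0) = h *\<^sub>R F (t, x) (1, 0)" for h
      using linear_scale[OF lin, of h "(1, 0)"] by (simp only: scaleR_Pair real_scaleR_def mult_1_right scaleR_zero_right)
    show ?thesis unfolding has_vector_derivative_def using D by (rule has_derivative_eq_rhs) (rule ext, rule *)
  qed
  then have ft: "\<phi>t t x = F (t, x) (1, 0)" if "0 < t" "t < S" for t x
    unfolding \<phi>t_def using that by (intro vector_derivative_at)
  have F0: "F z (1, 0) = 0" if "z \<in> ?O" "z \<notin> K" for z
  proof -
    have "((\<lambda>z. 0) has_derivative (\<lambda>h. 0)) (at z)" by simp
    then have "(?f has_derivative (\<lambda>h. 0)) (at z)"
      by (rule has_derivative_transform_within_open[of _ _ _ _ "- K"])
        (use that K in \<open>auto intro: compact_imp_closed\<close>)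
    then show ?thesis using has_derivative_unique[OF Fat[OF that(1)]] by metis
  qed
  have cF: "continuous_on A (\<lambda>z. F z (1, 0))" using F(2)[OF b1] by simp
  have cf: "continuous_on A ?f" using Ck by (rule Ck_on_imp_continuous)
  have "bounded (?f ` K)" "bounded ((\<lambda>z. F z (1, 0)) ` K)"
    by (intro compact_imp_bounded compact_continuous_image K continuous_on_subset[OF cf] continuous_on_subset[OF cF])+
  then obtain C1 C2 where C12: "C1 > 0" "\<forall>y\<in>?f ` K. norm y \<le> C1" "C2 > 0" "\<forall>y\<in>(\<lambda>z. F z (1, 0)) ` K. norm y \<le> C2"
    unfolding bounded_pos by blast
  have C: "C1 > 0" "\<And>z. z \<in> K \<Longrightarrow> norm (?f z) \<le> C1" "C2 > 0" "\<And>z. z \<in> K \<Longrightarrow> norm (F z (1, 0)) \<le> C2"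
    using C12 by auto
  define C where "C = max C1 C2"
  have nf: "norm (\<phi> t x) \<le> C" for t x
    using C(2)[of "(t, x)"] K(3)[of "(t, x)"] C(1) by (cases "(t, x) \<in> K") (auto simp: C_def)
  have nft: "norm (\<phi>t t x) \<le> C" if "0 < t" "t < S" for t x
    using C(4)[of "(t, x)"] F0[of "(t, x)"] C(3) that ft[OF that] by (cases "(t, x) \<in> K") (auto simp: C_def)
  \<comment> \<open>The midpoint between the last time of the support and S, so that the field
    vanishes in a whole neighbourhood of S.\<close>
  obtain S' where S': "S' < S" "\<And>t x. (t, x) \<in> K \<Longrightarrow> t < S'"
  proof (cases "K = {}")
    case True then show thesis using that[of "S - 1"] by auto
  next
    case False
    have "compact (fst ` K)" by (intro compact_continuous_image K continuous_intros)
    then obtain s where s: "s \<in> fst ` K" "\<And>t. t \<in> fst ` K \<Longrightarrow> t \<le> s"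
      using compact_attains_sup[of "fst ` K"] False by auto
    have "s < S" using s(1) K(2) A(2) by auto
    then show thesis using s(2) by (intro that[of "(s + S) / 2"]) force+
  qed
  have slice: "\<phi> t \<in> Cc_infty UNIV" if t: "0 < t" "t < S" for t
  proof -
    have "Ck_on k UNIV (\<lambda>x. ?f (t, x))" for k
    proof (rule Ck_on_compose[OF _ Ck])
      show "range (\<lambda>x. (t, x)) \<subseteq> A" using t A(1) by auto
      have "Ck_on k UNIV (\<lambda>x :: real^3. (0, x) + (t, 0))"
        by (intro Ck_on_add Ck_on_const Ck_on_linear bounded_linear_Pair bounded_linear_zero bounded_linear_ident)
      then show "Ck_on k UNIV (\<lambda>x :: real^3. (t, x))" by simp
    qed
    moreover have "compact (snd ` K)" by (intro compact_continuous_image K continuous_intros)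
    moreover have "\<phi> t x = 0" if "x \<notin> snd ` K" for x
    proof -
      have "(t, x) \<notin> K" using that by force
      then show ?thesis using K(3) by fastforce
    qed
    ultimately show ?thesis by (auto simp: Cc_infty_def smooth_on_def)
  qed
  have m1: "(\<lambda>(t, x). \<phi> t x) \<in> borel_measurable (borel \<Otimes>\<^sub>M borel)"
  proof -
    have "(\<lambda>z. indicator A z *\<^sub>R ?f z) \<in> borel_measurable borel"
      by (rule borel_measurable_continuous_on_indicator[OF A(3) cf])
    moreover have "(\<lambda>z. indicator A z *\<^sub>R ?f z) = (\<lambda>(t, x). \<phi> t x)"
      using K(2,3) by (force simp: indicator_def)
    ultimately show ?thesis by (simp add: borel_prod)
  qed
  have m2: "(\<lambda>(t, x). indicator {0<..<S} t *\<^sub>R \<phi>t t x) \<in> borel_measurable (borel \<Otimes>\<^sub>M borel)"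
  proof -
    have "(\<lambda>z. indicator ?O z *\<^sub>R F z (1, 0)) \<in> borel_measurable borel"
      by (rule borel_measurable_continuous_on_indicator[OF borel_open[OF oO] continuous_on_subset[OF cF A(1)]])
    moreover have "(\<lambda>z. indicator ?O z *\<^sub>R F z (1, 0)) = (\<lambda>(t, x). indicator {0<..<S} t *\<^sub>R \<phi>t t x)"
      using ft by (auto simp: fun_eq_iff split: split_indicator)
    ultimately show ?thesis by (simp add: borel_prod)
  qed
  show thesis
  proof (rule that[of S' C])
    show "\<phi> t x = 0" if "S' \<le> t" for t x using S'(2)[of t x] K(3)[of "(t, x)"] that by force
    show "((\<lambda>s. \<phi> s x) has_vector_derivative \<phi>t t x) (at t)" if "0 < t" "t < S" for t x
      using vd[OF that] ft[OF that] by simp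
  qed (use S' C nf nft slice m1 m2 in \<open>auto simp: C_def\<close>)
qed

lemma column_matrix: "column j (matrix f) = f (axis j 1)"
  by (simp add: column_def matrix_def vec_eq_iff)

lemma trace_matrix: "trace (matrix f) = (\<Sum>i\<in>UNIV. f (axis i 1) $ i)"
  by (simp add: trace_def matrix_def)

lemma frechet_derivative_eq: "(f has_derivative f') (at x) \<Longrightarrow> frechet_derivative f (at x) = f'"
  using frechet_derivative_at by metis

context swirl_flow
begin

abbreviation "DM b \<epsilon> t x \<equiv> matrix (DV b \<epsilon> t x)"

lemma DM_mult: "DM b \<epsilon> t x *v v = DV b \<epsilon> t x v"
  unfolding matrix_vector_columns column_matrix by (rule DV_expand[symmetric])

lemma is_weak_jacobian_V: "is_weak_jacobian (V b \<epsilon> t) (DM b \<epsilon> t)"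
  unfolding is_weak_jacobian_def column_matrix
  using weak_pderiv_classical[OF V_has_derivative continuous_V_space(2) axis_in_Basis] by blast

lemmas weak_jacobian_V = weak_jacobian_AE[OF is_weak_jacobian_V]

lemma slice_bound_cpt:
  assumes "slice_bound \<epsilon> t X" "0 \<le> \<epsilon>" "\<epsilon> \<le> 1" "x \<notin> cball (xm (idx t)) 1"
  shows "X x = 0"
proof (cases "\<bar>t - tm (idx t)\<bar> < dl (idx t)")
  case True
  then have "rad \<epsilon> (idx t) t \<le> norm (x - xm (idx t))"
    using rad_le(2)[OF assms(2,3) True] assms(4) by (simp add: dist_norm norm_minus_commute)
  then show ?thesis using assms(1) by (simp add: slice_bound_def)
qed (use assms(1) in \<open>simp add: slice_bound_def\<close>)

lemma V_test_functions:
  assumes ad: "adm b \<epsilon>"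
  shows "V b \<epsilon> t \<in> Cc_infty UNIV" "(\<lambda>x. DV b \<epsilon> t x (axis j 1)) \<in> Cc_infty UNIV"
    "LV b \<epsilon> t \<in> Cc_infty UNIV" "Vt b \<epsilon> t \<in> Cc_infty UNIV"
proof -
  have e: "0 \<le> \<epsilon>" "\<epsilon> \<le> 1" using ad by (auto simp: adm_def)
  have *: "X \<in> Cc_infty UNIV" if "slice_bound \<epsilon> t X" "\<And>k. Ck_on k UNIV X" for X
    using that slice_bound_cpt[OF that(1) e] compact_cball[of "xm (idx t)" 1]
    unfolding Cc_infty_def smooth_on_def by blast
  show "V b \<epsilon> t \<in> Cc_infty UNIV" "(\<lambda>x. DV b \<epsilon> t x (axis j 1)) \<in> Cc_infty UNIV"
    "LV b \<epsilon> t \<in> Cc_infty UNIV" "Vt b \<epsilon> t \<in> Cc_infty UNIV"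
    by (intro * slice_bound_fields ad Ck_on_V_space)+
qed

lemma jacobian_test: "\<psi> \<in> Cc_infty UNIV \<Longrightarrow> column j (jacobian \<psi> (at x)) = frechet_derivative \<psi> (at x) (axis j 1)"
  by (simp add: jacobian_def column_matrix)

lemma integrable_inner_continuous_Cc:
  fixes X \<psi> :: "real^3 \<Rightarrow> real^3"
  assumes "continuous_on UNIV X" "continuous_on UNIV \<psi>" "compact K" "\<And>x. x \<notin> K \<Longrightarrow> X x = 0 \<or> \<psi> x = 0"
  shows "integrable lebesgue (\<lambda>x. X x \<bullet> \<psi> x)"
  by (rule integrable_lebesgue_continuous_compact[OF _ assms(3)])
    (use assms in \<open>auto intro!: continuous_intros dest!: assms(4)\<close>)

text \<open>At a fixed time the field is smooth in space, also for the singular solution, so both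
  integrations by parts are classical: one derivative is moved either onto the gradient of V or onto
  the gradient of \<open>\<psi>\<close>. Compact support of \<open>\<psi>\<close> removes the
  boundary terms.\<close>

lemma V_integral_by_parts:
  assumes \<psi>: "\<psi> \<in> Cc_infty UNIV"
  shows "integrable lebesgue (\<lambda>x. DM b \<epsilon> t x \<bullet> jacobian \<psi> (at x))"
    "(LINT x|lebesgue. DM b \<epsilon> t x \<bullet> jacobian \<psi> (at x)) = - (LINT x|lebesgue. LV b \<epsilon> t x \<bullet> \<psi> x)"
    "(LINT x|lebesgue. DM b \<epsilon> t x \<bullet> jacobian \<psi> (at x)) = - (LINT x|lebesgue. V b \<epsilon> t x \<bullet> laplacian \<psi> x)"
    "integrable lebesgue (\<lambda>x. V b \<epsilon> t x \<bullet> laplacian \<psi> x)"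
proof -
  obtain K where K: "compact K" "\<And>x. x \<notin> K \<Longrightarrow> \<psi> x = 0 \<and> frechet_derivative \<psi> (at x) = (\<lambda>h. 0)"
    using Cc_inftyD(5)[OF \<psi>] by blast
  note a = axis_in_Basis
  note d\<psi> = Cc_inftyD(3)[OF \<psi>]
  note c\<psi> = Cc_inftyD(4)[OF \<psi> a]
  have Ck2: "Ck_on (Suc (Suc 0)) UNIV \<psi>" by (rule Cc_inftyD(1)[OF \<psi>])
  have Ck1: "Ck_on (Suc 0) UNIV (\<lambda>x. frechet_derivative \<psi> (at x) (axis j 1))" for j
    using Ck2 a unfolding Ck_on_Suc_open[OF open_UNIV, of "Suc 0"] by blast
  let ?D2 = "\<lambda>j x. frechet_derivative (\<lambda>x. frechet_derivative \<psi> (at x) (axis j 1)) (at x)"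
  have d2: "((\<lambda>x. frechet_derivative \<psi> (at x) (axis j 1)) has_derivative ?D2 j x) (at x)" for j x
    using Ck1[of j] unfolding Ck_on_Suc_open[OF open_UNIV] by (auto simp: frechet_derivative_works)
  have c2: "continuous_on UNIV (\<lambda>x. ?D2 j x (axis j 1))" for j
    using Ck1[of j] a unfolding Ck_on_Suc_open[OF open_UNIV] by auto
  have i1: "integrable lebesgue (\<lambda>x. DV b \<epsilon> t x (axis j 1) \<bullet> frechet_derivative \<psi> (at x) (axis j 1))" for j
    by (rule integrable_inner_continuous_Cc[OF continuous_V_space(2) c\<psi> K(1)]) (use K in auto)
  have i2: "integrable lebesgue (\<lambda>x. D2V b \<epsilon> t x (axis j 1) (axis j 1) \<bullet> \<psi> x)" for j
    by (rule integrable_inner_continuous_Cc[OF continuous_D2V[OF a] Cc_inftyD(2)[OF \<psi>] K(1)]) (use K in auto)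
  have z2: "?D2 j x (axis j 1) = 0" if "x \<notin> K" for j x
  proof -
    have "((\<lambda>x. 0) has_derivative (\<lambda>h. 0)) (at x)" by simp
    then have "((\<lambda>x. frechet_derivative \<psi> (at x) (axis j 1)) has_derivative (\<lambda>h. 0)) (at x)"
      by (rule has_derivative_transform_within_open[of _ _ _ _ "- K"])
        (use that K in \<open>auto intro: compact_imp_closed\<close>)
    then show ?thesis using has_derivative_unique[OF d2] by metis
  qed
  have i3: "integrable lebesgue (\<lambda>x. V b \<epsilon> t x \<bullet> ?D2 j x (axis j 1))" for j
    by (rule integrable_inner_continuous_Cc[OF continuous_V_space(1) c2 K(1)]) (use z2 in auto)
  have e: "DM b \<epsilon> t x \<bullet> jacobian \<psi> (at x) = (\<Sum>j\<in>UNIV. DV b \<epsilon> t x (axis j 1) \<bullet> frechet_derivative \<psi> (at x) (axis j 1))" for x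
    unfolding inner_mat_columns column_matrix jacobian_test[OF \<psi>] ..
  show "integrable lebesgue (\<lambda>x. DM b \<epsilon> t x \<bullet> jacobian \<psi> (at x))"
    unfolding e by (intro Bochner_Integration.integrable_sum i1)
  have s1: "(LINT x|lebesgue. DM b \<epsilon> t x \<bullet> jacobian \<psi> (at x))
    = (\<Sum>j\<in>UNIV. LINT x|lebesgue. DV b \<epsilon> t x (axis j 1) \<bullet> frechet_derivative \<psi> (at x) (axis j 1))"
    unfolding e by (rule Bochner_Integration.integral_sum[OF i1])
  have p1: "(LINT x|lebesgue. D2V b \<epsilon> t x (axis j 1) (axis j 1) \<bullet> \<psi> x)
    = - (LINT x|lebesgue. DV b \<epsilon> t x (axis j 1) \<bullet> frechet_derivative \<psi> (at x) (axis j 1))" for j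
    by (rule integral_by_parts_compact[OF bounded_bilinear_inner DV_has_derivative d\<psi> continuous_D2V[OF a] c\<psi> K(1) _ a i2 i1])
      (use K in auto)
  have p2: "(LINT x|lebesgue. DV b \<epsilon> t x (axis j 1) \<bullet> frechet_derivative \<psi> (at x) (axis j 1))
    = - (LINT x|lebesgue. V b \<epsilon> t x \<bullet> ?D2 j x (axis j 1))" for j
    by (rule integral_by_parts_compact[OF bounded_bilinear_inner V_has_derivative d2 continuous_V_space(2) c2 K(1) _ a i1 i3])
      (use K in auto)
  have "LV b \<epsilon> t x \<bullet> \<psi> x = (\<Sum>j\<in>UNIV. D2V b \<epsilon> t x (axis j 1) (axis j 1) \<bullet> \<psi> x)" for x
    unfolding LV_eq[symmetric] sum_Basis_vec3 inner_sum_left ..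
  then have "(LINT x|lebesgue. LV b \<epsilon> t x \<bullet> \<psi> x) = (\<Sum>j\<in>UNIV. LINT x|lebesgue. D2V b \<epsilon> t x (axis j 1) (axis j 1) \<bullet> \<psi> x)"
    by (simp only: Bochner_Integration.integral_sum[OF i2])
  then show "(LINT x|lebesgue. DM b \<epsilon> t x \<bullet> jacobian \<psi> (at x)) = - (LINT x|lebesgue. LV b \<epsilon> t x \<bullet> \<psi> x)"
    unfolding s1 p1 by (simp add: sum_negf)
  have l: "V b \<epsilon> t x \<bullet> laplacian \<psi> x = (\<Sum>j\<in>UNIV. V b \<epsilon> t x \<bullet> ?D2 j x (axis j 1))" for x
    unfolding laplacian_def sum_Basis_vec3 inner_sum_right ..
  show "integrable lebesgue (\<lambda>x. V b \<epsilon> t x \<bullet> laplacian \<psi> x)"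
    unfolding l by (intro Bochner_Integration.integrable_sum i3)
  have "(LINT x|lebesgue. V b \<epsilon> t x \<bullet> laplacian \<psi> x) = (\<Sum>j\<in>UNIV. LINT x|lebesgue. V b \<epsilon> t x \<bullet> ?D2 j x (axis j 1))"
    unfolding l by (rule Bochner_Integration.integral_sum[OF i3])
  then show "(LINT x|lebesgue. DM b \<epsilon> t x \<bullet> jacobian \<psi> (at x)) = - (LINT x|lebesgue. V b \<epsilon> t x \<bullet> laplacian \<psi> x)"
    unfolding s1 p2 by (simp add: sum_negf)
qed

definition bnd :: real where "bnd = 6 * (23 * flat_const)\<^sup>2"

definition fields :: "(nat \<Rightarrow> real) \<Rightarrow> real \<Rightarrow> real \<Rightarrow> (real^3 \<Rightarrow> real^3) set" where
  "fields b \<epsilon> t = {V b \<epsilon> t, LV b \<epsilon> t, Vt b \<epsilon> t, VV b \<epsilon> t, force b \<epsilon> t} \<union> range (\<lambda>j x. DV b \<epsilon> t x (axis j 1))"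

lemma in_fields [simp]:
  "V b \<epsilon> t \<in> fields b \<epsilon> t" "LV b \<epsilon> t \<in> fields b \<epsilon> t" "Vt b \<epsilon> t \<in> fields b \<epsilon> t" "VV b \<epsilon> t \<in> fields b \<epsilon> t"
  "force b \<epsilon> t \<in> fields b \<epsilon> t" "(\<lambda>x. DV b \<epsilon> t x (axis j 1)) \<in> fields b \<epsilon> t"
  by (auto simp: fields_def)

lemma sol_bounds:
  assumes ad: "adm b \<epsilon>" and X: "X \<in> fields b \<epsilon> t"
  shows "integrable lebesgue X" "(LINT x|lebesgue. norm (X x)) \<le> bnd" "X \<in> Lp_space 2 lebesgue"
    "integrable lebesgue (\<lambda>x. (norm (X x))\<^sup>2)" "(LINT x|lebesgue. (norm (X x))\<^sup>2) \<le> bnd" "X \<in> borel_measurable lebesgue"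
proof -
  have e: "0 \<le> \<epsilon>" "\<epsilon> \<le> 1" using ad by (auto simp: adm_def)
  have "slice_bound \<epsilon> t X" using X slice_bound_fields[OF ad] by (auto simp: fields_def)
  from slice_bound_norms[OF this e] this
  show "integrable lebesgue X" "(LINT x|lebesgue. norm (X x)) \<le> bnd" "X \<in> Lp_space 2 lebesgue"
    "integrable lebesgue (\<lambda>x. (norm (X x))\<^sup>2)" "(LINT x|lebesgue. (norm (X x))\<^sup>2) \<le> bnd" "X \<in> borel_measurable lebesgue"
    by (auto simp: bnd_def slice_bound_def intro: measurable_lebesgue_borel)
qed

lemma DM_L2:
  assumes "adm b \<epsilon>"
  shows "DM b \<epsilon> t \<in> Lp_space 2 lebesgue" "(LINT x|lebesgue. (norm (DM b \<epsilon> t x))\<^sup>2) \<le> 3 * bnd"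
proof -
  have i: "integrable lebesgue (\<lambda>x. (norm (DV b \<epsilon> t x (axis j 1)))\<^sup>2)" "(LINT x|lebesgue. (norm (DV b \<epsilon> t x (axis j 1)))\<^sup>2) \<le> bnd" for j
    using sol_bounds(4,5)[OF assms in_fields(6)] by auto
  have "DM b \<epsilon> t \<in> borel_measurable lebesgue"
    by (rule measurable_columns) (simp add: column_matrix measurable_lebesgue_continuous continuous_V_space)
  then show "DM b \<epsilon> t \<in> Lp_space 2 lebesgue"
    using i(1) by (simp add: Lp_space_ereal_2 norm_mat_columns column_matrix)
  have "(LINT x|lebesgue. (norm (DM b \<epsilon> t x))\<^sup>2) = (\<Sum>j\<in>UNIV. LINT x|lebesgue. (norm (DV b \<epsilon> t x (axis j 1)))\<^sup>2)"
    unfolding norm_mat_columns column_matrix by (rule Bochner_Integration.integral_sum[OF i(1)])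
  also have "\<dots> \<le> (\<Sum>j\<in>(UNIV :: 3 set). bnd)" by (intro sum_mono i(2))
  also have "\<dots> = 3 * bnd" by simp
  finally show "(LINT x|lebesgue. (norm (DM b \<epsilon> t x))\<^sup>2) \<le> 3 * bnd" .
qed

text \<open>\<open>Y\<close> stands for the time derivative of the test field. By the definition of
  \<open>force\<close> everything cancels except Vt . \<psi> + V . Y, which is the time derivative
  of V . \<psi>. Both weak formulations leave the same remainder.\<close>

lemma V_weak_form_space:
  assumes ad: "adm b \<epsilon>" and \<psi>: "\<psi> \<in> Cc_infty UNIV" and Y: "Y \<in> borel_measurable lebesgue" "\<And>x. norm (Y x) \<le> C"
  shows "(LINT x|lebesgue. weak_jacobian (V b \<epsilon> t) x \<bullet> jacobian \<psi> (at x) + (weak_jacobian (V b \<epsilon> t) x *v V b \<epsilon> t x) \<bullet> \<psi> x - V b \<epsilon> t x \<bullet> Y x)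
      = (LINT x|lebesgue. force b \<epsilon> t x \<bullet> \<psi> x) - (LINT x|lebesgue. Vt b \<epsilon> t x \<bullet> \<psi> x + V b \<epsilon> t x \<bullet> Y x)"
    "(LINT x|lebesgue. - (V b \<epsilon> t x \<bullet> Y x) - V b \<epsilon> t x \<bullet> laplacian \<psi> x + (weak_jacobian (V b \<epsilon> t) x *v V b \<epsilon> t x) \<bullet> \<psi> x)
      = (LINT x|lebesgue. force b \<epsilon> t x \<bullet> \<psi> x) - (LINT x|lebesgue. Vt b \<epsilon> t x \<bullet> \<psi> x + V b \<epsilon> t x \<bullet> Y x)"
proof -
  note L2 = Cc_infty_L2[OF \<psi>]
  have i: "integrable lebesgue (\<lambda>x. VV b \<epsilon> t x \<bullet> \<psi> x)" "integrable lebesgue (\<lambda>x. LV b \<epsilon> t x \<bullet> \<psi> x)" "integrable lebesgue (\<lambda>x. Vt b \<epsilon> t x \<bullet> \<psi> x)"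
    using L2_inner(1)[OF sol_bounds(3)[OF ad in_fields(4)] L2] L2_inner(1)[OF sol_bounds(3)[OF ad in_fields(2)] L2]
      L2_inner(1)[OF sol_bounds(3)[OF ad in_fields(3)] L2] by auto
  have iY: "integrable lebesgue (\<lambda>x. V b \<epsilon> t x \<bullet> Y x)"
    by (rule L1_bounded_inner(1)[OF sol_bounds(1)[OF ad in_fields(1)] Y])
  note ib = V_integral_by_parts[OF \<psi>, of b \<epsilon> t]
  have f: "(LINT x|lebesgue. force b \<epsilon> t x \<bullet> \<psi> x) = (LINT x|lebesgue. Vt b \<epsilon> t x \<bullet> \<psi> x) - (LINT x|lebesgue. LV b \<epsilon> t x \<bullet> \<psi> x) + (LINT x|lebesgue. VV b \<epsilon> t x \<bullet> \<psi> x)"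
    using i by (simp add: force_def inner_add_left inner_diff_left)
  have g: "(LINT x|lebesgue. Vt b \<epsilon> t x \<bullet> \<psi> x + V b \<epsilon> t x \<bullet> Y x) = (LINT x|lebesgue. Vt b \<epsilon> t x \<bullet> \<psi> x) + (LINT x|lebesgue. V b \<epsilon> t x \<bullet> Y x)"
    using i iY by simp
  note ae = weak_jacobian_V[of b \<epsilon> t]
  have c1: "(LINT x|lebesgue. weak_jacobian (V b \<epsilon> t) x \<bullet> jacobian \<psi> (at x) + (weak_jacobian (V b \<epsilon> t) x *v V b \<epsilon> t x) \<bullet> \<psi> x - V b \<epsilon> t x \<bullet> Y x)
    = (LINT x|lebesgue. DM b \<epsilon> t x \<bullet> jacobian \<psi> (at x) + VV b \<epsilon> t x \<bullet> \<psi> x - V b \<epsilon> t x \<bullet> Y x)"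
    by (rule integral_cong_AE_lebesgue(1)) (use ae in \<open>eventually_elim, simp add: DM_mult VV_def\<close>)
  show "(LINT x|lebesgue. weak_jacobian (V b \<epsilon> t) x \<bullet> jacobian \<psi> (at x) + (weak_jacobian (V b \<epsilon> t) x *v V b \<epsilon> t x) \<bullet> \<psi> x - V b \<epsilon> t x \<bullet> Y x)
      = (LINT x|lebesgue. force b \<epsilon> t x \<bullet> \<psi> x) - (LINT x|lebesgue. Vt b \<epsilon> t x \<bullet> \<psi> x + V b \<epsilon> t x \<bullet> Y x)"
    unfolding c1 f g using i iY ib(1,2) by simp
  have c2: "(LINT x|lebesgue. - (V b \<epsilon> t x \<bullet> Y x) - V b \<epsilon> t x \<bullet> laplacian \<psi> x + (weak_jacobian (V b \<epsilon> t) x *v V b \<epsilon> t x) \<bullet> \<psi> x)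
    = (LINT x|lebesgue. - (V b \<epsilon> t x \<bullet> Y x) - V b \<epsilon> t x \<bullet> laplacian \<psi> x + VV b \<epsilon> t x \<bullet> \<psi> x)"
    by (rule integral_cong_AE_lebesgue(1)) (use ae in \<open>eventually_elim, simp add: DM_mult VV_def\<close>)
  show "(LINT x|lebesgue. - (V b \<epsilon> t x \<bullet> Y x) - V b \<epsilon> t x \<bullet> laplacian \<psi> x + (weak_jacobian (V b \<epsilon> t) x *v V b \<epsilon> t x) \<bullet> \<psi> x)
      = (LINT x|lebesgue. force b \<epsilon> t x \<bullet> \<psi> x) - (LINT x|lebesgue. Vt b \<epsilon> t x \<bullet> \<psi> x + V b \<epsilon> t x \<bullet> Y x)"
    unfolding c2 f g using i iY ib(2,3,4) by simp
qed

end

lemma measurable_Lp_norm: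
  fixes F :: "real \<Rightarrow> 'a::euclidean_space \<Rightarrow> 'b::euclidean_space"
  assumes "(\<lambda>(t, x). F t x) \<in> borel_measurable (borel \<Otimes>\<^sub>M borel)"
  shows "(\<lambda>t. Lp_norm p (F t)) \<in> borel_measurable borel"
proof -
  have [measurable]: "(\<lambda>z. F (fst z) (snd z)) \<in> borel_measurable (borel \<Otimes>\<^sub>M borel)"
    using assms by (simp add: case_prod_beta')
  have "(\<lambda>z. norm (F (fst z) (snd z)) powr p) \<in> borel_measurable (borel \<Otimes>\<^sub>M borel)" by measurable
  then have "(\<lambda>(t, x). norm (F t x) powr p) \<in> borel_measurable (borel \<Otimes>\<^sub>M borel)" by (simp add: case_prod_beta')
  from time_integral_measurable[OF this] show ?thesis unfolding Lp_norm_def by measurable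
qed

lemma bounded_Lp_space_time:
  assumes m: "g \<in> borel_measurable (time S)" and b: "AE t in time S. \<bar>g t\<bar> \<le> (C :: real)" and p: "p = \<infinity> \<or> 0 \<le> p"
  shows "g \<in> Lp_space p (time S)"
proof (cases "p = \<infinity>")
  case True then show ?thesis using m b by (auto simp: Lp_space_def)
next
  case False
  then have p0: "0 \<le> real_of_ereal p" using p by (simp add: real_of_ereal_pos)
  have "integrable (time S) (\<lambda>t. norm (g t) powr real_of_ereal p)"
  proof (rule integrable_time_bounded)
    show "(\<lambda>t. norm (g t) powr real_of_ereal p) \<in> borel_measurable (time S)" using m by measurable
    show "AE t in time S. norm (norm (g t) powr real_of_ereal p) \<le> C powr real_of_ereal p"
      using b by eventually_elim (auto intro: powr_mono2 p0)
  qed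
  then show ?thesis using False m by (simp add: Lp_space_def)
qed

lemma Bochner_bounded:
  fixes F :: "real \<Rightarrow> real^3 \<Rightarrow> 'b::euclidean_space"
  assumes F: "(\<lambda>(t, x). F t x) \<in> borel_measurable (borel \<Otimes>\<^sub>M borel)" and X: "\<And>t. F t \<in> X"
    and m: "(\<lambda>t. nrm (F t)) \<in> borel_measurable borel" and b: "\<And>t. \<bar>nrm (F t)\<bar> \<le> C" and p: "p = \<infinity> \<or> 0 \<le> p"
  shows "F \<in> Bochner p S X nrm"
  using joint_measurable_lebesgue_on[OF F] X bounded_Lp_space_time[OF time_measurable[OF m] AE_I2[OF b] p]
  by (simp add: Bochner_def)

lemma frechet_derivative_expand:
  fixes \<phi> :: "real^3 \<Rightarrow> 'b::euclidean_space"
  assumes "\<phi> \<in> Cc_infty UNIV"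
  shows "frechet_derivative \<phi> (at x) v = (\<Sum>j\<in>UNIV. (v $ j) *\<^sub>R frechet_derivative \<phi> (at x) (axis j 1))"
proof -
  have "linear (frechet_derivative \<phi> (at x))" using Cc_inftyD(3)[OF assms] by (rule has_derivative_linear)
  from linear_sum_Basis[OF this, of v] show ?thesis by (simp add: sum_Basis_vec3 inner_axis)
qed

lemma sqrt_le_of_sq: "0 \<le> x \<Longrightarrow> x\<^sup>2 \<le> c \<Longrightarrow> \<bar>x\<bar> \<le> sqrt (c :: real)"
  using real_le_rsqrt[of x c] by simp

context swirl_flow
begin

lemma Lp_norm_2_le: "adm b \<epsilon> \<Longrightarrow> X \<in> fields b \<epsilon> t \<Longrightarrow> \<bar>Lp_norm 2 X\<bar> \<le> sqrt bnd"
  by (rule sqrt_le_of_sq[OF Lp_norm_nonneg]) (simp add: Lp_norm_2_sq sol_bounds(5))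

lemma V_in_Lp_sigma:
  assumes ad: "adm b \<epsilon>"
  shows "V b \<epsilon> t \<in> Lp_sigma 2"
proof -
  have "(LINT x|lebesgue. frechet_derivative \<phi> (at x) (V b \<epsilon> t x)) = 0" if \<phi>: "\<phi> \<in> Cc_infty UNIV" for \<phi> :: "real^3 \<Rightarrow> real"
  proof -
    obtain K where K: "compact K" "\<And>x. x \<notin> K \<Longrightarrow> \<phi> x = 0 \<and> frechet_derivative \<phi> (at x) = (\<lambda>h. 0)"
      using Cc_inftyD(5)[OF \<phi>] by blast
    note a = axis_in_Basis
    have dj: "((\<lambda>x. V b \<epsilon> t x $ j) has_derivative (\<lambda>h. DV b \<epsilon> t x h $ j)) (at x)" for j x
      by (rule bounded_linear.has_derivative[OF bounded_linear_vec_nth V_has_derivative])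
    have cj: "continuous_on UNIV (\<lambda>x. DV b \<epsilon> t x h $ j)" for h j
      by (intro continuous_intros continuous_V_space)
    have cV: "continuous_on UNIV (\<lambda>x. V b \<epsilon> t x $ j)" for j
      by (intro continuous_intros continuous_V_space)
    have i1: "integrable lebesgue (\<lambda>x. V b \<epsilon> t x $ j * frechet_derivative \<phi> (at x) (axis j 1))" for j
      by (rule integrable_lebesgue_continuous_compact[OF _ K(1)])
        (use K Cc_inftyD(4)[OF \<phi> a] in \<open>auto intro!: continuous_intros continuous_V_space\<close>)
    have i2: "integrable lebesgue (\<lambda>x. DV b \<epsilon> t x (axis j 1) $ j * \<phi> x)" for j
      by (rule integrable_lebesgue_continuous_compact[OF _ K(1)])
        (use K Cc_inftyD(2)[OF \<phi>] in \<open>auto intro!: continuous_intros continuous_V_space\<close>)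
    have p: "(LINT x|lebesgue. DV b \<epsilon> t x (axis j 1) $ j * \<phi> x) = - (LINT x|lebesgue. V b \<epsilon> t x $ j * frechet_derivative \<phi> (at x) (axis j 1))" for j
      by (rule integral_by_parts_compact[OF bounded_bilinear_mult dj Cc_inftyD(3)[OF \<phi>] cj Cc_inftyD(4)[OF \<phi> a] K(1) _ a i2 i1])
        (use K in auto)
    have "(LINT x|lebesgue. frechet_derivative \<phi> (at x) (V b \<epsilon> t x))
      = (LINT x|lebesgue. (\<Sum>j\<in>UNIV. V b \<epsilon> t x $ j * frechet_derivative \<phi> (at x) (axis j 1)))"
      by (subst frechet_derivative_expand[OF \<phi>]) simp
    also have "\<dots> = (\<Sum>j\<in>UNIV. LINT x|lebesgue. V b \<epsilon> t x $ j * frechet_derivative \<phi> (at x) (axis j 1))"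
      by (rule Bochner_Integration.integral_sum[OF i1])
    also have "\<dots> = - (\<Sum>j\<in>UNIV. LINT x|lebesgue. DV b \<epsilon> t x (axis j 1) $ j * \<phi> x)"
      unfolding p by (simp add: sum_negf)
    also have "(\<Sum>j\<in>UNIV. LINT x|lebesgue. DV b \<epsilon> t x (axis j 1) $ j * \<phi> x) = (LINT x|lebesgue. (\<Sum>j\<in>UNIV. DV b \<epsilon> t x (axis j 1) $ j) * \<phi> x)"
      unfolding sum_distrib_right by (rule Bochner_Integration.integral_sum[OF i2, symmetric])
    finally show ?thesis by (simp add: DV_divergence)
  qed
  then show ?thesis using sol_bounds(3)[OF ad in_fields(1)] by (simp add: Lp_sigma_def)
qed

lemma V_in_H1: "adm b \<epsilon> \<Longrightarrow> V b \<epsilon> t \<in> H1"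
  unfolding H1_def One_nat_def Sobolev.simps mem_Collect_eq
proof (intro conjI ballI)
  assume ad: "adm b \<epsilon>"
  show "V b \<epsilon> t \<in> Lp_space 2 lebesgue" by (rule sol_bounds(3)[OF ad in_fields(1)])
  fix h :: "real^3" assume "h \<in> Basis"
  then obtain j where h: "h = axis j 1" unfolding Basis_vec3 by auto
  show "\<exists>g\<in>Lp_space 2 lebesgue. weak_pderiv h (V b \<epsilon> t) g"
    unfolding h
  proof (rule bexI)
    show "weak_pderiv (axis j 1) (V b \<epsilon> t) (\<lambda>x. DV b \<epsilon> t x (axis j 1))"
      by (rule weak_pderiv_classical[OF V_has_derivative continuous_V_space(2) axis_in_Basis])
    show "(\<lambda>x. DV b \<epsilon> t x (axis j 1)) \<in> Lp_space 2 lebesgue" by (rule sol_bounds(3)[OF ad in_fields(6)])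
  qed
qed

lemma Lp_norm_weak_jacobian_V:
  assumes "adm b \<epsilon>"
  shows "Lp_norm 2 (weak_jacobian (V b \<epsilon> t)) = Lp_norm 2 (DM b \<epsilon> t)"
proof (rule Lp_norm_cong[symmetric])
  show "AE x in lebesgue. DM b \<epsilon> t x = weak_jacobian (V b \<epsilon> t) x"
    using weak_jacobian_V[of b \<epsilon> t] by eventually_elim simp
  show "DM b \<epsilon> t \<in> borel_measurable lebesgue" using DM_L2(1)[OF assms] by (simp add: Lp_space_ereal_2)
qed

lemma DM_norm: "(LINT x|lebesgue. (norm (DM b \<epsilon> t x))\<^sup>2) = - (LINT x|lebesgue. LV b \<epsilon> t x \<bullet> V b \<epsilon> t x)"
  if "adm b \<epsilon>"
proof -
  have "DM b \<epsilon> t x \<bullet> jacobian (V b \<epsilon> t) (at x) = (norm (DM b \<epsilon> t x))\<^sup>2" for x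
    by (simp add: jacobian_def frechet_derivative_eq[OF V_has_derivative] power2_norm_eq_inner)
  then show ?thesis using V_integral_by_parts(2)[OF V_test_functions(1)[OF that], of b \<epsilon> t t] by simp
qed

lemma DM_norm_measurable: "(\<lambda>t. LINT x|lebesgue. (norm (DM b \<epsilon> t x))\<^sup>2) \<in> borel_measurable borel"
proof (rule time_integral_measurable)
  have "(\<lambda>z. \<Sum>j\<in>UNIV. (norm (DV b \<epsilon> (fst z) (snd z) (axis j 1)))\<^sup>2) \<in> borel_measurable (borel \<Otimes>\<^sub>M borel)"
    using joint_measurable(2)[of b \<epsilon>] by (intro borel_measurable_sum borel_measurable_power borel_measurable_norm) (simp add: case_prod_beta')
  then show "(\<lambda>(t, x). (norm (DM b \<epsilon> t x))\<^sup>2) \<in> borel_measurable (borel \<Otimes>\<^sub>M borel)"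
    by (simp add: norm_mat_columns column_matrix case_prod_beta')
qed

lemma V_Bochner:
  assumes ad: "adm b \<epsilon>"
  shows "V b \<epsilon> \<in> Bochner \<infinity> S (Lp_sigma 2) (Lp_norm 2)" "V b \<epsilon> \<in> Bochner 2 S H1 H1_norm"
proof -
  show "V b \<epsilon> \<in> Bochner \<infinity> S (Lp_sigma 2) (Lp_norm 2)"
    by (rule Bochner_bounded[OF joint_measurable(1) V_in_Lp_sigma[OF ad] measurable_Lp_norm[OF joint_measurable(1)] Lp_norm_2_le[OF ad in_fields(1)]]) simp
  have eq: "H1_norm (V b \<epsilon> t) = sqrt ((Lp_norm 2 (V b \<epsilon> t))\<^sup>2 + (LINT x|lebesgue. (norm (DM b \<epsilon> t x))\<^sup>2))" for t
    unfolding H1_norm_def Lp_norm_weak_jacobian_V[OF ad] Lp_norm_2_sq ..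
  show "V b \<epsilon> \<in> Bochner 2 S H1 H1_norm"
  proof (rule Bochner_bounded[OF joint_measurable(1) V_in_H1[OF ad]])
    show "(\<lambda>t. H1_norm (V b \<epsilon> t)) \<in> borel_measurable borel"
      unfolding eq using measurable_Lp_norm[OF joint_measurable(1)] DM_norm_measurable by measurable
    show "\<bar>H1_norm (V b \<epsilon> t)\<bar> \<le> sqrt (4 * bnd)" for t
    proof (rule sqrt_le_of_sq)
      show "(H1_norm (V b \<epsilon> t))\<^sup>2 \<le> 4 * bnd"
        using sol_bounds(5)[OF ad in_fields(1), of t] DM_L2(2)[OF ad, of t] Lp_norm_2_sq[of "weak_jacobian (V b \<epsilon> t)"]
          Lp_norm_2_sq[of "DM b \<epsilon> t"] Lp_norm_weak_jacobian_V[OF ad, of t] by (simp add: H1_norm_sq)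
    qed (simp add: H1_norm_def)
  qed simp
qed

lemma V_time_integral_by_parts:
  assumes ad: "adm b \<epsilon>" and S: "S > 0" and A: "{0<..<S} \<times> UNIV \<subseteq> A" "A \<subseteq> {0..<S} \<times> UNIV" "A \<in> sets borel"
    and \<phi>: "(\<lambda>(t, x). \<phi> t x) \<in> Cc_infty A"
  shows "(LINT t|time S. LINT x|lebesgue. Vt b \<epsilon> t x \<bullet> \<phi> t x + V b \<epsilon> t x \<bullet> vector_derivative (\<lambda>s. \<phi> s x) (at t)) = 0"
    and "integrable (time S) (\<lambda>t. LINT x|lebesgue. Vt b \<epsilon> t x \<bullet> \<phi> t x + V b \<epsilon> t x \<bullet> vector_derivative (\<lambda>s. \<phi> s x) (at t))"
    and "integrable (time S) (\<lambda>t. LINT x|lebesgue. force b \<epsilon> t x \<bullet> \<phi> t x)"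
proof -
  obtain C S' where S': "S' < S" and C: "C \<ge> 0" "\<And>t x. norm (\<phi> t x) \<le> C" and z: "\<And>t x. S' \<le> t \<Longrightarrow> \<phi> t x = 0"
    and Ct: "\<And>t x. 0 < t \<Longrightarrow> t < S \<Longrightarrow> norm (vector_derivative (\<lambda>s. \<phi> s x) (at t)) \<le> C"
    and dt: "\<And>t x. 0 < t \<Longrightarrow> t < S \<Longrightarrow> ((\<lambda>s. \<phi> s x) has_vector_derivative vector_derivative (\<lambda>s. \<phi> s x) (at t)) (at t)"
    and m1: "(\<lambda>(t, x). \<phi> t x) \<in> borel_measurable (borel \<Otimes>\<^sub>M borel)"
    and m2: "(\<lambda>(t, x). indicator {0<..<S} t *\<^sub>R vector_derivative (\<lambda>s. \<phi> s x) (at t)) \<in> borel_measurable (borel \<Otimes>\<^sub>M borel)"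
    by (rule test_field[OF A \<phi> S]) blast
  define Y where "Y = (\<lambda>t x. indicator {0<..<S} t *\<^sub>R vector_derivative (\<lambda>s. \<phi> s x) (at t))"
  have Yb: "norm (Y t x) \<le> C" for t x using Ct[of t x] C(1) by (auto simp: Y_def indicator_def)
  have YS: "Y t x = vector_derivative (\<lambda>s. \<phi> s x) (at t)" if "0 < t" "t < S" for t x using that by (simp add: Y_def)
  have ms: "\<phi> t \<in> borel_measurable lebesgue" "Y t \<in> borel_measurable lebesgue" for t
    using section_measurable(2)[OF m1] section_measurable(2)[OF m2] by (auto simp: Y_def)
  define Ht where "Ht = (\<lambda>t x. Vt b \<epsilon> t x \<bullet> \<phi> t x + V b \<epsilon> t x \<bullet> Y t x)"
  have mH: "(\<lambda>(t, x). Ht t x) \<in> borel_measurable (borel \<Otimes>\<^sub>M borel)"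
    unfolding Ht_def case_prod_beta'
    by (intro borel_measurable_add borel_measurable_inner joint_measurable[of b \<epsilon>, unfolded case_prod_beta']
        m1[unfolded case_prod_beta'] m2[folded Y_def, unfolded case_prod_beta'])
  have i: "integrable lebesgue (\<lambda>x. Vt b \<epsilon> t x \<bullet> \<phi> t x)" "integrable lebesgue (\<lambda>x. V b \<epsilon> t x \<bullet> Y t x)"
    "(LINT x|lebesgue. \<bar>Vt b \<epsilon> t x \<bullet> \<phi> t x\<bar>) \<le> C * bnd" "(LINT x|lebesgue. \<bar>V b \<epsilon> t x \<bullet> Y t x\<bar>) \<le> C * bnd" for t
    using L1_bounded_inner[OF sol_bounds(1)[OF ad in_fields(3)] ms(1) C(2), of t t] mult_left_mono[OF sol_bounds(2)[OF ad in_fields(3), of t] C(1)]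
      L1_bounded_inner[OF sol_bounds(1)[OF ad in_fields(1)] ms(2) Yb, of t t] mult_left_mono[OF sol_bounds(2)[OF ad in_fields(1), of t] C(1)]
    by auto
  have iH: "integrable lebesgue (Ht t)" for t unfolding Ht_def using i by (intro Bochner_Integration.integrable_add)
  have K: "(LINT x|lebesgue. norm (Ht t x)) \<le> 2 * C * bnd" for t
  proof -
    have "(LINT x|lebesgue. norm (Ht t x)) \<le> (LINT x|lebesgue. \<bar>Vt b \<epsilon> t x \<bullet> \<phi> t x\<bar> + \<bar>V b \<epsilon> t x \<bullet> Y t x\<bar>)"
      using i iH by (intro integral_mono) (auto simp: Ht_def)
    also have "\<dots> = (LINT x|lebesgue. \<bar>Vt b \<epsilon> t x \<bullet> \<phi> t x\<bar>) + (LINT x|lebesgue. \<bar>V b \<epsilon> t x \<bullet> Y t x\<bar>)"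
      using i by simp
    also have "\<dots> \<le> 2 * C * bnd" using i(3,4)[of t] by simp
    finally show ?thesis .
  qed
  have eqH: "(LINT x|lebesgue. Vt b \<epsilon> t x \<bullet> \<phi> t x + V b \<epsilon> t x \<bullet> vector_derivative (\<lambda>s. \<phi> s x) (at t)) = (LINT x|lebesgue. Ht t x)"
    if "0 < t" "t < S" for t using that by (simp add: Ht_def YS)
  have dH: "((\<lambda>s. V b \<epsilon> s x \<bullet> \<phi> s x) has_real_derivative Ht t x) (at t)" if "0 < t" "t < S" for t x
  proof -
    have "((\<lambda>s. V b \<epsilon> s x) has_derivative (\<lambda>h. h *\<^sub>R Vt b \<epsilon> t x)) (at t)"
      using V_time_derivative[of \<epsilon> b x t] ad by (simp add: has_vector_derivative_def adm_def)
    moreover have "((\<lambda>s. \<phi> s x) has_derivative (\<lambda>h. h *\<^sub>R Y t x)) (at t)"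
      using dt[OF that] YS[OF that] by (simp add: has_vector_derivative_def)
    ultimately have "((\<lambda>s. V b \<epsilon> s x \<bullet> \<phi> s x) has_derivative (\<lambda>h. V b \<epsilon> t x \<bullet> (h *\<^sub>R Y t x) + (h *\<^sub>R Vt b \<epsilon> t x) \<bullet> \<phi> t x)) (at t)"
      by (rule has_derivative_inner)
    then show ?thesis unfolding has_field_derivative_def
      by (rule has_derivative_eq_rhs) (auto simp: Ht_def algebra_simps)
  qed
  have cH: "continuous_on {0..S} (\<lambda>t. V b \<epsilon> t x \<bullet> \<phi> t x)" for x
  proof (intro continuous_at_imp_continuous_on ballI)
    fix t assume t: "t \<in> {0..S}"
    have loc: "isCont (\<lambda>t. V b \<epsilon> t x \<bullet> \<phi> t x) t" if "open U" "t \<in> U" "\<And>s. s \<in> U \<Longrightarrow> V b \<epsilon> s x \<bullet> \<phi> s x = 0" for U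
    proof -
      have "\<forall>\<^sub>F s in nhds t. V b \<epsilon> s x \<bullet> \<phi> s x = 0" using that unfolding eventually_nhds by blast
      from isCont_cong[OF this] show ?thesis by simp
    qed
    consider "t = 0" | "t = S" | "0 < t" "t < S" using t by force
    then show "isCont (\<lambda>t. V b \<epsilon> t x \<bullet> \<phi> t x) t"
    proof cases
      case 1 then show ?thesis using T early_zero[OF ad] by (intro loc[of "{..<T/4}"]) auto
    next
      case 2 then show ?thesis using S' z by (intro loc[of "{S'<..}"]) auto
    next
      case 3 then show ?thesis using dH by (blast intro: DERIV_isCont)
    qed
  qed
  have "(LINT t|time S. LINT x|lebesgue. Ht t x) = (LINT x|lebesgue. V b \<epsilon> S x \<bullet> \<phi> S x - V b \<epsilon> 0 x \<bullet> \<phi> 0 x)"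
    by (rule time_FTC[OF _ mH iH K cH dH]) (use S in auto)
  also have "\<dots> = 0" using z[of S] S' early_zero[OF ad, of 0] T by simp
  finally have "(LINT t|time S. LINT x|lebesgue. Ht t x) = 0" .
  moreover have ae: "AE t in time S. (LINT x|lebesgue. Vt b \<epsilon> t x \<bullet> \<phi> t x + V b \<epsilon> t x \<bullet> vector_derivative (\<lambda>s. \<phi> s x) (at t)) = (LINT x|lebesgue. Ht t x)"
    by (rule AE_timeI) (rule eqH)
  ultimately show "(LINT t|time S. LINT x|lebesgue. Vt b \<epsilon> t x \<bullet> \<phi> t x + V b \<epsilon> t x \<bullet> vector_derivative (\<lambda>s. \<phi> s x) (at t)) = 0"
    using integral_cong_AE_time(1)[OF ae] by simp
  have "integrable (time S) (\<lambda>t. LINT x|lebesgue. Ht t x)"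
  proof (rule integrable_time_bounded)
    show "(\<lambda>t. LINT x|lebesgue. Ht t x) \<in> borel_measurable (time S)"
      by (intro time_measurable time_integral_measurable mH)
    show "AE t in time S. norm (LINT x|lebesgue. Ht t x) \<le> 2 * C * bnd"
      using K integral_norm_bound[of lebesgue] by (intro AE_I2) (blast intro: order_trans)
  qed
  then show "integrable (time S) (\<lambda>t. LINT x|lebesgue. Vt b \<epsilon> t x \<bullet> \<phi> t x + V b \<epsilon> t x \<bullet> vector_derivative (\<lambda>s. \<phi> s x) (at t))"
    using integral_cong_AE_time(2)[OF ae] by simp
  show "integrable (time S) (\<lambda>t. LINT x|lebesgue. force b \<epsilon> t x \<bullet> \<phi> t x)"
  proof (rule integrable_time_bounded)
    have "(\<lambda>(t, x). force b \<epsilon> t x \<bullet> \<phi> t x) \<in> borel_measurable (borel \<Otimes>\<^sub>M borel)"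
      unfolding case_prod_beta'
      by (intro borel_measurable_inner joint_measurable_force[of b \<epsilon>, unfolded case_prod_beta'] m1[unfolded case_prod_beta'])
    then show "(\<lambda>t. LINT x|lebesgue. force b \<epsilon> t x \<bullet> \<phi> t x) \<in> borel_measurable (time S)"
      by (intro time_measurable time_integral_measurable)
    have "norm (LINT x|lebesgue. force b \<epsilon> t x \<bullet> \<phi> t x) \<le> C * bnd" for t
      using L1_bounded_inner(2)[OF sol_bounds(1)[OF ad in_fields(5)] ms(1) C(2), of t t]
        mult_left_mono[OF sol_bounds(2)[OF ad in_fields(5), of t] C(1)] by simp
    then show "AE t in time S. norm (LINT x|lebesgue. force b \<epsilon> t x \<bullet> \<phi> t x) \<le> C * bnd" by simp
  qed
qed

definition pairing :: "(nat \<Rightarrow> real) \<Rightarrow> real \<Rightarrow> real \<Rightarrow> (real^3 \<Rightarrow> real^3) \<Rightarrow> real" where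
  "pairing b \<epsilon> t v = (LINT x|lebesgue. force b \<epsilon> t x \<bullet> v x)"

lemma V_weak_form:
  assumes ad: "adm b \<epsilon>" and S: "S > 0" and \<phi>: "\<phi> \<in> D_space S"
  shows "(LINT t|time S. LINT x|lebesgue. weak_jacobian (V b \<epsilon> t) x \<bullet> jacobian (\<phi> t) (at x)
       + (weak_jacobian (V b \<epsilon> t) x *v V b \<epsilon> t x) \<bullet> \<phi> t x - V b \<epsilon> t x \<bullet> vector_derivative (\<lambda>s. \<phi> s x) (at t))
     = (LINT t|time S. pairing b \<epsilon> t (\<phi> t))"
proof -
  let ?A = "{0..<S} \<times> (UNIV :: (real^3) set)"
  have A: "{0<..<S} \<times> UNIV \<subseteq> ?A" "?A \<subseteq> {0..<S} \<times> UNIV" "?A \<in> sets borel"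
    by (auto simp: borel_prod[symmetric])
  have \<phi>': "(\<lambda>(t, x). \<phi> t x) \<in> Cc_infty ?A" using \<phi> by (simp add: D_space_def)
  note ti = V_time_integral_by_parts[OF ad S A \<phi>']
  obtain C where C: "\<And>t x. 0 < t \<Longrightarrow> t < S \<Longrightarrow> norm (vector_derivative (\<lambda>s. \<phi> s x) (at t)) \<le> C"
    and tst: "\<And>t. 0 < t \<Longrightarrow> t < S \<Longrightarrow> \<phi> t \<in> Cc_infty UNIV"
    and m: "(\<lambda>(t, x). indicator {0<..<S} t *\<^sub>R vector_derivative (\<lambda>s. \<phi> s x) (at t)) \<in> borel_measurable (borel \<Otimes>\<^sub>M borel)"
    by (rule test_field[OF A \<phi>' S]) blast
  have mt: "(\<lambda>x. vector_derivative (\<lambda>s. \<phi> s x) (at t)) \<in> borel_measurable lebesgue" if "0 < t" "t < S" for t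
    using section_measurable(2)[OF m, of t] that by simp
  have "(LINT t|time S. LINT x|lebesgue. weak_jacobian (V b \<epsilon> t) x \<bullet> jacobian (\<phi> t) (at x)
       + (weak_jacobian (V b \<epsilon> t) x *v V b \<epsilon> t x) \<bullet> \<phi> t x - V b \<epsilon> t x \<bullet> vector_derivative (\<lambda>s. \<phi> s x) (at t))
    = (LINT t|time S. pairing b \<epsilon> t (\<phi> t) - (LINT x|lebesgue. Vt b \<epsilon> t x \<bullet> \<phi> t x + V b \<epsilon> t x \<bullet> vector_derivative (\<lambda>s. \<phi> s x) (at t)))"
    by (rule integral_cong_AE_time(1), rule AE_timeI, unfold pairing_def, rule V_weak_form_space(1)[OF ad])
      (use tst mt C in auto)
  also have "\<dots> = (LINT t|time S. pairing b \<epsilon> t (\<phi> t))"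
    using ti by (simp add: pairing_def)
  finally show ?thesis .
qed

lemma V_associated_pressure:
  assumes ad: "adm b \<epsilon>"
  shows "associated_pressure (pairing b \<epsilon>) (V b \<epsilon>) (\<lambda>t x. 0)"
  unfolding associated_pressure_def
proof (intro allI impI conjI)
  fix S :: real assume S: "S > 0"
  show "(\<lambda>(t, x). 0) \<in> L1_loc ({0<..<S} \<times> (UNIV :: (real^3) set))"
    by (simp add: L1_loc_def set_integrable_def case_prod_beta')
  fix \<phi> :: "real \<Rightarrow> real^3 \<Rightarrow> real^3"
  let ?A = "{0<..<S} \<times> (UNIV :: (real^3) set)"
  assume \<phi>': "(\<lambda>(t, x). \<phi> t x) \<in> Cc_infty ?A"
  have A: "{0<..<S} \<times> UNIV \<subseteq> ?A" "?A \<subseteq> {0..<S} \<times> UNIV" "?A \<in> sets borel"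
    by (auto simp: borel_prod[symmetric])
  note ti = V_time_integral_by_parts[OF ad S A \<phi>']
  obtain C where C: "\<And>t x. 0 < t \<Longrightarrow> t < S \<Longrightarrow> norm (vector_derivative (\<lambda>s. \<phi> s x) (at t)) \<le> C"
    and tst: "\<And>t. 0 < t \<Longrightarrow> t < S \<Longrightarrow> \<phi> t \<in> Cc_infty UNIV"
    and m: "(\<lambda>(t, x). indicator {0<..<S} t *\<^sub>R vector_derivative (\<lambda>s. \<phi> s x) (at t)) \<in> borel_measurable (borel \<Otimes>\<^sub>M borel)"
    by (rule test_field[OF A \<phi>' S]) blast
  have mt: "(\<lambda>x. vector_derivative (\<lambda>s. \<phi> s x) (at t)) \<in> borel_measurable lebesgue" if "0 < t" "t < S" for t
    using section_measurable(2)[OF m, of t] that by simp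
  have "(LINT t|time S. LINT x|lebesgue. - (V b \<epsilon> t x \<bullet> vector_derivative (\<lambda>s. \<phi> s x) (at t)) - V b \<epsilon> t x \<bullet> laplacian (\<phi> t) x
       + (weak_jacobian (V b \<epsilon> t) x *v V b \<epsilon> t x) \<bullet> \<phi> t x - 0 * divergence (\<phi> t) x)
    = (LINT t|time S. pairing b \<epsilon> t (\<phi> t) - (LINT x|lebesgue. Vt b \<epsilon> t x \<bullet> \<phi> t x + V b \<epsilon> t x \<bullet> vector_derivative (\<lambda>s. \<phi> s x) (at t)))"
    unfolding mult_zero_left diff_0_right
    by (rule integral_cong_AE_time(1), rule AE_timeI, unfold pairing_def, rule V_weak_form_space(2)[OF ad])
      (use tst mt C in auto)
  also have "\<dots> = (LINT t|time S. pairing b \<epsilon> t (\<phi> t))"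
    using ti by (simp add: pairing_def)
  finally show "(LINT t|time S. LINT x|lebesgue. - (V b \<epsilon> t x \<bullet> vector_derivative (\<lambda>s. \<phi> s x) (at t)) - V b \<epsilon> t x \<bullet> laplacian (\<phi> t) x
       + (weak_jacobian (V b \<epsilon> t) x *v V b \<epsilon> t x) \<bullet> \<phi> t x - 0 * divergence (\<phi> t) x) = (LINT t|time S. pairing b \<epsilon> t (\<phi> t))" .
qed

text \<open>V is a multiple of \<open>rot y\<close>. In that direction the radial profile does not
  change, so the convective term is a multiple of \<open>rot (rot y)\<close>, which is orthogonal to
  \<open>rot y\<close>.\<close>

lemma VV_orthogonal: "VV b \<epsilon> t x \<bullet> V b \<epsilon> t x = 0"
proof -
  have "rot (c *\<^sub>R v) = c *\<^sub>R rot v" for c v using linear_scale[OF linear_rot] .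
  then show ?thesis
    by (simp add: VV_def DV_def wd_def V_def w_def swirl_d_def swirl_def inner_rot inner_add_left)
qed

text \<open>The work of the force splits into the growth of kinetic energy and the dissipation,
  because the convective term does no work.\<close>

lemma force_power:
  assumes ad: "adm b \<epsilon>"
  shows "pairing b \<epsilon> t (V b \<epsilon> t) = (LINT x|lebesgue. Vt b \<epsilon> t x \<bullet> V b \<epsilon> t x) + (LINT x|lebesgue. (norm (DM b \<epsilon> t x))\<^sup>2)"
proof -
  note i = L2_inner(1)[OF sol_bounds(3)[OF ad in_fields(3)] sol_bounds(3)[OF ad in_fields(1)], of t t]
    L2_inner(1)[OF sol_bounds(3)[OF ad in_fields(2)] sol_bounds(3)[OF ad in_fields(1)], of t t]
  show ?thesis using i
    by (simp add: pairing_def force_def inner_add_left inner_diff_left VV_orthogonal DM_norm[OF ad])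
qed

text \<open>The weight is 1 in the energy equality and \<open>cutoff\<close> in the uniqueness
  proof. There is no contribution from time 0, where V vanishes.\<close>

lemma V_kinetic_energy:
  assumes ad: "adm b \<epsilon>" and S: "0 \<le> S" and \<kappa>: "\<And>t. (\<kappa> has_real_derivative \<kappa>' t) (at t)" "continuous_on UNIV \<kappa>'"
  shows "(LINT t|time S. \<kappa>' t * (LINT x|lebesgue. (norm (V b \<epsilon> t x))\<^sup>2) + 2 * \<kappa> t * (LINT x|lebesgue. Vt b \<epsilon> t x \<bullet> V b \<epsilon> t x))
    = \<kappa> S * (LINT x|lebesgue. (norm (V b \<epsilon> S x))\<^sup>2)"
proof -
  have c\<kappa>: "continuous_on UNIV \<kappa>" using \<kappa>(1) by (auto intro!: continuous_at_imp_continuous_on DERIV_isCont)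
  have [measurable]: "\<kappa> \<in> borel_measurable borel" "\<kappa>' \<in> borel_measurable borel"
    by (intro borel_measurable_continuous_onI c\<kappa> \<kappa>)+
  have "bounded (\<kappa> ` {0..S})" "bounded (\<kappa>' ` {0..S})"
    by (intro compact_imp_bounded compact_continuous_image continuous_on_subset[OF c\<kappa>] continuous_on_subset[OF \<kappa>(2)]; simp)+
  then obtain C1 C2 where C12: "\<forall>y\<in>\<kappa> ` {0..S}. norm y \<le> C1" "\<forall>y\<in>\<kappa>' ` {0..S}. norm y \<le> C2"
    unfolding bounded_iff by blast
  have C: "\<bar>\<kappa> t\<bar> \<le> C1" "\<bar>\<kappa>' t\<bar> \<le> C2" if "0 < t" "t < S" for t using C12 that by auto
  define Ht where "Ht = (\<lambda>t x. \<kappa>' t * (norm (V b \<epsilon> t x))\<^sup>2 + 2 * \<kappa> t * (Vt b \<epsilon> t x \<bullet> V b \<epsilon> t x))"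
  have mH: "(\<lambda>(t, x). Ht t x) \<in> borel_measurable (borel \<Otimes>\<^sub>M borel)"
  proof -
    have [measurable]: "(\<lambda>z. V b \<epsilon> (fst z) (snd z)) \<in> borel_measurable (borel \<Otimes>\<^sub>M borel)"
      "(\<lambda>z. Vt b \<epsilon> (fst z) (snd z)) \<in> borel_measurable (borel \<Otimes>\<^sub>M borel)"
      using joint_measurable by (simp_all add: case_prod_beta')
    show ?thesis unfolding Ht_def case_prod_beta' by measurable
  qed
  note L2 = sol_bounds(3)[OF ad in_fields(3)] sol_bounds(3)[OF ad in_fields(1)]
  note i1 = sol_bounds(4)[OF ad in_fields(1)]
  have i2: "integrable lebesgue (\<lambda>x. Vt b \<epsilon> t x \<bullet> V b \<epsilon> t x)" for t by (rule L2_inner(1)[OF L2])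
  have eqH: "(LINT x|lebesgue. Ht t x) = \<kappa>' t * (LINT x|lebesgue. (norm (V b \<epsilon> t x))\<^sup>2) + 2 * \<kappa> t * (LINT x|lebesgue. Vt b \<epsilon> t x \<bullet> V b \<epsilon> t x)" for t
    unfolding Ht_def using i1 i2 by simp
  have iH: "integrable lebesgue (Ht t)" for t
    unfolding Ht_def using i1 i2 by (intro Bochner_Integration.integrable_add integrable_mult_right)
  have K: "(LINT x|lebesgue. norm (Ht t x)) \<le> C2 * bnd + 2 * C1 * bnd" if t: "0 < t" "t < S" for t
  proof -
    have C0: "0 \<le> C1" "0 \<le> C2" using C[OF t] by linarith+
    have b1: "norm (Ht t x) \<le> C2 * (norm (V b \<epsilon> t x))\<^sup>2 + 2 * C1 * norm (Vt b \<epsilon> t x)" for x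
    proof -
      have "\<bar>Vt b \<epsilon> t x \<bullet> V b \<epsilon> t x\<bar> \<le> norm (Vt b \<epsilon> t x)"
        using Cauchy_Schwarz_ineq2[of "Vt b \<epsilon> t x" "V b \<epsilon> t x"] mult_left_mono[OF V_norm_le(2)[OF ad, of t x], of "norm (Vt b \<epsilon> t x)"] by simp
      then have "\<bar>\<kappa> t\<bar> * \<bar>Vt b \<epsilon> t x \<bullet> V b \<epsilon> t x\<bar> \<le> C1 * norm (Vt b \<epsilon> t x)" using C[OF t] C0 by (intro mult_mono) auto
      moreover have "\<bar>\<kappa>' t\<bar> * (norm (V b \<epsilon> t x))\<^sup>2 \<le> C2 * (norm (V b \<epsilon> t x))\<^sup>2" using C[OF t] by (intro mult_right_mono) auto
      ultimately show ?thesis unfolding Ht_def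
        by (intro order_trans[OF norm_triangle_ineq]) (simp add: abs_mult)
    qed
    have ib: "integrable lebesgue (\<lambda>x. C2 * (norm (V b \<epsilon> t x))\<^sup>2 + 2 * C1 * norm (Vt b \<epsilon> t x))"
      using i1 sol_bounds(1)[OF ad in_fields(3)] by (intro Bochner_Integration.integrable_add integrable_mult_right integrable_norm)
    have "(LINT x|lebesgue. norm (Ht t x)) \<le> (LINT x|lebesgue. C2 * (norm (V b \<epsilon> t x))\<^sup>2 + 2 * C1 * norm (Vt b \<epsilon> t x))"
      by (rule integral_mono[OF integrable_norm[OF iH] ib b1])
    also have "\<dots> = C2 * (LINT x|lebesgue. (norm (V b \<epsilon> t x))\<^sup>2) + 2 * C1 * (LINT x|lebesgue. norm (Vt b \<epsilon> t x))"
      using i1 sol_bounds(1)[OF ad in_fields(3)] by simp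
    also have "\<dots> \<le> C2 * bnd + 2 * C1 * bnd"
      using sol_bounds(5)[OF ad in_fields(1), of t] sol_bounds(2)[OF ad in_fields(3), of t] C0 by (intro add_mono mult_left_mono) auto
    finally show ?thesis .
  qed
  have dH: "((\<lambda>s. \<kappa> s * (V b \<epsilon> s x \<bullet> V b \<epsilon> s x)) has_real_derivative Ht t x) (at t)" for t x
  proof -
    have v: "((\<lambda>s. V b \<epsilon> s x) has_derivative (\<lambda>h. h *\<^sub>R Vt b \<epsilon> t x)) (at t)"
      using V_time_derivative[of \<epsilon> b x t] ad by (simp add: has_vector_derivative_def adm_def)
    have "((\<lambda>s. V b \<epsilon> s x \<bullet> V b \<epsilon> s x) has_real_derivative 2 * (Vt b \<epsilon> t x \<bullet> V b \<epsilon> t x)) (at t)"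
      unfolding has_field_derivative_def
      by (rule has_derivative_eq_rhs[OF has_derivative_inner[OF v v]]) (auto simp: inner_commute algebra_simps)
    from DERIV_mult[OF \<kappa>(1) this] show ?thesis
      by (rule DERIV_cong) (simp add: Ht_def power2_norm_eq_inner algebra_simps)
  qed
  have "(LINT t|time S. LINT x|lebesgue. Ht t x) = (LINT x|lebesgue. \<kappa> S * (V b \<epsilon> S x \<bullet> V b \<epsilon> S x) - \<kappa> 0 * (V b \<epsilon> 0 x \<bullet> V b \<epsilon> 0 x))"
    by (rule time_FTC[OF S mH iH K]) (auto intro!: continuous_at_imp_continuous_on DERIV_isCont dH)
  also have "\<dots> = \<kappa> S * (LINT x|lebesgue. (norm (V b \<epsilon> S x))\<^sup>2)"
    using early_zero[OF ad, of 0] T by (simp add: power2_norm_eq_inner)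
  finally show ?thesis by (simp only: eqH)
qed

lemma Vt_V_measurable: "(\<lambda>t. LINT x|lebesgue. Vt b \<epsilon> t x \<bullet> V b \<epsilon> t x) \<in> borel_measurable borel"
  by (intro time_integral_measurable, unfold case_prod_beta')
    (intro borel_measurable_inner joint_measurable[of b \<epsilon>, unfolded case_prod_beta'])

lemma time_integrable_energies:
  assumes ad: "adm b \<epsilon>"
  shows "integrable (time S) (\<lambda>t. LINT x|lebesgue. Vt b \<epsilon> t x \<bullet> V b \<epsilon> t x)"
    "integrable (time S) (\<lambda>t. LINT x|lebesgue. (norm (DM b \<epsilon> t x))\<^sup>2)"
proof -
  have "\<bar>LINT x|lebesgue. Vt b \<epsilon> t x \<bullet> V b \<epsilon> t x\<bar> \<le> bnd + bnd" for t
    using L2_inner(3)[OF sol_bounds(3)[OF ad in_fields(3)] sol_bounds(3)[OF ad in_fields(1)], of t t]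
      sol_bounds(5)[OF ad in_fields(3), of t] sol_bounds(5)[OF ad in_fields(1), of t] by linarith
  then show "integrable (time S) (\<lambda>t. LINT x|lebesgue. Vt b \<epsilon> t x \<bullet> V b \<epsilon> t x)"
    by (intro integrable_time_bounded[OF time_measurable[OF Vt_V_measurable]] AE_I2) auto
  show "integrable (time S) (\<lambda>t. LINT x|lebesgue. (norm (DM b \<epsilon> t x))\<^sup>2)"
    using DM_L2(2)[OF ad] by (intro integrable_time_bounded[OF time_measurable[OF DM_norm_measurable]] AE_I2) auto
qed

lemma V_energy_equality:
  assumes ad: "adm b \<epsilon>" and t: "t > 0"
  shows "energy_lhs (V b \<epsilon>) t = energy_rhs (\<lambda>x. 0) (pairing b \<epsilon>) (V b \<epsilon>) t"
proof -
  note i = time_integrable_energies[OF ad, of t]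
  have kin: "(LINT s|time t. 2 * (LINT x|lebesgue. Vt b \<epsilon> s x \<bullet> V b \<epsilon> s x)) = (LINT x|lebesgue. (norm (V b \<epsilon> t x))\<^sup>2)"
    using V_kinetic_energy[OF ad, of t "\<lambda>_. 1" "\<lambda>_. 0"] t by simp
  have "energy_lhs (V b \<epsilon>) t = (LINT x|lebesgue. (norm (V b \<epsilon> t x))\<^sup>2) + 2 * (LINT s|time t. LINT x|lebesgue. (norm (DM b \<epsilon> s x))\<^sup>2)"
    unfolding energy_lhs_def Lp_norm_weak_jacobian_V[OF ad] Lp_norm_2_sq ..
  also have "\<dots> = 2 * (LINT s|time t. pairing b \<epsilon> s (V b \<epsilon> s))"
    unfolding force_power[OF ad] kin[symmetric] using i by simp
  also have "\<dots> = energy_rhs (\<lambda>x. 0) (pairing b \<epsilon>) (V b \<epsilon>) t"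
    by (simp add: energy_rhs_def Lp_norm_def)
  finally show ?thesis .
qed

lemma V_0: "adm b \<epsilon> \<Longrightarrow> V b \<epsilon> 0 = (\<lambda>x. 0)"
  using early_zero[of b \<epsilon> 0] T by (intro ext) simp

text \<open>The weak Jacobian of the zero field is itself an arbitrary choice, so its norm is read
  off from V at time 0, which is the zero field.\<close>

lemma zero_in_H1: "(\<lambda>x. 0) \<in> H1" "H1_norm (\<lambda>x. 0) = 0"
proof -
  note z = V_0[OF adm_dl, symmetric]
  show "(\<lambda>x. 0) \<in> H1" using V_in_H1[OF adm_dl, of 0] by (simp add: V_0[OF adm_dl])
  have "(Lp_norm 2 (weak_jacobian (V dl 0 0)))\<^sup>2 = 0"
    unfolding Lp_norm_weak_jacobian_V[OF adm_dl] Lp_norm_2_sq DM_norm[OF adm_dl] by (simp add: V_0[OF adm_dl])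
  then have "(H1_norm (V dl 0 0))\<^sup>2 = 0"
    unfolding H1_norm_sq by (simp add: Lp_norm_2_sq V_0[OF adm_dl])
  then show "H1_norm (\<lambda>x. 0) = 0" by (simp add: V_0[OF adm_dl])
qed

text \<open>The force is bounded in L^2 uniformly in time, so it is taken as the L^1(0,S;L^2)
  summand and the H^(-1) summand is 0.\<close>

lemma pairing_force_space:
  assumes ad: "adm b \<epsilon>"
  shows "pairing b \<epsilon> \<in> force_space S"
proof -
  have "H_minus1_norm (\<lambda>v. 0) = (SUP v\<in>{v \<in> H1. H1_norm v \<le> 1}. 0)" by (simp add: H_minus1_norm_def)
  also have "\<dots> = 0" by (rule cSUP_const) (use zero_in_H1 in auto)
  finally have n0: "H_minus1_norm (\<lambda>v. 0) = 0" .
  have "(\<lambda>t v. 0) \<in> L2_H_minus1 S"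
    using bounded_Lp_space_time[of "\<lambda>t. 0" S 0 2] n0
    by (auto simp: L2_H_minus1_def H_minus1_def intro!: AE_I2 exI[of _ 0])
  moreover have "force b \<epsilon> \<in> LrLq 1 2 S"
    unfolding LrLq_def
    by (rule Bochner_bounded[OF joint_measurable_force(2) _ measurable_Lp_norm[OF joint_measurable_force(2)] Lp_norm_2_le[OF ad in_fields(5)]])
      (use sol_bounds(3)[OF ad in_fields(5)] in \<open>auto simp: Lp_space_2 Lp_space_ereal_2\<close>)
  ultimately show ?thesis unfolding force_space_def
    by (intro CollectI bexI[of _ "\<lambda>t v. 0"] bexI[of _ "force b \<epsilon>"]) (auto simp: pairing_def)
qed

lemma represents_pairing:
  assumes ad: "adm b \<epsilon>"
  shows "represents (force b \<epsilon>) (pairing b \<epsilon>)"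
proof -
  have "integrable lebesgue (\<lambda>x. force b \<epsilon> t x \<bullet> \<phi> x)" if "\<phi> \<in> Cc_infty UNIV" for t \<phi>
    by (rule L2_inner(1)[OF sol_bounds(3)[OF ad in_fields(5)] Cc_infty_L2[OF that]])
  then show ?thesis by (simp add: represents_def pairing_def)
qed

lemma V_Leray_Hopf:
  assumes ad: "adm b \<epsilon>"
  shows "global_Leray_Hopf (\<lambda>x. 0) (pairing b \<epsilon>) (V b \<epsilon>)"
  unfolding global_Leray_Hopf_def
proof (intro allI impI)
  fix S :: real assume S: "S > 0"
  show "Leray_Hopf S (\<lambda>x. 0) (pairing b \<epsilon>) (V b \<epsilon>)"
    unfolding Leray_Hopf_def
  proof (intro conjI ballI)
    show "(\<lambda>x. 0) \<in> Lp_sigma 2" using V_in_Lp_sigma[OF ad, of 0] by (simp add: V_0[OF ad])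
    show "V b \<epsilon> t \<in> Lp_space 2 lebesgue" for t by (rule sol_bounds(3)[OF ad in_fields(1)])
    show "energy_lhs (V b \<epsilon>) t \<le> energy_rhs (\<lambda>x. 0) (pairing b \<epsilon>) (V b \<epsilon>) t" if "t \<in> {0<..S}" for t
      using V_energy_equality[OF ad, of t] that by simp
  qed (use pairing_force_space[OF ad] V_Bochner[OF ad] V_weak_form[OF ad S] in auto)
qed

end

section \<open>Integrability and blow-up\<close>

text \<open>If a number r lay strictly between the essential supremum and \<open>g x0\<close>, the
  set where \<open>g\<close> exceeds r would be open, nonempty and null.\<close>

lemma esssup_ge_continuous:
  fixes g :: "'a::euclidean_space \<Rightarrow> real"
  assumes ae: "AE x in lebesgue. f x = g x" and c: "continuous_on UNIV g"
  shows "ereal (g x0) \<le> esssup lebesgue (\<lambda>x. ereal (f x))"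
proof (rule ccontr)
  assume "\<not> ?thesis"
  then obtain r where r: "esssup lebesgue (\<lambda>x. ereal (f x)) < ereal r" "ereal r < ereal (g x0)"
    using ereal_dense2 by (metis not_le)
  let ?U = "{x. r < g x}"
  have o: "open ?U" by (intro open_Collect_less c continuous_on_const)
  have "AE x in lebesgue. ereal (f x) \<le> esssup lebesgue (\<lambda>x. ereal (f x))" by (rule esssup_AE)
  then have "AE x in lebesgue. x \<notin> ?U" using ae
  proof eventually_elim
    case (elim x)
    then have "ereal (g x) < ereal r" using r(1) by (metis order.strict_trans1)
    then show ?case by simp
  qed
  then have "?U \<in> null_sets lebesgue" by (subst AE_iff_null_sets) (use o in auto)
  then have "negligible ?U" by (simp add: negligible_iff_null_sets)
  moreover have "x0 \<in> ?U" using r(2) by simp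
  ultimately show False using open_not_negligible[OF o] by blast
qed

lemma nn_integral_abs_powr:
  assumes "e > -1"
  shows "(\<integral>\<^sup>+s. ennreal (\<bar>s\<bar> powr e * indicator {-1<..<1} s) \<partial>lborel) < \<infinity>"
proof -
  define g where "g = (\<lambda>s::real. s powr e * indicator {0..1} s)"
  have gm [measurable]: "g \<in> borel_measurable borel" unfolding g_def by measurable
  have "((\<lambda>s. s powr e) has_integral (1 powr (e + 1) / (e + 1))) {0..1}"
    by (rule has_integral_powr_from_0) (use assms in auto)
  then have "((\<lambda>s. if s \<in> {0..1} then s powr e else 0) has_integral (1 powr (e + 1) / (e + 1))) UNIV"
    by (simp only: has_integral_restrict_UNIV)
  moreover have "(\<lambda>s. if s \<in> {0..1} then s powr e else 0) = g" by (auto simp: g_def)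
  ultimately have "(g has_integral (1 powr (e + 1) / (e + 1))) UNIV" by simp
  from nn_integral_has_integral_lborel[OF gm _ this]
  have fin: "(\<integral>\<^sup>+s. ennreal (g s) \<partial>lborel) < \<infinity>" by (simp add: g_def)
  have neg: "(\<integral>\<^sup>+s. ennreal (g (- s)) \<partial>lborel) = (\<integral>\<^sup>+s. ennreal (g s) \<partial>lborel)"
    using nn_integral_real_affine[of "\<lambda>s. ennreal (g s)" "-1" 0] by simp
  have "(\<integral>\<^sup>+s. ennreal (\<bar>s\<bar> powr e * indicator {-1<..<1} s) \<partial>lborel) \<le> (\<integral>\<^sup>+s. ennreal (g s) + ennreal (g (- s)) \<partial>lborel)"
    by (intro nn_integral_mono) (auto simp: g_def indicator_def abs_if)
  also have "\<dots> = (\<integral>\<^sup>+s. ennreal (g s) \<partial>lborel) + (\<integral>\<^sup>+s. ennreal (g (- s)) \<partial>lborel)"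
    by (rule nn_integral_add) auto
  also have "\<dots> < \<infinity>" using fin neg by simp
  finally show ?thesis .
qed

context swirl_flow
begin

lemma dl_le_geometric: "dl m \<le> (1 / 2) ^ m"
proof -
  have "1 / 2 ^ (m + 3) \<le> (1::real) / 2 ^ m" by (intro divide_left_mono power_increasing) auto
  then show ?thesis using dl_le(2)[of m] by (simp add: power_one_over)
qed

lemma summable_dl: "summable dl"
  by (rule summable_comparison_test'[of "\<lambda>m. (1 / 2) ^ m" 0])
    (use dl_le_geometric dl_pos in \<open>auto simp: summable_geometric abs_of_pos\<close>)

text \<open>A majorant of |V(t)| that is independent of t and integrable, because the amplitudes
  \<open>dl m\<close> are summable and all balls have the same volume.\<close>

definition envelope :: "real^3 \<Rightarrow> real" where
  "envelope x = (\<Sum>m. dl m * indicator (ball (xm m) 1) x)"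

lemma envelope:
  shows "integrable lebesgue envelope" "norm (V dl 0 t x) \<le> envelope x"
proof -
  have sm: "summable (\<lambda>m. dl m * indicator (ball (xm m) 1) x)" for x
    by (rule summable_comparison_test'[OF summable_dl, of 0]) (use dl_pos in \<open>auto simp: indicator_def abs_of_pos less_imp_le\<close>)
  have ib: "integrable lebesgue (\<lambda>x. dl m * indicator (ball (xm m) 1) x)" for m
  proof -
    have "integrable lborel (\<lambda>x. dl m * indicator (ball (xm m) 1) x)"
      by (intro integrable_mult_right integrable_real_indicator emeasure_bounded_finite bounded_ball) simp
    then show ?thesis by (subst integrable_completion) auto
  qed
  have vol: "measure lebesgue (ball (xm m) 1) = unit_ball_vol 3" for m
    by (simp add: content_ball)
  show "integrable lebesgue envelope"
    unfolding envelope_def[abs_def]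
  proof (rule integrable_suminf[OF ib])
    show "AE x in lebesgue. summable (\<lambda>m. norm (dl m * indicator (ball (xm m) 1) x))"
      using sm dl_pos by (intro AE_I2) (simp add: abs_mult abs_of_pos)
    have "(LINT x|lebesgue. norm (dl m * indicator (ball (xm m) 1) x)) = dl m * unit_ball_vol 3" for m
    proof -
      have "(LINT x|lebesgue. norm (dl m * indicator (ball (xm m) 1) x)) = (LINT x|lebesgue. dl m * indicator (ball (xm m) 1) x)"
        using dl_pos[of m] by (simp add: abs_mult)
      also have "\<dots> = dl m * measure lebesgue (ball (xm m) 1)" by simp
      finally show ?thesis unfolding vol .
    qed
    then show "summable (\<lambda>m. LINT x|lebesgue. norm (dl m * indicator (ball (xm m) 1) x))"
      using summable_mult2[OF summable_dl] by simp
  qed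
  show "norm (V dl 0 t x) \<le> envelope x"
  proof (cases "V dl 0 t x = 0")
    case True
    have "0 \<le> envelope x" unfolding envelope_def by (intro suminf_nonneg sm) (auto simp: less_imp_le[OF dl_pos])
    then show ?thesis using True by simp
  next
    case False
    then have "norm (x - xm (idx t)) < 1"
      using local_fields(1)[of 0 dl] by (auto simp: local_field_def V_def)
    then have i: "indicator (ball (xm (idx t)) 1) x = (1::real)" by (simp add: dist_norm norm_minus_commute)
    have single: "sum f {i} = f i" for f :: "nat \<Rightarrow> real" and i by simp
    have "(\<Sum>m\<in>{idx t}. dl m * indicator (ball (xm m) 1) x) \<le> envelope x"
      unfolding envelope_def by (rule sum_le_suminf[OF sm]) (auto simp: less_imp_le[OF dl_pos])
    then have "dl (idx t) * indicator (ball (xm (idx t)) 1) x \<le> envelope x" unfolding single .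
    then show ?thesis using V_norm_le(1)[OF adm_dl, of t x] i by simp
  qed
qed

text \<open>Dominated convergence in \<open>x\<close> along sequences of times. V is continuous in
  time at every point, and as |V| \<le> 1 the square of a difference is at most twice the sum of the
  two norms, hence at most \<open>4 * envelope x\<close>.\<close>

lemma V_C0_L2: "V dl 0 \<in> C0_L2"
  unfolding C0_L2_def
proof (intro CollectI conjI allI impI)
  show "V dl 0 t \<in> Lp_space 2 lebesgue" for t by (rule sol_bounds(3)[OF adm_dl in_fields(1)])
  fix t :: real
  show "((\<lambda>s. Lp_norm 2 (\<lambda>x. V dl 0 s x - V dl 0 t x)) \<longlongrightarrow> 0) (at t within {0..})"
    unfolding tendsto_at_iff_sequentially
  proof (intro allI impI)
    fix X :: "nat \<Rightarrow> real" assume X: "X \<longlonglongrightarrow> t"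
    have "(\<lambda>n. LINT x|lebesgue. (norm (V dl 0 (X n) x - V dl 0 t x))\<^sup>2) \<longlonglongrightarrow> (LINT x|(lebesgue :: (real^3) measure). 0)"
    proof (rule integral_dominated_convergence[where w="\<lambda>x. 4 * envelope x"])
      show "integrable lebesgue (\<lambda>x. 4 * envelope x)" using envelope(1) by simp
      show "(\<lambda>x. (norm (V dl 0 (X n) x - V dl 0 t x))\<^sup>2) \<in> borel_measurable lebesgue" for n
      proof -
        have [measurable]: "V dl 0 s \<in> borel_measurable lebesgue" for s by (rule sol_bounds(6)[OF adm_dl in_fields(1)])
        show ?thesis by measurable
      qed
      show "AE x in lebesgue. (\<lambda>n. (norm (V dl 0 (X n) x - V dl 0 t x))\<^sup>2) \<longlonglongrightarrow> 0"
      proof (rule AE_I2)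
        fix x
        have "isCont (\<lambda>t. V dl 0 t x) t"
          using has_vector_derivative_continuous[OF V_time_derivative[of 0 dl x t]] by simp
        then have "(\<lambda>n. V dl 0 (X n) x) \<longlonglongrightarrow> V dl 0 t x" using X by (rule isCont_tendsto_compose)
        then have "(\<lambda>n. (norm (V dl 0 (X n) x - V dl 0 t x))\<^sup>2) \<longlonglongrightarrow> (norm (V dl 0 t x - V dl 0 t x))\<^sup>2"
          by (intro tendsto_intros)
        then show "(\<lambda>n. (norm (V dl 0 (X n) x - V dl 0 t x))\<^sup>2) \<longlonglongrightarrow> 0" by simp
      qed
      show "AE x in lebesgue. norm ((norm (V dl 0 (X n) x - V dl 0 t x))\<^sup>2) \<le> 4 * envelope x" for n
      proof (rule AE_I2)
        fix x
        let ?a = "norm (V dl 0 (X n) x)" and ?b = "norm (V dl 0 t x)"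
        have d: "norm (V dl 0 (X n) x - V dl 0 t x) \<le> ?a + ?b" by (rule norm_triangle_ineq4)
        have "?a \<le> 1" "?b \<le> 1" using V_norm_le(2)[OF adm_dl] by auto
        then have "norm (V dl 0 (X n) x - V dl 0 t x) \<le> 2" using d by linarith
        then have "norm (V dl 0 (X n) x - V dl 0 t x) * norm (V dl 0 (X n) x - V dl 0 t x) \<le> 2 * (?a + ?b)"
          using d by (intro mult_mono) auto
        also have "\<dots> \<le> 2 * (envelope x + envelope x)" by (intro mult_left_mono add_mono envelope(2)) simp
        finally show "norm ((norm (V dl 0 (X n) x - V dl 0 t x))\<^sup>2) \<le> 4 * envelope x"
          by (simp add: power2_eq_square)
      qed
    qed simp
    then have "(\<lambda>n. (Lp_norm 2 (\<lambda>x. V dl 0 (X n) x - V dl 0 t x))\<^sup>2) \<longlonglongrightarrow> 0" by (simp add: Lp_norm_2_sq)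
    from tendsto_real_sqrt[OF this]
    show "((\<lambda>s. Lp_norm 2 (\<lambda>x. V dl 0 s x - V dl 0 t x)) \<circ> X) \<longlonglongrightarrow> 0"
      by (simp add: o_def Lp_norm_nonneg)
  qed
qed

text \<open>As |V| \<le> 1, the s-th power is at most |V|, whose integral is bounded in time. Hence
  V is bounded in time with values in L^s, which yields every finite exponent in time.\<close>

lemma V_LrLq:
  assumes s: "s > 4"
  shows "V dl 0 \<in> LrLq_loc (2 * s / (s - 3)) s"
  unfolding LrLq_loc_def LrLq_def
proof (intro CollectI allI impI Bochner_bounded[OF joint_measurable(1) _ measurable_Lp_norm[OF joint_measurable(1)]])
  have i: "integrable lebesgue (\<lambda>x. norm (V dl 0 t x) powr s)" for t
    by (rule slice_bound_integral(1)[OF slice_bound_fields(1)[OF adm_dl]]) (use s in simp)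
  then show "V dl 0 t \<in> Lp_space (ereal s) lebesgue" for t
    using sol_bounds(6)[OF adm_dl in_fields(1), of t] by (simp add: Lp_space_def)
  show "\<bar>Lp_norm s (V dl 0 t)\<bar> \<le> bnd powr (1 / s)" for t
  proof -
    have "(LINT x|lebesgue. norm (V dl 0 t x) powr s) \<le> (LINT x|lebesgue. norm (V dl 0 t x))"
    proof (rule integral_mono[OF i integrable_norm[OF sol_bounds(1)[OF adm_dl in_fields(1)]]])
      fix x
      have "norm (V dl 0 t x) powr s \<le> norm (V dl 0 t x) powr 1"
        using V_norm_le(2)[OF adm_dl, of t x] s by (intro powr_mono') auto
      then show "norm (V dl 0 t x) powr s \<le> norm (V dl 0 t x)" by simp
    qed
    also have "\<dots> \<le> bnd" by (rule sol_bounds(2)[OF adm_dl in_fields(1)])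
    finally have "(LINT x|lebesgue. norm (V dl 0 t x) powr s) powr (1 / s) \<le> bnd powr (1 / s)"
      using s by (intro powr_mono2) auto
    then show ?thesis by (simp add: Lp_norm_def)
  qed
  show "ereal (2 * s / (s - 3)) = \<infinity> \<or> 0 \<le> ereal (2 * s / (s - 3))" using s by simp
qed

lemma V_blowup:
  "((\<lambda>t. esssup lebesgue (\<lambda>x. ereal (norm (weak_jacobian (V dl 0 t) x)))) \<longlongrightarrow> \<infinity>) (at (tm m))"
proof -
  \<comment> \<open>The gradient is tested at the centre, in the direction of the first axis. There
    exp(-1) is the value \<open>flat 1 1\<close> of the radial profile, and
    \<open>flat 1 (3 / 4)\<close> bounds the cutoff in time from below as long as |t - tm m| < dl m
    / 2.\<close>
  define c where "c = dl m * flat 1 (3 / 4) * exp (-1)"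
  have c: "c > 0" using dl_pos[of m] flat_1_pos[of "3/4"] by (simp add: c_def)
  have low: "ereal (c * \<bar>t - tm m\<bar> powr (- \<gamma>)) \<le> esssup lebesgue (\<lambda>x. ereal (norm (weak_jacobian (V dl 0 t) x)))"
    if t: "t \<noteq> tm m" "\<bar>t - tm m\<bar> < dl m / 2" for t
  proof -
    have idx: "idx t = m" using t(2) dl_pos[of m] by (intro idx_eq) simp
    have cont: "continuous_on UNIV (\<lambda>x. norm (DM dl 0 t x))"
    proof -
      have "continuous_on UNIV (\<lambda>x. sqrt (\<Sum>j\<in>UNIV. (norm (DV dl 0 t x (axis j 1)))\<^sup>2))"
        by (intro continuous_intros continuous_V_space)
      moreover have "norm (DM dl 0 t x) = sqrt (\<Sum>j\<in>UNIV. (norm (DV dl 0 t x (axis j 1)))\<^sup>2)" for x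
        using arg_cong[OF norm_mat_columns[of "DM dl 0 t x"], of sqrt] by (simp add: column_matrix)
      ultimately show ?thesis by simp
    qed
    have ae: "AE x in lebesgue. norm (weak_jacobian (V dl 0 t) x) = norm (DM dl 0 t x)"
      using weak_jacobian_V[of dl 0 t] by eventually_elim simp
    have "c * \<bar>t - tm m\<bar> powr (- \<gamma>) \<le> norm (DM dl 0 t (xm m))"
    proof -
      have "((t - tm m) / dl m)\<^sup>2 \<le> (1 / 2)\<^sup>2"
      proof -
        have "\<bar>(t - tm m) / dl m\<bar> \<le> 1 / 2" using t(2) dl_pos[of m] by (simp add: field_simps)
        then show ?thesis by (simp only: abs_le_square_iff[symmetric])
      qed
      then have f: "flat 1 (3 / 4) \<le> flat 1 (1 - ((t - tm m) / dl m)\<^sup>2)" by (intro flat_1_mono) (simp add: power_divide)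
      have r: "rho 0 m t powr (- \<gamma> / 2) = \<bar>t - tm m\<bar> powr (- \<gamma>)"
      proof -
        have *: "rho 0 m t = \<bar>t - tm m\<bar> powr 2" using t(1) by (simp add: rho_def powr_numeral)
        show ?thesis unfolding * powr_powr by simp
      qed
      have ca: "ca dl 0 m t \<ge> dl m * flat 1 (3 / 4) * \<bar>t - tm m\<bar> powr (- \<gamma>)"
        unfolding ca_def r using f dl_pos[of m] by (intro mult_right_mono mult_left_mono) auto
      have f1: "flat 1 1 = exp (-1)" by (simp add: flat_def)
      have r1: "norm (rot (axis 1 1)) = 1"
        by (simp add: norm_eq_sqrt_inner inner_vec_def sum_3 rot_nth axis_def)
      have dv: "DV dl 0 t (xm m) (axis 1 1) = (ca dl 0 m t * exp (-1)) *\<^sub>R rot (axis 1 1)"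
        using linear_0[OF linear_rot] by (simp add: DV_def wd_def idx swirl_d_def f1)
      have "0 \<le> dl m * flat 1 (3 / 4) * \<bar>t - tm m\<bar> powr (- \<gamma>)"
        using dl_pos[of m] flat_1_nonneg by simp
      then have "norm (DV dl 0 t (xm m) (axis 1 1)) = ca dl 0 m t * exp (-1)"
        unfolding dv norm_scaleR r1 using ca by (simp add: abs_mult)
      also have "\<dots> \<ge> dl m * flat 1 (3 / 4) * \<bar>t - tm m\<bar> powr (- \<gamma>) * exp (-1)" using ca by (intro mult_right_mono) auto
      finally have "c * \<bar>t - tm m\<bar> powr (- \<gamma>) \<le> norm (column 1 (DM dl 0 t (xm m)))"
        by (simp add: c_def column_matrix mult_ac)
      also have "\<dots> \<le> norm (DM dl 0 t (xm m))"
      proof (rule power2_le_imp_le)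
        show "(norm (column 1 (DM dl 0 t (xm m))))\<^sup>2 \<le> (norm (DM dl 0 t (xm m)))\<^sup>2"
          unfolding norm_mat_columns by (rule member_le_sum) auto
      qed simp
      finally show ?thesis .
    qed
    then show ?thesis
      by (intro order_trans[OF _ esssup_ge_continuous[OF ae cont, of "xm m"]]) simp
  qed
  show ?thesis unfolding tendsto_PInfty
  proof
    fix r :: real
    \<comment> \<open>The second entry solves c s^(-\<gamma>) = max r 1 for s; the maximum keeps the
      base of the power positive. The first entry stays where the lower bound is valid.\<close>
    define d where "d = min (dl m / 2) ((max r 1 / c) powr (- 1 / \<gamma>))"
    have d: "d > 0" using dl_pos[of m] c by (simp add: d_def)
    have "ereal r < esssup lebesgue (\<lambda>x. ereal (norm (weak_jacobian (V dl 0 t) x)))" if t: "t \<noteq> tm m" "dist t (tm m) < d" for t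
    proof -
      let ?s = "\<bar>t - tm m\<bar>"
      have s: "0 < ?s" "?s < dl m / 2" "?s < (max r 1 / c) powr (- 1 / \<gamma>)" using t by (auto simp: d_def dist_real_def)
      have "((max r 1 / c) powr (- 1 / \<gamma>)) powr (- \<gamma>) < ?s powr (- \<gamma>)"
        using s gam by (intro powr_less_mono2_neg) auto
      then have "max r 1 / c < ?s powr (- \<gamma>)" using gam c by (simp add: powr_powr)
      then have "r < c * ?s powr (- \<gamma>)" using c by (simp add: field_simps)
      then show ?thesis by (intro order.strict_trans2[OF _ low[OF t(1) s(2)]]) simp
    qed
    then show "\<forall>\<^sub>F t in at (tm m). ereal r < esssup lebesgue (\<lambda>x. ereal (norm (weak_jacobian (V dl 0 t) x)))"
      unfolding eventually_at using d by blast
  qed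
qed

lemma rad_0: "rad 0 m t = \<bar>t - tm m\<bar> powr (1 / 2)"
proof (cases "t = tm m")
  case False
  then have *: "rho 0 m t = \<bar>t - tm m\<bar> powr 2" by (simp add: rho_def powr_numeral)
  show ?thesis unfolding rad_def * powr_powr by simp
qed (simp add: rad_def rho_def)

lemma force_LrLq:
  assumes r: "r \<ge> 1" and q: "q > 1" and g: "2 * \<gamma> < 2 / r + 3 / q - 1"
  shows "force dl 0 \<in> LrLq_loc r q"
  unfolding LrLq_loc_def LrLq_def
proof (intro CollectI allI impI)
  fix S :: real assume S: "S > 0"
  \<comment> \<open>The exponent of |t - tm m| in the r-th power of the L^q norm: r (-1 - 2
    \<gamma>) from the size and 3 r / q from the volume, halved because R is the square root of |t -
    tm m|.\<close>
  define e where "e = r * (- 1 / 2 - \<gamma> + 3 / (2 * q))"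
  have e: "e > -1"
  proof -
    have "r * (2 / r + 3 / q - 1) > r * (2 * \<gamma>)" using g r by (intro mult_strict_left_mono) auto
    moreover have "r * (2 / r + 3 / q - 1) = 2 + 3 * r / q - r" using r by (simp add: algebra_simps)
    moreover have "2 * e = 3 * r / q - r - r * (2 * \<gamma>)" using q by (simp add: e_def field_simps)
    ultimately show ?thesis by linarith
  qed
  define C where "C = (23 * flat_const) powr r * 6 powr (r / q)"
  have C0: "C \<ge> 0" by (simp add: C_def)
  have i: "integrable lebesgue (\<lambda>x. norm (force dl 0 t x) powr q)" for t
    by (rule slice_bound_integral(1)[OF slice_bound_fields(6)[OF adm_dl]]) (use q in simp)
  define \<Phi> where "\<Phi> = (\<lambda>t. \<bar>Lp_norm q (force dl 0 t)\<bar> powr r)"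
  have m\<Phi> [measurable]: "\<Phi> \<in> borel_measurable borel"
    unfolding \<Phi>_def using measurable_Lp_norm[OF joint_measurable_force(2)] by measurable
  have bound: "\<Phi> t \<le> C * dl (idx t) * (\<bar>t - tm (idx t)\<bar> powr e * indicator {-1<..<1} (t - tm (idx t)))" for t
  proof -
    let ?m = "idx t" let ?R = "rad 0 (idx t) t"
    define I where "I = (LINT x|lebesgue. norm (force dl 0 t x) powr q)"
    have I0: "0 \<le> I" unfolding I_def by (rule Bochner_Integration.integral_nonneg) simp
    have \<Phi>I: "\<Phi> t = I powr (r / q)" using q r by (simp add: \<Phi>_def Lp_norm_def I_def powr_powr)
    show ?thesis
    proof (cases "\<bar>t - tm ?m\<bar> < dl ?m")
      case False
      then have "force dl 0 t x = 0" for x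
        using slice_bound_fields(6)[OF adm_dl, of t] by (auto simp: slice_bound_def)
      then have "I = 0" by (simp add: I_def)
      then show ?thesis using C0 dl_pos[of ?m] by (simp add: \<Phi>I)
    next
      case True
      then have ind: "indicator {-1<..<1} (t - tm ?m) = (1::real)" using dl_le(3)[of ?m] by (auto simp: indicator_def)
      have I: "I \<le> (23 * flat_const * dl ?m * ?R powr (- 1 - 2 * \<gamma>)) powr q * (6 * ?R ^ 3)"
        unfolding I_def by (rule slice_bound_integral(2)[OF slice_bound_fields(6)[OF adm_dl]]) (use q in simp)
      show ?thesis
      proof (cases "t = tm ?m")
        case True
        then have "?R = 0" by (simp add: rad_0)
        then have "I = 0" using I I0 by simp
        then show ?thesis using C0 dl_pos[of ?m] by (simp add: \<Phi>I)
      next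
        case False
        then have R: "?R > 0" by (simp add: rad_0)
        have K: "23 * flat_const > 0" using flat_const(1) by simp
        have "\<Phi> t \<le> ((23 * flat_const * dl ?m * ?R powr (- 1 - 2 * \<gamma>)) powr q * (6 * ?R ^ 3)) powr (r / q)"
          unfolding \<Phi>I using I I0 q r by (intro powr_mono2) auto
        also have "\<dots> = (23 * flat_const * dl ?m * ?R powr (- 1 - 2 * \<gamma>)) powr r * (6 powr (r / q) * ?R powr (3 * (r / q)))"
          using q R K dl_pos[of ?m] by (simp add: powr_mult powr_powr flip: powr_numeral)
        also have "\<dots> = C * dl ?m powr r * (?R powr ((- 1 - 2 * \<gamma>) * r) * ?R powr (3 * (r / q)))"
          using K dl_pos[of ?m] by (simp add: powr_mult powr_powr C_def)
        also have "?R powr ((- 1 - 2 * \<gamma>) * r) * ?R powr (3 * (r / q)) = \<bar>t - tm ?m\<bar> powr e"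
        proof -
          have *: "(1 / 2) * ((- 1 - 2 * \<gamma>) * r) + (1 / 2) * (3 * (r / q)) = e" using q by (simp add: e_def field_simps)
          show ?thesis unfolding powr_add[symmetric] rad_0 powr_powr * ..
        qed
        also have "C * dl ?m powr r * \<bar>t - tm ?m\<bar> powr e \<le> C * dl ?m * \<bar>t - tm ?m\<bar> powr e"
        proof -
          \<comment> \<open>Only one factor \<open>dl m\<close> is kept; it makes the contributions
            of the vortices summable.\<close>
          have "dl ?m powr r \<le> dl ?m powr 1" using r dl_pos[of ?m] dl_le(3)[of ?m] by (intro powr_mono') auto
          then show ?thesis using C0 dl_pos[of ?m] by (intro mult_right_mono mult_left_mono) auto
        qed
        finally show ?thesis unfolding ind by simp
      qed
    qed
  qed
  let ?h = "\<lambda>m t. ennreal (C * dl m * (\<bar>t - tm m\<bar> powr e * indicator {-1<..<1} (t - tm m)))"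
  define I0 where "I0 = (\<integral>\<^sup>+s. ennreal (\<bar>s\<bar> powr e * indicator {-1<..<1} s) \<partial>lborel)"
  have I0: "I0 < \<infinity>" unfolding I0_def by (rule nn_integral_abs_powr[OF e])
  have hm [measurable]: "?h m \<in> borel_measurable lborel" for m by measurable
  have hI: "(\<integral>\<^sup>+t. ?h m t \<partial>lborel) = ennreal (C * dl m) * I0" for m
  proof -
    have "(\<integral>\<^sup>+t. ?h m t \<partial>lborel) = (\<integral>\<^sup>+t. ennreal (C * dl m) * ennreal (\<bar>t - tm m\<bar> powr e * indicator {-1<..<1} (t - tm m)) \<partial>lborel)"
      using C0 dl_pos[of m] by (intro nn_integral_cong) (simp add: ennreal_mult)
    also have "\<dots> = ennreal (C * dl m) * (\<integral>\<^sup>+t. ennreal (\<bar>t - tm m\<bar> powr e * indicator {-1<..<1} (t - tm m)) \<partial>lborel)"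
      by (rule nn_integral_cmult) measurable
    also have "(\<integral>\<^sup>+t. ennreal (\<bar>t - tm m\<bar> powr e * indicator {-1<..<1} (t - tm m)) \<partial>lborel) = I0"
      unfolding I0_def by (subst nn_integral_real_affine[of _ 1 "tm m"]) auto
    finally show ?thesis .
  qed
  have "(\<integral>\<^sup>+t. ennreal (norm (indicator {0<..<S} t *\<^sub>R \<Phi> t)) \<partial>lborel) \<le> (\<integral>\<^sup>+t. (\<Sum>m. ?h m t) \<partial>lborel)"
  proof (rule nn_integral_mono)
    fix t
    have "norm (indicator {0<..<S} t *\<^sub>R \<Phi> t) \<le> \<Phi> t" by (auto simp: indicator_def \<Phi>_def)
    also have "\<dots> \<le> C * dl (idx t) * (\<bar>t - tm (idx t)\<bar> powr e * indicator {-1<..<1} (t - tm (idx t)))" by (rule bound)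
    finally have "ennreal (norm (indicator {0<..<S} t *\<^sub>R \<Phi> t)) \<le> ?h (idx t) t" by (rule ennreal_leI)
    \<comment> \<open>A single term is bounded by the whole series, so that the integral can be
      evaluated vortex by vortex.\<close>
    also have "\<dots> \<le> (\<Sum>m. ?h m t)"
      using sum_le_suminf[of "\<lambda>m. ?h m t" "{idx t}"] by simp
    finally show "ennreal (norm (indicator {0<..<S} t *\<^sub>R \<Phi> t)) \<le> (\<Sum>m. ?h m t)" .
  qed
  also have "\<dots> = (\<Sum>m. ennreal (C * dl m) * I0)"
    by (subst nn_integral_suminf) (auto simp: hI)
  also have "\<dots> = (\<Sum>m. ennreal (C * dl m)) * I0" by simp
  also have "(\<Sum>m. ennreal (C * dl m)) = ennreal (\<Sum>m. C * dl m)"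
    by (rule suminf_ennreal2) (use C0 dl_pos summable_mult[OF summable_dl] in \<open>auto simp: less_imp_le\<close>)
  also have "\<dots> * I0 < \<infinity>" using I0 by (simp add: ennreal_mult_less_top)
  finally have "integrable lborel (\<lambda>t. indicator {0<..<S} t *\<^sub>R \<Phi> t)"
    by (intro integrableI_bounded) measurable
  then have "integrable (time S) \<Phi>" by (simp add: time_integral_lborel(2)[OF m\<Phi>])
  then have "(\<lambda>t. Lp_norm q (force dl 0 t)) \<in> Lp_space (ereal r) (time S)"
    using time_measurable[OF measurable_Lp_norm[OF joint_measurable_force(2)]] by (simp add: Lp_space_def \<Phi>_def)
  then show "force dl 0 \<in> Bochner (ereal r) S (Lp_space (ereal q) lebesgue) (Lp_norm q)"
    using joint_measurable_lebesgue_on[OF joint_measurable_force(2)] i sol_bounds(6)[OF adm_dl in_fields(5)]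
    by (simp add: Bochner_def Lp_space_def)
qed

end

section \<open>Comparison with another Leray--Hopf solution\<close>

lemma Cc_infty_bilinear:
  assumes "bounded_bilinear p" "f \<in> Cc_infty UNIV" "g \<in> Cc_infty UNIV"
  shows "(\<lambda>x. p (f x) (g x)) \<in> Cc_infty UNIV"
proof -
  interpret p: bounded_bilinear p by fact
  obtain K where K: "compact K" "\<And>x. x \<notin> K \<Longrightarrow> f x = 0" using Cc_inftyD(5)[OF assms(2)] by blast
  have "Ck_on k UNIV (\<lambda>x. p (f x) (g x))" for k
    by (rule Ck_on_bilinear[OF assms(1) Cc_inftyD(1)[OF assms(2)] Cc_inftyD(1)[OF assms(3)]])
  moreover have "\<exists>K. compact K \<and> K \<subseteq> UNIV \<and> (\<forall>x. x \<notin> K \<longrightarrow> p (f x) (g x) = 0)"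
    by (intro exI[of _ K]) (simp add: K p.zero_left)
  ultimately show ?thesis unfolding Cc_infty_def smooth_on_def by blast
qed

lemma Cc_infty_linear:
  assumes "bounded_linear l" "f \<in> Cc_infty UNIV"
  shows "(\<lambda>x. l (f x)) \<in> Cc_infty UNIV"
proof -
  obtain K where K: "compact K" "\<And>x. x \<notin> K \<Longrightarrow> f x = 0" using Cc_inftyD(5)[OF assms(2)] by blast
  have C: "Ck_on k UNIV (\<lambda>x. l (f x))" for k
    by (rule Ck_on_compose[OF _ Ck_on_linear[OF assms(1), of k UNIV] Cc_inftyD(1)[OF assms(2)]]) simp
  have "l 0 = 0" using assms(1) by (simp add: linear_0 bounded_linear.linear)
  then have "\<exists>K. compact K \<and> K \<subseteq> UNIV \<and> (\<forall>x. x \<notin> K \<longrightarrow> l (f x) = 0)"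
    by (intro exI[of _ K]) (simp add: K)
  then show ?thesis using C unfolding Cc_infty_def smooth_on_def by blast
qed

lemma L2_norm_prod:
  fixes X :: "'a::euclidean_space \<Rightarrow> 'b::euclidean_space" and Y :: "'a \<Rightarrow> 'c::euclidean_space"
  assumes "X \<in> Lp_space 2 lebesgue" "Y \<in> Lp_space 2 lebesgue"
  shows "integrable lebesgue (\<lambda>x. norm (X x) * norm (Y x))"
    "(LINT x|lebesgue. norm (X x) * norm (Y x)) \<le> (LINT x|lebesgue. (norm (X x))\<^sup>2) + (LINT x|lebesgue. (norm (Y x))\<^sup>2)"
proof -
  have 2: "(\<lambda>x. norm (X x)) \<in> Lp_space 2 lebesgue" "(\<lambda>x. norm (Y x)) \<in> Lp_space 2 lebesgue"
    using assms by (auto simp: Lp_space_ereal_2 intro: borel_measurable_norm)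
  show "integrable lebesgue (\<lambda>x. norm (X x) * norm (Y x))" using L2_inner(2)[OF 2] by simp
  have "0 \<le> (LINT x|lebesgue. norm (X x) * norm (Y x))" by (intro Bochner_Integration.integral_nonneg) simp
  then show "(LINT x|lebesgue. norm (X x) * norm (Y x)) \<le> (LINT x|lebesgue. (norm (X x))\<^sup>2) + (LINT x|lebesgue. (norm (Y x))\<^sup>2)"
    using L2_inner(3)[OF 2] by simp
qed

lemma measurable_matrix_vector:
  fixes M :: "'a \<Rightarrow> real^3^3"
  assumes "M \<in> borel_measurable N" "X \<in> borel_measurable N"
  shows "(\<lambda>x. M x *v X x) \<in> borel_measurable N"
proof -
  have c: "(\<lambda>x. column j (M x)) \<in> borel_measurable N" for j
  proof (rule measurable_compose[OF assms(1) borel_measurable_continuous_onI])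
    have "linear (\<lambda>A :: real^3^3. column j A)" by (rule linearI) (auto simp: column_def vec_eq_iff)
    then show "continuous_on UNIV (\<lambda>A :: real^3^3. column j A)"
      by (simp add: linear_continuous_on linear_conv_bounded_linear)
  qed
  have x: "(\<lambda>x. X x $ j) \<in> borel_measurable N" for j
    by (rule measurable_compose[OF assms(2) borel_measurable_continuous_onI]) (intro continuous_intros)
  show ?thesis unfolding matrix_vector_columns by (intro borel_measurable_sum borel_measurable_scaleR x c)
qed

lemma L2_triple:
  fixes M :: "real^3 \<Rightarrow> real^3^3" and X Z :: "real^3 \<Rightarrow> real^3"
  assumes M: "M \<in> Lp_space 2 lebesgue" and X: "X \<in> Lp_space 2 lebesgue" and Z: "Z \<in> borel_measurable lebesgue" "\<And>x. norm (Z x) \<le> 1"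
  shows "integrable lebesgue (\<lambda>x. (M x *v X x) \<bullet> Z x)" "integrable lebesgue (\<lambda>x. M x *v X x)"
    "\<bar>LINT x|lebesgue. (M x *v X x) \<bullet> Z x\<bar> \<le> (LINT x|lebesgue. norm (M x) * norm (X x))"
proof -
  have m: "(\<lambda>x. M x *v X x) \<in> borel_measurable lebesgue"
    using M X by (intro measurable_matrix_vector) (auto simp: Lp_space_ereal_2)
  note i0 = L2_norm_prod(1)[OF M X]
  show "integrable lebesgue (\<lambda>x. M x *v X x)"
    by (rule Bochner_Integration.integrable_bound[OF i0 m]) (use norm_matrix_vector_le in \<open>auto intro!: AE_I2\<close>)
  have le: "\<bar>(M x *v X x) \<bullet> Z x\<bar> \<le> norm (M x) * norm (X x)" for x
  proof -
    have "\<bar>(M x *v X x) \<bullet> Z x\<bar> \<le> norm (M x *v X x) * norm (Z x)" by (rule Cauchy_Schwarz_ineq2)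
    also have "\<dots> \<le> (norm (M x) * norm (X x)) * 1" using norm_matrix_vector_le Z(2) by (intro mult_mono) auto
    finally show ?thesis by simp
  qed
  show i: "integrable lebesgue (\<lambda>x. (M x *v X x) \<bullet> Z x)"
    by (rule Bochner_Integration.integrable_bound[OF i0 borel_measurable_inner[OF m Z(1)]]) (use le in auto)
  have "\<bar>LINT x|lebesgue. (M x *v X x) \<bullet> Z x\<bar> \<le> (LINT x|lebesgue. \<bar>(M x *v X x) \<bullet> Z x\<bar>)" by (rule integral_abs_bound)
  also have "\<dots> \<le> (LINT x|lebesgue. norm (M x) * norm (X x))"
    by (rule integral_mono[OF integrable_abs[OF i] i0 le])
  finally show "\<bar>LINT x|lebesgue. (M x *v X x) \<bullet> Z x\<bar> \<le> (LINT x|lebesgue. norm (M x) * norm (X x))" .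
qed

lemma pairing_tendsto:
  fixes M :: "'a::euclidean_space \<Rightarrow> 'b::euclidean_space"
  assumes M: "M \<in> L1_loc UNIV" and m: "\<And>n. X n \<in> borel_measurable lebesgue" and l: "\<And>x. (\<lambda>n. X n x) \<longlonglongrightarrow> Y x"
    and K: "compact K" and b: "\<And>n x. norm (X n x) \<le> C * indicator K x"
  shows "(\<lambda>n. LINT x|lebesgue. M x \<bullet> X n x) \<longlonglongrightarrow> (LINT x|lebesgue. M x \<bullet> Y x)"
proof (rule integral_dominated_convergence[where w="\<lambda>x. C * norm (indicator K x *\<^sub>R M x)"])
  have mY: "Y \<in> borel_measurable lebesgue" using m l by (rule borel_measurable_LIMSEQ_metric)
  show "(\<lambda>x. M x \<bullet> Y x) \<in> borel_measurable lebesgue" "(\<lambda>x. M x \<bullet> X n x) \<in> borel_measurable lebesgue" for n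
    by (intro borel_measurable_inner L1_locD(1)[OF M] mY m)+
  show "integrable lebesgue (\<lambda>x. C * norm (indicator K x *\<^sub>R M x))"
    by (intro integrable_mult_right integrable_norm L1_locD(2)[OF M K])
  show "AE x in lebesgue. norm (M x \<bullet> X n x) \<le> C * norm (indicator K x *\<^sub>R M x)" for n
  proof (rule AE_I2)
    fix x
    have "norm (M x \<bullet> X n x) \<le> norm (M x) * norm (X n x)" using Cauchy_Schwarz_ineq2 by simp
    also have "\<dots> \<le> norm (M x) * (C * indicator K x)" by (intro mult_left_mono b) auto
    finally show "norm (M x \<bullet> X n x) \<le> C * norm (indicator K x *\<^sub>R M x)" by (simp add: mult_ac)
  qed
  show "AE x in lebesgue. (\<lambda>n. M x \<bullet> X n x) \<longlonglongrightarrow> M x \<bullet> Y x"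
    by (intro AE_I2 tendsto_intros l)
qed

lemma integral_double_sum:
  assumes "\<And>i j. integrable M (\<lambda>x. f i j x :: real)"
  shows "(LINT x|M. (\<Sum>j\<in>(UNIV :: 'j::finite set). \<Sum>i\<in>(UNIV :: 'i::finite set). f i j x)) = (\<Sum>j\<in>UNIV. \<Sum>i\<in>UNIV. LINT x|M. f i j x)"
  by (subst Bochner_Integration.integral_sum; (intro Bochner_Integration.integrable_sum assms sum.cong refl)?)
    (rule Bochner_Integration.integral_sum[OF assms])

lemma inner_vec3: "(x :: real^3) \<bullet> y = (\<Sum>i\<in>UNIV. x $ i * y $ i)"
  by (simp add: inner_vec_def)

text \<open>A second Leray-Hopf solution with initial value 0 and the force of V, adjusted on a null
  set of times so that it lies in the energy spaces at every time. \<open>W'\<close> is a jointly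
  Borel version of W. The Jacobian of W is chosen separately for each t, and only the integral of
  its squared norm comes with measurability in time. The energy inequality is available for almost
  every time.\<close>

locale comparison = swirl_flow +
  fixes W W' :: "real \<Rightarrow> real^3 \<Rightarrow> real^3" and S :: real
  assumes S: "S > 0" and sig: "\<And>t. W t \<in> Lp_sigma 2" and H1: "\<And>t. W t \<in> H1"
    and W': "(\<lambda>(t, x). W' t x) \<in> borel_measurable (borel \<Otimes>\<^sub>M borel)" and W_eq: "\<And>t. AE x in lebesgue. W t x = W' t x"
    and ia: "integrable (time S) (\<lambda>t. LINT x|lebesgue. (norm (W t x))\<^sup>2)"
    and ig: "integrable (time S) (\<lambda>t. LINT x|lebesgue. (norm (weak_jacobian (W t) x))\<^sup>2)"
    and weak: "\<And>\<phi>. \<phi> \<in> D_space S \<Longrightarrow> (LINT t|time S. LINT x|lebesgue. weak_jacobian (W t) x \<bullet> jacobian (\<phi> t) (at x)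
       + (weak_jacobian (W t) x *v W t x) \<bullet> \<phi> t x - W t x \<bullet> vector_derivative (\<lambda>s. \<phi> s x) (at t))
     = (LINT t|time S. pairing dl 0 t (\<phi> t))"
    and EI: "AE t in time S. (LINT x|lebesgue. (norm (W t x))\<^sup>2) + 2 * (LINT s|time t. LINT x|lebesgue. (norm (weak_jacobian (W s) x))\<^sup>2)
      \<le> 2 * (LINT s|time t. pairing dl 0 s (W s))"
begin

abbreviation "G t \<equiv> weak_jacobian (W t)"

definition nW where "nW t = (LINT x|lebesgue. (norm (W t x))\<^sup>2)"
definition nG where "nG t = (LINT x|lebesgue. (norm (G t x))\<^sup>2)"
text \<open>The pairings of W with V or one of its approximations: gradients (A), fields (B), W with
  the time derivative of V (C), the convective term of W against V (N), that of V against W (P), and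
  the work of the force on V (E). In \<open>fE\<close> the force is always that of the solution
  itself, since this is the force that drives W.\<close>

definition fA where "fA b \<epsilon> t = (LINT x|lebesgue. G t x \<bullet> DM b \<epsilon> t x)"
definition fB where "fB b \<epsilon> t = (LINT x|lebesgue. W t x \<bullet> V b \<epsilon> t x)"
definition fC where "fC b \<epsilon> t = (LINT x|lebesgue. W t x \<bullet> Vt b \<epsilon> t x)"
definition fN where "fN b \<epsilon> t = (LINT x|lebesgue. (G t x *v W t x) \<bullet> V b \<epsilon> t x)"
definition fP where "fP b \<epsilon> t = (LINT x|lebesgue. VV b \<epsilon> t x \<bullet> W t x)"
definition fE where "fE b \<epsilon> t = (LINT x|lebesgue. force dl 0 t x \<bullet> V b \<epsilon> t x)"

section \<open>Moving derivatives off the second solution\<close>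

lemma W_L2: "W t \<in> Lp_space 2 lebesgue" and G_L2: "G t \<in> Lp_space 2 lebesgue"
  and G_pderiv: "weak_pderiv (axis j 1) (W t) (\<lambda>x. column j (G t x))"
  using H1_weak_jacobian[OF H1[of t]] by (auto simp: is_weak_jacobian_def)

lemma W_measurable: "W t \<in> borel_measurable lebesgue"
  using W_L2[of t] by (simp add: Lp_space_ereal_2)

lemma weak_component:
  assumes "\<eta> \<in> Cc_infty UNIV"
  shows "(LINT x|lebesgue. frechet_derivative \<eta> (at x) (axis j 1) * W t x $ i) = - (LINT x|lebesgue. \<eta> x * column j (G t x) $ i)"
    "integrable lebesgue (\<lambda>x. frechet_derivative \<eta> (at x) (axis j 1) * W t x $ i)"
    "integrable lebesgue (\<lambda>x. \<eta> x * column j (G t x) $ i)"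
  using weak_pderiv_scalar[OF G_pderiv axis_in_Basis assms] by auto

text \<open>The entries of \<open>DM\<close> are test functions, so the weak derivative of W can be
  applied entry by entry. The right side involves W without its gradient, which makes it accessible
  to measurability in time.\<close>

lemma fA_eq:
  assumes ad: "adm b \<epsilon>"
  shows "fA b \<epsilon> t = - (LINT x|lebesgue. LV b \<epsilon> t x \<bullet> W t x)"
proof -
  define \<eta> where "\<eta> = (\<lambda>i j x. DV b \<epsilon> t x (axis j 1) $ i)"
  have \<eta>: "\<eta> i j \<in> Cc_infty UNIV" for i j
    unfolding \<eta>_def by (rule Cc_infty_linear[OF bounded_linear_vec_nth V_test_functions(2)[OF ad]])
  have d: "frechet_derivative (\<eta> i j) (at x) h = D2V b \<epsilon> t x (axis j 1) h $ i" for i j x h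
    unfolding \<eta>_def
    using frechet_derivative_eq[OF bounded_linear.has_derivative[OF bounded_linear_vec_nth DV_has_derivative]] by simp
  have 1: "G t x \<bullet> DM b \<epsilon> t x = (\<Sum>j\<in>UNIV. \<Sum>i\<in>UNIV. \<eta> i j x * column j (G t x) $ i)" for x
    unfolding inner_mat_columns column_matrix inner_vec3 \<eta>_def by (simp add: mult.commute)
  have 2: "LV b \<epsilon> t x \<bullet> W t x = (\<Sum>j\<in>UNIV. \<Sum>i\<in>UNIV. frechet_derivative (\<eta> i j) (at x) (axis j 1) * W t x $ i)" for x
    unfolding LV_eq[symmetric] sum_Basis_vec3 inner_sum_left unfolding inner_vec3 d ..
  show ?thesis
    unfolding fA_def 1 2 integral_double_sum[OF weak_component(2)[OF \<eta>]] integral_double_sum[OF weak_component(3)[OF \<eta>]]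
      weak_component(1)[OF \<eta>] by (simp add: sum_negf)
qed

text \<open>The test functions are the products V_j V_i. Differentiating them gives the convective
  term and, from the other factor, the divergence of V, which vanishes. Afterwards V appears without
  derivatives.\<close>

lemma fP_eq:
  assumes ad: "adm b \<epsilon>"
  shows "fP b \<epsilon> t = - (LINT x|lebesgue. (G t x *v V b \<epsilon> t x) \<bullet> V b \<epsilon> t x)"
proof -
  define \<eta> where "\<eta> = (\<lambda>i j x. V b \<epsilon> t x $ j * V b \<epsilon> t x $ i)"
  have \<eta>: "\<eta> i j \<in> Cc_infty UNIV" for i j
    unfolding \<eta>_def by (intro Cc_infty_bilinear[OF bounded_bilinear_mult] Cc_infty_linear[OF bounded_linear_vec_nth] V_test_functions(1)[OF ad])
  have dn: "((\<lambda>x. V b \<epsilon> t x $ j) has_derivative (\<lambda>h. DV b \<epsilon> t x h $ j)) (at x)" for j x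
    by (rule bounded_linear.has_derivative[OF bounded_linear_vec_nth V_has_derivative])
  have d: "frechet_derivative (\<eta> i j) (at x) h = V b \<epsilon> t x $ j * DV b \<epsilon> t x h $ i + DV b \<epsilon> t x h $ j * V b \<epsilon> t x $ i" for i j x h
    unfolding \<eta>_def using frechet_derivative_eq[OF has_derivative_mult[OF dn dn]] by simp
  have 1: "(G t x *v V b \<epsilon> t x) \<bullet> V b \<epsilon> t x = (\<Sum>j\<in>UNIV. \<Sum>i\<in>UNIV. \<eta> i j x * column j (G t x) $ i)" for x
    unfolding matrix_vector_columns inner_sum_left unfolding inner_vec3 \<eta>_def by (simp add: mult_ac)
  have 2: "VV b \<epsilon> t x \<bullet> W t x = (\<Sum>j\<in>UNIV. \<Sum>i\<in>UNIV. frechet_derivative (\<eta> i j) (at x) (axis j 1) * W t x $ i)" for x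
  proof -
    have "(\<Sum>j\<in>UNIV. \<Sum>i\<in>UNIV. frechet_derivative (\<eta> i j) (at x) (axis j 1) * W t x $ i)
      = (\<Sum>j\<in>UNIV. \<Sum>i\<in>UNIV. (V b \<epsilon> t x $ j *\<^sub>R DV b \<epsilon> t x (axis j 1)) $ i * W t x $ i)
        + (\<Sum>j\<in>UNIV. DV b \<epsilon> t x (axis j 1) $ j * (V b \<epsilon> t x \<bullet> W t x))"
      unfolding d inner_vec3 by (simp add: sum.distrib sum_distrib_left algebra_simps)
    also have "(\<Sum>j\<in>UNIV. DV b \<epsilon> t x (axis j 1) $ j * (V b \<epsilon> t x \<bullet> W t x)) = 0"
      unfolding sum_distrib_right[symmetric] DV_divergence by simp
    also have "(\<Sum>j\<in>UNIV. \<Sum>i\<in>UNIV. (V b \<epsilon> t x $ j *\<^sub>R DV b \<epsilon> t x (axis j 1)) $ i * W t x $ i) = VV b \<epsilon> t x \<bullet> W t x"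
    proof -
      have "VV b \<epsilon> t x \<bullet> W t x = (\<Sum>j\<in>UNIV. V b \<epsilon> t x $ j *\<^sub>R DV b \<epsilon> t x (axis j 1)) \<bullet> W t x"
        unfolding VV_def by (subst DV_expand) (rule refl)
      then show ?thesis unfolding inner_sum_left unfolding inner_vec3 ..
    qed
    finally show ?thesis by simp
  qed
  show ?thesis
    unfolding fP_def 1 2 integral_double_sum[OF weak_component(2)[OF \<eta>]] integral_double_sum[OF weak_component(3)[OF \<eta>]]
      weak_component(1)[OF \<eta>] by (simp add: sum_negf)
qed

text \<open>(X . grad) V . V is half the derivative of |V|^2 in direction X, and |V|^2 is a
  legitimate test function for X being divergence-free.\<close>

lemma transport_orthogonal:
  assumes ad: "adm b \<epsilon>" and X: "X \<in> Lp_sigma 2"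
  shows "(LINT x|lebesgue. (DM b \<epsilon> t x *v X x) \<bullet> V b \<epsilon> t x) = 0"
proof -
  have \<eta>: "(\<lambda>x. V b \<epsilon> t x \<bullet> V b \<epsilon> t x) \<in> Cc_infty UNIV"
    by (intro Cc_infty_bilinear[OF bounded_bilinear_inner] V_test_functions(1)[OF ad])
  have "frechet_derivative (\<lambda>x. V b \<epsilon> t x \<bullet> V b \<epsilon> t x) (at x) h = 2 * ((DM b \<epsilon> t x *v h) \<bullet> V b \<epsilon> t x)" for x h
    using frechet_derivative_eq[OF has_derivative_inner[OF V_has_derivative V_has_derivative]]
    by (simp add: DM_mult inner_commute)
  then have "(LINT x|lebesgue. 2 * ((DM b \<epsilon> t x *v X x) \<bullet> V b \<epsilon> t x)) = 0"
    using X \<eta> unfolding Lp_sigma_def by fastforce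
  then show ?thesis by simp
qed

lemma V_meas: "adm b \<epsilon> \<Longrightarrow> V b \<epsilon> t \<in> borel_measurable lebesgue"
  by (rule sol_bounds(6)[OF _ in_fields(1)])

lemma L2_diff:
  fixes X Y :: "'a::euclidean_space \<Rightarrow> 'b::euclidean_space"
  assumes "X \<in> Lp_space 2 lebesgue" "Y \<in> Lp_space 2 lebesgue"
  shows "(\<lambda>x. X x - Y x) \<in> Lp_space 2 lebesgue"
    "(LINT x|lebesgue. (norm (X x - Y x))\<^sup>2) = (LINT x|lebesgue. (norm (X x))\<^sup>2) - 2 * (LINT x|lebesgue. X x \<bullet> Y x) + (LINT x|lebesgue. (norm (Y x))\<^sup>2)"
proof -
  have i: "integrable lebesgue (\<lambda>x. (norm (X x))\<^sup>2)" "integrable lebesgue (\<lambda>x. (norm (Y x))\<^sup>2)" "integrable lebesgue (\<lambda>x. X x \<bullet> Y x)"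
    using assms L2_inner(1)[OF assms] by (auto simp: Lp_space_ereal_2)
  have e: "(norm (X x - Y x))\<^sup>2 = (norm (X x))\<^sup>2 - 2 * (X x \<bullet> Y x) + (norm (Y x))\<^sup>2" for x
    by (simp add: power2_norm_eq_inner inner_diff_left inner_diff_right inner_commute)
  show "(\<lambda>x. X x - Y x) \<in> Lp_space 2 lebesgue"
    using assms i unfolding Lp_space_2 e by (auto intro!: borel_measurable_diff)
  show "(LINT x|lebesgue. (norm (X x - Y x))\<^sup>2) = (LINT x|lebesgue. (norm (X x))\<^sup>2) - 2 * (LINT x|lebesgue. X x \<bullet> Y x) + (LINT x|lebesgue. (norm (Y x))\<^sup>2)"
    unfolding e using i by simp
qed

text \<open>The convective terms combine to \<open>((W - V) \<cdot> \<nabla>)(W - V) \<cdot> V\<close>. Since \<open>|V| \<le> 1\<close>, Young's inequality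
  suffices and no Sobolev embedding is needed.\<close>

lemma convective_bound:
  assumes ad: "adm b \<epsilon>"
  shows "\<bar>fN b \<epsilon> t + fP b \<epsilon> t\<bar> \<le> (LINT x|lebesgue. (norm (G t x - DM b \<epsilon> t x))\<^sup>2) + (1 / 4) * (LINT x|lebesgue. (norm (W t x - V b \<epsilon> t x))\<^sup>2)"
proof -
  note V1 = V_meas[OF ad, of t] V_norm_le(2)[OF ad, of t]
  note V2 = sol_bounds(3)[OF ad in_fields(1), of t]
  note D2 = DM_L2(1)[OF ad, of t]
  have U2: "(\<lambda>x. W t x - V b \<epsilon> t x) \<in> Lp_space 2 lebesgue" by (rule L2_diff(1)[OF W_L2 V2])
  have Z2: "(\<lambda>x. G t x - DM b \<epsilon> t x) \<in> Lp_space 2 lebesgue" by (rule L2_diff(1)[OF G_L2 D2])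
  note i1 = L2_triple(1)[OF G_L2 W_L2 V1] and i2 = L2_triple(1)[OF G_L2 V2 V1]
    and i3 = L2_triple(1)[OF D2 W_L2 V1] and i4 = L2_triple(1)[OF D2 V2 V1]
  have e: "((G t x - DM b \<epsilon> t x) *v (W t x - V b \<epsilon> t x)) \<bullet> V b \<epsilon> t x
     = (G t x *v W t x) \<bullet> V b \<epsilon> t x - (G t x *v V b \<epsilon> t x) \<bullet> V b \<epsilon> t x
       - (DM b \<epsilon> t x *v W t x) \<bullet> V b \<epsilon> t x + (DM b \<epsilon> t x *v V b \<epsilon> t x) \<bullet> V b \<epsilon> t x" for x
    by (simp add: matrix_vector_mult_diff_distrib matrix_vector_mult_diff_rdistrib inner_diff_left)
  have "(LINT x|lebesgue. ((G t x - DM b \<epsilon> t x) *v (W t x - V b \<epsilon> t x)) \<bullet> V b \<epsilon> t x)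
    = (LINT x|lebesgue. (G t x *v W t x) \<bullet> V b \<epsilon> t x) - (LINT x|lebesgue. (G t x *v V b \<epsilon> t x) \<bullet> V b \<epsilon> t x)
      - (LINT x|lebesgue. (DM b \<epsilon> t x *v W t x) \<bullet> V b \<epsilon> t x) + (LINT x|lebesgue. (DM b \<epsilon> t x *v V b \<epsilon> t x) \<bullet> V b \<epsilon> t x)"
    unfolding e using i1 i2 i3 i4 by simp
  also have "\<dots> = fN b \<epsilon> t + fP b \<epsilon> t"
    unfolding fN_def fP_eq[OF ad] transport_orthogonal[OF ad sig] transport_orthogonal[OF ad V_in_Lp_sigma[OF ad]] by simp
  finally have "\<bar>fN b \<epsilon> t + fP b \<epsilon> t\<bar> \<le> (LINT x|lebesgue. norm (G t x - DM b \<epsilon> t x) * norm (W t x - V b \<epsilon> t x))"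
    using L2_triple(3)[OF Z2 U2 V1] by simp
  also have "\<dots> \<le> (LINT x|lebesgue. (norm (G t x - DM b \<epsilon> t x))\<^sup>2 + (1 / 4) * (norm (W t x - V b \<epsilon> t x))\<^sup>2)"
  proof (rule integral_mono[OF L2_norm_prod(1)[OF Z2 U2]])
    show "integrable lebesgue (\<lambda>x. (norm (G t x - DM b \<epsilon> t x))\<^sup>2 + (1 / 4) * (norm (W t x - V b \<epsilon> t x))\<^sup>2)"
      using Z2 U2 by (simp add: Lp_space_ereal_2)
    fix x
    have "0 \<le> (norm (G t x - DM b \<epsilon> t x) - (1 / 2) * norm (W t x - V b \<epsilon> t x))\<^sup>2" by simp
    then show "norm (G t x - DM b \<epsilon> t x) * norm (W t x - V b \<epsilon> t x) \<le> (norm (G t x - DM b \<epsilon> t x))\<^sup>2 + (1 / 4) * (norm (W t x - V b \<epsilon> t x))\<^sup>2"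
      by (simp add: power2_diff power_divide algebra_simps)
  qed
  also have "\<dots> = (LINT x|lebesgue. (norm (G t x - DM b \<epsilon> t x))\<^sup>2) + (1 / 4) * (LINT x|lebesgue. (norm (W t x - V b \<epsilon> t x))\<^sup>2)"
    using Z2 U2 by (simp add: Lp_space_ereal_2)
  finally show ?thesis .
qed

section \<open>Measurability and bounds of the pairings\<close>

lemma measurable_W_pairing:
  assumes "(\<lambda>(t, x). X t x) \<in> borel_measurable (borel \<Otimes>\<^sub>M borel)"
  shows "(\<lambda>t. LINT x|lebesgue. W t x \<bullet> X t x) \<in> borel_measurable borel"
proof -
  have "(\<lambda>(t, x). W' t x \<bullet> X t x) \<in> borel_measurable (borel \<Otimes>\<^sub>M borel)"
    unfolding case_prod_beta' by (intro borel_measurable_inner W'[unfolded case_prod_beta'] assms[unfolded case_prod_beta'])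
  from time_integral_measurable[OF this] have "(\<lambda>t. LINT x|lebesgue. W' t x \<bullet> X t x) \<in> borel_measurable borel" .
  moreover have "(LINT x|lebesgue. W t x \<bullet> X t x) = (LINT x|lebesgue. W' t x \<bullet> X t x)" for t
    by (rule integral_cong_AE_lebesgue(1)) (use W_eq[of t] in \<open>eventually_elim, simp\<close>)
  ultimately show ?thesis by simp
qed

lemma measurable_functionals:
  assumes ad: "adm b \<epsilon>"
  shows "fA b \<epsilon> \<in> borel_measurable borel" "fB b \<epsilon> \<in> borel_measurable borel" "fC b \<epsilon> \<in> borel_measurable borel"
    "fP b \<epsilon> \<in> borel_measurable borel" "fE b \<epsilon> \<in> borel_measurable borel" "(\<lambda>t. pairing b \<epsilon> t (W t)) \<in> borel_measurable borel"
proof -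
  have "fA b \<epsilon> = (\<lambda>t. - (LINT x|lebesgue. W t x \<bullet> LV b \<epsilon> t x))"
    using fA_eq[OF ad] by (simp add: fun_eq_iff inner_commute)
  then show "fA b \<epsilon> \<in> borel_measurable borel"
    using borel_measurable_uminus[OF measurable_W_pairing[OF joint_measurable(3)]] by simp
  show "fB b \<epsilon> \<in> borel_measurable borel" "fC b \<epsilon> \<in> borel_measurable borel"
    unfolding fB_def fC_def by (intro measurable_W_pairing joint_measurable)+
  show "fP b \<epsilon> \<in> borel_measurable borel"
    unfolding fP_def inner_commute[of "VV _ _ _ _"] by (intro measurable_W_pairing joint_measurable_force)
  show "(\<lambda>t. pairing b \<epsilon> t (W t)) \<in> borel_measurable borel"
    unfolding pairing_def inner_commute[of "force _ _ _ _"] by (intro measurable_W_pairing joint_measurable_force)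
  have "(\<lambda>(t, x). force dl 0 t x \<bullet> V b \<epsilon> t x) \<in> borel_measurable (borel \<Otimes>\<^sub>M borel)"
    unfolding case_prod_beta'
    by (intro borel_measurable_inner joint_measurable_force[unfolded case_prod_beta'] joint_measurable[unfolded case_prod_beta'])
  then show "fE b \<epsilon> \<in> borel_measurable borel" unfolding fE_def by (rule time_integral_measurable)
qed

lemma functional_bounds:
  assumes ad: "adm b \<epsilon>"
  shows "\<bar>fA b \<epsilon> t\<bar> \<le> nG t + 3 * bnd" "\<bar>fB b \<epsilon> t\<bar> \<le> nW t + bnd" "\<bar>fC b \<epsilon> t\<bar> \<le> nW t + bnd"
    "\<bar>fN b \<epsilon> t\<bar> \<le> nG t + nW t" "\<bar>fP b \<epsilon> t\<bar> \<le> bnd + nW t" "\<bar>fE b \<epsilon> t\<bar> \<le> 2 * bnd" "\<bar>pairing b \<epsilon> t (W t)\<bar> \<le> bnd + nW t"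
proof -
  note s3 = sol_bounds(3)[OF ad] and s5 = sol_bounds(5)[OF ad]
  show "\<bar>fA b \<epsilon> t\<bar> \<le> nG t + 3 * bnd"
    using L2_inner(3)[OF G_L2 DM_L2(1)[OF ad], of t t] DM_L2(2)[OF ad, of t] unfolding fA_def nG_def by linarith
  show "\<bar>fB b \<epsilon> t\<bar> \<le> nW t + bnd"
    using L2_inner(3)[OF W_L2 s3[OF in_fields(1)], of t t] s5[OF in_fields(1), of t] unfolding fB_def nW_def by linarith
  show "\<bar>fC b \<epsilon> t\<bar> \<le> nW t + bnd"
    using L2_inner(3)[OF W_L2 s3[OF in_fields(3)], of t t] s5[OF in_fields(3), of t] unfolding fC_def nW_def by linarith
  show "\<bar>fN b \<epsilon> t\<bar> \<le> nG t + nW t"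
    using L2_triple(3)[OF G_L2 W_L2 V_meas[OF ad] V_norm_le(2)[OF ad], of t t t] L2_norm_prod(2)[OF G_L2 W_L2, of t t]
    unfolding fN_def nW_def nG_def by linarith
  show "\<bar>fP b \<epsilon> t\<bar> \<le> bnd + nW t"
    using L2_inner(3)[OF s3[OF in_fields(4)] W_L2, of t t] s5[OF in_fields(4), of t] unfolding fP_def nW_def by linarith
  show "\<bar>pairing b \<epsilon> t (W t)\<bar> \<le> bnd + nW t"
    using L2_inner(3)[OF s3[OF in_fields(5)] W_L2, of t t] s5[OF in_fields(5), of t] unfolding pairing_def nW_def by linarith
  show "\<bar>fE b \<epsilon> t\<bar> \<le> 2 * bnd"
    using L2_inner(3)[OF sol_bounds(3)[OF adm_dl in_fields(5)] s3[OF in_fields(1)], of t t] s5[OF in_fields(1), of t]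
      sol_bounds(5)[OF adm_dl in_fields(5), of t] unfolding fE_def by linarith
qed

text \<open>The centres with index below n lie within 4 n of the origin, and a vortex has radius at
  most 1.\<close>

lemma V_trunc_support: "norm x \<ge> 4 * real n + 1 \<Longrightarrow> V (trunc n) (eps n) t x = 0"
proof (rule ccontr)
  assume x: "norm x \<ge> 4 * real n + 1" and nz: "V (trunc n) (eps n) t x \<noteq> 0"
  have "trunc n (idx t) \<noteq> 0" using nz by (auto simp: V_def w_def ca_def)
  then have "idx t < n" by (auto simp: trunc_def split: if_splits)
  then have "norm (xm (idx t)) \<le> 4 * real n" by (simp add: xm_def)
  moreover have "norm (x - xm (idx t)) < 1"
    using nz local_fields(1)[of "eps n" "trunc n"] adm_trunc[of n] by (auto simp: local_field_def V_def adm_def)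
  moreover have "norm x \<le> norm (x - xm (idx t)) + norm (xm (idx t))" by norm
  ultimately show False using x by linarith
qed

text \<open>Here the gradient of W cannot be removed, as it is multiplied by W. Against a fixed test
  function it is measurable in time, because the derivative moves to the test function;
  \<open>measurable_pairing\<close> extends this to the factors W_j V_i, whose common bounded
  support is due to the truncation.\<close>

lemma measurable_fN_trunc: "fN (trunc n) (eps n) \<in> borel_measurable borel"
proof -
  let ?V = "V (trunc n) (eps n)"
  note ad = adm_trunc[of n]
  define g where "g = (\<lambda>i j t x. W' t x $ j * ?V t x $ i)"
  define Gij where "Gij = (\<lambda>i j t x. column j (G t x) $ i)"
  have nth: "(\<lambda>z. f z $ i) \<in> borel_measurable M" if "f \<in> borel_measurable M" for f :: "'z \<Rightarrow> real^3" and M i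
    by (rule measurable_compose[OF that borel_measurable_continuous_onI]) (intro continuous_intros)
  have gm: "(\<lambda>(t, x). g i j t x) \<in> borel_measurable (borel \<Otimes>\<^sub>M borel)" for i j
    unfolding g_def case_prod_beta'
    by (intro borel_measurable_times nth W'[unfolded case_prod_beta'] joint_measurable[unfolded case_prod_beta'])
  have Gm: "Gij i j t \<in> borel_measurable lebesgue" for i j t
    using G_pderiv[of j t] unfolding weak_pderiv_def Gij_def by (intro nth) (auto dest: L1_locD(1))
  have ae: "AE x in lebesgue. g i j t x * Gij i j t x = ?V t x $ i * (W t x $ j * Gij i j t x)" for i j t
    using W_eq[of t] by eventually_elim (simp add: g_def mult_ac)
  have iV: "integrable lebesgue (\<lambda>x. ?V t x $ i * (W t x $ j * Gij i j t x))" for i j t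
  proof (rule Bochner_Integration.integrable_bound[OF L2_norm_prod(1)[OF G_L2 W_L2]])
    show "(\<lambda>x. ?V t x $ i * (W t x $ j * Gij i j t x)) \<in> borel_measurable lebesgue"
      by (intro borel_measurable_times nth V_meas[OF ad] W_measurable Gm)
    show "AE x in lebesgue. norm (?V t x $ i * (W t x $ j * Gij i j t x)) \<le> norm (norm (G t x) * norm (W t x))"
    proof (rule AE_I2)
      fix x
      have "\<bar>?V t x $ i\<bar> \<le> 1" using component_le_norm_cart[of "?V t x" i] V_norm_le(2)[OF ad, of t x] by linarith
      moreover have "\<bar>W t x $ j\<bar> \<le> norm (W t x)" by (rule component_le_norm_cart)
      moreover have "\<bar>Gij i j t x\<bar> \<le> norm (G t x)"
        using component_le_norm_cart[of "G t x $ i" j] Finite_Cartesian_Product.norm_nth_le[of "G t x" i]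
        by (simp add: Gij_def column_def)
      ultimately have "\<bar>?V t x $ i\<bar> * (\<bar>W t x $ j\<bar> * \<bar>Gij i j t x\<bar>) \<le> 1 * (norm (W t x) * norm (G t x))"
        by (intro mult_mono) auto
      then show "norm (?V t x $ i * (W t x $ j * Gij i j t x)) \<le> norm (norm (G t x) * norm (W t x))"
        by (simp add: abs_mult mult.commute)
    qed
  qed
  have iG: "integrable lebesgue (\<lambda>x. g i j t x * Gij i j t x)" for i j t
    using integral_cong_AE_lebesgue(2)[OF ae] iV by simp
  have pm: "(\<lambda>t. LINT x|lebesgue. g i j t x * Gij i j t x) \<in> borel_measurable borel" for i j
  proof (rule measurable_pairing[OF _ _ gm _ iG, where c="- ((4 * real n + 1) *\<^sub>R One)" and d="(4 * real n + 1) *\<^sub>R One"])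
    show "Gij i j t \<in> L1_loc UNIV" for t
    proof -
      have "(\<lambda>x. column j (G t x)) \<in> L1_loc UNIV" using G_pderiv[of j t] by (simp add: weak_pderiv_def)
      then show ?thesis unfolding L1_loc_def set_integrable_def Gij_def
        using integrable_bounded_linear[OF bounded_linear_vec_nth] by fastforce
    qed
    show "(\<lambda>t. LINT x|lebesgue. \<phi> x * Gij i j t x) \<in> borel_measurable borel" if \<phi>: "\<phi> \<in> Cc_infty UNIV" for \<phi>
    proof -
      have "(\<lambda>x. frechet_derivative \<phi> (at x) (axis j 1)) \<in> borel_measurable borel"
        by (intro borel_measurable_continuous_onI Cc_inftyD(4)[OF \<phi>] axis_in_Basis)
      then have "(\<lambda>(t, x). frechet_derivative \<phi> (at x) (axis j 1) *\<^sub>R axis i 1 :: real^3) \<in> borel_measurable (borel \<Otimes>\<^sub>M borel)"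
        unfolding case_prod_beta' by (intro borel_measurable_scaleR borel_measurable_const) (rule measurable_compose[OF measurable_snd])
      from measurable_W_pairing[OF this]
      have "(\<lambda>t. LINT x|lebesgue. frechet_derivative \<phi> (at x) (axis j 1) * W t x $ i) \<in> borel_measurable borel"
        by (simp add: inner_axis)
      moreover have "(\<lambda>t. LINT x|lebesgue. \<phi> x * Gij i j t x) = (\<lambda>t. - (LINT x|lebesgue. frechet_derivative \<phi> (at x) (axis j 1) * W t x $ i))"
        using weak_component(1)[OF \<phi>] by (simp add: Gij_def)
      ultimately show ?thesis by simp
    qed
    fix t x assume x: "x \<notin> box (- ((4 * real n + 1) *\<^sub>R One)) ((4 * real n + 1) *\<^sub>R One :: real^3)"
    then obtain k where "k \<in> Basis" "\<bar>x \<bullet> k\<bar> \<ge> 4 * real n + 1" by (auto simp: box_def inner_Basis not_less abs_if)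
    then have "norm x \<ge> 4 * real n + 1" using Basis_le_norm[of k x] by linarith
    then show "g i j t x = 0" using V_trunc_support by (simp add: g_def)
  qed
  have "fN (trunc n) (eps n) t = (\<Sum>j\<in>UNIV. \<Sum>i\<in>UNIV. LINT x|lebesgue. g i j t x * Gij i j t x)" for t
  proof -
    have "(G t x *v W t x) \<bullet> ?V t x = (\<Sum>j\<in>UNIV. \<Sum>i\<in>UNIV. ?V t x $ i * (W t x $ j * Gij i j t x))" for x
      unfolding matrix_vector_columns inner_sum_left unfolding inner_vec3 Gij_def by (simp add: mult_ac)
    then have "fN (trunc n) (eps n) t = (\<Sum>j\<in>UNIV. \<Sum>i\<in>UNIV. LINT x|lebesgue. ?V t x $ i * (W t x $ j * Gij i j t x))"
      unfolding fN_def by (simp only: integral_double_sum[OF iV])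
    then show ?thesis using integral_cong_AE_lebesgue(1)[OF ae] by simp
  qed
  then have "fN (trunc n) (eps n) = (\<lambda>t. \<Sum>j\<in>UNIV. \<Sum>i\<in>UNIV. LINT x|lebesgue. g i j t x * Gij i j t x)" by auto
  then show ?thesis using pm by simp
qed

end

text \<open>The factor exp(-t) yields \<open>cutoff s t \<le> - cutoff' s t\<close>, since the other
  factor is nonincreasing in t. That other factor vanishes smoothly from time s on, as a test field
  on [0,S) must when s < S.\<close>

definition cutoff :: "real \<Rightarrow> real \<Rightarrow> real" where
  "cutoff s t = exp (- t) * flat 1 (s - t)"
definition cutoff' :: "real \<Rightarrow> real \<Rightarrow> real" where
  "cutoff' s t = - cutoff s t - exp (- t) * flat (flat_deriv 1) (s - t)"

lemma cutoff_derivative: "(cutoff s has_real_derivative cutoff' s t) (at t)"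
proof -
  have 1: "((\<lambda>t. s - t) has_real_derivative -1) (at t)" by (auto intro!: derivative_eq_intros)
  have 2: "((\<lambda>t. exp (- t)) has_real_derivative - exp (- t)) (at t)" by (auto intro!: derivative_eq_intros)
  have "((\<lambda>t. exp (- t) * flat 1 (s - t)) has_real_derivative
    (- exp (- t)) * flat 1 (s - t) + (flat (flat_deriv 1) (s - t) * -1) * exp (- t)) (at t)"
    by (rule DERIV_mult[OF 2 DERIV_chain2[OF DERIV_flat 1]])
  then show ?thesis unfolding cutoff_def[abs_def] cutoff'_def by (rule DERIV_cong) (simp add: mult.commute)
qed

lemma continuous_cutoff: "continuous_on A (cutoff s)" "continuous_on A (cutoff' s)"
  unfolding cutoff_def[abs_def] cutoff'_def[abs_def] by (intro continuous_intros)+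

lemma Ck_on_cutoff: "Ck_on k A g \<Longrightarrow> Ck_on k A (\<lambda>x. cutoff s (g x))"
  unfolding cutoff_def
  by (intro Ck_on_mult Ck_on_flat_comp Ck_on_diff Ck_on_const Ck_on_compose[where f=exp and B=UNIV, OF _ Ck_on_exp] Ck_on_minus) auto

lemma cutoff_zero: "s \<le> t \<Longrightarrow> cutoff s t = 0" and cutoff_nonneg: "0 \<le> cutoff s t" and cutoff_pos: "t < s \<Longrightarrow> 0 < cutoff s t"
  and cutoff_decay: "cutoff s t \<le> - cutoff' s t"
proof -
  have "0 \<le> flat (flat_deriv 1) (s - t)" by (simp add: flat_def flat_deriv_def)
  then show "cutoff s t \<le> - cutoff' s t" by (simp add: cutoff'_def)
qed (auto simp: cutoff_def flat_nonpos flat_1_nonneg flat_1_pos)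

context comparison
begin

text \<open>The support is bounded in the past because V is 0 before T / 4, in the future by the
  cutoff, and in space by the truncation.\<close>

lemma regularized_test_field:
  assumes s: "0 < s" "s < S"
  shows "(\<lambda>t x. cutoff s t *\<^sub>R V (trunc n) (eps n) t x) \<in> D_space S"
proof -
  let ?V = "V (trunc n) (eps n)"
  have e: "0 \<le> eps n" "eps n \<le> 1" using adm_trunc[of n] by (auto simp: adm_def)
  have CV: "Ck_on k UNIV (\<lambda>z. ?V (fst z) (snd z))" for k
    by (rule Ck_on_V_local[OF e open_UNIV Ck_on_w_pos[OF eps_pos]])
  have "Ck_on k UNIV (\<lambda>z. cutoff s (fst z) *\<^sub>R ?V (fst z) (snd z))" for k
    by (rule Ck_on_scaleR[OF Ck_on_cutoff[OF Ck_on_linear[OF bounded_linear_fst]] CV])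
  then have "smooth_on ({0..<S} \<times> UNIV) (\<lambda>(t, x). cutoff s t *\<^sub>R ?V t x)"
    by (auto simp: smooth_on_def case_prod_beta' intro: Ck_on_subset)
  moreover define K where "K = {0..s} \<times> cball (0 :: real^3) (4 * real n + 1)"
  moreover have "compact K" unfolding K_def by (intro compact_Times) auto
  moreover have "K \<subseteq> {0..<S} \<times> UNIV" using s by (auto simp: K_def)
  moreover have "cutoff s (fst z) *\<^sub>R ?V (fst z) (snd z) = 0" if "z \<notin> K" for z
  proof -
    have "fst z < 0 \<or> s < fst z \<or> norm (snd z) \<ge> 4 * real n + 1"
      using that by (cases "fst z < 0"; cases "s < fst z"; cases z) (simp_all add: K_def)
    then consider "fst z < 0" | "s < fst z" | "norm (snd z) \<ge> 4 * real n + 1" by blast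
    then show ?thesis
      by cases (use early_zero[OF adm_trunc, of "fst z" n "snd z"] T cutoff_zero[of s "fst z"] V_trunc_support[of n "snd z"] in auto)
  qed
  ultimately have "(\<lambda>(t, x). cutoff s t *\<^sub>R ?V t x) \<in> Cc_infty ({0..<S} \<times> UNIV)"
    unfolding Cc_infty_def case_prod_beta' by blast
  moreover have "divergence (\<lambda>x. cutoff s t *\<^sub>R ?V t x) x = 0" for t x
    using frechet_derivative_eq[OF has_derivative_scaleR_right[OF V_has_derivative]] DV_divergence
    by (simp add: divergence_def jacobian_def trace_matrix sum_distrib_left[symmetric])
  ultimately show ?thesis by (simp add: D_space_def)
qed

text \<open>The integrand in time of the weak equation of W tested with \<open>cutoff s t\<close>
  times V, all terms on one side. The time derivative of the product is responsible for the pair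
  \<open>fB\<close>, \<open>fC\<close>.\<close>

definition tested :: "real \<Rightarrow> (nat \<Rightarrow> real) \<Rightarrow> real \<Rightarrow> real \<Rightarrow> real" where
  "tested s b \<epsilon> t = cutoff s t * fA b \<epsilon> t + cutoff s t * fN b \<epsilon> t - cutoff' s t * fB b \<epsilon> t - cutoff s t * fC b \<epsilon> t - cutoff s t * fE b \<epsilon> t"

lemma cutoff_bounded: obtains C where "C \<ge> 0" "\<And>t. 0 < t \<Longrightarrow> t < S \<Longrightarrow> \<bar>cutoff s t\<bar> \<le> C" "\<And>t. 0 < t \<Longrightarrow> t < S \<Longrightarrow> \<bar>cutoff' s t\<bar> \<le> C"
proof -
  have "bounded (cutoff s ` {0..S})" "bounded (cutoff' s ` {0..S})"
    by (intro compact_imp_bounded compact_continuous_image continuous_cutoff; simp)+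
  then obtain C1 C2 where "\<forall>y\<in>cutoff s ` {0..S}. norm y \<le> C1" "\<forall>y\<in>cutoff' s ` {0..S}. norm y \<le> C2"
    unfolding bounded_iff by blast
  then show thesis by (intro that[of "max 0 (max C1 C2)"]) (auto simp: le_max_iff_disj)
qed

text \<open>The coefficients 2, 3 and 7 add up the five estimates from
  \<open>functional_bounds\<close>. As the bound is the same for all approximations, it serves as
  dominating function in \<open>tested_limit\<close>.\<close>

lemma tested_bound: obtains C where "\<And>b \<epsilon> t. adm b \<epsilon> \<Longrightarrow> 0 < t \<Longrightarrow> t < S \<Longrightarrow> \<bar>tested s b \<epsilon> t\<bar> \<le> C * (2 * nG t + 3 * nW t + 7 * bnd)"
proof -
  obtain C where C: "C \<ge> 0" "\<And>t. 0 < t \<Longrightarrow> t < S \<Longrightarrow> \<bar>cutoff s t\<bar> \<le> C" "\<And>t. 0 < t \<Longrightarrow> t < S \<Longrightarrow> \<bar>cutoff' s t\<bar> \<le> C"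
    by (rule cutoff_bounded[of s]) blast
  have "\<bar>tested s b \<epsilon> t\<bar> \<le> C * (2 * nG t + 3 * nW t + 7 * bnd)" if ad: "adm b \<epsilon>" and t: "0 < t" "t < S" for b \<epsilon> t
  proof -
    note fb = functional_bounds[OF ad, of t]
    have m: "\<bar>c * x\<bar> \<le> C * y" if "\<bar>c\<bar> \<le> C" "\<bar>x\<bar> \<le> y" for c x y
      unfolding abs_mult using that by (intro mult_mono) auto
    note c = C(2)[OF t] and c' = C(3)[OF t]
    have "\<bar>tested s b \<epsilon> t\<bar> \<le> \<bar>cutoff s t * fA b \<epsilon> t\<bar> + \<bar>cutoff s t * fN b \<epsilon> t\<bar> + \<bar>cutoff' s t * fB b \<epsilon> t\<bar> + \<bar>cutoff s t * fC b \<epsilon> t\<bar> + \<bar>cutoff s t * fE b \<epsilon> t\<bar>"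
      unfolding tested_def by linarith
    also have "\<dots> \<le> C * (nG t + 3 * bnd) + C * (nG t + nW t) + C * (nW t + bnd) + C * (nW t + bnd) + C * (2 * bnd)"
      by (intro add_mono m c c' fb)
    also have "\<dots> = C * (2 * nG t + 3 * nW t + 7 * bnd)" by (simp add: algebra_simps)
    finally show ?thesis .
  qed
  then show thesis by (rule that)
qed

lemma tested_dominant_integrable: "integrable (time S) (\<lambda>t. C * (2 * nG t + 3 * nW t + 7 * bnd))"
proof -
  have i: "integrable (time S) nG" "integrable (time S) nW" using ia ig by (simp_all add: nG_def[abs_def] nW_def[abs_def])
  have c: "integrable (time S) (\<lambda>t. 7 * bnd)" by (rule finite_measure.integrable_const[OF finite_measure_time])
  show ?thesis
    by (rule integrable_mult_right[OF Bochner_Integration.integrable_add[OF Bochner_Integration.integrable_add[OF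
      integrable_mult_right[OF i(1)] integrable_mult_right[OF i(2)]] c]])
qed

lemma tested_measurable:
  assumes ad: "adm b \<epsilon>" and N: "fN b \<epsilon> \<in> borel_measurable M" and M: "\<And>f :: real \<Rightarrow> real. f \<in> borel_measurable borel \<Longrightarrow> f \<in> borel_measurable M"
  shows "tested s b \<epsilon> \<in> borel_measurable M"
  unfolding tested_def[abs_def]
  by (intro borel_measurable_add borel_measurable_diff borel_measurable_times N M[OF borel_measurable_continuous_onI] continuous_cutoff
      M[OF measurable_functionals(1)[OF ad]] M[OF measurable_functionals(2)[OF ad]] M[OF measurable_functionals(3)[OF ad]] M[OF measurable_functionals(5)[OF ad]])

lemma tested_regularized:
  assumes s: "0 < s" "s < S"
  shows "(LINT t|time S. tested s (trunc n) (eps n) t) = 0"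
proof -
  let ?V = "V (trunc n) (eps n)" let ?\<phi> = "\<lambda>t x. cutoff s t *\<^sub>R V (trunc n) (eps n) t x"
  note ad = adm_trunc[of n]
  have e: "0 \<le> eps n" "eps n \<le> 1" using ad by (auto simp: adm_def)
  have vd: "vector_derivative (\<lambda>s'. ?\<phi> s' x) (at t) = cutoff' s t *\<^sub>R ?V t x + cutoff s t *\<^sub>R Vt (trunc n) (eps n) t x" for t x
    using vector_derivative_at[OF has_vector_derivative_scaleR[OF cutoff_derivative V_time_derivative[OF e]]]
    by (simp add: add.commute)
  have jac: "jacobian (?\<phi> t) (at x) = cutoff s t *\<^sub>R DM (trunc n) (eps n) t x" for t x
    using frechet_derivative_eq[OF has_derivative_scaleR_right[OF V_has_derivative]]
    by (simp add: jacobian_def matrix_def vec_eq_iff)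
  have space: "(LINT x|lebesgue. G t x \<bullet> jacobian (?\<phi> t) (at x) + (G t x *v W t x) \<bullet> ?\<phi> t x - W t x \<bullet> vector_derivative (\<lambda>s'. ?\<phi> s' x) (at t))
    = tested s (trunc n) (eps n) t + pairing dl 0 t (?\<phi> t)" for t
  proof -
    have i: "integrable lebesgue (\<lambda>x. G t x \<bullet> DM (trunc n) (eps n) t x)" "integrable lebesgue (\<lambda>x. (G t x *v W t x) \<bullet> ?V t x)"
      "integrable lebesgue (\<lambda>x. W t x \<bullet> ?V t x)" "integrable lebesgue (\<lambda>x. W t x \<bullet> Vt (trunc n) (eps n) t x)"
      using L2_inner(1)[OF G_L2 DM_L2(1)[OF ad]] L2_triple(1)[OF G_L2 W_L2 V_meas[OF ad] V_norm_le(2)[OF ad]]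
        L2_inner(1)[OF W_L2 sol_bounds(3)[OF ad in_fields(1)]] L2_inner(1)[OF W_L2 sol_bounds(3)[OF ad in_fields(3)]] by auto
    have "(LINT x|lebesgue. G t x \<bullet> jacobian (?\<phi> t) (at x) + (G t x *v W t x) \<bullet> ?\<phi> t x - W t x \<bullet> vector_derivative (\<lambda>s'. ?\<phi> s' x) (at t))
      = (LINT x|lebesgue. cutoff s t * (G t x \<bullet> DM (trunc n) (eps n) t x) + cutoff s t * ((G t x *v W t x) \<bullet> ?V t x)
         - (cutoff' s t * (W t x \<bullet> ?V t x) + cutoff s t * (W t x \<bullet> Vt (trunc n) (eps n) t x)))"
      unfolding vd jac by (simp add: inner_add_right)
    also have "\<dots> = cutoff s t * fA (trunc n) (eps n) t + cutoff s t * fN (trunc n) (eps n) t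
       - (cutoff' s t * fB (trunc n) (eps n) t + cutoff s t * fC (trunc n) (eps n) t)"
      unfolding fA_def fN_def fB_def fC_def using i by simp
    also have "\<dots> = tested s (trunc n) (eps n) t + pairing dl 0 t (?\<phi> t)"
      by (simp add: tested_def pairing_def fE_def)
    finally show ?thesis .
  qed
  obtain C where C: "\<And>b \<epsilon> t. adm b \<epsilon> \<Longrightarrow> 0 < t \<Longrightarrow> t < S \<Longrightarrow> \<bar>tested s b \<epsilon> t\<bar> \<le> C * (2 * nG t + 3 * nW t + 7 * bnd)"
    by (rule tested_bound[of s]) blast
  have mt: "tested s (trunc n) (eps n) \<in> borel_measurable (time S)"
    by (rule tested_measurable[OF ad time_measurable[OF measurable_fN_trunc] time_measurable])
  have it: "integrable (time S) (tested s (trunc n) (eps n))"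
  proof (rule Bochner_Integration.integrable_bound[OF tested_dominant_integrable mt])
    show "AE t in time S. norm (tested s (trunc n) (eps n) t) \<le> norm (C * (2 * nG t + 3 * nW t + 7 * bnd))"
      by (rule AE_timeI) (use C[OF ad] in \<open>auto intro: order_trans[OF _ abs_ge_self]\<close>)
  qed
  have pf: "pairing dl 0 t (?\<phi> t) = cutoff s t * fE (trunc n) (eps n) t" for t by (simp add: pairing_def fE_def)
  have ip: "integrable (time S) (\<lambda>t. pairing dl 0 t (?\<phi> t))"
  proof -
    obtain C where C: "C \<ge> 0" "\<And>t. 0 < t \<Longrightarrow> t < S \<Longrightarrow> \<bar>cutoff s t\<bar> \<le> C" by (rule cutoff_bounded[of s]) blast
    show ?thesis unfolding pf
    proof (rule integrable_time_bounded)
      show "(\<lambda>t. cutoff s t * fE (trunc n) (eps n) t) \<in> borel_measurable (time S)"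
        by (intro time_measurable borel_measurable_times measurable_functionals(5)[OF ad] borel_measurable_continuous_onI continuous_cutoff)
      show "AE t in time S. norm (cutoff s t * fE (trunc n) (eps n) t) \<le> C * (2 * bnd)"
        by (rule AE_timeI) (use C functional_bounds(6)[OF ad] in \<open>auto simp: abs_mult intro!: mult_mono\<close>)
    qed
  qed
  have "(LINT t|time S. tested s (trunc n) (eps n) t + pairing dl 0 t (?\<phi> t)) = (LINT t|time S. pairing dl 0 t (?\<phi> t))"
    using weak[OF regularized_test_field[OF s, of n]] unfolding space .
  then show ?thesis using it ip by simp
qed

text \<open>At a fixed nonsingular time regularisation only enlarges the radius, which is positive,
  while sizes are bounded by a negative power of it. All approximating fields thus share one bound
  on one unit ball, and their pairings with a locally integrable function converge by dominated
  convergence.\<close>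

lemma functional_limits:
  assumes t: "t \<noteq> tm (idx t)"
  shows "(\<lambda>n. tested s (trunc n) (eps n) t) \<longlonglongrightarrow> tested s dl 0 t" "(\<lambda>n. fN (trunc n) (eps n) t) \<longlonglongrightarrow> fN dl 0 t"
proof -
  let ?m = "idx t"
  define C where "C = 23 * flat_const * dl ?m * rad 0 ?m t powr (- 1 - 2 * \<gamma>)"
  have R0: "rad 0 ?m t > 0" using t by (simp add: rad_def rho_def)
  have C0: "C \<ge> 0" using flat_const(1) dl_pos[of ?m] by (simp add: C_def)
  have bound: "norm (X x) \<le> C * indicator (cball (xm ?m) 1) x" if X: "X \<in> fields (trunc n) (eps n) t" for X n x
  proof -
   have sb: "slice_bound (eps n) t X" using X slice_bound_fields[OF adm_trunc[of n], of t] by (auto simp: fields_def)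
   show ?thesis
   proof (cases "x \<in> cball (xm ?m) 1")
    case True
    have e: "0 \<le> eps n" using eps_pos[of n] by simp
    have "rho 0 ?m t \<le> rho (eps n) ?m t" using e by (simp add: rho_def)
    then have "rad 0 ?m t \<le> rad (eps n) ?m t" unfolding rad_def by (intro powr_mono2) (auto simp: rho_def)
    then have "rad (eps n) ?m t powr (- 1 - 2 * \<gamma>) \<le> rad 0 ?m t powr (- 1 - 2 * \<gamma>)"
      using R0 gam by (intro powr_mono2') auto
    then have "23 * flat_const * dl ?m * rad (eps n) ?m t powr (- 1 - 2 * \<gamma>) \<le> C"
      unfolding C_def using flat_const(1) dl_pos[of ?m] by (intro mult_left_mono) auto
    moreover have "norm (X x) \<le> 23 * flat_const * dl ?m * rad (eps n) ?m t powr (- 1 - 2 * \<gamma>)"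
      using sb unfolding slice_bound_def by blast
    ultimately show ?thesis using True by simp
  next
    case False
    from slice_bound_cpt[OF sb _ _ False] show ?thesis using adm_trunc[of n] C0 by (simp add: adm_def)
   qed
  qed
  have meas: "X \<in> borel_measurable lebesgue" if "X \<in> fields (trunc n) (eps n) t" for X n
    by (rule sol_bounds(6)[OF adm_trunc that])
  have conv: "(\<lambda>n. LINT x|lebesgue. M x \<bullet> X n x) \<longlonglongrightarrow> (LINT x|lebesgue. M x \<bullet> Y x)"
    if "M \<in> L1_loc UNIV" "\<And>n. X n \<in> fields (trunc n) (eps n) t" "\<And>x. (\<lambda>n. X n x) \<longlonglongrightarrow> Y x" for M Y :: "real^3 \<Rightarrow> real^3" and X
    by (rule pairing_tendsto[OF that(1) meas[OF that(2)] that(3) compact_cball bound[OF that(2)]])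
  note rt = regularized_tendsto[OF t]
  have W1: "W t \<in> L1_loc UNIV" by (rule L2_imp_L1_loc[OF W_L2])
  have B: "(\<lambda>n. fB (trunc n) (eps n) t) \<longlonglongrightarrow> fB dl 0 t"
    unfolding fB_def by (rule conv[OF W1 in_fields(1) rt(1)])
  have Cc: "(\<lambda>n. fC (trunc n) (eps n) t) \<longlonglongrightarrow> fC dl 0 t"
    unfolding fC_def by (rule conv[OF W1 in_fields(3) rt(3)])
  have E: "(\<lambda>n. fE (trunc n) (eps n) t) \<longlonglongrightarrow> fE dl 0 t"
    unfolding fE_def by (rule conv[OF L2_imp_L1_loc[OF sol_bounds(3)[OF adm_dl in_fields(5)]] in_fields(1) rt(1)])
  have GW: "(\<lambda>x. G t x *v W t x) \<in> L1_loc UNIV"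
  proof -
    have i: "integrable lebesgue (\<lambda>x. G t x *v W t x)"
      by (rule L2_triple(2)[OF G_L2 W_L2, where Z="\<lambda>x. 0"]) auto
    have "integrable lebesgue (\<lambda>x. indicator K x *\<^sub>R (G t x *v W t x))" if "compact K" for K
      using integrable_mult_indicator[OF _ i, of K] that by (simp add: compact_imp_closed)
    then show ?thesis by (auto simp: L1_loc_def set_integrable_def)
  qed
  show N: "(\<lambda>n. fN (trunc n) (eps n) t) \<longlonglongrightarrow> fN dl 0 t"
    unfolding fN_def by (rule conv[OF GW in_fields(1) rt(1)])
  have A: "(\<lambda>n. fA (trunc n) (eps n) t) \<longlonglongrightarrow> fA dl 0 t"
  proof -
    have c: "(\<lambda>x. column j (G t x)) \<in> L1_loc UNIV" for j using G_pderiv[of j t] by (simp add: weak_pderiv_def)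
    have cm: "(\<lambda>x. column j (G t x)) \<in> Lp_space 2 lebesgue" for j
    proof -
      have m: "(\<lambda>x. column j (G t x)) \<in> borel_measurable lebesgue" by (rule L1_locD(1)[OF c])
      have i: "integrable lebesgue (\<lambda>x. (norm (G t x))\<^sup>2)" using G_L2[of t] by (simp add: Lp_space_ereal_2)
      have le: "(norm (column j (G t x)))\<^sup>2 \<le> (norm (G t x))\<^sup>2" for x unfolding norm_mat_columns by (rule member_le_sum) auto
      have "integrable lebesgue (\<lambda>x. (norm (column j (G t x)))\<^sup>2)"
        by (intro Bochner_Integration.integrable_bound[OF i borel_measurable_power[OF measurable_compose[OF m borel_measurable_norm]] AE_I2]) (simp only: real_norm_def abs_power2 le)
      then show ?thesis using m by (simp add: Lp_space_ereal_2)
    qed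
    have eq: "fA b \<epsilon> t = (\<Sum>j\<in>UNIV. LINT x|lebesgue. column j (G t x) \<bullet> DV b \<epsilon> t x (axis j 1))" if "adm b \<epsilon>" for b \<epsilon>
      unfolding fA_def inner_mat_columns column_matrix
      by (rule Bochner_Integration.integral_sum) (rule L2_inner(1)[OF cm sol_bounds(3)[OF that in_fields(6)]])
    show ?thesis unfolding eq[OF adm_trunc] eq[OF adm_dl]
      by (intro tendsto_sum conv[OF c in_fields(6) rt(2)])
  qed
  show "(\<lambda>n. tested s (trunc n) (eps n) t) \<longlonglongrightarrow> tested s dl 0 t"
    unfolding tested_def by (intro tendsto_diff tendsto_add tendsto_mult tendsto_const A B Cc N E)
qed

lemma AE_not_singular: "AE t in time S. t \<noteq> tm (idx t)"
proof -
  have "countable (range tm)" by simp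
  then have "range tm \<in> null_sets lborel" by (rule countable_imp_null_set_lborel)
  then have "AE t in lborel. t \<notin> range tm" by (rule AE_not_in)
  then have "AE t in lebesgue. t \<notin> range tm" by (rule AE_completion)
  then have "AE t in time S. t \<notin> range tm" by (subst AE_restrict_space_iff) (auto elim: eventually_mono)
  then show ?thesis by eventually_elim (metis rangeI)
qed

text \<open>Obtained as a limit of the truncated functionals off the countable set of singular
  times; completeness of Lebesgue measure takes care of that set.\<close>

lemma fN_measurable: "fN dl 0 \<in> borel_measurable (time S)"
proof -
  have N: "range tm \<in> null_sets lborel" by (rule countable_imp_null_set_lborel) simp
  then have r: "range tm \<in> sets borel" by (metis null_setsD2 sets_lborel)
  define h where "h = (\<lambda>t. if t \<in> range tm then 0 else fN dl 0 t)"
  have "h \<in> borel_measurable borel"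
  proof (rule borel_measurable_LIMSEQ_real)
    show "(\<lambda>t. if t \<in> range tm then 0 else fN (trunc n) (eps n) t) \<in> borel_measurable borel" for n
      using measurable_fN_trunc[of n] r by (intro measurable_If_set borel_measurable_const) simp_all
    show "(\<lambda>n. if t \<in> range tm then 0 else fN (trunc n) (eps n) t) \<longlonglongrightarrow> h t" for t
      using functional_limits(2)[of t] by (auto simp: h_def)
  qed
  then have m: "h \<in> borel_measurable (time S)" by (rule time_measurable)
  have "AE t in lebesgue. t \<notin> range tm" using N by (intro AE_completion AE_not_in)
  then have "AE t in time S. t \<notin> range tm" by (subst AE_restrict_space_iff) (auto elim: eventually_mono)
  then have "AE t in time S. h t = fN dl 0 t" by eventually_elim (simp add: h_def)
  then show ?thesis by (intro measurable_AE_lebesgue[OF m]) auto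
qed

lemma tested_limit:
  assumes s: "0 < s" "s < S"
  shows "(LINT t|time S. tested s dl 0 t) = 0" "integrable (time S) (tested s dl 0)"
proof -
  obtain C where C: "\<And>b \<epsilon> t. adm b \<epsilon> \<Longrightarrow> 0 < t \<Longrightarrow> t < S \<Longrightarrow> \<bar>tested s b \<epsilon> t\<bar> \<le> C * (2 * nG t + 3 * nW t + 7 * bnd)"
    by (rule tested_bound[of s]) blast
  have m: "tested s dl 0 \<in> borel_measurable (time S)"
    by (rule tested_measurable[OF adm_dl fN_measurable time_measurable])
  show "integrable (time S) (tested s dl 0)"
  proof (rule Bochner_Integration.integrable_bound[OF tested_dominant_integrable m])
    show "AE t in time S. norm (tested s dl 0 t) \<le> norm (C * (2 * nG t + 3 * nW t + 7 * bnd))"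
      by (rule AE_timeI) (use C[OF adm_dl] in \<open>auto intro: order_trans[OF _ abs_ge_self]\<close>)
  qed
  have "(\<lambda>n. LINT t|time S. tested s (trunc n) (eps n) t) \<longlonglongrightarrow> (LINT t|time S. tested s dl 0 t)"
  proof (rule integral_dominated_convergence[OF m _ tested_dominant_integrable])
    show "tested s (trunc n) (eps n) \<in> borel_measurable (time S)" for n
      by (rule tested_measurable[OF adm_trunc time_measurable[OF measurable_fN_trunc] time_measurable])
    show "AE t in time S. (\<lambda>n. tested s (trunc n) (eps n) t) \<longlonglongrightarrow> tested s dl 0 t"
      using AE_not_singular by eventually_elim (rule functional_limits(1))
    show "AE t in time S. norm (tested s (trunc n) (eps n) t) \<le> C * (2 * nG t + 3 * nW t + 7 * bnd)" for n
      by (rule AE_timeI) (use C[OF adm_trunc] in auto)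
  qed
  then show "(LINT t|time S. tested s dl 0 t) = 0" by (simp add: tested_regularized[OF s] LIMSEQ_const_iff)
qed

lemma pairing_W_integrable: "integrable (time S) (\<lambda>t. pairing dl 0 t (W t))"
proof (rule Bochner_Integration.integrable_bound)
  show "integrable (time S) (\<lambda>t. bnd + nW t)"
    using ia by (intro Bochner_Integration.integrable_add finite_measure.integrable_const[OF finite_measure_time]) (simp add: nW_def[abs_def])
  show "(\<lambda>t. pairing dl 0 t (W t)) \<in> borel_measurable (time S)"
    by (rule time_measurable[OF measurable_functionals(6)[OF adm_dl]])
  show "AE t in time S. norm (pairing dl 0 t (W t)) \<le> norm (bnd + nW t)"
    using functional_bounds(7)[OF adm_dl] by (intro AE_I2) (auto intro: order_trans[OF _ abs_ge_self])
qed

lemma cutoff_mult_integrable: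
  assumes "integrable (time S) g"
  shows "integrable (time S) (\<lambda>t. cutoff s t * g t)" "integrable (time S) (\<lambda>t. cutoff' s t * g t)"
proof -
  obtain C where C: "C \<ge> 0" "\<And>t. 0 < t \<Longrightarrow> t < S \<Longrightarrow> \<bar>cutoff s t\<bar> \<le> C" "\<And>t. 0 < t \<Longrightarrow> t < S \<Longrightarrow> \<bar>cutoff' s t\<bar> \<le> C"
    by (rule cutoff_bounded[of s]) blast
  have i: "integrable (time S) (\<lambda>t. C * \<bar>g t\<bar>)" using assms by (intro integrable_mult_right integrable_abs)
  have m: "g \<in> borel_measurable (time S)" using assms by (rule borel_measurable_integrable)
  show "integrable (time S) (\<lambda>t. cutoff s t * g t)"
  proof (rule Bochner_Integration.integrable_bound[OF i])
    show "(\<lambda>t. cutoff s t * g t) \<in> borel_measurable (time S)"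
      by (intro borel_measurable_times m time_measurable borel_measurable_continuous_onI continuous_cutoff)
    show "AE t in time S. norm (cutoff s t * g t) \<le> norm (C * \<bar>g t\<bar>)"
      by (rule AE_timeI) (use C in \<open>auto simp: abs_mult intro!: mult_right_mono\<close>)
  qed
  show "integrable (time S) (\<lambda>t. cutoff' s t * g t)"
  proof (rule Bochner_Integration.integrable_bound[OF i])
    show "(\<lambda>t. cutoff' s t * g t) \<in> borel_measurable (time S)"
      by (intro borel_measurable_times m time_measurable borel_measurable_continuous_onI continuous_cutoff)
    show "AE t in time S. norm (cutoff' s t * g t) \<le> norm (C * \<bar>g t\<bar>)"
      by (rule AE_timeI) (use C in \<open>auto simp: abs_mult intro!: mult_right_mono\<close>)
  qed
qed

text \<open>The energy inequality is multiplied by \<open>- cutoff' s t\<close>, which is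
  nonnegative, and integrated. \<open>time_integral_weight\<close> then turns the inner integral
  from 0 to t into one with weight \<open>cutoff s t\<close>.\<close>

lemma weighted_energy_inequality:
  assumes s: "0 < s" "s < S"
  shows "(LINT t|time S. - cutoff' s t * nW t + 2 * cutoff s t * nG t - 2 * cutoff s t * pairing dl 0 t (W t)) \<le> 0"
proof -
  define q where "q = (\<lambda>t. 2 * nG t - 2 * pairing dl 0 t (W t))"
  have iG: "integrable (time S) nG" and iW: "integrable (time S) nW" using ig ia by (simp_all add: nG_def[abs_def] nW_def[abs_def])
  have iq: "integrable (time S) q"
    unfolding q_def using iG pairing_W_integrable by (intro Bochner_Integration.integrable_diff integrable_mult_right)
  note tw = time_integral_weight[OF S iq cutoff_derivative continuous_cutoff(2) cutoff_zero[OF less_imp_le[OF s(2)]]]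
  have le: "AE t in time S. - cutoff' s t * nW t \<le> cutoff' s t * (LINT r|time t. q r)"
  proof -
    have "AE t in time S. 0 < t \<and> t < S" by (rule AE_timeI) simp
    with EI show ?thesis
    proof eventually_elim
      case (elim t)
      have sub: "integrable (time t) f" if "integrable (time S) f" for f :: "real \<Rightarrow> real"
      proof -
        have "set_integrable lebesgue {0<..<S} f" using that by (simp add: set_integrable_def integrable_restrict_space)
        then have "set_integrable lebesgue {0<..<t} f" by (rule set_integrable_subset) (use elim in auto)
        then show ?thesis by (simp add: set_integrable_def integrable_restrict_space)
      qed
      have "(LINT r|time t. q r) = 2 * (LINT r|time t. nG r) - 2 * (LINT r|time t. pairing dl 0 r (W r))"
        unfolding q_def using sub[OF iG] sub[OF pairing_W_integrable] by simp
      then have "nW t + (LINT r|time t. q r) \<le> 0" using elim(1) by (simp add: nW_def nG_def)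
      moreover have "0 \<le> - cutoff' s t" using cutoff_decay[of s t] cutoff_nonneg[of s t] by linarith
      ultimately have "- cutoff' s t * (nW t + (LINT r|time t. q r)) \<le> 0" by (intro mult_nonneg_nonpos)
      then show ?case by (simp add: algebra_simps)
    qed
  qed
  have i1: "integrable (time S) (\<lambda>t. - cutoff' s t * nW t)" using cutoff_mult_integrable(2)[OF iW] by simp
  have i2: "integrable (time S) (\<lambda>t. cutoff s t * q t)" by (rule cutoff_mult_integrable(1)[OF iq])
  have "(LINT t|time S. - cutoff' s t * nW t) \<le> (LINT t|time S. cutoff' s t * (LINT r|time t. q r))"
    by (rule integral_mono_AE[OF i1 tw(2) le])
  also have "\<dots> = - (LINT t|time S. cutoff s t * q t)" by (rule tw(1))
  finally have "(LINT t|time S. - cutoff' s t * nW t + cutoff s t * q t) \<le> 0" using i1 i2 by simp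
  moreover have e: "- cutoff' s t * nW t + cutoff s t * q t = - cutoff' s t * nW t + 2 * cutoff s t * nG t - 2 * cutoff s t * pairing dl 0 t (W t)" for t
    by (simp add: q_def algebra_simps)
  ultimately show ?thesis by (simp only: e)
qed

text \<open>The square |W - V|^2 is expanded: the energy inequality controls |W|^2, the kinetic
  energy balance gives |V|^2, and the cross term comes from the equation of W tested with V, taken
  twice.\<close>

lemma weighted_difference_zero:
  assumes s: "0 < s" "s < S"
  shows "AE t in time S. cutoff s t * (LINT x|lebesgue. (norm (W t x - V dl 0 t x))\<^sup>2) = 0"
proof -
  define y where "y = (\<lambda>t. LINT x|lebesgue. (norm (W t x - V dl 0 t x))\<^sup>2)"
  define z where "z = (\<lambda>t. LINT x|lebesgue. (norm (G t x - DM dl 0 t x))\<^sup>2)"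
  define nV where "nV = (\<lambda>t. LINT x|lebesgue. (norm (V dl 0 t x))\<^sup>2)"
  define nD where "nD = (\<lambda>t. LINT x|lebesgue. (norm (DM dl 0 t x))\<^sup>2)"
  define c where "c = (\<lambda>t. LINT x|lebesgue. Vt dl 0 t x \<bullet> V dl 0 t x)"
  define p where "p = (\<lambda>t. pairing dl 0 t (W t))"
  note ad = adm_dl
  have y: "y t = nW t - 2 * fB dl 0 t + nV t" for t
    unfolding y_def nW_def fB_def nV_def by (rule L2_diff(2)[OF W_L2 sol_bounds(3)[OF ad in_fields(1)]])
  have z: "z t = nG t - 2 * fA dl 0 t + nD t" for t
    unfolding z_def nG_def fA_def nD_def by (rule L2_diff(2)[OF G_L2 DM_L2(1)[OF ad]])
  have E: "fE dl 0 t = c t + nD t" for t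
    using force_power[OF ad, of t] by (simp add: fE_def pairing_def c_def nD_def)
  have P: "p t = fC dl 0 t + fA dl 0 t + fP dl 0 t" for t
  proof -
    have i: "integrable lebesgue (\<lambda>x. Vt dl 0 t x \<bullet> W t x)" "integrable lebesgue (\<lambda>x. LV dl 0 t x \<bullet> W t x)" "integrable lebesgue (\<lambda>x. VV dl 0 t x \<bullet> W t x)"
      using L2_inner(1)[OF sol_bounds(3)[OF ad in_fields(3)] W_L2] L2_inner(1)[OF sol_bounds(3)[OF ad in_fields(2)] W_L2]
        L2_inner(1)[OF sol_bounds(3)[OF ad in_fields(4)] W_L2] by auto
    have "p t = (LINT x|lebesgue. Vt dl 0 t x \<bullet> W t x) - (LINT x|lebesgue. LV dl 0 t x \<bullet> W t x) + (LINT x|lebesgue. VV dl 0 t x \<bullet> W t x)"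
      using i by (simp add: p_def pairing_def force_def inner_add_left inner_diff_left)
    then show ?thesis by (simp add: fA_eq[OF ad] fC_def fP_def inner_commute)
  qed
  have cb: "fN dl 0 t + fP dl 0 t \<le> z t + (1 / 4) * y t" for t
    using convective_bound[OF ad, of t] unfolding y_def z_def by linarith
  have iG: "integrable (time S) nG" and iW: "integrable (time S) nW" using ig ia by (simp_all add: nG_def[abs_def] nW_def[abs_def])
  have iV: "integrable (time S) nV"
  proof (rule integrable_time_bounded)
    have "nV = (\<lambda>t. (Lp_norm 2 (V dl 0 t))\<^sup>2)" by (simp add: nV_def Lp_norm_2_sq)
    then show "nV \<in> borel_measurable (time S)"
      using borel_measurable_power[OF measurable_Lp_norm[OF joint_measurable(1)], of 2] by (intro time_measurable) simp
    show "AE t in time S. norm (nV t) \<le> bnd"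
      using sol_bounds(5)[OF ad in_fields(1)] by (intro AE_I2) (simp add: nV_def)
  qed
  have ic: "integrable (time S) c" unfolding c_def by (rule time_integrable_energies(1)[OF ad])
  have iB: "integrable (time S) (fB dl 0)"
  proof (rule Bochner_Integration.integrable_bound)
    show "integrable (time S) (\<lambda>t. nW t + bnd)"
      using iW by (intro Bochner_Integration.integrable_add finite_measure.integrable_const[OF finite_measure_time])
    show "fB dl 0 \<in> borel_measurable (time S)" by (rule time_measurable[OF measurable_functionals(2)[OF ad]])
    show "AE t in time S. norm (fB dl 0 t) \<le> norm (nW t + bnd)"
      using functional_bounds(2)[OF ad] by (intro AE_I2) (auto intro: order_trans[OF _ abs_ge_self])
  qed
  have iy: "integrable (time S) y"
    unfolding y[abs_def] using iW iB iV by (intro Bochner_Integration.integrable_add Bochner_Integration.integrable_diff integrable_mult_right)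
  define e1 where "e1 = (\<lambda>t. - cutoff' s t * nW t + 2 * cutoff s t * nG t - 2 * cutoff s t * p t)"
  define e2 where "e2 = (\<lambda>t. cutoff' s t * nV t + 2 * cutoff s t * c t)"
  have i1: "integrable (time S) e1"
    using cutoff_mult_integrable(2)[OF iW, of s] cutoff_mult_integrable(1)[OF iG, of s] cutoff_mult_integrable(1)[OF pairing_W_integrable, of s]
    by (simp add: e1_def p_def mult.assoc)
  have i2: "integrable (time S) e2"
    using cutoff_mult_integrable(2)[OF iV, of s] cutoff_mult_integrable(1)[OF ic, of s] by (simp add: e2_def mult.assoc)
  have I1: "(LINT t|time S. e1 t) \<le> 0" using weighted_energy_inequality[OF s] by (simp add: e1_def p_def)
  have I2: "(LINT t|time S. e2 t) = 0"
    using V_kinetic_energy[OF ad less_imp_le[OF S] cutoff_derivative[of s] continuous_cutoff(2)] cutoff_zero[of s S] s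
    by (simp add: e2_def nV_def c_def)
  note I3 = tested_limit[OF s]
  \<comment> \<open>With \<kappa> for the cutoff the right side equals -\<kappa>' y + 2 \<kappa> (z
    - (N + P)), where y and z are the squared distances of the fields and of their gradients.
    \<open>convective_bound\<close> spends exactly the available dissipation z and leaves -y / 4;
    together with -\<kappa>' \<ge> \<kappa> this gives \<kappa> y / 2. On integration the three
    terms contribute at most 0, then 0 and 0.\<close>
  have low: "(1 / 2) * (cutoff s t * y t) \<le> e1 t - e2 t - 2 * tested s dl 0 t" for t
  proof -
    have "e1 t - e2 t - 2 * tested s dl 0 t = - cutoff' s t * y t + 2 * cutoff s t * (z t - (fN dl 0 t + fP dl 0 t))"
      unfolding e1_def e2_def tested_def y z E P by (simp add: algebra_simps)
    moreover have "2 * cutoff s t * (- (1 / 4) * y t) \<le> 2 * cutoff s t * (z t - (fN dl 0 t + fP dl 0 t))"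
      using cb[of t] cutoff_nonneg[of s t] by (intro mult_left_mono) auto
    moreover have "cutoff s t * y t \<le> - cutoff' s t * y t"
      using cutoff_decay[of s t] by (intro mult_right_mono) (simp_all add: y_def)
    ultimately show ?thesis by (simp add: algebra_simps)
  qed
  have iky: "integrable (time S) (\<lambda>t. cutoff s t * y t)" by (rule cutoff_mult_integrable(1)[OF iy])
  have nn: "0 \<le> cutoff s t * y t" for t using cutoff_nonneg by (simp add: y_def)
  have "(LINT t|time S. (1 / 2) * (cutoff s t * y t)) \<le> (LINT t|time S. e1 t - e2 t - 2 * tested s dl 0 t)"
    by (rule integral_mono[OF _ _ low])
      (intro integrable_mult_right iky Bochner_Integration.integrable_diff i1 i2 I3(2))+
  also have "\<dots> = (LINT t|time S. e1 t) - (LINT t|time S. e2 t) - 2 * (LINT t|time S. tested s dl 0 t)"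
    using i1 i2 I3(2) by simp
  also have "\<dots> \<le> 0" using I1 I2 I3(1) by simp
  finally have "(LINT t|time S. cutoff s t * y t) \<le> 0" by simp
  moreover have "0 \<le> (LINT t|time S. cutoff s t * y t)" using nn by (intro Bochner_Integration.integral_nonneg)
  ultimately have "(LINT t|time S. cutoff s t * y t) = 0" by simp
  then have "AE t in time S. cutoff s t * y t = 0"
    using integral_nonneg_eq_0_iff_AE[OF iky] nn by simp
  then show ?thesis by (simp add: y_def)
qed

lemma W_eq_V: "AE t in time S. AE x in lebesgue. W t x = V dl 0 t x"
proof -
  \<comment> \<open>Cutoff times increasing to S, so that every t < S is eventually reached; n + 2
    keeps the first one positive.\<close>
  define \<sigma> where "\<sigma> = (\<lambda>n. S - S / real (n + 2))"
  have \<sigma>: "0 < \<sigma> n" "\<sigma> n < S" for n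
  proof -
    have "S * 1 < S * real (n + 2)" using S by (intro mult_strict_left_mono) auto
    then have "S / real (n + 2) < S" "0 < S / real (n + 2)" using S by (simp_all add: divide_less_eq)
    then show "0 < \<sigma> n" "\<sigma> n < S" by (simp_all add: \<sigma>_def)
  qed
  have "AE t in time S. \<forall>n. cutoff (\<sigma> n) t * (LINT x|lebesgue. (norm (W t x - V dl 0 t x))\<^sup>2) = 0"
    unfolding AE_all_countable using weighted_difference_zero[OF \<sigma>] by blast
  moreover have "AE t in time S. 0 < t \<and> t < S" by (rule AE_timeI) simp
  ultimately show ?thesis
  proof eventually_elim
    case (elim t)
    obtain n where n: "S / (S - t) < real n" using reals_Archimedean2 by blast
    have "S / real (n + 2) < S - t"
    proof -
      have "S < real n * (S - t)" using n elim(2) by (simp add: field_simps)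
      also have "\<dots> \<le> real (n + 2) * (S - t)" using elim(2) by (intro mult_right_mono) auto
      finally show ?thesis by (simp add: field_simps)
    qed
    then have "t < \<sigma> n" by (simp add: \<sigma>_def)
    then have "cutoff (\<sigma> n) t \<noteq> 0" using cutoff_pos[of t "\<sigma> n"] by simp
    then have z: "(LINT x|lebesgue. (norm (W t x - V dl 0 t x))\<^sup>2) = 0" using spec[OF elim(1), of n] by simp
    have "integrable lebesgue (\<lambda>x. (norm (W t x - V dl 0 t x))\<^sup>2)"
      using L2_diff(1)[OF W_L2 sol_bounds(3)[OF adm_dl in_fields(1)], of t t] by (simp add: Lp_space_ereal_2)
    then have "AE x in lebesgue. (norm (W t x - V dl 0 t x))\<^sup>2 = 0"
      by (rule integral_nonneg_eq_0_iff_AE[THEN iffD1, OF _ _ z]) simp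
    then show ?case by eventually_elim simp
  qed
qed

end

section \<open>The singular solution\<close>

lemma zero_in_Sobolev: "(\<lambda>x. 0 :: 'b::euclidean_space) \<in> Sobolev k q"
proof (induction k)
  case (Suc k)
  have "weak_pderiv b (\<lambda>x. 0 :: 'b) (\<lambda>x. 0)" for b :: 'a
    by (simp add: weak_pderiv_def L1_loc_def set_integrable_def)
  then show ?case using Suc by (auto simp: Lp_space_def intro!: exI[of _ 0])
qed (auto simp: Lp_space_def intro!: exI[of _ 0])

lemma zero_in_G_sigma: "(\<lambda>x. 0) \<in> G_sigma"
proof -
  have "smooth_on UNIV (\<lambda>x :: real^3. 0 :: real^3)" by (simp add: smooth_on_def Ck_on_const)
  moreover have "divergence (\<lambda>x. 0) x = 0" for x
    by (simp add: divergence_def jacobian_def trace_matrix)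
  ultimately show ?thesis by (simp add: G_sigma_def G_space_def zero_in_Sobolev)
qed

lemma zero_in_LrLq_loc:
  assumes "0 \<le> r" "0 < q"
  shows "(\<lambda>t x. 0 :: 'b::euclidean_space) \<in> LrLq_loc r q"
proof -
  have "(\<lambda>t. 0 :: real) \<in> Lp_space (ereal r) (time S)" for S by (simp add: Lp_space_def)
  moreover have "(\<lambda>x. 0 :: 'b) \<in> Lp_space (ereal q) (lebesgue :: (real^3) measure)" by (simp add: Lp_space_def)
  ultimately show ?thesis by (simp add: LrLq_loc_def LrLq_def Bochner_def Lp_norm_def)
qed

context swirl_flow
begin

text \<open>An arbitrary Leray-Hopf solution meets the assumptions of \<open>comparison\<close> only
  for almost every time. Replacing it by 0 outside a set \<open>A\<close> of good times of full
  measure repairs this: time integrals are unaffected, and the energy inequality survives at the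
  times in \<open>A\<close>.\<close>

lemma V_unique: "unique_Leray_Hopf (\<lambda>x. 0) (pairing dl 0) (V dl 0)"
  unfolding unique_Leray_Hopf_def
proof (intro allI impI)
  fix S :: real and W assume S: "S > 0" and LH: "Leray_Hopf S (\<lambda>x. 0) (pairing dl 0) W"
  note L = LH[unfolded Leray_Hopf_def]
  have B1: "W \<in> Bochner \<infinity> S (Lp_sigma 2) (Lp_norm 2)" using L by (elim conjE)
  have B2: "W \<in> Bochner 2 S H1 H1_norm" using L by (elim conjE)
  have weak: "\<forall>\<phi>\<in>D_space S. (LINT t|time S. LINT x|lebesgue. weak_jacobian (W t) x \<bullet> jacobian (\<phi> t) (at x)
       + (weak_jacobian (W t) x *v W t x) \<bullet> \<phi> t x - W t x \<bullet> vector_derivative (\<lambda>s. \<phi> s x) (at t))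
       = (LINT t|time S. pairing dl 0 t (\<phi> t)) + (LINT x|lebesgue. 0 \<bullet> \<phi> 0 x)" using L by (elim conjE)
  have EI: "\<forall>t\<in>{0<..S}. W t \<in> Lp_space 2 lebesgue \<and> energy_lhs W t \<le> energy_rhs (\<lambda>x. 0) (pairing dl 0) W t"
    using L by (elim conjE)
  have M: "(\<lambda>(t, x). W t x) \<in> borel_measurable (lebesgue_on ({0<..<S} \<times> UNIV))"
    using B1 by (simp add: Bochner_def)
  obtain F where F: "(\<lambda>(t, x). F t x) \<in> borel_measurable (borel \<Otimes>\<^sub>M borel)" "AE t in time S. AE x in lebesgue. W t x = F t x"
    by (rule joint_borel_representative[OF M])
  define good where "good = (\<lambda>t. W t \<in> Lp_sigma 2 \<and> W t \<in> H1 \<and> (AE x in lebesgue. W t x = F t x))"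
  have "AE t in time S. W t \<in> Lp_sigma 2" "AE t in time S. W t \<in> H1" using B1 B2 by (simp_all add: Bochner_def)
  with F(2) have "AE t in time S. good t" unfolding good_def by eventually_elim blast
  then have "AE t in lebesgue. t \<in> {0<..<S} \<longrightarrow> good t" by (subst (asm) AE_restrict_space_iff) auto
  then have "AE t in lborel. t \<in> {0<..<S} \<longrightarrow> good t" by (simp only: AE_completion_iff)
  \<comment> \<open>A Borel null set containing all exceptional times, so that cutting off there
    keeps \<open>X'\<close> Borel measurable.\<close>
  then obtain B where B: "{t \<in> space lborel. \<not> (t \<in> {0<..<S} \<longrightarrow> good t)} \<subseteq> B" "emeasure lborel B = 0" "B \<in> sets lborel"
    by (rule AE_E)
  define A where "A = {0<..<S} - B"
  have A: "A \<in> sets borel" using B(3) by (simp add: A_def sets.Diff)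
  have good: "good t" if "t \<in> A" for t using that B(1) by (auto simp: A_def)
  have "AE t in lborel. t \<notin> B" by (rule AE_not_in) (use B in \<open>simp add: null_sets_def\<close>)
  then have nB: "AE t in lebesgue. t \<notin> B" by (rule AE_completion)
  have AEA: "AE t in time s. t \<in> A" if "s \<le> S" for s
    by (subst AE_restrict_space_iff) (use nB that in \<open>auto simp: A_def elim: eventually_mono\<close>)
  define X where "X = (\<lambda>t. if t \<in> A then W t else (\<lambda>x. 0))"
  define X' where "X' = (\<lambda>t x. if t \<in> A then F t x else 0)"
  have XW: "X t = W t" if "t \<in> A" for t using that by (simp add: X_def)
  have cong: "(LINT t|time s. g (X t) t) = (LINT t|time s. g (W t) t)" if "s \<le> S" for s and g :: "_ \<Rightarrow> _ \<Rightarrow> real"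
    by (rule integral_cong_AE_time(1)) (use AEA[OF that] in \<open>eventually_elim, simp add: XW\<close>)
  have icong: "integrable (time S) (\<lambda>t. g (X t))" if "integrable (time S) (\<lambda>t. g (W t))" for g :: "_ \<Rightarrow> real"
  proof -
    have "AE t in time S. g (X t) = g (W t)" using AEA[OF order_refl] by eventually_elim (simp add: XW)
    from integral_cong_AE_time(2)[OF this] that show ?thesis by simp
  qed
  have iW: "integrable (time S) (\<lambda>t. LINT x|lebesgue. (norm (W t x))\<^sup>2)"
  proof -
    obtain C where m: "(\<lambda>t. Lp_norm 2 (W t)) \<in> borel_measurable (time S)" and C: "AE t in time S. norm (Lp_norm 2 (W t)) \<le> C"
      using B1 by (auto simp: Bochner_def Lp_space_def)
    have "integrable (time S) (\<lambda>t. (Lp_norm 2 (W t))\<^sup>2)"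
    proof (rule integrable_time_bounded[OF borel_measurable_power[OF m]])
      show "AE t in time S. norm ((Lp_norm 2 (W t))\<^sup>2) \<le> C\<^sup>2"
        using C by eventually_elim (simp add: abs_le_square_iff[symmetric])
    qed
    then show ?thesis by (simp only: Lp_norm_2_sq)
  qed
  have iG: "integrable (time S) (\<lambda>t. LINT x|lebesgue. (norm (weak_jacobian (W t) x))\<^sup>2)"
  proof -
    have "integrable (time S) (\<lambda>t. (H1_norm (W t))\<^sup>2)" using B2 by (simp add: Bochner_def Lp_space_ereal_2)
    then have "integrable (time S) (\<lambda>t. (H1_norm (W t))\<^sup>2 - (LINT x|lebesgue. (norm (W t x))\<^sup>2))"
      using iW by (rule Bochner_Integration.integrable_diff)
    then show ?thesis by (simp add: H1_norm_sq)
  qed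
  have zero: "(\<lambda>x. 0) \<in> Lp_sigma 2" using V_in_Lp_sigma[OF adm_dl, of 0] by (simp add: V_0[OF adm_dl])
  interpret comparison \<gamma> T X X' S
  proof
    show "S > 0" by (rule S)
    show "X t \<in> Lp_sigma 2" "X t \<in> H1" for t using good[of t] zero zero_in_H1(1) by (auto simp: X_def good_def)
    have "A \<times> UNIV \<in> sets (borel \<Otimes>\<^sub>M (borel :: (real^3) measure))" using A by (intro pair_measureI) auto
    moreover have "A \<times> UNIV = {z \<in> space (borel \<Otimes>\<^sub>M (borel :: (real^3) measure)). fst z \<in> A}" by (auto simp: space_pair_measure)
    ultimately have fst: "{z \<in> space (borel \<Otimes>\<^sub>M (borel :: (real^3) measure)). fst z \<in> A} \<in> sets (borel \<Otimes>\<^sub>M borel)" by simp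
    show "(\<lambda>(t, x). X' t x) \<in> borel_measurable (borel \<Otimes>\<^sub>M borel)"
      using F(1) unfolding X'_def case_prod_beta' by (intro measurable_If fst borel_measurable_const)
    show "AE x in lebesgue. X t x = X' t x" for t using good[of t] by (auto simp: X_def X'_def good_def)
    show "integrable (time S) (\<lambda>t. LINT x|lebesgue. (norm (X t x))\<^sup>2)" by (rule icong[OF iW])
    show "integrable (time S) (\<lambda>t. LINT x|lebesgue. (norm (weak_jacobian (X t) x))\<^sup>2)" by (rule icong[OF iG])
    show "(LINT t|time S. LINT x|lebesgue. weak_jacobian (X t) x \<bullet> jacobian (\<phi> t) (at x)
       + (weak_jacobian (X t) x *v X t x) \<bullet> \<phi> t x - X t x \<bullet> vector_derivative (\<lambda>s. \<phi> s x) (at t))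
       = (LINT t|time S. pairing dl 0 t (\<phi> t))" if "\<phi> \<in> D_space S" for \<phi>
      using cong[OF order_refl, of "\<lambda>v t. LINT x|lebesgue. weak_jacobian v x \<bullet> jacobian (\<phi> t) (at x)
          + (weak_jacobian v x *v v x) \<bullet> \<phi> t x - v x \<bullet> vector_derivative (\<lambda>s. \<phi> s x) (at t)"] bspec[OF weak that]
      by (simp only: inner_zero_left Bochner_Integration.integral_zero add_0_right)
    show "AE t in time S. (LINT x|lebesgue. (norm (X t x))\<^sup>2) + 2 * (LINT s|time t. LINT x|lebesgue. (norm (weak_jacobian (X s) x))\<^sup>2)
      \<le> 2 * (LINT s|time t. pairing dl 0 s (X s))"
      using AEA[OF order_refl]
    proof eventually_elim
      case (elim t)
      then have t: "0 < t" "t \<le> S" by (auto simp: A_def)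
      have "Lp_norm 2 (\<lambda>x :: real^3. 0 :: real^3) = 0" by (simp add: Lp_norm_def)
      then have "(LINT x|lebesgue. (norm (W t x))\<^sup>2) + 2 * (LINT s|time t. LINT x|lebesgue. (norm (weak_jacobian (W s) x))\<^sup>2)
        \<le> 2 * (LINT s|time t. pairing dl 0 s (W s))"
        using bspec[OF EI, of t] t by (simp add: energy_lhs_def energy_rhs_def Lp_norm_2_sq)
      then show ?case
        unfolding XW[OF elim] cong[OF t(2), of "\<lambda>v s. LINT x|lebesgue. (norm (weak_jacobian v x))\<^sup>2"] cong[OF t(2), of "\<lambda>v s. pairing dl 0 s v"] .
    qed
  qed
  show "AE t in time S. AE x in lebesgue. W t x = V dl 0 t x"
    using W_eq_V AEA[OF order_refl] by eventually_elim (simp add: XW)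
qed

lemma V_singular_solution:
  assumes "r \<ge> 1" "q > 1"
  shows "singular_solution T r q (\<lambda>x. 0) (force dl 0) (V dl 0) (\<lambda>t x. 0) tm xm"
  unfolding singular_solution_def
proof (intro conjI allI impI)
  have "\<exists>qbar>3. \<forall>s>qbar. V dl 0 \<in> LrLq_loc (2 * s / (s - 3)) s" using V_LrLq by (intro exI[of _ 4]) simp
  then show "\<exists>F. represents (force dl 0) F \<and> global_Leray_Hopf (\<lambda>x. 0) F (V dl 0) \<and> V dl 0 \<in> C0_L2 \<and>
    (\<forall>t>0. energy_lhs (V dl 0) t = energy_rhs (\<lambda>x. 0) F (V dl 0) t) \<and>
    (\<exists>qbar>3. \<forall>s>qbar. V dl 0 \<in> LrLq_loc (2 * s / (s - 3)) s) \<and>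
    unique_Leray_Hopf (\<lambda>x. 0) F (V dl 0) \<and> associated_pressure F (V dl 0) (\<lambda>t x. 0)"
    using represents_pairing[OF adm_dl] V_Leray_Hopf[OF adm_dl] V_C0_L2 V_energy_equality[OF adm_dl] V_unique
      V_associated_pressure[OF adm_dl] by blast
  show "tm m \<in> {0<..<T}" for m using tm_bounds[of m] T by auto
  show "smooth_on ({0..} \<times> UNIV - (\<Union>m. {(tm m, xm m)})) (\<lambda>(t, x). 0)" by (simp add: smooth_on_def case_prod_beta' Ck_on_const)
  show "(\<lambda>t x. 0) \<in> LrLq_loc 2 p" if "1 \<le> p" for p using that by (intro zero_in_LrLq_loc) auto
  have "is_weak_gradient (\<lambda>x. 0) (\<lambda>x. 0)" by (simp add: is_weak_gradient_def weak_pderiv_def L1_loc_def set_integrable_def)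
  then show "\<exists>Q\<in>LrLq_loc r q. AE t in lebesgue. t \<in> {0<..} \<longrightarrow> is_weak_gradient (\<lambda>x. 0) (Q t)"
    using zero_in_LrLq_loc[of r q] assms by (intro bexI[of _ "\<lambda>t x. 0"]) auto
qed (fact tm_strict_mono V_smooth V_blowup)+

end

lemma singular_solution_exists:
  assumes T: "T > 0" and r: "r \<ge> 1" and q: "q > 1" and rq: "1 < 2 / r + 3 / q"
  shows "\<exists>f \<in> LrLq_loc r q. \<exists>V P \<tau> \<xi>. singular_solution T r q (\<lambda>x. 0) f V P \<tau> \<xi> \<and>
    continuous_on ({0..} \<times> UNIV) (\<lambda>(t, x). V t x) \<and> (\<forall>m x. V (\<tau> m) x = 0)"
proof -
  \<comment> \<open>A quarter of the surplus of 2/r + 3/q over 1 makes 2 \<gamma> at most half of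
    the surplus, hence strictly smaller than it; 1/4 is the upper limit for \<open>\<gamma>\<close>
    in \<open>swirl_flow\<close>.\<close>
  define \<gamma> where "\<gamma> = min (1 / 4) ((2 / r + 3 / q - 1) / 4)"
  interpret swirl_flow \<gamma> T by unfold_locales (use T rq in \<open>auto simp: \<gamma>_def\<close>)
  have "4 * \<gamma> \<le> 2 / r + 3 / q - 1" unfolding \<gamma>_def by (simp add: min_def)
  then have "force dl 0 \<in> LrLq_loc r q" using gam by (intro force_LrLq r q) auto
  then show ?thesis
    using V_singular_solution[OF r q] continuous_on_subset[OF V_joint_continuous] V_at_singular_time by blast
qed

theorem theorem2p6:
  fixes T :: real
  assumes "T > 0"
  shows "(\<forall>r q. r \<ge> 1 \<and> q > 1 \<and> (exponents_i r q \<or> exponents_ii r q) \<longrightarrow>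
            (\<exists>V0 \<in> G_sigma. \<exists>f \<in> LrLq_loc r q. \<exists>V P \<tau> \<xi>.
               singular_solution T r q V0 f V P \<tau> \<xi>)) \<and>
         (\<exists>r q. r \<ge> 1 \<and> q > 1 \<and> exponents_i r q \<and>
            (\<exists>V0 \<in> G_sigma. \<exists>f \<in> LrLq_loc r q. \<exists>V P \<tau> \<xi>.
               singular_solution T r q V0 f V P \<tau> \<xi> \<and>
               continuous_on ({0..} \<times> UNIV) (\<lambda>(t, x). V t x) \<and>
               (\<forall>m x. V (\<tau> m) x = 0)))"
proof (intro conjI allI impI)
  fix r q :: real
  assume rq: "r \<ge> 1 \<and> q > 1 \<and> (exponents_i r q \<or> exponents_ii r q)"
  \<comment> \<open>Common to both ranges: for q \<le> 3 already 3/q is at least 1 and 2/r is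
    positive; for q > 3 the sum is above 1 in (i) and at least 5 in (ii).\<close>
  have "1 < 2 / r + 3 / q"
  proof (cases "q \<le> 3")
    case True
    then have "1 \<le> 3 / q" "0 < 2 / r" using rq by (auto simp: field_simps)
    then show ?thesis by linarith
  qed (use rq in \<open>auto simp: exponents_i_def exponents_ii_def\<close>)
  from singular_solution_exists[OF assms _ _ this] rq
  show "\<exists>V0\<in>G_sigma. \<exists>f\<in>LrLq_loc r q. \<exists>V P \<tau> \<xi>. singular_solution T r q V0 f V P \<tau> \<xi>"
    using zero_in_G_sigma by blast
next
  \<comment> \<open>2/2 + 3/4 = 7/4 lies between 1 and 5, and 4 > 3.\<close>
  have "exponents_i 2 4" by (simp add: exponents_i_def)
  moreover from this have "\<exists>f \<in> LrLq_loc 2 4. \<exists>V P \<tau> \<xi>. singular_solution T 2 4 (\<lambda>x. 0) f V P \<tau> \<xi> \<and>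
    continuous_on ({0..} \<times> UNIV) (\<lambda>(t, x). V t x) \<and> (\<forall>m x. V (\<tau> m) x = 0)"
    by (intro singular_solution_exists assms) (auto simp: exponents_i_def)
  ultimately show "\<exists>r q. r \<ge> 1 \<and> q > 1 \<and> exponents_i r q \<and>
            (\<exists>V0 \<in> G_sigma. \<exists>f \<in> LrLq_loc r q. \<exists>V P \<tau> \<xi>.
               singular_solution T r q V0 f V P \<tau> \<xi> \<and>
               continuous_on ({0..} \<times> UNIV) (\<lambda>(t, x). V t x) \<and>
               (\<forall>m x. V (\<tau> m) x = 0))"
    using zero_in_G_sigma by (intro exI[of _ 2] exI[of _ 4] conjI bexI[of _ "\<lambda>x. 0"]) auto
qed
end
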